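(* Let $A\simeq kQ_A/I_A$ be a representation-finite monomial algebra whose Auslander-Reiten quiver $\Gamma_A$ is a component with length. Let $(R_A)_0$ be the set of vertices $u$ of $Q_A$ involved in zero-relations of $I_A$. Then the nilpotency index $r_A$ of $\Re(\mathrm{mod}\,A)$ is determined by the length of the longest path of irreducible morphisms from the projective $P_u$ to the injective $I_u$, where $u\in (R_A)_0$; that is, $r_A=\max\{r_u+1 : u\in (R_A)_0\}$, where $r_u$ is the length of such a path for the vertex $u$. More precisely, it is enough to study only one vertex of each zero-relation of $A$: if $\mathcal S\subset (R_A)_0$ is a set obtained by choosing, for each two zero-relations $\gamma_1,\gamma_2$ of $I_A$ that overlap each other, one vertex involved in $\gamma_1\cap\gamma_2$ (i.e. involved in both $\gamma_1$ and $\gamma_2$), and, for each different not overlapped zero-relation $\rho$ of $I_A$, one vertex involved in $\rho$, then $r_A=\max\{r_a+1 : a\in\mathcal S\}$.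
   Context: All algebras are finite dimensional over an algebraically closed field $k$; $\mathrm{mod}\,A$ is the category of finitely generated right $A$-modules; $P_a,I_a$ are the indecomposable projective and indecomposable injective modules at the vertex $a$ of the ordinary quiver $Q_A$. $\Re$ is the radical of $\mathrm{mod}\,A$; the nilpotency index $r_A$ is the least $m\ge 1$ with $\Re^m(\mathrm{mod}\,A)=0$. Paths of irreducible morphisms are taken between indecomposable $A$-modules. $A$ is monomial if the admissible ideal $I_A$ is generated by paths; fix a minimal set $\chi$ of paths generating $I_A$ (the zero-relations). A vertex $x$ is involved in a zero-relation $\alpha_m\cdots\alpha_1$ ($\alpha_1$ is the first arrow) if $x=s(\alpha_i)$ for some $i=2,\dots,m$, where $s$ and $e$ denote starting and ending points. Two relations $\gamma_1,\gamma_2\in\chi$ lying on a common path $w$ of $Q_A$ overlap each other if, in the order of vertices along $w$, $s(\gamma_1)<s(\gamma_2)<e(\gamma_1)$ or $s(\gamma_2)<s(\gamma_1)<e(\gamma_2)$. A component of the Auslander-Reiten quiver is a component with length if any two parallel paths in it (paths of irreducible morphisms between indecomposable modules with the same start and the same end) have the same length. *)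

theory Defs
  imports
    "HOL-Library.Poly_Mapping"
    "HOL-Computational_Algebra.Polynomial"
    "Jordan_Normal_Form.Matrix"
    "Graph_Theory.Arc_Walk"
    "Graph_Theory.Digraph_Component"
begin

text \<open>The base field has class \<open>alg_closed_field\<close>, so it is algebraically closed.\<close>

locale fd_algebra = vector_space scale
  for scale :: "'k :: alg_closed_field \<Rightarrow> 'a :: ring_1 \<Rightarrow> 'a" +
  assumes scale_mult_left: "scale c x * y = scale c (x * y)"
    and scale_mult_right: "x * scale c y = scale c (x * y)"
    and finite_dim: "\<exists>B. finite B \<and> span B = UNIV"

text \<open>
  Over a finite-dimensional algebra the finitely generated modules are the finite-dimensional
  ones, and each of these is isomorphic to one on a coordinate space of column vectors. A pair
  \<open>(n, \<rho>)\<close> stands for the right module on \<open>n\<close>-dimensional column vectors with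
  \<open>v \<cdot> a = \<rho> a v\<close>; thus \<open>\<rho>\<close> reverses products. The objects of mod A are these modules
  and the morphisms are matrices, composed by matrix multiplication.
\<close>

type_synonym ('a, 'k) rmod = "nat \<times> ('a \<Rightarrow> 'k mat)"

abbreviation mdim :: "('a, 'k) rmod \<Rightarrow> nat" where "mdim \<equiv> fst"
abbreviation mact :: "('a, 'k) rmod \<Rightarrow> 'a \<Rightarrow> 'k mat" where "mact \<equiv> snd"

definition right_module ::
  "('k :: field \<Rightarrow> 'a :: ring_1 \<Rightarrow> 'a) \<Rightarrow> ('a, 'k) rmod \<Rightarrow> bool" where
  "right_module sc M \<longleftrightarrow>
     (\<forall>a. mact M a \<in> carrier_mat (mdim M) (mdim M)) \<and>
     (\<forall>a b. mact M (a + b) = mact M a + mact M b) \<and>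
     (\<forall>c a. mact M (sc c a) = c \<cdot>\<^sub>m mact M a) \<and>
     (\<forall>a b. mact M (a * b) = mact M b * mact M a) \<and>
     mact M 1 = 1\<^sub>m (mdim M)"

definition mhom :: "('a, 'k :: field) rmod \<Rightarrow> ('a, 'k) rmod \<Rightarrow> 'k mat set" where
  "mhom X Y = {F \<in> carrier_mat (mdim Y) (mdim X). \<forall>a. F * mact X a = mact Y a * F}"

definition split_mono :: "('a, 'k :: field) rmod \<Rightarrow> ('a, 'k) rmod \<Rightarrow> 'k mat \<Rightarrow> bool" where
  "split_mono X Y F \<longleftrightarrow> F \<in> mhom X Y \<and> (\<exists>G\<in>mhom Y X. G * F = 1\<^sub>m (mdim X))"

definition split_epi :: "('a, 'k :: field) rmod \<Rightarrow> ('a, 'k) rmod \<Rightarrow> 'k mat \<Rightarrow> bool" where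
  "split_epi X Y F \<longleftrightarrow> F \<in> mhom X Y \<and> (\<exists>G\<in>mhom Y X. F * G = 1\<^sub>m (mdim Y))"

definition is_iso :: "('a, 'k :: field) rmod \<Rightarrow> ('a, 'k) rmod \<Rightarrow> 'k mat \<Rightarrow> bool" where
  "is_iso X Y F \<longleftrightarrow>
     F \<in> mhom X Y \<and> (\<exists>G\<in>mhom Y X. G * F = 1\<^sub>m (mdim X) \<and> F * G = 1\<^sub>m (mdim Y))"

definition isomorphic :: "('a, 'k :: field) rmod \<Rightarrow> ('a, 'k) rmod \<Rightarrow> bool" where
  "isomorphic X Y \<longleftrightarrow> (\<exists>F. is_iso X Y F)"

definition msum :: "('a, 'k :: field) rmod \<Rightarrow> ('a, 'k) rmod \<Rightarrow> ('a, 'k) rmod" where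
  "msum X Y = (mdim X + mdim Y,
     \<lambda>a. four_block_mat (mact X a) (0\<^sub>m (mdim X) (mdim Y))
                        (0\<^sub>m (mdim Y) (mdim X)) (mact Y a))"

definition indecomposable ::
  "('k :: field \<Rightarrow> 'a :: ring_1 \<Rightarrow> 'a) \<Rightarrow> ('a, 'k) rmod \<Rightarrow> bool" where
  "indecomposable sc M \<longleftrightarrow> right_module sc M \<and> mdim M \<noteq> 0 \<and>
     (\<forall>X Y. right_module sc X \<and> right_module sc Y \<and> isomorphic M (msum X Y)
        \<longrightarrow> mdim X = 0 \<or> mdim Y = 0)"

definition mrad :: "('a, 'k :: field) rmod \<Rightarrow> ('a, 'k) rmod \<Rightarrow> 'k mat set" where
  "mrad X Y = {F \<in> mhom X Y. \<forall>G\<in>mhom Y X. is_iso X X (1\<^sub>m (mdim X) - G * F)}"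

text \<open>
  The \<open>m\<close>-th power of the radical consists of the finite sums of composites of \<open>m\<close> radical
  morphisms; its zeroth power is all of Hom.
\<close>

inductive rad_power ::
  "('k :: field \<Rightarrow> 'a :: ring_1 \<Rightarrow> 'a) \<Rightarrow> nat \<Rightarrow> ('a, 'k) rmod \<Rightarrow> ('a, 'k) rmod \<Rightarrow> 'k mat \<Rightarrow> bool"
  for sc where
  zero: "F \<in> mhom X Y \<Longrightarrow> rad_power sc 0 X Y F"
| comp: "rad_power sc m X Z F \<Longrightarrow> right_module sc Z \<Longrightarrow> G \<in> mrad Z Y
           \<Longrightarrow> rad_power sc (Suc m) X Y (G * F)"
| add: "rad_power sc m X Y F \<Longrightarrow> rad_power sc m X Y F' \<Longrightarrow> rad_power sc m X Y (F + F')"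

definition rad_power_vanishes :: "('k :: field \<Rightarrow> 'a :: ring_1 \<Rightarrow> 'a) \<Rightarrow> nat \<Rightarrow> bool" where
  "rad_power_vanishes sc m \<longleftrightarrow>
     (\<forall>X Y F. right_module sc X \<and> right_module sc Y \<and> rad_power sc m X Y F
        \<longrightarrow> F = 0\<^sub>m (mdim Y) (mdim X))"

definition nilpotency_index :: "('k :: field \<Rightarrow> 'a :: ring_1 \<Rightarrow> 'a) \<Rightarrow> nat" where
  "nilpotency_index sc = (LEAST m. 1 \<le> m \<and> rad_power_vanishes sc m)"

definition irreducible_mor ::
  "('k :: field \<Rightarrow> 'a :: ring_1 \<Rightarrow> 'a) \<Rightarrow> ('a, 'k) rmod \<Rightarrow> ('a, 'k) rmod \<Rightarrow> 'k mat \<Rightarrow> bool" where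
  "irreducible_mor sc X Y F \<longleftrightarrow>
     F \<in> mhom X Y \<and> \<not> split_mono X Y F \<and> \<not> split_epi X Y F \<and>
     (\<forall>Z G H. right_module sc Z \<and> G \<in> mhom X Z \<and> H \<in> mhom Z Y \<and> F = H * G
        \<longrightarrow> split_mono X Z G \<or> split_epi Z Y H)"

definition iso_class ::
  "('k :: field \<Rightarrow> 'a :: ring_1 \<Rightarrow> 'a) \<Rightarrow> ('a, 'k) rmod \<Rightarrow> ('a, 'k) rmod set" where
  "iso_class sc X = {Y. right_module sc Y \<and> isomorphic X Y}"

text \<open>
  Parallel arrows of the Auslander-Reiten quiver are drawn only once: multiplicities affect
  neither its connectedness nor the lengths of its paths. A walk in this digraph is a path of
  irreducible morphisms between indecomposable modules, taken up to isomorphism.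
\<close>

definition AR_quiver ::
  "('k :: field \<Rightarrow> 'a :: ring_1 \<Rightarrow> 'a) \<Rightarrow>
   (('a, 'k) rmod set, ('a, 'k) rmod set \<times> ('a, 'k) rmod set) pre_digraph" where
  "AR_quiver sc = \<lparr>
     verts = {iso_class sc X |X. indecomposable sc X},
     arcs = {(iso_class sc X, iso_class sc Y) |X Y.
       indecomposable sc X \<and> indecomposable sc Y \<and> (\<exists>F. irreducible_mor sc X Y F)},
     tail = fst, head = snd \<rparr>"

definition representation_finite :: "('k :: field \<Rightarrow> 'a :: ring_1 \<Rightarrow> 'a) \<Rightarrow> bool" where
  "representation_finite sc \<longleftrightarrow> finite {iso_class sc X |X. indecomposable sc X}"

definition component_with_length :: "('v, 'b) pre_digraph \<Rightarrow> bool" where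
  "component_with_length G \<longleftrightarrow> Digraph_Component.connected G \<and>
     (\<forall>u v p q. pre_digraph.awalk G u p v \<and> pre_digraph.awalk G u q v \<longrightarrow> length p = length q)"

text \<open>
  \<open>M\<close> is isomorphic to the module with underlying set \<open>V\<close>, addition \<open>pl\<close>, scalar
  multiplication \<open>sm\<close> and right action \<open>ac\<close>.
\<close>

definition coordinatizes ::
  "('a, 'k :: field) rmod \<Rightarrow> 'm set \<Rightarrow> ('m \<Rightarrow> 'm \<Rightarrow> 'm) \<Rightarrow> ('k \<Rightarrow> 'm \<Rightarrow> 'm) \<Rightarrow> ('m \<Rightarrow> 'a \<Rightarrow> 'm) \<Rightarrow> bool"
  where
  "coordinatizes M V pl sm ac \<longleftrightarrow> (\<exists>\<theta>.
     bij_betw \<theta> (carrier_vec (mdim M)) V \<and>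
     (\<forall>v\<in>carrier_vec (mdim M). \<forall>w\<in>carrier_vec (mdim M). \<theta> (v + w) = pl (\<theta> v) (\<theta> w)) \<and>
     (\<forall>c. \<forall>v\<in>carrier_vec (mdim M). \<theta> (c \<cdot>\<^sub>v v) = sm c (\<theta> v)) \<and>
     (\<forall>a. \<forall>v\<in>carrier_vec (mdim M). \<theta> (mact M a *\<^sub>v v) = ac (\<theta> v) a))"

text \<open>The isomorphism class of the right module \<open>e A\<close>, for an idempotent \<open>e\<close>.\<close>

definition projective_at ::
  "('k :: field \<Rightarrow> 'a :: ring_1 \<Rightarrow> 'a) \<Rightarrow> 'a \<Rightarrow> ('a, 'k) rmod set" where
  "projective_at sc e =
     {M. right_module sc M \<and> coordinatizes M (range (\<lambda>x. e * x)) (+) sc (*)}"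

text \<open>
  The isomorphism class of the right module \<open>D (A e) = Hom\<^sub>k (A e, k)\<close>, where
  \<open>(f \<cdot> b) x = f (b x)\<close>. A functional on \<open>A e\<close> is extended by zero to all of \<open>A\<close>.
\<close>

definition functionals_on ::
  "('k :: field \<Rightarrow> 'a :: ring_1 \<Rightarrow> 'a) \<Rightarrow> 'a set \<Rightarrow> ('a \<Rightarrow> 'k) set" where
  "functionals_on sc L = {f.
     (\<forall>x\<in>L. \<forall>y\<in>L. f (x + y) = f x + f y) \<and>
     (\<forall>c. \<forall>x\<in>L. f (sc c x) = c * f x) \<and>
     (\<forall>x. x \<notin> L \<longrightarrow> f x = 0)}"

definition injective_at ::
  "('k :: field \<Rightarrow> 'a :: ring_1 \<Rightarrow> 'a) \<Rightarrow> 'a \<Rightarrow> ('a, 'k) rmod set" where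
  "injective_at sc e = (let L = range (\<lambda>x. x * e) in
     {M. right_module sc M \<and>
         coordinatizes M (functionals_on sc L)
           (\<lambda>f g x. f x + g x) (\<lambda>c f x. c * f x)
           (\<lambda>f b x. if x \<in> L then f (b * x) else 0)})"

text \<open>
  A path is given by its starting vertex and the list of its arrows in the order in which they
  are traversed, so \<open>(u, [])\<close> is the trivial path at \<open>u\<close>, and the path written
  \<open>\<alpha>\<^sub>m \<dots> \<alpha>\<^sub>1\<close> with first arrow \<open>\<alpha>\<^sub>1\<close> is \<open>(u, [\<alpha>\<^sub>1, \<dots>, \<alpha>\<^sub>m])\<close>.
  The path algebra consists of the finitely supported functions on paths. In the product
  \<open>p q\<close> of two paths, \<open>q\<close> is traversed first.
\<close>

type_synonym ('v, 'b) qpath = "'v \<times> 'b list"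

definition qpaths :: "('v, 'b) pre_digraph \<Rightarrow> ('v, 'b) qpath set" where
  "qpaths Q = {(u, p). \<exists>v. pre_digraph.awalk Q u p v}"

abbreviation path_end :: "('v, 'b) pre_digraph \<Rightarrow> ('v, 'b) qpath \<Rightarrow> 'v" where
  "path_end Q p \<equiv> pre_digraph.awlast Q (fst p) (snd p)"

definition path_algebra :: "('v, 'b) pre_digraph \<Rightarrow> (('v, 'b) qpath \<Rightarrow>\<^sub>0 'k :: field) set" where
  "path_algebra Q = {c. Poly_Mapping.keys c \<subseteq> qpaths Q}"

definition path_mult :: "('v, 'b) pre_digraph \<Rightarrow> (('v, 'b) qpath \<Rightarrow>\<^sub>0 'k :: field) \<Rightarrow>
    (('v, 'b) qpath \<Rightarrow>\<^sub>0 'k) \<Rightarrow> (('v, 'b) qpath \<Rightarrow>\<^sub>0 'k)" where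
  "path_mult Q c d = (\<Sum>p\<in>Poly_Mapping.keys c. \<Sum>q\<in>Poly_Mapping.keys d.
     if path_end Q q = fst p
     then Poly_Mapping.single (fst q, snd q @ snd p)
            (Poly_Mapping.lookup c p * Poly_Mapping.lookup d q)
     else 0)"

definition path_one :: "('v, 'b) pre_digraph \<Rightarrow> (('v, 'b) qpath \<Rightarrow>\<^sub>0 'k :: field)" where
  "path_one Q = (\<Sum>v\<in>verts Q. Poly_Mapping.single (v, []) 1)"

definition path_scale :: "'k :: field \<Rightarrow> (('v, 'b) qpath \<Rightarrow>\<^sub>0 'k) \<Rightarrow> (('v, 'b) qpath \<Rightarrow>\<^sub>0 'k)" where
  "path_scale r c = Poly_Mapping.map ((*) r) c"

text \<open>
  Two-sided ideals of the path algebra. For a finite quiver, closure under scalars and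
  negatives follows, since the path algebra then contains all multiples of \<open>path_one Q\<close>.
\<close>

definition path_ideal ::
  "('v, 'b) pre_digraph \<Rightarrow> (('v, 'b) qpath \<Rightarrow>\<^sub>0 'k :: field) set \<Rightarrow> bool" where
  "path_ideal Q I \<longleftrightarrow> I \<subseteq> path_algebra Q \<and> 0 \<in> I \<and> (\<forall>x\<in>I. \<forall>y\<in>I. x + y \<in> I) \<and>
     (\<forall>x\<in>I. \<forall>c\<in>path_algebra Q. path_mult Q c x \<in> I \<and> path_mult Q x c \<in> I)"

definition generated_ideal ::
  "('v, 'b) pre_digraph \<Rightarrow> ('v, 'b) qpath set \<Rightarrow> (('v, 'b) qpath \<Rightarrow>\<^sub>0 'k :: field) set" where
  "generated_ideal Q \<chi> =
     \<Inter>{I. path_ideal Q I \<and> (\<forall>p\<in>\<chi>. Poly_Mapping.single p 1 \<in> I)}"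

text \<open>The \<open>l\<close>-th power of the arrow ideal is spanned by the paths of length at least \<open>l\<close>.\<close>

definition arrow_ideal_power ::
  "('v, 'b) pre_digraph \<Rightarrow> nat \<Rightarrow> (('v, 'b) qpath \<Rightarrow>\<^sub>0 'k :: field) set" where
  "arrow_ideal_power Q l =
     {c \<in> path_algebra Q. \<forall>p\<in>Poly_Mapping.keys c. l \<le> length (snd p)}"

definition admissible_ideal ::
  "('v, 'b) pre_digraph \<Rightarrow> (('v, 'b) qpath \<Rightarrow>\<^sub>0 'k :: field) set \<Rightarrow> bool" where
  "admissible_ideal Q I \<longleftrightarrow> path_ideal Q I \<and> I \<subseteq> arrow_ideal_power Q 2 \<and>
     (\<exists>m\<ge>2. arrow_ideal_power Q m \<subseteq> I)"

text \<open>
  The algebra is isomorphic to the quotient of the path algebra by \<open>I\<close>, through the surjective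
  algebra homomorphism \<open>\<phi>\<close> with kernel \<open>I\<close>. Only the values of \<open>\<phi>\<close> on the path algebra matter.
\<close>

definition algebra_presentation ::
  "('k :: field \<Rightarrow> 'a :: ring_1 \<Rightarrow> 'a) \<Rightarrow> ('v, 'b) pre_digraph \<Rightarrow>
   (('v, 'b) qpath \<Rightarrow>\<^sub>0 'k) set \<Rightarrow> ((('v, 'b) qpath \<Rightarrow>\<^sub>0 'k) \<Rightarrow> 'a) \<Rightarrow> bool" where
  "algebra_presentation sc Q I \<phi> \<longleftrightarrow>
     (\<forall>c\<in>path_algebra Q. \<forall>d\<in>path_algebra Q.
        \<phi> (c + d) = \<phi> c + \<phi> d \<and> \<phi> (path_mult Q c d) = \<phi> c * \<phi> d) \<and>
     (\<forall>r. \<forall>c\<in>path_algebra Q. \<phi> (path_scale r c) = sc r (\<phi> c)) \<and>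
     \<phi> (path_one Q) = 1 \<and>
     \<phi> ` path_algebra Q = UNIV \<and>
     {c \<in> path_algebra Q. \<phi> c = 0} = I"

definition minimal_path_generators ::
  "('v, 'b) pre_digraph \<Rightarrow> (('v, 'b) qpath \<Rightarrow>\<^sub>0 'k :: field) set \<Rightarrow> ('v, 'b) qpath set \<Rightarrow> bool" where
  "minimal_path_generators Q I \<chi> \<longleftrightarrow>
     \<chi> \<subseteq> qpaths Q \<and> generated_ideal Q \<chi> = I \<and>
     (\<forall>\<chi>'. \<chi>' \<subset> \<chi> \<longrightarrow> generated_ideal Q \<chi>' \<noteq> I)"

definition involved_vertices :: "('v, 'b) pre_digraph \<Rightarrow> ('v, 'b) qpath \<Rightarrow> 'v set" where
  "involved_vertices Q \<gamma> = tail Q ` set (tl (snd \<gamma>))"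

definition relation_vertices :: "('v, 'b) pre_digraph \<Rightarrow> ('v, 'b) qpath set \<Rightarrow> 'v set" where
  "relation_vertices Q \<chi> = (\<Union>\<gamma>\<in>\<chi>. involved_vertices Q \<gamma>)"

text \<open>
  The order of vertices along the common path \<open>w\<close> is the order of positions on \<open>w\<close>: if
  \<open>w = a \<gamma> b\<close> in traversal order, then \<open>\<gamma>\<close> starts at position \<open>length a\<close> and ends at
  position \<open>length a + length \<gamma>\<close>.
\<close>

definition overlap :: "('v, 'b) pre_digraph \<Rightarrow> ('v, 'b) qpath \<Rightarrow> ('v, 'b) qpath \<Rightarrow> bool" where
  "overlap Q \<gamma>\<^sub>1 \<gamma>\<^sub>2 \<longleftrightarrow> \<gamma>\<^sub>1 \<noteq> \<gamma>\<^sub>2 \<and>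
     (\<exists>w\<in>qpaths Q. \<exists>a\<^sub>1 b\<^sub>1 a\<^sub>2 b\<^sub>2.
        snd w = a\<^sub>1 @ snd \<gamma>\<^sub>1 @ b\<^sub>1 \<and> snd w = a\<^sub>2 @ snd \<gamma>\<^sub>2 @ b\<^sub>2 \<and>
        (length a\<^sub>1 < length a\<^sub>2 \<and> length a\<^sub>2 < length a\<^sub>1 + length (snd \<gamma>\<^sub>1) \<or>
         length a\<^sub>2 < length a\<^sub>1 \<and> length a\<^sub>1 < length a\<^sub>2 + length (snd \<gamma>\<^sub>2)))"

text \<open>
  The instances for which a vertex has to be chosen: the unordered pairs of overlapping
  zero-relations, and the singletons of zero-relations that overlap no other one.
\<close>

definition relation_groups ::
  "('v, 'b) pre_digraph \<Rightarrow> ('v, 'b) qpath set \<Rightarrow> ('v, 'b) qpath set set" where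
  "relation_groups Q \<chi> =
     {{\<gamma>\<^sub>1, \<gamma>\<^sub>2} |\<gamma>\<^sub>1 \<gamma>\<^sub>2. \<gamma>\<^sub>1 \<in> \<chi> \<and> \<gamma>\<^sub>2 \<in> \<chi> \<and> overlap Q \<gamma>\<^sub>1 \<gamma>\<^sub>2} \<union>
     {{\<rho>} |\<rho>. \<rho> \<in> \<chi> \<and> \<not> (\<exists>\<gamma>\<in>\<chi>. overlap Q \<rho> \<gamma>)}"

definition vertex_selection ::
  "('v, 'b) pre_digraph \<Rightarrow> ('v, 'b) qpath set \<Rightarrow> 'v set \<Rightarrow> bool" where
  "vertex_selection Q \<chi> S \<longleftrightarrow> (\<exists>f.
     (\<forall>R\<in>relation_groups Q \<chi>. \<forall>\<gamma>\<in>R. f R \<in> involved_vertices Q \<gamma>) \<and>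
     S = f ` relation_groups Q \<chi>)"

definition vertex_idem :: "((('v, 'b) qpath \<Rightarrow>\<^sub>0 'k :: field) \<Rightarrow> 'a) \<Rightarrow> 'v \<Rightarrow> 'a" where
  "vertex_idem \<phi> u = \<phi> (Poly_Mapping.single (u, []) 1)"

definition proj_inj_length ::
  "('k :: field \<Rightarrow> 'a :: ring_1 \<Rightarrow> 'a) \<Rightarrow> ((('v, 'b) qpath \<Rightarrow>\<^sub>0 'k) \<Rightarrow> 'a) \<Rightarrow> 'v \<Rightarrow> nat" where
  "proj_inj_length sc \<phi> u = Max {length p |p.
     pre_digraph.awalk (AR_quiver sc)
       (projective_at sc (vertex_idem \<phi> u)) p (injective_at sc (vertex_idem \<phi> u))}"

end

theory Submission
  imports Defs "HOL-Library.Function_Algebras" "HOL-Library.Sublist" "Jordan_Normal_Form.Determinant"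
begin

text \<open>Write \<open>r\<^sub>a\<close> for the length of the paths from \<open>P\<^sub>a\<close> to \<open>I\<^sub>a\<close>. As the Auslander-Reiten quiver is finite and its
  parallel paths have equal lengths, a nonzero morphism in the \<open>m\<close>-th power of the radical between
  indecomposables yields a path of length at least \<open>m\<close>. Every nonzero \<open>f : X \<rightarrow> Y\<close> has a nonzero composite
  \<open>P\<^sub>a \<rightarrow> X \<rightarrow> Y \<rightarrow> I\<^sub>a\<close> for some vertex \<open>a\<close>, so \<open>r\<^sub>A\<close> is the maximum of \<open>r\<^sub>a + 1\<close> over all vertices. It remains
  to locate the set \<open>D\<close> of the vertices with maximal \<open>r\<^sub>a\<close>.

  Let \<open>\<beta> : b \<rightarrow> a\<close> be an arrow. If no zero-relation ends with \<open>\<beta>\<close>, then \<open>P\<^sub>b \<rightarrow> P\<^sub>a\<close> is irreducible; comparing the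
  paths \<open>P\<^sub>b \<rightarrow> P\<^sub>a \<rightarrow> I\<^sub>a\<close> and \<open>P\<^sub>b \<rightarrow> I\<^sub>b \<rightarrow> I\<^sub>a\<close> gives \<open>r\<^sub>b \<le> r\<^sub>a\<close>. Dually, \<open>r\<^sub>a \<le> r\<^sub>b\<close> if no zero-relation starts with \<open>\<beta>\<close>.
  Hence, if \<open>D\<close> contained no vertex involved in a zero-relation, it would be closed under adjacency and
  connectedness would make it the set of all vertices.

  Suppose a selection avoids \<open>D\<close>. A path whose interior is a maximal stretch inside \<open>D\<close>, at the beginning
  of a zero-relation, leaves \<open>D\<close> through an arrow that ends a zero-relation; the last stretch of that relation
  in \<open>D\<close> is entered through an arrow that starts a zero-relation. Both stretches give uniserial
  modules, and as two overlapping relations share a chosen vertex, these modules have non-split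
  extensions, which give a path of positive length between them in the Auslander-Reiten quiver. Iterating
  produces arbitrarily long paths, a contradiction.\<close>

section \<open>Matrices and the module category\<close>

text \<open>Every path in the Auslander-Reiten quiver comes from a nonzero morphism: one that lies
  in the \<open>m\<close>-th power of the radical but not in the next yields a path of length
  \<open>m\<close>. Since a closed path would be parallel to the trivial one, a path repeats no
  vertex, so lengths are bounded and the powers of the radical stabilise. That the stable power is
  zero is the delicate point; Nakayama's lemma gives it once finite representation type makes this
  power finitely generated as a functor. The absence of closed paths also makes every radical
  endomorphism of an indecomposable zero, from which the behaviour of morphisms at the top of a
  projective and at the socle of an injective is read off. It makes the quiver acyclic, too, because
  an arrow extends one simple module by another. The concrete modules are instances of one
  construction, a basis on which arrows act as partial maps, so that homomorphisms become conditions
  on matrix entries. In the last part the path that ends like one block and starts like the next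
  diverges from both, and the arrows at which it diverges are the ones by which uniserial modules
  are glued.\<close>

lemma mult_mat_assoc:
  "dim_col A = dim_row B \<Longrightarrow> dim_col B = dim_row C \<Longrightarrow> (A * B) * C = A * (B * (C :: 'a :: semiring_0 mat))"
  by (rule assoc_mult_mat[of A "dim_row A" "dim_col A" B "dim_col B" C "dim_col C"]) auto

lemma mult_mat_add_right:
  "dim_col A = dim_row B \<Longrightarrow> dim_row B = dim_row C \<Longrightarrow> dim_col B = dim_col C
    \<Longrightarrow> A * (B + C) = A * B + A * (C :: 'a :: semiring_0 mat)"
  by (rule mult_add_distrib_mat[of A "dim_row A" "dim_col A" B "dim_col B" C]) auto

lemma mult_mat_add_left:
  "dim_col A = dim_row C \<Longrightarrow> dim_row A = dim_row B \<Longrightarrow> dim_col A = dim_col B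
    \<Longrightarrow> (A + B) * C = A * C + B * (C :: 'a :: semiring_0 mat)"
  by (rule add_mult_distrib_mat[of A "dim_row A" "dim_col A" B C "dim_col C"]) auto

lemma mult_mat_diff_right:
  "dim_col A = dim_row B \<Longrightarrow> dim_row B = dim_row C \<Longrightarrow> dim_col B = dim_col C
    \<Longrightarrow> A * (B - C) = A * B - A * (C :: 'a :: ring mat)"
  by (rule mult_minus_distrib_mat[of A "dim_row A" "dim_col A" B "dim_col B" C]) auto

lemma mult_mat_diff_left:
  "dim_col A = dim_row C \<Longrightarrow> dim_row A = dim_row B \<Longrightarrow> dim_col A = dim_col B
    \<Longrightarrow> (A - B) * C = A * C - B * (C :: 'a :: ring mat)"
  by (rule minus_mult_distrib_mat[of A "dim_row A" "dim_col A" B C "dim_col C"]) auto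

lemma mult_mat_one_right: "dim_col A = n \<Longrightarrow> A * 1\<^sub>m n = (A :: 'a :: semiring_1 mat)"
  by (rule right_mult_one_mat') auto

lemma mult_mat_one_left: "dim_row A = n \<Longrightarrow> 1\<^sub>m n * A = (A :: 'a :: semiring_1 mat)"
  by (rule left_mult_one_mat') auto

lemma mult_mat_zero_right: "dim_col A = n \<Longrightarrow> A * 0\<^sub>m n k = (0\<^sub>m (dim_row A) k :: 'a :: semiring_0 mat)"
  by (rule right_mult_zero_mat) auto

lemma mult_mat_zero_left: "dim_row A = n \<Longrightarrow> 0\<^sub>m k n * A = (0\<^sub>m k (dim_col A) :: 'a :: semiring_0 mat)"
  by (rule left_mult_zero_mat) auto

lemma mult_mat_smult_left: "dim_col A = dim_row B \<Longrightarrow> (c \<cdot>\<^sub>m A) * B = c \<cdot>\<^sub>m (A * (B :: 'a :: comm_semiring_0 mat))"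
  by (rule mult_smult_assoc_mat[of A "dim_row A" "dim_col A" B "dim_col B"]) auto

lemma mult_mat_smult_right: "dim_col A = dim_row B \<Longrightarrow> A * (c \<cdot>\<^sub>m B) = c \<cdot>\<^sub>m (A * (B :: 'a :: comm_semiring_0 mat))"
  by (rule mult_smult_distrib[of A "dim_row A" "dim_col A" B "dim_col B"]) auto

text \<open>These laws state their side conditions by \<open>dim_row\<close> and
  \<open>dim_col\<close> rather than by carriers, so that the simplifier can discharge them; as a
  rewrite system they nest products to the right.\<close>

lemmas mult_mat_simps = mult_mat_assoc mult_mat_add_right mult_mat_add_left mult_mat_diff_right
  mult_mat_diff_left mult_mat_one_right mult_mat_one_left mult_mat_zero_right mult_mat_zero_left
  mult_mat_smult_left mult_mat_smult_right

lemma add_mat_zero_right: "dim_row A = n \<Longrightarrow> dim_col A = k \<Longrightarrow> A + 0\<^sub>m n k = (A :: 'a :: monoid_add mat)"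
  by (intro eq_matI) auto
lemma add_mat_zero_left: "dim_row A = n \<Longrightarrow> dim_col A = k \<Longrightarrow> 0\<^sub>m n k + A = (A :: 'a :: monoid_add mat)"
  by (intro eq_matI) auto
lemma diff_mat_self: "A - A = 0\<^sub>m (dim_row A) (dim_col (A :: 'a :: group_add mat))"
  by (intro eq_matI) auto
lemma diff_mat_zero: "dim_row A = n \<Longrightarrow> dim_col A = k \<Longrightarrow> A - 0\<^sub>m n k = (A :: 'a :: group_add mat)"
  by (intro eq_matI) auto

lemmas add_mat_simps = add_mat_zero_right add_mat_zero_left diff_mat_self diff_mat_zero

text \<open>With products nested to the right, a known product \<open>A * B\<close> occurs only as
  the head of \<open>A * (B * D)\<close>; this form rewrites it there.\<close>

lemma mat_assoc_eq:
  assumes "A * B = (C :: 'a :: semiring_0 mat)" "dim_col A = dim_row B" "dim_col B = dim_row D"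
  shows "A * (B * D) = C * D"
  using assms by (metis mult_mat_assoc)

text \<open>Rank-one deflation: a nonzero entry of \<open>E\<close> gives a column \<open>v\<close>
  and a scaled row \<open>w\<close> with \<open>w * v = 1\<close>, and \<open>E - v * w\<close> is
  an idempotent with fewer nonzero rows. The zero matrix splits through dimension 0.\<close>

lemma idempotent_mat_splits:
  fixes E :: "'k :: field mat"
  assumes "E \<in> carrier_mat n n" "E * E = E"
  shows "\<exists>r F G. F \<in> carrier_mat n r \<and> G \<in> carrier_mat r n \<and> F * G = E \<and> G * F = 1\<^sub>m r"
  using assms
proof (induction "card {i. i < n \<and> (\<exists>j<n. E $$ (i,j) \<noteq> 0)}" arbitrary: E rule: less_induct)
  case less
  note E = less.prems
  have dE [simp]: "dim_row E = n" "dim_col E = n" using E by auto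
  show ?case
  proof (cases "\<exists>i<n. \<exists>j<n. E $$ (i,j) \<noteq> 0")
    case False
    then have "E = 0\<^sub>m n n" by (intro eq_matI) auto
    moreover have "(0\<^sub>m n 0 :: 'k mat) * 0\<^sub>m 0 n = 0\<^sub>m n n" by (simp add: mult_mat_simps)
    moreover have "(0\<^sub>m 0 n :: 'k mat) * 0\<^sub>m n 0 = 1\<^sub>m 0" by (intro eq_matI) auto
    ultimately show ?thesis by (metis zero_carrier_mat)
  next
    case True
    then obtain i j where ij: "i < n" "j < n" "E $$ (i,j) \<noteq> 0" by auto
    define ej where "ej = mat n 1 (\<lambda>(k,_). if k = j then 1 else 0 :: 'k)"
    \<comment> \<open>The division by the chosen entry normalises \<open>w * v\<close> to 1.\<close>
    define ei where "ei = mat 1 n (\<lambda>(_,k). if k = i then 1 / E $$ (i,j) else 0 :: 'k)"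
    define v where "v = E * ej"
    define w where "w = ei * E"
    have d [simp]: "dim_row ej = n" "dim_col ej = 1" "dim_row ei = 1" "dim_col ei = n"
      "dim_row v = n" "dim_col v = 1" "dim_row w = 1" "dim_col w = n"
      by (auto simp: ej_def ei_def v_def w_def)
    have sum_pick: "(\<Sum>k = 0..<n. f k * (if k = l then c else 0)) = f l * c"
      "(\<Sum>k = 0..<n. (if k = l then c else 0) * f k) = c * f l" if "l < n" for f :: "nat \<Rightarrow> 'k" and c l
    proof -
      have "(\<Sum>k = 0..<n. f k * (if k = l then c else 0)) = (\<Sum>k = 0..<n. if k = l then f l * c else 0)"
        "(\<Sum>k = 0..<n. (if k = l then c else 0) * f k) = (\<Sum>k = 0..<n. if k = l then c * f l else 0)"
        by (rule sum.cong; simp)+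
      then show "(\<Sum>k = 0..<n. f k * (if k = l then c else 0)) = f l * c"
        "(\<Sum>k = 0..<n. (if k = l then c else 0) * f k) = c * f l" using that by simp_all
    qed
    have v: "v $$ (k,0) = E $$ (k,j)" if "k < n" for k
      using that ij by (simp add: v_def ej_def scalar_prod_def sum_pick cong: if_cong)
    have w: "w $$ (0,k) = E $$ (i,k) / E $$ (i,j)" if "k < n" for k
      using that ij by (simp add: w_def ei_def scalar_prod_def sum_pick cong: if_cong)
    have Ev: "E * v = v" unfolding v_def by (subst mult_mat_assoc[symmetric]) (simp_all add: E)
    have wE: "w * E = w" unfolding w_def by (subst mult_mat_assoc) (simp_all add: E)
    \<comment> \<open>By idempotence \<open>ei * E * E * ej\<close> equals
      \<open>ei * E * ej\<close>, the chosen entry divided by itself.\<close>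
    have wv: "w * v = 1\<^sub>m 1"
    proof -
      have "w * v = ei * (E * v)" by (simp add: w_def mult_mat_simps)
      then have "w * v = ei * v" by (simp add: Ev)
      also have "\<dots> = 1\<^sub>m 1"
        using ij by (intro eq_matI) (auto simp: ei_def scalar_prod_def sum_pick v cong: if_cong)
      finally show ?thesis .
    qed
    define E' where "E' = E - v * w"
    have dE' [simp]: "dim_row E' = n" "dim_col E' = n" by (auto simp: E'_def)
    have E'v: "E' * v = 0\<^sub>m n 1" by (simp add: E'_def mult_mat_simps Ev wv add_mat_simps)
    have wE': "w * E' = 0\<^sub>m 1 n"
      by (simp add: E'_def mult_mat_simps wE mat_assoc_eq[OF wv] add_mat_simps)
    have E'E: "E' * E = E'" by (simp add: E'_def mult_mat_simps wE E)
    have E'E': "E' * E' = E'"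
    proof -
      have "E' * E' = E' * E - E' * (v * w)" by (subst (2) E'_def) (simp add: mult_mat_simps)
      also have "E' * (v * w) = 0\<^sub>m n n"
        using mat_assoc_eq[OF E'v, of w] by (simp add: mult_mat_simps)
      finally show ?thesis by (simp add: E'E add_mat_simps)
    qed
    have E'ent: "E' $$ (k,l) = E $$ (k,l) - E $$ (k,j) * (E $$ (i,l) / E $$ (i,j))" if "k < n" "l < n" for k l
      using that by (simp add: E'_def scalar_prod_def v w)
    \<comment> \<open>Row \<open>i\<close> is cleared, and a row that vanishes in \<open>E\<close>
      still vanishes in \<open>E'\<close>, so the induction measure drops.\<close>
    have "{k. k < n \<and> (\<exists>l<n. E' $$ (k,l) \<noteq> 0)} \<subset> {k. k < n \<and> (\<exists>l<n. E $$ (k,l) \<noteq> 0)}"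
    proof (rule psubsetI)
      show "{k. k < n \<and> (\<exists>l<n. E' $$ (k,l) \<noteq> 0)} \<subseteq> {k. k < n \<and> (\<exists>l<n. E $$ (k,l) \<noteq> 0)}"
      proof clarify
        fix k l assume kl: "k < n" "l < n" "E' $$ (k,l) \<noteq> 0"
        then have "E $$ (k,l) \<noteq> 0 \<or> E $$ (k,j) \<noteq> 0" by (auto simp: E'ent)
        then show "\<exists>l<n. E $$ (k,l) \<noteq> 0" using kl ij by blast
      qed
      have "i \<notin> {k. k < n \<and> (\<exists>l<n. E' $$ (k,l) \<noteq> 0)}" using ij by (auto simp: E'ent)
      moreover have "i \<in> {k. k < n \<and> (\<exists>l<n. E $$ (k,l) \<noteq> 0)}" using ij by auto
      ultimately show "{k. k < n \<and> (\<exists>l<n. E' $$ (k,l) \<noteq> 0)} \<noteq> {k. k < n \<and> (\<exists>l<n. E $$ (k,l) \<noteq> 0)}"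
        by blast
    qed
    then have "card {k. k < n \<and> (\<exists>l<n. E' $$ (k,l) \<noteq> 0)} < card {k. k < n \<and> (\<exists>l<n. E $$ (k,l) \<noteq> 0)}"
      by (intro psubset_card_mono) auto
    moreover have "E' \<in> carrier_mat n n" by (rule carrier_matI) simp_all
    ultimately obtain r F G where
      FG: "F \<in> carrier_mat n r" "G \<in> carrier_mat r n" "F * G = E'" "G * F = 1\<^sub>m r"
      using less.hyps[of E'] E'E' by blast
    have d' [simp]: "dim_row F = n" "dim_col F = r" "dim_row G = r" "dim_col G = n" using FG by auto
    have "G * E' = (G * F) * G" unfolding FG(3)[symmetric] by (rule mult_mat_assoc[symmetric]) simp_all
    then have GE: "G * E' = G" by (simp only: FG(4)) (simp add: mult_mat_one_left)
    have "G * v = (G * E') * v" by (simp only: GE)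
    also have "\<dots> = G * (E' * v)" by (rule mult_mat_assoc) simp_all
    finally have Gv: "G * v = 0\<^sub>m r 1" by (simp only: E'v) (simp add: mult_mat_zero_right)
    have "E' * F = F * (G * F)" unfolding FG(3)[symmetric] by (rule mult_mat_assoc) simp_all
    then have EF: "E' * F = F" by (simp only: FG(4)) (simp add: mult_mat_one_right)
    have "w * F = w * (E' * F)" by (simp only: EF)
    also have "\<dots> = (w * E') * F" by (rule mult_mat_assoc[symmetric]) simp_all
    finally have wF: "w * F = 0\<^sub>m 1 r" by (simp only: wE') (simp add: mult_mat_zero_left)
    \<comment> \<open>\<open>v\<close> becomes a further column of \<open>F\<close> and
      \<open>w\<close> a further row of \<open>G\<close>; blocks of height or width 0 let
      \<open>four_block_mat\<close> express this.\<close>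
    define F2 where "F2 = four_block_mat F v (0\<^sub>m 0 r) (0\<^sub>m 0 1)"
    define G2 where "G2 = four_block_mat G (0\<^sub>m r 0) w (0\<^sub>m 1 0)"
    have c: "v \<in> carrier_mat n 1" "w \<in> carrier_mat 1 n" by auto
    have "F2 * G2 = four_block_mat (F * G + v * w) (F * 0\<^sub>m r 0 + v * 0\<^sub>m 1 0)
        (0\<^sub>m 0 r * G + 0\<^sub>m 0 1 * w) (0\<^sub>m 0 r * 0\<^sub>m r 0 + 0\<^sub>m 0 1 * 0\<^sub>m 1 0)"
      unfolding F2_def G2_def
      by (rule mult_four_block_mat[OF FG(1) c(1) zero_carrier_mat zero_carrier_mat FG(2) zero_carrier_mat c(2) zero_carrier_mat])
    also have "\<dots> = E" unfolding FG(3) by (intro eq_matI) (auto simp: E'_def)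
    finally have "F2 * G2 = E" .
    moreover have "G2 * F2 = four_block_mat (G * F + 0\<^sub>m r 0 * 0\<^sub>m 0 r) (G * v + 0\<^sub>m r 0 * 0\<^sub>m 0 1)
        (w * F + 0\<^sub>m 1 0 * 0\<^sub>m 0 r) (w * v + 0\<^sub>m 1 0 * 0\<^sub>m 0 1)"
      unfolding F2_def G2_def
      by (rule mult_four_block_mat[OF FG(2) zero_carrier_mat c(2) zero_carrier_mat FG(1) c(1) zero_carrier_mat zero_carrier_mat])
    then have "G2 * F2 = 1\<^sub>m (r + 1)"
      by (simp add: FG(4) Gv wF wv add_mat_simps mult_mat_zero_left)
    moreover have "F2 \<in> carrier_mat n (r + 1)" "G2 \<in> carrier_mat (r + 1) n"
      unfolding F2_def G2_def by (rule carrier_matI; simp)+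
    ultimately show ?thesis by blast
  qed
qed

context vector_space begin

text \<open>Otherwise every finite stretch of the sequence would be independent, and long ones would
  exceed the size of \<open>T\<close>. Applied to the powers of an endomorphism, it provides the
  stabilisation in Fitting's lemma.\<close>

lemma sequence_dependent:
  assumes "finite T" "\<And>k :: nat. f k \<in> span T"
  shows "\<exists>k. f k \<in> span (f ` {k<..})"
proof (rule ccontr)
  assume c: "\<not> ?thesis"
  \<comment> \<open>The stretch grows at its front, since the hypothesis compares a member with the
    later ones.\<close>
  have *: "independent (f ` {m..<m+n}) \<and> card (f ` {m..<m+n}) = n" for m n
  proof (induction n arbitrary: m)
    case (Suc n)
    have e: "{m..<m + Suc n} = insert m {Suc m..<Suc m + n}" by auto
    have "span (f ` {Suc m..<Suc m + n}) \<subseteq> span (f ` {m<..})" by (intro span_mono) auto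
    with c have "f m \<notin> span (f ` {Suc m..<Suc m + n})" by blast
    moreover from this have "f m \<notin> f ` {Suc m..<Suc m + n}" using span_base by blast
    ultimately show ?case using Suc[of "Suc m"] unfolding e by (simp add: independent_insert)
  qed (simp add: independent_empty)
  have "f ` {0..<0 + Suc (card T)} \<subseteq> span T" using assms by auto
  from independent_span_bound[OF assms(1) _ this] *[of 0 "Suc (card T)"] show False by simp
qed

lemma finite_spanning_subset:
  assumes "finite T" "V \<subseteq> span T"
  shows "\<exists>B\<subseteq>V. finite B \<and> V \<subseteq> span B"
proof -
  obtain B where B: "B \<subseteq> V" "independent B" "V \<subseteq> span B" using maximal_independent_subset by blast
  then have "finite B" using independent_span_bound[OF assms(1) B(2)] assms by auto
  with B show ?thesis by blast
qed

end

definition fun_scale :: "'k :: field \<Rightarrow> ('i \<Rightarrow> 'k) \<Rightarrow> 'i \<Rightarrow> 'k" where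
  "fun_scale c f = (\<lambda>x. c * f x)"

interpretation fun_vs: vector_space "fun_scale :: 'k :: field \<Rightarrow> ('i \<Rightarrow> 'k) \<Rightarrow> _"
  by unfold_locales (auto simp: fun_scale_def algebra_simps fun_eq_iff plus_fun_def)

text \<open>The type of matrices contains all sizes at once and is not a vector space; extension by
  zero embeds the matrices of each fixed size linearly into the functions on pairs of
  naturals.\<close>

definition mat_fun :: "'k :: field mat \<Rightarrow> nat \<times> nat \<Rightarrow> 'k" where
  "mat_fun A = (\<lambda>(i,j). if i < dim_row A \<and> j < dim_col A then A $$ (i,j) else 0)"

lemma mat_fun_inject: "A \<in> carrier_mat m n \<Longrightarrow> B \<in> carrier_mat m n \<Longrightarrow> mat_fun A = mat_fun B \<longleftrightarrow> A = B"
proof (rule iffI)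
  assume c: "A \<in> carrier_mat m n" "B \<in> carrier_mat m n" and e: "mat_fun A = mat_fun B"
  show "A = B"
  proof (rule eq_matI)
    fix i j assume "i < dim_row B" "j < dim_col B"
    then show "A $$ (i,j) = B $$ (i,j)" using c fun_cong[OF e, of "(i,j)"] by (simp add: mat_fun_def)
  qed (use c in auto)
qed simp

lemma mat_fun_add: "A \<in> carrier_mat m n \<Longrightarrow> B \<in> carrier_mat m n \<Longrightarrow> mat_fun (A + B) = mat_fun A + mat_fun B"
  by (auto simp: mat_fun_def fun_eq_iff)

lemma mat_fun_smult: "mat_fun (c \<cdot>\<^sub>m A) = fun_scale c (mat_fun A)"
  by (auto simp: mat_fun_def fun_eq_iff fun_scale_def)

lemma mat_fun_zero: "mat_fun (0\<^sub>m m n) = 0"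
  by (auto simp: mat_fun_def fun_eq_iff)

lemma sum_fun_apply: "(\<Sum>p\<in>A. f p) q = (\<Sum>p\<in>A. f p q)"
  by (induction A rule: infinite_finite_induct) auto

lemma mat_fun_finite_dim:
  "\<exists>T. finite T \<and> (\<forall>A\<in>carrier_mat m n. mat_fun (A :: 'k :: field mat) \<in> fun_vs.span T)"
proof (intro exI conjI ballI)
  let ?u = "\<lambda>p q. if q = p then 1 else (0 :: 'k)"
  show "finite (?u ` ({..<m} \<times> {..<n}))" by auto
  fix A :: "'k mat" assume A: "A \<in> carrier_mat m n"
  have "mat_fun A = (\<Sum>p\<in>{..<m} \<times> {..<n}. fun_scale (A $$ p) (?u p))"
  proof
    fix q
    have "(\<Sum>p\<in>{..<m} \<times> {..<n}. fun_scale (A $$ p) (?u p)) q = (\<Sum>p\<in>{..<m} \<times> {..<n}. if q = p then A $$ p else 0)"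
      unfolding sum_fun_apply by (intro sum.cong) (auto simp: fun_scale_def)
    also have "\<dots> = mat_fun A q" using A by (cases q) (auto simp: mat_fun_def)
    finally show "mat_fun A q = (\<Sum>p\<in>{..<m} \<times> {..<n}. fun_scale (A $$ p) (?u p)) q" by simp
  qed
  then show "mat_fun A \<in> fun_vs.span (?u ` ({..<m} \<times> {..<n}))"
    by (simp only:) (intro fun_vs.span_sum fun_vs.span_scale fun_vs.span_base, auto)
qed

section \<open>Homomorphisms, isomorphisms and the radical of the module category\<close>

lemma mhom_dims: "F \<in> mhom X Y \<Longrightarrow> dim_row F = mdim Y" "F \<in> mhom X Y \<Longrightarrow> dim_col F = mdim X"
  by (auto simp: mhom_def)

lemma mhom_comm: "F \<in> mhom X Y \<Longrightarrow> F * mact X a = mact Y a * F"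
  by (auto simp: mhom_def)

lemma mhomI:
  "dim_row F = mdim Y \<Longrightarrow> dim_col F = mdim X \<Longrightarrow> (\<And>a. F * mact X a = mact Y a * F) \<Longrightarrow> F \<in> mhom X Y"
  by (auto simp: mhom_def)

lemma mact_dims:
  "right_module sc X \<Longrightarrow> dim_row (mact X a) = mdim X" "right_module sc X \<Longrightarrow> dim_col (mact X a) = mdim X"
  unfolding right_module_def by blast+

lemma mact_simps:
  assumes "right_module sc X"
  shows "mact X (a + b) = mact X a + mact X b" "mact X (sc c a) = c \<cdot>\<^sub>m mact X a"
    "mact X (a * b) = mact X b * mact X a" "mact X 1 = 1\<^sub>m (mdim X)"
  using assms unfolding right_module_def by blast+

lemma mhom_mult:
  assumes "right_module sc X" "right_module sc Y" "right_module sc Z" "F \<in> mhom X Y" "G \<in> mhom Y Z"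
  shows "G * F \<in> mhom X Z"
proof (rule mhomI)
  note d = mhom_dims[OF assms(4)] mhom_dims[OF assms(5)] assms(1-3)[THEN mact_dims(1)] assms(1-3)[THEN mact_dims(2)]
  fix a
  have "G * F * mact X a = G * (mact Y a * F)"
    by (simp add: d mult_mat_simps mhom_comm[OF assms(4)])
  also have "\<dots> = mact Z a * G * F"
    by (subst mult_mat_assoc[symmetric]) (simp_all add: d mhom_comm[OF assms(5)])
  also have "\<dots> = mact Z a * (G * F)" by (rule mult_mat_assoc) (simp_all add: d)
  finally show "G * F * mact X a = mact Z a * (G * F)" .
qed (use assms in \<open>auto dest: mhom_dims\<close>)

lemma mhom_add:
  assumes "right_module sc X" "right_module sc Y" "F \<in> mhom X Y" "G \<in> mhom X Y"
  shows "F + G \<in> mhom X Y"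
  using assms by (intro mhomI) (simp_all add: mhom_dims mult_mat_simps mact_dims[of sc] mhom_comm)

lemma mhom_diff:
  assumes "right_module sc X" "right_module sc Y" "F \<in> mhom X Y" "G \<in> mhom X Y"
  shows "F - G \<in> mhom X Y"
  using assms by (intro mhomI) (simp_all add: mhom_dims mult_mat_simps mact_dims[of sc] mhom_comm)

lemma mhom_smult:
  assumes "right_module sc X" "right_module sc Y" "F \<in> mhom X Y"
  shows "c \<cdot>\<^sub>m F \<in> mhom X Y"
  using assms by (intro mhomI) (simp_all add: mhom_dims mult_mat_simps mact_dims[of sc] mhom_comm)

lemma mhom_zero:
  assumes "right_module sc X" "right_module sc Y"
  shows "0\<^sub>m (mdim Y) (mdim X) \<in> mhom X Y"
  using assms by (intro mhomI) (simp_all add: mult_mat_simps mact_dims[of sc])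

lemma mhom_one:
  assumes "right_module sc X"
  shows "1\<^sub>m (mdim X) \<in> mhom X X"
  using assms by (intro mhomI) (simp_all add: mult_mat_simps mact_dims[of sc])

lemma is_isoI:
  "F \<in> mhom X Y \<Longrightarrow> G \<in> mhom Y X \<Longrightarrow> G * F = 1\<^sub>m (mdim X) \<Longrightarrow> F * G = 1\<^sub>m (mdim Y) \<Longrightarrow> is_iso X Y F"
  unfolding is_iso_def by blast

lemma is_isoE:
  assumes "is_iso X Y F"
  obtains G where "F \<in> mhom X Y" "G \<in> mhom Y X" "G * F = 1\<^sub>m (mdim X)" "F * G = 1\<^sub>m (mdim Y)"
  using assms unfolding is_iso_def by blast

lemma is_iso_one: "right_module sc X \<Longrightarrow> is_iso X X (1\<^sub>m (mdim X))"
  by (rule is_isoI[where G = "1\<^sub>m (mdim X)"]) (auto simp: mhom_one)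

lemma is_iso_mult:
  assumes "right_module sc X" "right_module sc Y" "right_module sc Z" "is_iso X Y F" "is_iso Y Z G"
  shows "is_iso X Z (G * F)"
proof -
  obtain F' where F: "F \<in> mhom X Y" "F' \<in> mhom Y X" "F' * F = 1\<^sub>m (mdim X)" "F * F' = 1\<^sub>m (mdim Y)"
    using assms by (auto elim: is_isoE)
  obtain G' where G: "G \<in> mhom Y Z" "G' \<in> mhom Z Y" "G' * G = 1\<^sub>m (mdim Y)" "G * G' = 1\<^sub>m (mdim Z)"
    using assms by (auto elim: is_isoE)
  note d = mhom_dims[OF F(1)] mhom_dims[OF F(2)] mhom_dims[OF G(1)] mhom_dims[OF G(2)]
  show ?thesis
  proof (rule is_isoI[where G = "F' * G'"])
    show "F' * G' * (G * F) = 1\<^sub>m (mdim X)"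
      by (simp add: d mult_mat_simps mat_assoc_eq[OF G(3)] F)
    show "G * F * (F' * G') = 1\<^sub>m (mdim Z)"
      by (simp add: d mult_mat_simps mat_assoc_eq[OF F(4)] G)
  qed (use assms F G in \<open>auto intro: mhom_mult\<close>)
qed

lemma isomorphic_sym: "isomorphic X Y \<Longrightarrow> isomorphic Y X"
  unfolding isomorphic_def is_iso_def by blast

lemma isomorphic_refl: "right_module sc X \<Longrightarrow> isomorphic X X"
  unfolding isomorphic_def using is_iso_one by blast

lemma isomorphic_trans:
  "right_module sc X \<Longrightarrow> right_module sc Y \<Longrightarrow> right_module sc Z \<Longrightarrow> isomorphic X Y \<Longrightarrow> isomorphic Y Z
    \<Longrightarrow> isomorphic X Z"
  unfolding isomorphic_def using is_iso_mult by blast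

lemma iso_class_eq:
  assumes "right_module sc X" "right_module sc Y" "isomorphic X Y"
  shows "iso_class sc X = iso_class sc Y"
  unfolding iso_class_def using assms by (auto intro: isomorphic_trans isomorphic_sym)

lemma iso_class_eqD:
  assumes "right_module sc X" "right_module sc Y" "iso_class sc X = iso_class sc Y"
  shows "isomorphic X Y"
  using assms isomorphic_refl[of sc Y] unfolding iso_class_def by auto

text \<open>If \<open>U\<close> inverts \<open>1 - B A\<close>, then \<open>1 + A U B\<close>
  inverts \<open>1 - A B\<close>, as the geometric series suggests. It makes the definition of
  \<open>mrad\<close> symmetric in left and right composition.\<close>

lemma iso_one_minus_swap:
  assumes m: "right_module sc X" "right_module sc Y" and AB: "A \<in> mhom X Y" "B \<in> mhom Y X"
    and i: "is_iso X X (1\<^sub>m (mdim X) - B * A)"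
  shows "is_iso Y Y (1\<^sub>m (mdim Y) - A * B)"
proof -
  from i obtain U where U: "U \<in> mhom X X" "U * (1\<^sub>m (mdim X) - B * A) = 1\<^sub>m (mdim X)"
    "(1\<^sub>m (mdim X) - B * A) * U = 1\<^sub>m (mdim X)" by (rule is_isoE)
  note d = mhom_dims[OF AB(1)] mhom_dims[OF AB(2)] mhom_dims[OF U(1)]
  have "U - U * B * A = 1\<^sub>m (mdim X)" "U - B * A * U = 1\<^sub>m (mdim X)"
    using U(2,3) by (simp_all add: d mult_mat_simps)
  \<comment> \<open>The two equations for \<open>U\<close>, multiplied by \<open>A\<close> on the
    left and \<open>B\<close> on the right, are what the candidate inverse needs.\<close>
  then have "A * (U - U * B * A) * B = A * B" "A * (U - B * A * U) * B = A * B"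
    by (simp_all add: d mult_mat_simps)
  then have e: "A * (U * B) - A * (U * (B * (A * B))) = A * B" "A * (U * B) - A * (B * (A * (U * B))) = A * B"
    by (simp_all add: d mult_mat_simps)
  show ?thesis
  proof (rule is_isoI[where G = "1\<^sub>m (mdim Y) + A * U * B"])
    have at: "(A * (U * B)) $$ (i,j) - (A * (U * (B * (A * B)))) $$ (i,j) = (A * B) $$ (i,j)"
      "(A * (U * B)) $$ (i,j) - (A * (B * (A * (U * B)))) $$ (i,j) = (A * B) $$ (i,j)"
      if "i < mdim Y" "j < mdim Y" for i j
      using arg_cong[OF e(1), of "\<lambda>M. M $$ (i,j)"] arg_cong[OF e(2), of "\<lambda>M. M $$ (i,j)"] that
      by (simp_all add: d del: index_mult_mat(1))
    show "(1\<^sub>m (mdim Y) + A * U * B) * (1\<^sub>m (mdim Y) - A * B) = 1\<^sub>m (mdim Y)"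
      by (rule eq_matI; simp add: d mult_mat_simps at(1)[symmetric] del: index_mult_mat(1))
    show "(1\<^sub>m (mdim Y) - A * B) * (1\<^sub>m (mdim Y) + A * U * B) = 1\<^sub>m (mdim Y)"
      by (rule eq_matI; simp add: d mult_mat_simps at(2)[symmetric] del: index_mult_mat(1))
  qed (use m AB U in \<open>auto intro!: mhom_mult mhom_add mhom_diff mhom_one\<close>)
qed

lemma mradD: "F \<in> mrad X Y \<Longrightarrow> F \<in> mhom X Y"
  "F \<in> mrad X Y \<Longrightarrow> G \<in> mhom Y X \<Longrightarrow> is_iso X X (1\<^sub>m (mdim X) - G * F)"
  unfolding mrad_def by blast+

lemma mradI: "F \<in> mhom X Y \<Longrightarrow> (\<And>G. G \<in> mhom Y X \<Longrightarrow> is_iso X X (1\<^sub>m (mdim X) - G * F)) \<Longrightarrow> F \<in> mrad X Y"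
  unfolding mrad_def by blast

lemma mradD_right:
  assumes "right_module sc X" "right_module sc Y" "F \<in> mrad X Y" "G \<in> mhom Y X"
  shows "is_iso Y Y (1\<^sub>m (mdim Y) - F * G)"
  using iso_one_minus_swap[OF assms(1,2) mradD(1)[OF assms(3)] assms(4)] mradD(2)[OF assms(3,4)] by blast

lemma mradI_right:
  assumes "right_module sc X" "right_module sc Y" "F \<in> mhom X Y"
    "\<And>G. G \<in> mhom Y X \<Longrightarrow> is_iso Y Y (1\<^sub>m (mdim Y) - F * G)"
  shows "F \<in> mrad X Y"
  using assms iso_one_minus_swap[OF assms(2,1)] by (intro mradI) blast+

lemma mrad_mult_left:
  assumes m: "right_module sc X" "right_module sc Y" "right_module sc Z" and F: "F \<in> mrad X Y" and H: "H \<in> mhom Y Z"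
  shows "H * F \<in> mrad X Z"
proof (rule mradI)
  note F' = mradD(1)[OF F]
  show "H * F \<in> mhom X Z" by (rule mhom_mult[OF m F' H])
  fix G assume G: "G \<in> mhom Z X"
  then have "is_iso X X (1\<^sub>m (mdim X) - G * H * F)" using mradD(2)[OF F] mhom_mult[OF m(2,3,1) H G] by blast
  then show "is_iso X X (1\<^sub>m (mdim X) - G * (H * F))"
    by (simp add: mult_mat_assoc mhom_dims[OF F'] mhom_dims[OF G] mhom_dims[OF H])
qed

lemma mrad_mult_right:
  assumes m: "right_module sc W" "right_module sc X" "right_module sc Y" and F: "F \<in> mrad X Y" and H: "H \<in> mhom W X"
  shows "F * H \<in> mrad W Y"
proof (rule mradI_right[OF m(1,3)])
  note F' = mradD(1)[OF F]
  show "F * H \<in> mhom W Y" by (rule mhom_mult[OF m H F'])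
  fix G assume G: "G \<in> mhom Y W"
  then have "is_iso Y Y (1\<^sub>m (mdim Y) - F * (H * G))"
    using mradD_right[OF m(2,3) F] mhom_mult[OF m(3,1,2) G H] by blast
  then show "is_iso Y Y (1\<^sub>m (mdim Y) - F * H * G)"
    by (simp add: mult_mat_assoc mhom_dims[OF F'] mhom_dims[OF G] mhom_dims[OF H])
qed

text \<open>With \<open>U\<close> the inverse of \<open>1 - G F\<close>, the difference
  \<open>1 - G (F + F')\<close> factors as \<open>(1 - G F) (1 - U G F')\<close>, a product of two
  isomorphisms.\<close>

lemma mrad_add:
  assumes m: "right_module sc X" "right_module sc Y" and F: "F \<in> mrad X Y" and F': "F' \<in> mrad X Y"
  shows "F + F' \<in> mrad X Y"
proof (rule mradI)
  note h = mradD(1)[OF F] mradD(1)[OF F']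
  show "F + F' \<in> mhom X Y" by (rule mhom_add[OF m h])
  fix G assume G: "G \<in> mhom Y X"
  obtain U where U: "U \<in> mhom X X" "U * (1\<^sub>m (mdim X) - G * F) = 1\<^sub>m (mdim X)"
      "(1\<^sub>m (mdim X) - G * F) * U = 1\<^sub>m (mdim X)"
    using mradD(2)[OF F G] by (elim is_isoE)
  have UG: "U * G \<in> mhom Y X" by (rule mhom_mult[OF m(2,1,1) G U(1)])
  note d = mhom_dims[OF h(1)] mhom_dims[OF h(2)] mhom_dims[OF G] mhom_dims[OF U(1)]
  have "is_iso X X ((1\<^sub>m (mdim X) - G * F) * (1\<^sub>m (mdim X) - U * G * F'))"
    using is_iso_mult[OF m(1,1,1) mradD(2)[OF F' UG] mradD(2)[OF F G]] .
  also have "(1\<^sub>m (mdim X) - G * F) * (1\<^sub>m (mdim X) - U * G * F')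
      = (1\<^sub>m (mdim X) - G * F) - ((1\<^sub>m (mdim X) - G * F) * U) * (G * F')"
    by (simp add: d mult_mat_diff_right mult_mat_assoc mult_mat_one_right)
  also have "\<dots> = 1\<^sub>m (mdim X) - G * F - G * F'"
    unfolding U(3) by (simp add: d mult_mat_one_left)
  also have "\<dots> = 1\<^sub>m (mdim X) - G * (F + F')"
    by (rule eq_matI; simp add: d mult_mat_add_right del: index_mult_mat(1))
  finally show "is_iso X X (1\<^sub>m (mdim X) - G * (F + F'))" .
qed

lemma mrad_zero:
  assumes "right_module sc X" "right_module sc Y"
  shows "0\<^sub>m (mdim Y) (mdim X) \<in> mrad X Y"
  using assms by (intro mradI mhom_zero)
    (simp_all add: mult_mat_zero_right mhom_dims diff_mat_zero is_iso_one)

lemma iso_not_zero: "is_iso X X F \<Longrightarrow> mdim X \<noteq> 0 \<Longrightarrow> F \<noteq> 0\<^sub>m (mdim X) (mdim X)"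
proof
  assume "is_iso X X F" and F: "F = 0\<^sub>m (mdim X) (mdim X)" and X: "mdim X \<noteq> 0"
  then obtain G where "G \<in> mhom X X" "G * F = 1\<^sub>m (mdim X)" by (elim is_isoE)
  then have "F = 1\<^sub>m (mdim X)" by (simp add: F mult_mat_zero_right mhom_dims)
  from arg_cong[OF this, of "\<lambda>M. M $$ (0,0)"] show False using X by (simp add: F)
qed

text \<open>A one-sided inverse would turn an isomorphism of the form \<open>1 - G F\<close> or
  \<open>1 - F G\<close> into the zero map of a nonzero module.\<close>

lemma mrad_not_split:
  assumes m: "right_module sc X" "right_module sc Y" and F: "F \<in> mrad X Y"
  shows "mdim X \<noteq> 0 \<Longrightarrow> \<not> split_mono X Y F" "mdim Y \<noteq> 0 \<Longrightarrow> \<not> split_epi X Y F"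
proof -
  show "\<not> split_mono X Y F" if "mdim X \<noteq> 0"
    using mradD(2)[OF F] iso_not_zero[of X] that unfolding split_mono_def
    by (metis diff_mat_self index_one_mat(2,3))
  show "\<not> split_epi X Y F" if "mdim Y \<noteq> 0"
    using mradD_right[OF m F] iso_not_zero[of Y] that unfolding split_epi_def
    by (metis diff_mat_self index_one_mat(2,3))
qed

text \<open>If \<open>r\<close> exceeded \<open>n\<close>, padding with zeros to square matrices
  would make \<open>F2\<close> invertible although it has a zero row.\<close>

lemma left_invertible_dims:
  fixes F :: "'k :: field mat"
  assumes F: "F \<in> carrier_mat n r" and G: "G \<in> carrier_mat r n" and GF: "G * F = 1\<^sub>m r"
  shows "r \<le> n" "r = n \<Longrightarrow> F * G = 1\<^sub>m n"
proof -
  show "r = n \<Longrightarrow> F * G = 1\<^sub>m n" using assms mat_mult_left_right_inverse by blast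
  show "r \<le> n"
  proof (rule ccontr)
    assume "\<not> r \<le> n"
    then obtain k where k: "r = n + k" "k > 0" using less_imp_add_positive by (metis not_le)
    define F2 where "F2 = four_block_mat F (0\<^sub>m n 0) (0\<^sub>m k r) (0\<^sub>m k 0)"
    define G2 where "G2 = four_block_mat G (0\<^sub>m r k) (0\<^sub>m 0 n) (0\<^sub>m 0 k)"
    have d [simp]: "dim_row F = n" "dim_col F = r" "dim_row G = r" "dim_col G = n" using F G by auto
    have c: "F2 \<in> carrier_mat r r" "G2 \<in> carrier_mat r r"
      unfolding F2_def G2_def by (rule carrier_matI; simp add: k)+
    have "G2 * F2 = four_block_mat (G * F + 0\<^sub>m r k * 0\<^sub>m k r) (G * 0\<^sub>m n 0 + 0\<^sub>m r k * 0\<^sub>m k 0)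
       (0\<^sub>m 0 n * F + 0\<^sub>m 0 k * 0\<^sub>m k r) (0\<^sub>m 0 n * 0\<^sub>m n 0 + 0\<^sub>m 0 k * 0\<^sub>m k 0)"
      unfolding F2_def G2_def
      by (rule mult_four_block_mat[OF G zero_carrier_mat zero_carrier_mat zero_carrier_mat F zero_carrier_mat zero_carrier_mat zero_carrier_mat])
    also have "\<dots> = 1\<^sub>m r"
      by (simp add: GF mult_mat_zero_left mult_mat_zero_right add_mat_simps) (rule eq_matI; simp)
    finally have "F2 * G2 = 1\<^sub>m r" using c mat_mult_left_right_inverse by blast
    then have "(F2 * G2) $$ (n,n) = 1" using k by simp
    moreover have "F2 $$ (n,j) = 0" if "j < r" for j using that k by (simp add: F2_def)
    then have "(F2 * G2) $$ (n,n) = 0" using c k by (simp add: scalar_prod_def)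
    ultimately show False by simp
  qed
qed

section \<open>Direct sums, idempotents and decompositions\<close>

lemma four_block_append_mult:
  fixes F :: "'k :: field mat"
  assumes "F \<in> carrier_mat n r" "F' \<in> carrier_mat n r'" "G \<in> carrier_mat r m" "G' \<in> carrier_mat r' m"
  shows "four_block_mat F F' (0\<^sub>m 0 r) (0\<^sub>m 0 r') * four_block_mat G (0\<^sub>m r 0) G' (0\<^sub>m r' 0) = F * G + F' * G'"
proof -
  have "four_block_mat F F' (0\<^sub>m 0 r) (0\<^sub>m 0 r') * four_block_mat G (0\<^sub>m r 0) G' (0\<^sub>m r' 0) =
    four_block_mat (F * G + F' * G') (F * 0\<^sub>m r 0 + F' * 0\<^sub>m r' 0) (0\<^sub>m 0 r * G + 0\<^sub>m 0 r' * G')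
      (0\<^sub>m 0 r * 0\<^sub>m r 0 + 0\<^sub>m 0 r' * 0\<^sub>m r' 0)"
    by (rule mult_four_block_mat) (use assms in auto)
  also have "\<dots> = F * G + F' * G'" by (rule eq_matI) (use assms in auto)
  finally show ?thesis .
qed

lemma four_block_append_mult':
  fixes F :: "'k :: field mat"
  assumes "F \<in> carrier_mat n r" "F' \<in> carrier_mat n r'" "G \<in> carrier_mat m n" "G' \<in> carrier_mat m' n"
  shows "four_block_mat G (0\<^sub>m m 0) G' (0\<^sub>m m' 0) * four_block_mat F F' (0\<^sub>m 0 r) (0\<^sub>m 0 r')
     = four_block_mat (G * F) (G * F') (G' * F) (G' * F')"
proof -
  have "four_block_mat G (0\<^sub>m m 0) G' (0\<^sub>m m' 0) * four_block_mat F F' (0\<^sub>m 0 r) (0\<^sub>m 0 r')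
     = four_block_mat (G * F + 0\<^sub>m m 0 * 0\<^sub>m 0 r) (G * F' + 0\<^sub>m m 0 * 0\<^sub>m 0 r')
        (G' * F + 0\<^sub>m m' 0 * 0\<^sub>m 0 r) (G' * F' + 0\<^sub>m m' 0 * 0\<^sub>m 0 r')"
    by (rule mult_four_block_mat) (use assms in auto)
  then show ?thesis using assms by (simp add: mult_mat_zero_left add_mat_simps)
qed

text \<open>The image of \<open>E\<close> becomes a module by transport: \<open>a\<close> acts on
  its coordinates as \<open>G a F\<close>. This is multiplicative because \<open>F * G = E\<close>
  commutes with the action.\<close>

lemma idempotent_splits_module:
  assumes M: "right_module sc M" and E: "E \<in> mhom M M" "E * E = E"
  shows "\<exists>X F G. right_module sc X \<and> F \<in> mhom X M \<and> G \<in> mhom M X \<and> F * G = E \<and> G * F = 1\<^sub>m (mdim X)"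
proof -
  have "E \<in> carrier_mat (mdim M) (mdim M)" using E by (auto simp: mhom_def)
  from idempotent_mat_splits[OF this E(2)] obtain r F G where
    FG: "F \<in> carrier_mat (mdim M) r" "G \<in> carrier_mat r (mdim M)" "F * G = E" "G * F = 1\<^sub>m r" by blast
  note d = carrier_matD[OF FG(1)] carrier_matD[OF FG(2)] mact_dims[OF M] mhom_dims[OF E(1)]
  define X where "X = (r, \<lambda>a. G * (mact M a * F))"
  have [simp]: "mdim X = r" by (simp add: X_def)
  have EF: "E * F = F"
    unfolding FG(3)[symmetric] by (subst mult_mat_assoc) (simp_all add: d FG(4) mult_mat_one_right)
  have GE: "G * E = G"
    unfolding FG(3)[symmetric] by (subst mult_mat_assoc[symmetric]) (simp_all add: d FG(4) mult_mat_one_left)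
  have FX: "F * mact X a = mact M a * F" for a
  proof -
    have "F * mact X a = (F * G) * (mact M a * F)" by (simp add: X_def d mult_mat_assoc)
    also have "\<dots> = (E * mact M a) * F" by (subst FG(3)) (simp add: d mult_mat_assoc)
    also have "\<dots> = mact M a * (E * F)" by (simp only: mhom_comm[OF E(1)]) (simp add: d mult_mat_assoc)
    finally show ?thesis by (simp only: EF)
  qed
  have XG: "mact X a * G = G * mact M a" for a
  proof -
    have "mact X a * G = G * (mact M a * (F * G))" by (simp add: X_def d mult_mat_assoc)
    also have "\<dots> = G * (E * mact M a)" by (simp only: FG(3) mhom_comm[OF E(1)])
    also have "\<dots> = (G * E) * mact M a" by (simp add: d mult_mat_assoc)
    finally show ?thesis by (simp only: GE)
  qed
  have "right_module sc X"
    unfolding right_module_def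
  proof (intro conjI allI)
    fix a b c
    show "mact X a \<in> carrier_mat (mdim X) (mdim X)" unfolding X_def by (rule carrier_matI) (simp_all add: d)
    show "mact X (a + b) = mact X a + mact X b"
      by (simp add: X_def mact_simps[OF M] d mult_mat_simps)
    show "mact X (sc c a) = c \<cdot>\<^sub>m mact X a"
      by (simp add: X_def mact_simps[OF M] d mult_mat_simps)
    have "mact X (a * b) = G * mact M b * (mact M a * F)"
      by (simp add: X_def mact_simps[OF M] d mult_mat_assoc)
    also have "\<dots> = mact X b * G * (F * mact X a)" by (simp only: XG FX)
    also have "\<dots> = mact X b * ((G * F) * mact X a)" by (simp add: X_def d mult_mat_assoc)
    also have "\<dots> = mact X b * mact X a" by (simp only: FG(4)) (simp add: X_def d mult_mat_one_left)
    finally show "mact X (a * b) = mact X b * mact X a" .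
    show "mact X 1 = 1\<^sub>m (mdim X)" by (simp add: X_def mact_simps[OF M] d mult_mat_one_left FG(4))
  qed
  moreover have "F \<in> mhom X M" "G \<in> mhom M X" by (rule mhomI; simp add: d FX XG)+
  ultimately show ?thesis
    using FG(3,4) by (intro exI[of _ X] exI[of _ F] exI[of _ G]) simp
qed

lemma msum_simps: "mdim (msum X Y) = mdim X + mdim Y"
  "mact (msum X Y) a = four_block_mat (mact X a) (0\<^sub>m (mdim X) (mdim Y)) (0\<^sub>m (mdim Y) (mdim X)) (mact Y a)"
  by (auto simp: msum_def)

text \<open>Phrased with the sizes of the action matrices, so that it applies directly to
  \<open>msum X Y\<close>.\<close>

lemma mhom_inverse:
  assumes B: "B \<in> mhom X Y" and dX: "\<And>a. mact X a \<in> carrier_mat (mdim X) (mdim X)"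
    and dY: "\<And>a. mact Y a \<in> carrier_mat (mdim Y) (mdim Y)"
    and AB: "A * B = 1\<^sub>m (mdim X)" and BA: "B * A = 1\<^sub>m (mdim Y)"
  shows "A \<in> mhom Y X"
proof (rule mhomI)
  show dA: "dim_row A = mdim X" "dim_col A = mdim Y"
    using arg_cong[OF AB, of dim_row] arg_cong[OF BA, of dim_col] by simp_all
  note d = dA mhom_dims[OF B] carrier_matD[OF dX] carrier_matD[OF dY]
  fix a
  have "A * mact Y a = A * (mact Y a * (B * A))" by (simp only: BA) (simp add: d mult_mat_one_right)
  also have "\<dots> = A * (mact Y a * B) * A" by (simp add: d mult_mat_assoc)
  also have "\<dots> = A * (B * mact X a) * A" by (simp only: mhom_comm[OF B])
  also have "\<dots> = (A * B) * (mact X a * A)" by (simp add: d mult_mat_assoc)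
  finally show "A * mact Y a = mact X a * A" by (simp only: AB) (simp add: d mult_mat_one_left)
qed

lemma isomorphic_msumI:
  assumes m: "right_module sc M" "right_module sc X" "right_module sc Y"
    and F: "F \<in> mhom X M" "G \<in> mhom M X" and F': "F' \<in> mhom Y M" "G' \<in> mhom M Y"
    and s: "F * G + F' * G' = 1\<^sub>m (mdim M)" "G * F = 1\<^sub>m (mdim X)" "G' * F' = 1\<^sub>m (mdim Y)"
      "G * F' = 0\<^sub>m (mdim X) (mdim Y)" "G' * F = 0\<^sub>m (mdim Y) (mdim X)"
  shows "isomorphic M (msum X Y)"
proof -
  have c: "F \<in> carrier_mat (mdim M) (mdim X)" "F' \<in> carrier_mat (mdim M) (mdim Y)"
    "G \<in> carrier_mat (mdim X) (mdim M)" "G' \<in> carrier_mat (mdim Y) (mdim M)"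
    using F F' by (auto simp: mhom_def)
  have cm: "mact M a \<in> carrier_mat (mdim M) (mdim M)" "mact X a \<in> carrier_mat (mdim X) (mdim X)"
    "mact Y a \<in> carrier_mat (mdim Y) (mdim Y)" for a
    using m[THEN mact_dims(1)] m[THEN mact_dims(2)] by (auto intro: carrier_matI)
  note d = mhom_dims[OF F(1)] mhom_dims[OF F(2)] mhom_dims[OF F'(1)] mhom_dims[OF F'(2)]
    mact_dims[OF m(1)] mact_dims[OF m(2)] mact_dims[OF m(3)]
  let ?A = "four_block_mat G (0\<^sub>m (mdim X) 0) G' (0\<^sub>m (mdim Y) 0)"
  let ?B = "four_block_mat F F' (0\<^sub>m 0 (mdim X)) (0\<^sub>m 0 (mdim Y))"
  have dA: "dim_row ?A = mdim X + mdim Y" "dim_col ?A = mdim M" by (simp_all add: d)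
  have dB: "dim_row ?B = mdim M" "dim_col ?B = mdim X + mdim Y" by (simp_all add: d)
  have BA: "?B * ?A = 1\<^sub>m (mdim M)"
    using four_block_append_mult[OF c] s(1) by simp
  have AB: "?A * ?B = 1\<^sub>m (mdim (msum X Y))"
    using four_block_append_mult'[OF c] by (simp add: s msum_simps)
  have B: "?B \<in> mhom (msum X Y) M"
  proof (rule mhomI)
    fix a
    have "?B * mact (msum X Y) a = four_block_mat (F * mact X a + F' * 0\<^sub>m (mdim Y) (mdim X))
       (F * 0\<^sub>m (mdim X) (mdim Y) + F' * mact Y a)
       (0\<^sub>m 0 (mdim X) * mact X a + 0\<^sub>m 0 (mdim Y) * 0\<^sub>m (mdim Y) (mdim X))
       (0\<^sub>m 0 (mdim X) * 0\<^sub>m (mdim X) (mdim Y) + 0\<^sub>m 0 (mdim Y) * mact Y a)"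
      unfolding msum_simps
      by (rule mult_four_block_mat[OF c(1,2) zero_carrier_mat zero_carrier_mat cm(2) zero_carrier_mat zero_carrier_mat cm(3)])
    also have "\<dots> = four_block_mat (mact M a * F) (mact M a * F') (0\<^sub>m 0 (mdim X)) (0\<^sub>m 0 (mdim Y))"
      by (simp add: d mult_mat_zero_right mult_mat_zero_left add_mat_simps mhom_comm[OF F(1)] mhom_comm[OF F'(1)])
    also have "\<dots> = mact M a * ?B"
      by (rule eq_matI) (auto simp: d scalar_prod_def)
    finally show "?B * mact (msum X Y) a = mact M a * ?B" .
  qed (simp_all add: d msum_simps)
  have A: "?A \<in> mhom M (msum X Y)"
    by (rule mhom_inverse[OF B _ cm(1) AB BA]) (unfold msum_simps, intro four_block_carrier_mat cm)
  show ?thesis unfolding isomorphic_def using is_isoI[OF A B BA AB] by blast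
qed

lemma indecomposableD: "indecomposable sc M \<Longrightarrow> right_module sc M" "indecomposable sc M \<Longrightarrow> mdim M \<noteq> 0"
  unfolding indecomposable_def by blast+

lemma indecomposable_msumD:
  assumes M: "indecomposable sc M" and X: "right_module sc X" "right_module sc Y" "isomorphic M (msum X Y)"
  shows "mdim X = 0 \<or> mdim Y = 0"
proof -
  from M have "\<forall>X Y. right_module sc X \<and> right_module sc Y \<and> isomorphic M (msum X Y)
        \<longrightarrow> mdim X = 0 \<or> mdim Y = 0"
    unfolding indecomposable_def by (elim conjE)
  from this[THEN spec, THEN spec, THEN mp, OF conjI[OF X(1) conjI[OF X(2,3)]]] show ?thesis .
qed

lemma one_minus_idempotent:
  assumes "E \<in> carrier_mat n n" "E * E = (E :: 'k :: field mat)"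
  shows "(1\<^sub>m n - E) * (1\<^sub>m n - E) = 1\<^sub>m n - E" "E * (1\<^sub>m n - E) = 0\<^sub>m n n" "(1\<^sub>m n - E) * E = 0\<^sub>m n n"
proof -
  have d: "dim_row E = n" "dim_col E = n" using assms by auto
  show e: "E * (1\<^sub>m n - E) = 0\<^sub>m n n"
    by (subst mult_mat_diff_right) (simp_all add: d mult_mat_one_right assms(2) diff_mat_self)
  show "(1\<^sub>m n - E) * E = 0\<^sub>m n n"
    by (subst mult_mat_diff_left) (simp_all add: d mult_mat_one_left assms(2) diff_mat_self)
  have "(1\<^sub>m n - E) * (1\<^sub>m n - E) = 1\<^sub>m n * (1\<^sub>m n - E) - E * (1\<^sub>m n - E)"
    by (rule mult_mat_diff_left) (simp_all add: d)
  also have "\<dots> = 1\<^sub>m n - E" unfolding e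
    by (subst mult_mat_one_left, simp add: d) (rule diff_mat_zero; simp add: d)
  finally show "(1\<^sub>m n - E) * (1\<^sub>m n - E) = 1\<^sub>m n - E" .
qed

text \<open>\<open>E\<close> and \<open>1 - E\<close> split off complementary summands, one of which
  must be zero.\<close>

lemma indecomposable_idempotent:
  assumes M: "indecomposable sc M" and E: "E \<in> mhom M M" "E * E = E"
  shows "E = 0\<^sub>m (mdim M) (mdim M) \<or> E = 1\<^sub>m (mdim M)"
proof -
  note rm = indecomposableD(1)[OF M]
  let ?n = "mdim M"
  have c: "E \<in> carrier_mat ?n ?n" by (rule carrier_matI) (simp_all add: mhom_dims[OF E(1)])
  note o = one_minus_idempotent[OF c E(2)]
  have E': "1\<^sub>m ?n - E \<in> mhom M M" using mhom_diff[OF rm rm mhom_one[OF rm] E(1)] .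
  obtain X F G where X: "right_module sc X" "F \<in> mhom X M" "G \<in> mhom M X" "F * G = E" "G * F = 1\<^sub>m (mdim X)"
    using idempotent_splits_module[OF rm E] by (elim exE conjE) (rule that; assumption)
  obtain Y F' G' where Y: "right_module sc Y" "F' \<in> mhom Y M" "G' \<in> mhom M Y" "F' * G' = 1\<^sub>m ?n - E"
      "G' * F' = 1\<^sub>m (mdim Y)"
    using idempotent_splits_module[OF rm E' o(1)] by (elim exE conjE) (rule that; assumption)
  note d = mhom_dims[OF X(2)] mhom_dims[OF X(3)] mhom_dims[OF Y(2)] mhom_dims[OF Y(3)] mhom_dims[OF E(1)]
  \<comment> \<open>\<open>G * F'\<close> factors through \<open>E * (1 - E)\<close>, which is
    zero.\<close>
  have GF': "G * F' = 0\<^sub>m (mdim X) (mdim Y)"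
  proof -
    have "G * F' = ((G * F) * G) * (F' * (G' * F'))"
      by (simp only: X(5) Y(5)) (simp add: d mult_mat_one_left mult_mat_one_right)
    also have "\<dots> = G * ((F * G) * (F' * G')) * F'" by (simp add: d mult_mat_assoc)
    finally show ?thesis by (simp only: X(4) Y(4) o(2)) (simp add: d mult_mat_zero_left mult_mat_zero_right)
  qed
  have G'F: "G' * F = 0\<^sub>m (mdim Y) (mdim X)"
  proof -
    have "G' * F = ((G' * F') * G') * (F * (G * F))"
      by (simp only: X(5) Y(5)) (simp add: d mult_mat_one_left mult_mat_one_right)
    also have "\<dots> = G' * ((F' * G') * (F * G)) * F" by (simp add: d mult_mat_assoc)
    finally show ?thesis by (simp only: X(4) Y(4) o(3)) (simp add: d mult_mat_zero_left mult_mat_zero_right)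
  qed
  have "F * G + F' * G' = 1\<^sub>m ?n" by (rule eq_matI) (simp_all add: X(4) Y(4) d)
  from indecomposable_msumD[OF M X(1) Y(1) isomorphic_msumI[OF rm X(1) Y(1) X(2,3) Y(2,3) this X(5) Y(5) GF' G'F]]
  have "mdim X = 0 \<or> mdim Y = 0" .
  then show ?thesis
  proof
    assume "mdim X = 0"
    then have "F * G = 0\<^sub>m ?n ?n" by (intro eq_matI) (simp_all add: d scalar_prod_def)
    then show ?thesis by (simp add: X(4))
  next
    assume "mdim Y = 0"
    then have "F' * G' = 0\<^sub>m ?n ?n" by (intro eq_matI) (simp_all add: d scalar_prod_def)
    then have "1\<^sub>m ?n - E = 0\<^sub>m ?n ?n" by (simp add: Y(4))
    then have "E = 1\<^sub>m ?n"
    proof (intro eq_matI)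
      fix i j assume "1\<^sub>m ?n - E = 0\<^sub>m ?n ?n" "i < dim_row (1\<^sub>m ?n :: 'a mat)" "j < dim_col (1\<^sub>m ?n :: 'a mat)"
      then have ij: "(1\<^sub>m ?n - E) $$ (i,j) = 0" "i < ?n" "j < ?n" by simp_all
      show "E $$ (i,j) = 1\<^sub>m ?n $$ (i,j)" using ij(1) ij(2,3) by (simp add: d split: if_splits)
    qed (simp_all add: d)
    then show ?thesis ..
  qed
qed

text \<open>Converse of \<open>indecomposable_idempotent\<close>: in a decomposition the projection
  \<open>D\<close> onto \<open>X\<close> transports to an idempotent of \<open>M\<close>, which can
  be 0 only if \<open>X\<close> is zero and 1 only if \<open>Y\<close> is zero.\<close>

lemma indecomposableI:
  fixes M :: "('a :: ring_1, 'k :: field) rmod"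
  assumes M: "right_module sc M" "mdim M \<noteq> 0"
    and idem: "\<And>E. E \<in> mhom M M \<Longrightarrow> E * E = E \<Longrightarrow> E = 0\<^sub>m (mdim M) (mdim M) \<or> E = 1\<^sub>m (mdim M)"
  shows "indecomposable sc M"
  unfolding indecomposable_def
proof (intro conjI allI impI M)
  fix X Y assume *: "right_module sc X \<and> right_module sc Y \<and> isomorphic M (msum X Y)"
  then have m: "right_module sc X" "right_module sc Y" by auto
  from * obtain F G where F: "F \<in> mhom M (msum X Y)" and G: "G \<in> mhom (msum X Y) M"
    and GF: "G * F = 1\<^sub>m (mdim M)" "F * G = 1\<^sub>m (mdim (msum X Y))"
    unfolding isomorphic_def is_iso_def by blast
  let ?x = "mdim X" and ?y = "mdim Y"
  define D where "D = four_block_mat (1\<^sub>m ?x) (0\<^sub>m ?x ?y) (0\<^sub>m ?y ?x) (0\<^sub>m ?y ?y :: 'k mat)"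
  have dD: "dim_row D = ?x + ?y" "dim_col D = ?x + ?y" by (simp_all add: D_def)
  note d = mhom_dims[OF F] mhom_dims[OF G] dD msum_simps(1) mact_dims[OF m(1)] mact_dims[OF m(2)] mact_dims[OF M(1)]
  have cX: "mact X a \<in> carrier_mat ?x ?x" "mact Y a \<in> carrier_mat ?y ?y" for a
    by (auto intro: carrier_matI simp: d)
  have DD: "D * D = D" unfolding D_def
    by (subst mult_four_block_mat[where ?nr1.0 = ?x and ?n1.0 = ?x and ?n2.0 = ?y and ?nr2.0 = ?y and ?nc1.0 = ?x and ?nc2.0 = ?y]) auto
  have Dc: "D * mact (msum X Y) a = mact (msum X Y) a * D" for a
    unfolding D_def msum_simps
    by (subst (1 2) mult_four_block_mat[where ?nr1.0 = ?x and ?n1.0 = ?x and ?n2.0 = ?y and ?nr2.0 = ?y and ?nc1.0 = ?x and ?nc2.0 = ?y])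
      (use cX in \<open>auto simp: d mult_mat_zero_left mult_mat_zero_right mult_mat_one_left mult_mat_one_right\<close>)
  define E where "E = G * (D * F)"
  have "E \<in> mhom M M"
  proof (rule mhomI)
    fix a
    have dm: "dim_row (mact (msum X Y) a) = ?x + ?y" "dim_col (mact (msum X Y) a) = ?x + ?y"
      by (simp_all add: msum_simps d)
    have "E * mact M a = G * (D * (F * mact M a))" by (simp add: E_def d mult_mat_assoc)
    also have "\<dots> = G * (D * mact (msum X Y) a * F)" by (simp only: mhom_comm[OF F]) (simp add: d dm mult_mat_assoc)
    also have "\<dots> = (G * mact (msum X Y) a) * (D * F)" by (simp only: Dc) (simp add: d dm mult_mat_assoc)
    also have "\<dots> = mact M a * E" by (simp only: mhom_comm[OF G]) (simp add: E_def d dm mult_mat_assoc)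
    finally show "E * mact M a = mact M a * E" .
  qed (simp_all add: E_def d)
  moreover have EE: "E * E = E"
  proof -
    have "E * E = G * (D * ((F * G) * (D * F)))" by (simp add: E_def d mult_mat_assoc)
    also have "\<dots> = G * (D * D * F)" by (simp only: GF) (simp add: d mult_mat_one_left mult_mat_assoc)
    finally show ?thesis by (simp only: DD E_def)
  qed
  moreover have DE: "D = F * (E * G)"
  proof -
    have "F * (E * G) = (F * G) * (D * (F * G))" by (simp add: E_def d mult_mat_assoc)
    then show ?thesis by (simp only: GF) (simp add: d mult_mat_one_left mult_mat_one_right)
  qed
  ultimately consider "E = 0\<^sub>m (mdim M) (mdim M)" | "E = 1\<^sub>m (mdim M)" using idem by blast
  then show "?x = 0 \<or> ?y = 0"
  proof cases
    case 1
    then have "D = 0\<^sub>m (?x + ?y) (?x + ?y)" using DE by (simp add: d mult_mat_zero_left mult_mat_zero_right)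
    then have "D $$ (0,0) = 0" if "?x > 0" using that by simp
    then show ?thesis by (cases "?x = 0") (auto simp: D_def)
  next
    case 2
    then have "D = 1\<^sub>m (?x + ?y)" using DE GF by (simp add: d mult_mat_one_left)
    then have "D $$ (?x, ?x) = 1" if "?y > 0" using that by simp
    then show ?thesis by (cases "?y = 0") (auto simp: D_def)
  qed
qed

text \<open>A summand of full dimension would make its idempotent the identity by
  \<open>left_invertible_dims\<close>; hence the strict inequalities that induction over
  decompositions needs.\<close>

lemma decomposable_splits:
  fixes M :: "('a :: ring_1, 'k :: field) rmod"
  assumes M: "right_module sc M" "mdim M \<noteq> 0" "\<not> indecomposable sc M"
  obtains X Y F G F' G' where "right_module sc X" "right_module sc Y" "mdim X < mdim M" "mdim Y < mdim M"
    "F \<in> mhom X M" "G \<in> mhom M X" "F' \<in> mhom Y M" "G' \<in> mhom M Y"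
    "F * G + F' * G' = 1\<^sub>m (mdim M)" "G * F = 1\<^sub>m (mdim X)" "G' * F' = 1\<^sub>m (mdim Y)"
proof -
  let ?n = "mdim M"
  obtain E where E: "E \<in> mhom M M" "E * E = E" "E \<noteq> 0\<^sub>m ?n ?n" "E \<noteq> 1\<^sub>m ?n"
    using indecomposableI[OF M(1,2)] M(3) by blast
  have c: "E \<in> carrier_mat ?n ?n" by (rule carrier_matI) (simp_all add: mhom_dims[OF E(1)])
  note o = one_minus_idempotent[OF c E(2)]
  have E': "1\<^sub>m ?n - E \<in> mhom M M" using mhom_diff[OF M(1) M(1) mhom_one[OF M(1)] E(1)] .
  have lt: "mdim X < ?n" if "F \<in> mhom X M" "G \<in> mhom M X" "G * F = 1\<^sub>m (mdim X)" "F * G \<noteq> 1\<^sub>m ?n"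
    for X :: "('a, 'k) rmod" and F G
  proof -
    have cc: "F \<in> carrier_mat ?n (mdim X)" "G \<in> carrier_mat (mdim X) ?n"
      using that(1,2) unfolding mhom_def by blast+
    show ?thesis using left_invertible_dims[OF cc that(3)] that(4) by linarith
  qed
  obtain X F G where X: "right_module sc X" "F \<in> mhom X M" "G \<in> mhom M X" "F * G = E" "G * F = 1\<^sub>m (mdim X)"
    using idempotent_splits_module[OF M(1) E(1,2)] by (elim exE conjE) (rule that; assumption)
  obtain Y F' G' where Y: "right_module sc Y" "F' \<in> mhom Y M" "G' \<in> mhom M Y" "F' * G' = 1\<^sub>m ?n - E"
      "G' * F' = 1\<^sub>m (mdim Y)"
    using idempotent_splits_module[OF M(1) E' o(1)] by (elim exE conjE) (rule that; assumption)
  have s: "F * G + F' * G' = 1\<^sub>m ?n"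
    using mhom_dims[OF E(1)] by (intro eq_matI) (simp_all add: X(4) Y(4))
  have "1\<^sub>m ?n - E \<noteq> 1\<^sub>m ?n"
  proof
    assume a: "1\<^sub>m ?n - E = 1\<^sub>m ?n"
    have "E = 0\<^sub>m ?n ?n"
    proof (rule eq_matI)
      fix i j assume ij: "i < dim_row (0\<^sub>m ?n ?n :: 'k mat)" "j < dim_col (0\<^sub>m ?n ?n :: 'k mat)"
      have "(1\<^sub>m ?n - E) $$ (i,j) = 1\<^sub>m ?n $$ (i,j)" by (simp only: a)
      then show "E $$ (i,j) = 0\<^sub>m ?n ?n $$ (i,j)" using ij mhom_dims[OF E(1)] by simp
    qed (use mhom_dims[OF E(1)] in simp_all)
    then show False using E(3) by blast
  qed
  then have "mdim Y < ?n" using lt[OF Y(2,3,5)] Y(4) by simp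
  moreover have "mdim X < ?n" using lt[OF X(2,3,5)] X(4) E(4) by simp
  ultimately show ?thesis using that X Y s by blast
qed

text \<open>Existence of decompositions into indecomposables, in the form of an induction rule. The
  zero module is a case of its own, since it does not count as indecomposable.\<close>

lemma module_induct [consumes 1, case_names zero indecomposable split]:
  assumes "right_module sc M"
    and zero: "\<And>M. right_module sc M \<Longrightarrow> mdim M = 0 \<Longrightarrow> P M"
    and indec: "\<And>M. indecomposable sc M \<Longrightarrow> P M"
    and split: "\<And>M X Y F G F' G'. right_module sc M \<Longrightarrow> right_module sc X \<Longrightarrow> right_module sc Y \<Longrightarrow> P X \<Longrightarrow> P Y \<Longrightarrow>
      F \<in> mhom X M \<Longrightarrow> G \<in> mhom M X \<Longrightarrow> F' \<in> mhom Y M \<Longrightarrow> G' \<in> mhom M Y \<Longrightarrow>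
      F * G + F' * G' = 1\<^sub>m (mdim M) \<Longrightarrow> G * F = 1\<^sub>m (mdim X) \<Longrightarrow> G' * F' = 1\<^sub>m (mdim Y) \<Longrightarrow> P M"
  shows "P M"
  using assms(1)
proof (induction "mdim M" arbitrary: M rule: less_induct)
  case less
  show ?case
  proof (cases "mdim M = 0 \<or> indecomposable sc M")
    case True then show ?thesis using zero indec less.prems by blast
  next
    case False
    then have nz: "mdim M \<noteq> 0" "\<not> indecomposable sc M" by auto
    show ?thesis
    proof (rule decomposable_splits[OF less.prems nz])
      fix X Y F G F' G'
      assume *: "right_module sc X" "right_module sc Y" "mdim X < mdim M" "mdim Y < mdim M"
        "F \<in> mhom X M" "G \<in> mhom M X" "F' \<in> mhom Y M" "G' \<in> mhom M Y"
        "F * G + F' * G' = 1\<^sub>m (mdim M)" "G * F = 1\<^sub>m (mdim X)" "G' * F' = 1\<^sub>m (mdim Y)"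
      show "P M"
        by (rule split[OF less.prems *(1,2) less.hyps[OF *(3,1)] less.hyps[OF *(4,2)] *(5-11)])
    qed
  qed
qed

text \<open>An element of the span of the powers above the \<open>k\<close>-th is
  \<open>H^k H R\<close> with \<open>R\<close> a polynomial in \<open>H\<close>; of this, the
  statement keeps that \<open>R\<close> is an endomorphism commuting with \<open>H\<close>.\<close>

lemma mhom_span_power:
  fixes H :: "'k :: field mat"
  assumes M: "right_module sc M" and H: "H \<in> mhom M M"
    and x: "x \<in> fun_vs.span ((\<lambda>i. mat_fun (H ^\<^sub>m i)) ` {k<..})"
  shows "\<exists>R\<in>mhom M M. R * H = H * R \<and> x = mat_fun (H ^\<^sub>m k * (H * R))"
  using x
proof (induction rule: fun_vs.span_induct_alt)
  case base
  show ?case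
    by (rule bexI[where x = "0\<^sub>m (mdim M) (mdim M)"])
      (simp_all add: mult_mat_zero_right mult_mat_zero_left mhom_dims[OF H] pow_mat_dim mat_fun_zero mhom_zero[OF M M])
next
  case (step c x y)
  note dH = mhom_dims[OF H]
  have pw: "H ^\<^sub>m j \<in> mhom M M \<and> H ^\<^sub>m j * H = H * H ^\<^sub>m j" for j
  proof (induction j)
    case 0 then show ?case by (simp add: dH mhom_one[OF M] mult_mat_one_left mult_mat_one_right)
  next
    case (Suc j)
    then have j: "H ^\<^sub>m j \<in> mhom M M" "H ^\<^sub>m j * H = H * H ^\<^sub>m j" by auto
    have "H ^\<^sub>m j * H * H = (H * H ^\<^sub>m j) * H" by (simp only: j(2))
    also have "\<dots> = H * (H ^\<^sub>m j * H)" by (rule mult_mat_assoc) (simp_all add: dH)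
    finally have "H ^\<^sub>m j * H * H = H * (H ^\<^sub>m j * H)" .
    with mhom_mult[OF M M M H j(1)] show ?case by simp
  qed
  have dp: "dim_row (H ^\<^sub>m j) = mdim M" "dim_col (H ^\<^sub>m j) = mdim M" for j
    using mhom_dims[of "H ^\<^sub>m j" M M] pw by auto
  have padd: "H ^\<^sub>m (i + j) = H ^\<^sub>m i * H ^\<^sub>m j" for i j
    by (induction j) (simp_all add: dp dH mult_mat_assoc mult_mat_one_right)
  from step obtain i where i: "i > k" "x = mat_fun (H ^\<^sub>m i)" by auto
  obtain R where R: "R \<in> mhom M M" "R * H = H * R" "y = mat_fun (H ^\<^sub>m k * (H * R))" using step by blast
  note dR = mhom_dims[OF R(1)]
  define j where "j = i - Suc k"
  have ij: "H ^\<^sub>m i = H ^\<^sub>m k * (H * H ^\<^sub>m j)"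
    using padd[of "Suc k" j] i(1) by (simp add: j_def mult_mat_assoc dp dH)
  let ?R = "c \<cdot>\<^sub>m H ^\<^sub>m j + R"
  have "?R \<in> mhom M M" using mhom_add[OF M M mhom_smult[OF M M] R(1)] pw by blast
  moreover have "?R * H = H * ?R"
    using pw[of j] by (simp add: mult_mat_simps dp dH dR R(2))
  moreover have "mat_fun (H ^\<^sub>m k * (H * ?R)) = fun_scale c x + y"
  proof -
    have "H ^\<^sub>m k * (H * ?R) = c \<cdot>\<^sub>m H ^\<^sub>m i + H ^\<^sub>m k * (H * R)"
      unfolding ij by (simp add: mult_mat_simps dp dH dR)
    also have "mat_fun \<dots> = mat_fun (c \<cdot>\<^sub>m H ^\<^sub>m i) + mat_fun (H ^\<^sub>m k * (H * R))"
      by (rule mat_fun_add[where m = "mdim M" and n = "mdim M"]; rule carrier_matI; simp add: dp dR dH)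
    finally show ?thesis unfolding mat_fun_smult R(3) i(2) .
  qed
  ultimately show ?case by metis
qed

text \<open>The powers of \<open>H\<close> live in a finite-dimensional space, so some power depends
  linearly on higher ones.\<close>

lemma endo_power_divides:
  fixes H :: "'k :: field mat"
  assumes M: "right_module sc M" and H: "H \<in> mhom M M"
  shows "\<exists>k R. R \<in> mhom M M \<and> R * H = H * R \<and> H ^\<^sub>m k = H ^\<^sub>m k * (H * R)"
proof -
  note dH = mhom_dims[OF H]
  obtain T where T: "finite T" "\<forall>A\<in>carrier_mat (mdim M) (mdim M). mat_fun (A :: 'k mat) \<in> fun_vs.span T"
    using mat_fun_finite_dim[of "mdim M" "mdim M"] by (elim exE conjE) (rule that; assumption)
  have c: "H ^\<^sub>m i \<in> carrier_mat (mdim M) (mdim M)" for i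
    by (rule pow_carrier_mat) (rule carrier_matI; simp add: dH)
  obtain k where "mat_fun (H ^\<^sub>m k) \<in> fun_vs.span ((\<lambda>i. mat_fun (H ^\<^sub>m i)) ` {k<..})"
    using fun_vs.sequence_dependent[of T "\<lambda>i. mat_fun (H ^\<^sub>m i)", OF T(1) T(2)[rule_format, OF c]] by (elim exE) (rule that)
  from mhom_span_power[OF M H this] obtain R where
    R: "R \<in> mhom M M" "R * H = H * R" "mat_fun (H ^\<^sub>m k) = mat_fun (H ^\<^sub>m k * (H * R))"
    by (elim bexE conjE) (rule that; assumption)
  have "H ^\<^sub>m k * (H * R) \<in> carrier_mat (mdim M) (mdim M)"
    using c[of k] by (intro carrier_matI) (simp_all add: mhom_dims[OF R(1)] dH)
  from mat_fun_inject[THEN iffD1, OF c[of k] this R(3)]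
  show ?thesis by (intro exI[of _ k] exI[of _ R] conjI R(1,2))
qed

text \<open>Fitting's lemma: the endomorphism ring of an indecomposable is local. From
  \<open>H^k = H^k H R\<close> an idempotent \<open>E = H^k S\<close> with
  \<open>H^k E = H^k\<close> is built. If it is 1 then \<open>H\<close> is invertible; if it is 0
  then \<open>H\<close> is nilpotent and \<open>1 - H\<close> is invertible.\<close>

lemma endo_iso_or_one_minus_iso:
  fixes H :: "'k :: field mat"
  assumes ind: "indecomposable sc M" and H: "H \<in> mhom M M"
  shows "is_iso M M H \<or> is_iso M M (1\<^sub>m (mdim M) - H)"
proof -
  let ?n = "mdim M"
  note M = indecomposableD(1)[OF ind] and dH = mhom_dims[OF H]
  obtain k R where R: "R \<in> mhom M M" "R * H = H * R" "H ^\<^sub>m k = H ^\<^sub>m k * (H * R)"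
    using endo_power_divides[OF M H] by (elim exE conjE) (rule that; assumption)
  define P where "P = H ^\<^sub>m k"
  have pw: "H ^\<^sub>m j \<in> mhom M M \<and> H ^\<^sub>m j * H = H * H ^\<^sub>m j" for j
  proof (induction j)
    case 0 then show ?case by (simp add: dH mhom_one[OF M] mult_mat_one_left mult_mat_one_right)
  next
    case (Suc j)
    then have j: "H ^\<^sub>m j \<in> mhom M M" "H ^\<^sub>m j * H = H * H ^\<^sub>m j" by auto
    have "H ^\<^sub>m j * H * H = (H * H ^\<^sub>m j) * H" by (simp only: j(2))
    also have "\<dots> = H * (H ^\<^sub>m j * H)" by (rule mult_mat_assoc) (simp_all add: dH)
    finally have "H ^\<^sub>m j * H * H = H * (H ^\<^sub>m j * H)" .
    with mhom_mult[OF M M M H j(1)] show ?case by simp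
  qed
  have P: "P \<in> mhom M M" "P = P * (H * R)" using pw R(3) by (auto simp: P_def)
  note d = dH mhom_dims[OF R(1)] mhom_dims[OF P(1)]
  have dp: "dim_row (H ^\<^sub>m j) = ?n" "dim_col (H ^\<^sub>m j) = ?n" for j
    using mhom_dims[of "H ^\<^sub>m j" M M] pw by auto
  \<comment> \<open>Iterating \<open>P = P (H R)\<close> moves any number of factors
    \<open>H\<close> to the left; the value \<open>j = k\<close> then gives
    \<open>P = P (P S)\<close>.\<close>
  have ex: "\<exists>S\<in>mhom M M. S * H = H * S \<and> P = H ^\<^sub>m j * (P * S)" for j
  proof (induction j)
    case 0 then show ?case
      by (intro bexI[of _ "1\<^sub>m ?n"]) (simp_all add: d mhom_one[OF M] mult_mat_one_left mult_mat_one_right)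
  next
    case (Suc j)
    then obtain S where S: "S \<in> mhom M M" "S * H = H * S" "P = H ^\<^sub>m j * (P * S)"
      by (elim bexE conjE) (rule that; assumption)
    note dS = mhom_dims[OF S(1)]
    have PH: "P * H = H * P" using pw by (simp add: P_def)
    have "P = H ^\<^sub>m j * (P * (H * R) * S)" using S(3) P(2) by simp
    also have "\<dots> = H ^\<^sub>m j * ((P * H) * (R * S))" by (simp add: d dp dS mult_mat_assoc)
    also have "\<dots> = (H ^\<^sub>m j * H) * (P * (R * S))" by (simp only: PH) (simp add: d dp dS mult_mat_assoc)
    finally have "P = H ^\<^sub>m Suc j * (P * (R * S))" by simp
    moreover have "(R * S) * H = H * (R * S)"
    proof -
      have "(R * S) * H = R * (S * H)" by (rule mult_mat_assoc) (simp_all add: d dS)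
      also have "\<dots> = (R * H) * S" by (simp only: S(2)) (simp add: d dS mult_mat_assoc)
      also have "\<dots> = H * (R * S)" by (simp only: R(2)) (simp add: d dS mult_mat_assoc)
      finally show ?thesis .
    qed
    ultimately show ?case by (intro bexI[of _ "R * S"] conjI mhom_mult[OF M M M S(1) R(1)])
  qed
  obtain S where S: "S \<in> mhom M M" "S * H = H * S" "P = P * (P * S)"
    using ex[of k, folded P_def] by (elim bexE conjE) (rule that; assumption)
  note dS = mhom_dims[OF S(1)]
  have SP: "S * P = P * S"
  proof -
    have "S * H ^\<^sub>m j = H ^\<^sub>m j * S" for j
    proof (induction j)
      case 0 show ?case by (simp add: d dS mult_mat_one_left mult_mat_one_right)
    next
      case (Suc j)
      have "S * H ^\<^sub>m Suc j = (S * H ^\<^sub>m j) * H" by (simp add: mult_mat_assoc d dp dS)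
      also have "\<dots> = H ^\<^sub>m j * (S * H)" by (simp only: Suc) (simp add: mult_mat_assoc d dp dS)
      also have "\<dots> = H ^\<^sub>m Suc j * S" by (simp only: S(2)) (simp add: mult_mat_assoc d dp dS)
      finally show ?case .
    qed
    then show ?thesis by (simp add: P_def)
  qed
  define E where "E = P * S"
  have E: "E \<in> mhom M M" unfolding E_def by (rule mhom_mult[OF M M M S(1) P(1)])
  have PE: "P * E = P" using S(3) by (simp add: E_def)
  have "E * E = P * (S * P) * S" by (simp add: E_def mult_mat_assoc d dS)
  also have "\<dots> = P * (P * S) * S" by (simp only: SP)
  also have "\<dots> = E" using PE by (simp add: E_def)
  finally have "E * E = E" .
  from indecomposable_idempotent[OF ind E this] show ?thesis
  proof
    assume E1: "E = 1\<^sub>m ?n"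
    have SPHR: "S * P = S * P * (H * R)"
    proof -
      have "S * P = S * (P * (H * R))" by (rule arg_cong[OF P(2)])
      also have "\<dots> = S * P * (H * R)" by (rule mult_mat_assoc[symmetric]) (simp_all add: d dS)
      finally show ?thesis .
    qed
    have "S * P = 1\<^sub>m ?n" using SP E1 by (simp add: E_def)
    with SPHR have "H * R = 1\<^sub>m ?n" by (simp add: mult_mat_one_left d)
    with R have "is_iso M M H" by (intro is_isoI[OF H R(1)]) simp_all
    then show ?thesis ..
  next
    assume "E = 0\<^sub>m ?n ?n"
    then have P0: "H ^\<^sub>m k = 0\<^sub>m ?n ?n" using PE by (simp add: P_def[symmetric] mult_mat_zero_right d)
    \<comment> \<open>Partial sums of the geometric series; at \<open>j = k\<close> the remainder
      vanishes and \<open>U\<close> inverts \<open>1 - H\<close>.\<close>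
    have "\<exists>U\<in>mhom M M. U * H = H * U \<and> (1\<^sub>m ?n - H) * U = 1\<^sub>m ?n - H ^\<^sub>m j" for j
    proof (induction j)
      case 0
      show ?case
        by (intro bexI[of _ "0\<^sub>m ?n ?n"]) (simp_all add: mult_mat_zero_left mult_mat_zero_right d mhom_zero[OF M M] diff_mat_self)
    next
      case (Suc j)
      then obtain U where U: "U \<in> mhom M M" "U * H = H * U" "(1\<^sub>m ?n - H) * U = 1\<^sub>m ?n - H ^\<^sub>m j"
        by (elim bexE conjE) (rule that; assumption)
      note dU = mhom_dims[OF U(1)]
      show ?case
      proof (intro bexI[of _ "U + H ^\<^sub>m j"] conjI)
        show "U + H ^\<^sub>m j \<in> mhom M M" using mhom_add[OF M M U(1)] pw by blast
        show "(U + H ^\<^sub>m j) * H = H * (U + H ^\<^sub>m j)"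
          using pw[of j] by (simp add: mult_mat_add_left mult_mat_add_right d dp dU U(2))
        have "(1\<^sub>m ?n - H) * (U + H ^\<^sub>m j) = (1\<^sub>m ?n - H) * U + (1\<^sub>m ?n - H) * H ^\<^sub>m j"
          by (rule mult_mat_add_right) (simp_all add: d dp dU)
        also have "(1\<^sub>m ?n - H) * H ^\<^sub>m j = H ^\<^sub>m j - H * H ^\<^sub>m j"
          by (subst mult_mat_diff_left) (simp_all add: d dp mult_mat_one_left)
        also have "H * H ^\<^sub>m j = H ^\<^sub>m Suc j" using pw[of j] by simp
        also have "(1\<^sub>m ?n - H) * U + (H ^\<^sub>m j - H ^\<^sub>m Suc j) = 1\<^sub>m ?n - H ^\<^sub>m Suc j"
          unfolding U(3) by (rule eq_matI) (simp_all add: d dp del: index_mult_mat(1))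
        finally show "(1\<^sub>m ?n - H) * (U + H ^\<^sub>m j) = 1\<^sub>m ?n - H ^\<^sub>m Suc j" .
      qed
    qed
    from this[of k] obtain U where U: "U \<in> mhom M M" "U * H = H * U" "(1\<^sub>m ?n - H) * U = 1\<^sub>m ?n - H ^\<^sub>m k"
      by (elim bexE conjE) (rule that; assumption)
    note dU = mhom_dims[OF U(1)]
    have r: "(1\<^sub>m ?n - H) * U = 1\<^sub>m ?n" using U(3) unfolding P0 by (simp add: diff_mat_zero)
    have "U * (1\<^sub>m ?n - H) = (1\<^sub>m ?n - H) * U"
      by (subst mult_mat_diff_left, simp_all add: d dU, subst mult_mat_diff_right)
        (simp_all add: d dU U(2) mult_mat_one_left mult_mat_one_right)
    then have "is_iso M M (1\<^sub>m ?n - H)"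
      by (intro is_isoI[OF mhom_diff[OF M M mhom_one[OF M] H] U(1)]) (simp_all add: r)
    then show ?thesis ..
  qed
qed

lemma split_monoI: "F \<in> mhom X Y \<Longrightarrow> G \<in> mhom Y X \<Longrightarrow> G * F = 1\<^sub>m (mdim X) \<Longrightarrow> split_mono X Y F"
  unfolding split_mono_def by (rule conjI, assumption) (rule bexI)

lemma split_epiI: "F \<in> mhom X Y \<Longrightarrow> G \<in> mhom Y X \<Longrightarrow> F * G = 1\<^sub>m (mdim Y) \<Longrightarrow> split_epi X Y F"
  unfolding split_epi_def by (rule conjI, assumption) (rule bexI)

text \<open>If \<open>G F\<close> were invertible, \<open>F\<close> would be a split monomorphism;
  so it is not, and by locality \<open>1 - G F\<close> is.\<close>

lemma mrad_of_not_split_mono: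
  assumes X: "indecomposable sc X" and Y: "right_module sc Y" and F: "F \<in> mhom X Y" and n: "\<not> split_mono X Y F"
  shows "F \<in> mrad X Y"
proof (rule mradI[OF F])
  fix G assume G: "G \<in> mhom Y X"
  note mX = indecomposableD(1)[OF X]
  have "\<not> is_iso X X (G * F)"
  proof
    assume "is_iso X X (G * F)"
    then obtain K where K: "K \<in> mhom X X" "K * (G * F) = 1\<^sub>m (mdim X)" by (rule is_isoE)
    then have "K * G * F = 1\<^sub>m (mdim X)"
      by (subst mult_mat_assoc) (simp_all add: mhom_dims[OF F] mhom_dims[OF G] mhom_dims[OF K(1)])
    from split_monoI[OF F mhom_mult[OF Y mX mX G K(1)] this] n show False by simp
  qed
  then show "is_iso X X (1\<^sub>m (mdim X) - G * F)"
    using endo_iso_or_one_minus_iso[OF X mhom_mult[OF mX Y mX F G]] by blast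
qed

lemma mrad_of_not_split_epi:
  assumes Y: "indecomposable sc Y" and X: "right_module sc X" and F: "F \<in> mhom X Y" and n: "\<not> split_epi X Y F"
  shows "F \<in> mrad X Y"
proof (rule mradI_right[OF X indecomposableD(1)[OF Y] F])
  fix G assume G: "G \<in> mhom Y X"
  note mY = indecomposableD(1)[OF Y]
  have "\<not> is_iso Y Y (F * G)"
  proof
    assume "is_iso Y Y (F * G)"
    then obtain K where K: "K \<in> mhom Y Y" "F * G * K = 1\<^sub>m (mdim Y)" by (rule is_isoE)
    then have "F * (G * K) = 1\<^sub>m (mdim Y)"
      by (subst mult_mat_assoc[symmetric]) (simp_all add: mhom_dims[OF F] mhom_dims[OF G] mhom_dims[OF K(1)])
    from split_epiI[OF F mhom_mult[OF mY mY X K(1) G] this] n show False by simp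
  qed
  then show "is_iso Y Y (1\<^sub>m (mdim Y) - F * G)"
    using endo_iso_or_one_minus_iso[OF Y mhom_mult[OF mY X mY G F]] by blast
qed

section \<open>Powers of the radical and irreducible morphisms\<close>

lemma rad_power_mhom:
  assumes "rad_power sc m X Y F" "right_module sc X" "right_module sc Y"
  shows "F \<in> mhom X Y"
  using assms by (induction rule: rad_power.induct) (auto intro: mhom_mult mradD(1) mhom_add)

lemma rad_power_zero_mat:
  assumes X: "right_module sc X" and Y: "right_module sc Y"
  shows "rad_power sc m X Y (0\<^sub>m (mdim Y) (mdim X))"
  using Y
proof (induction m arbitrary: Y)
  case 0 then show ?case by (intro rad_power.zero mhom_zero[OF X])
next
  case (Suc m)
  from rad_power.comp[OF Suc.IH[OF Suc.prems] Suc.prems mrad_zero[OF Suc.prems Suc.prems]]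
  show ?case by (simp add: mult_mat_zero_left)
qed

lemma rad_power_mult_left:
  assumes "rad_power sc m X Y F" "right_module sc X" "right_module sc Y" "right_module sc Z" "G \<in> mhom Y Z"
  shows "rad_power sc m X Z (G * F)"
  using assms
proof (induction arbitrary: Z G rule: rad_power.induct)
  case (zero F X Y)
  then show ?case by (blast intro: rad_power.zero mhom_mult)
next
  case (comp m X W F H Y)
  have "rad_power sc (Suc m) X Z ((G * H) * F)"
    by (rule rad_power.comp[OF comp.hyps(1,2)]) (rule mrad_mult_left[OF comp.hyps(2) comp.prems(2,3) comp.hyps(3) comp.prems(4)])
  also have "(G * H) * F = G * (H * F)"
    by (rule mult_mat_assoc)
      (simp_all add: mhom_dims[OF comp.prems(4)] mhom_dims[OF mradD(1)[OF comp.hyps(3)]]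
         mhom_dims[OF rad_power_mhom[OF comp.hyps(1) comp.prems(1) comp.hyps(2)]])
  finally show ?case .
next
  case (add m X Y F F')
  have "G * (F + F') = G * F + G * F'"
    by (rule mult_mat_add_right)
      (simp_all add: mhom_dims[OF add.prems(4)] mhom_dims[OF rad_power_mhom[OF add.hyps(1) add.prems(1,2)]]
        mhom_dims[OF rad_power_mhom[OF add.hyps(2) add.prems(1,2)]])
  then show ?case using rad_power.add[OF add.IH(1)[OF add.prems] add.IH(2)[OF add.prems]] by simp
qed

lemma rad_power_mult:
  assumes "rad_power sc n Y Z G" "rad_power sc m X Y F" "right_module sc X" "right_module sc Y" "right_module sc Z"
  shows "rad_power sc (m + n) X Z (G * F)"
  using assms
proof (induction rule: rad_power.induct)
  case (zero G Y Z)
  then show ?case using rad_power_mult_left by fastforce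
next
  case (comp n Y W G H Z)
  have "rad_power sc (Suc (m + n)) X Z (H * (G * F))"
    using comp.IH[OF comp.prems(1-3) comp.hyps(2)] by (rule rad_power.comp[OF _ comp.hyps(2,3)])
  also have "H * (G * F) = H * G * F"
    by (rule mult_mat_assoc[symmetric])
      (simp_all add: mhom_dims[OF mradD(1)[OF comp.hyps(3)]] mhom_dims[OF rad_power_mhom[OF comp.hyps(1) comp.prems(3) comp.hyps(2)]]
         mhom_dims[OF rad_power_mhom[OF comp.prems(1,2,3)]])
  finally show ?case by simp
next
  case (add n Y Z G G')
  have "(G + G') * F = G * F + G' * F"
    by (rule mult_mat_add_left)
      (simp_all add: mhom_dims[OF rad_power_mhom[OF add.hyps(1) add.prems(3,4)]] mhom_dims[OF rad_power_mhom[OF add.hyps(2) add.prems(3,4)]]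
         mhom_dims[OF rad_power_mhom[OF add.prems(1,2,3)]])
  then show ?case using rad_power.add[OF add.IH(1)[OF add.prems] add.IH(2)[OF add.prems]] by simp
qed

lemma rad_power_one:
  assumes "right_module sc X" "F \<in> mrad X Y"
  shows "rad_power sc 1 X Y F"
  using rad_power.comp[OF rad_power.zero[OF mhom_one[OF assms(1)]] assms]
  by (simp add: mult_mat_one_right mhom_dims[OF mradD(1)[OF assms(2)]])

lemma rad_power_Suc_imp:
  assumes "rad_power sc n X Y F" "n = Suc m" "right_module sc X" "right_module sc Y"
  shows "rad_power sc m X Y F"
  using assms
proof (induction arbitrary: m rule: rad_power.induct)
  case (comp n X Z F G Y)
  then show ?case using rad_power_mult_left[OF comp.hyps(1) comp.prems(2) comp.hyps(2) comp.prems(3) mradD(1)[OF comp.hyps(3)]]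
    by simp
qed (auto intro: rad_power.add)

lemma rad_power_antimono:
  assumes "right_module sc X" "right_module sc Y" "m \<le> n" "rad_power sc n X Y F"
  shows "rad_power sc m X Y F"
  using assms(3,4)
proof (induction n)
  case (Suc n)
  then show ?case using rad_power_Suc_imp[OF Suc.prems(2) refl assms(1,2)] by (cases "m = Suc n") auto
qed simp

text \<open>One half of the description of the irreducible morphisms between indecomposables as
  those in the radical outside of its square: in a factorisation without a split factor, both
  factors are radical.\<close>

lemma irreducible_of_mrad:
  assumes X: "indecomposable sc X" and Y: "indecomposable sc Y" and F: "F \<in> mrad X Y" "\<not> rad_power sc 2 X Y F"
  shows "irreducible_mor sc X Y F"
  unfolding irreducible_mor_def
proof (intro conjI allI impI mradD(1)[OF F(1)] mrad_not_split[OF indecomposableD(1)[OF X] indecomposableD(1)[OF Y] F(1)]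
    indecomposableD(2)[OF X] indecomposableD(2)[OF Y])
  fix Z G H assume *: "right_module sc Z \<and> G \<in> mhom X Z \<and> H \<in> mhom Z Y \<and> F = H * G"
  show "split_mono X Z G \<or> split_epi Z Y H"
  proof (rule ccontr)
    assume n: "\<not> ?thesis"
    have G: "G \<in> mrad X Z" using mrad_of_not_split_mono[OF X, of Z G] * n by simp
    have H: "H \<in> mrad Z Y" using mrad_of_not_split_epi[OF Y, of Z H] * n by simp
    have "rad_power sc (Suc 1) X Y (H * G)"
      using rad_power.comp[OF rad_power_one[OF indecomposableD(1)[OF X] G] _ H] * by simp
    with F(2) * show False by (simp add: numeral_2_eq_2)
  qed
qed

text \<open>\<open>F * G\<close> is an idempotent endomorphism of \<open>Y\<close>, and it is
  nonzero because \<open>G * F = 1\<close>.\<close>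

lemma split_mono_indecomposable_iso:
  assumes X: "indecomposable sc X" and Y: "indecomposable sc Y" and s: "split_mono X Y F"
  shows "is_iso X Y F"
proof -
  note m = indecomposableD(1)[OF X] indecomposableD(1)[OF Y]
  obtain G where F: "F \<in> mhom X Y" and G: "G \<in> mhom Y X" and GF: "G * F = 1\<^sub>m (mdim X)"
    using s unfolding split_mono_def by (elim conjE bexE) (rule that; assumption)
  note d = mhom_dims[OF F] mhom_dims[OF G]
  have "F * G * (F * G) = F * ((G * F) * G)" by (simp add: d mult_mat_assoc)
  also have "\<dots> = F * G" by (simp only: GF) (simp add: d mult_mat_one_left)
  finally have "F * G = 0\<^sub>m (mdim Y) (mdim Y) \<or> F * G = 1\<^sub>m (mdim Y)"
    by (rule indecomposable_idempotent[OF Y mhom_mult[OF m(2,1,2) G F]])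
  then show ?thesis
  proof
    assume z: "F * G = 0\<^sub>m (mdim Y) (mdim Y)"
    have "G * (F * G) * F = (G * F) * (G * F)" by (simp add: d mult_mat_assoc)
    then have "0\<^sub>m (mdim X) (mdim X) = 1\<^sub>m (mdim X) * (1\<^sub>m (mdim X) :: 'a mat)"
      unfolding z GF by (simp add: d mult_mat_zero_left mult_mat_zero_right)
    then have "\<not> is_iso X X (1\<^sub>m (mdim X))" using iso_not_zero[OF _ indecomposableD(2)[OF X]] by auto
    then show ?thesis using is_iso_one[OF m(1)] by blast
  qed (rule is_isoI[OF F G GF])
qed

lemma mrad_of_not_iso:
  assumes X: "indecomposable sc X" and Y: "indecomposable sc Y" and F: "F \<in> mhom X Y" "\<not> is_iso X Y F"
  shows "F \<in> mrad X Y"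
  using mrad_of_not_split_mono[OF X indecomposableD(1)[OF Y] F(1)] split_mono_indecomposable_iso[OF X Y] F(2) by blast

section \<open>Powers of the radical and paths in the Auslander-Reiten quiver\<close>

text \<open>A relation rather than a distance, because lengths become unique only under the
  assumptions of \<open>directed_modules\<close>.\<close>

definition AR_walk :: "('k :: field \<Rightarrow> 'a :: ring_1 \<Rightarrow> 'a) \<Rightarrow> ('a, 'k) rmod \<Rightarrow> ('a, 'k) rmod \<Rightarrow> nat \<Rightarrow> bool" where
  "AR_walk sc X Y n \<longleftrightarrow>
     (\<exists>p. pre_digraph.awalk (AR_quiver sc) (iso_class sc X) p (iso_class sc Y) \<and> length p = n)"

lemma AR_quiver_simps:
  "verts (AR_quiver sc) = {iso_class sc X |X. indecomposable sc X}"
  "arcs (AR_quiver sc) = {(iso_class sc X, iso_class sc Y) |X Y.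
     indecomposable sc X \<and> indecomposable sc Y \<and> (\<exists>F. irreducible_mor sc X Y F)}"
  "tail (AR_quiver sc) = fst" "head (AR_quiver sc) = snd"
  unfolding AR_quiver_def by (rule pre_digraph.simps)+

lemma iso_class_in_AR_verts: "indecomposable sc X \<Longrightarrow> iso_class sc X \<in> verts (AR_quiver sc)"
  unfolding AR_quiver_simps by blast

lemma arc_in_AR_arcs:
  "indecomposable sc X \<Longrightarrow> indecomposable sc Y \<Longrightarrow> irreducible_mor sc X Y F
    \<Longrightarrow> (iso_class sc X, iso_class sc Y) \<in> arcs (AR_quiver sc)"
  unfolding AR_quiver_simps by blast

lemma AR_arcE:
  assumes "e \<in> arcs (AR_quiver sc)"
  obtains X Y F where "e = (iso_class sc X, iso_class sc Y)" "indecomposable sc X" "indecomposable sc Y"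
    "irreducible_mor sc X Y F"
  using assms unfolding AR_quiver_simps by blast

lemma wf_AR_quiver: "wf_digraph (AR_quiver sc)"
proof
  fix e assume "e \<in> arcs (AR_quiver sc)"
  then show "tail (AR_quiver sc) e \<in> verts (AR_quiver sc)" "head (AR_quiver sc) e \<in> verts (AR_quiver sc)"
    by (elim AR_arcE; simp add: AR_quiver_simps(3,4) iso_class_in_AR_verts)+
qed

lemma AR_walk_zero:
  assumes "indecomposable sc X" "right_module sc Y" "isomorphic X Y"
  shows "AR_walk sc X Y 0"
  unfolding AR_walk_def
  using iso_class_in_AR_verts[OF assms(1)] iso_class_eq[OF indecomposableD(1)[OF assms(1)] assms(2,3)]
  by (intro exI[of _ "[]"]) (simp add: pre_digraph.awalk_def pre_digraph.cas.simps)

lemma AR_walk_arrow: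
  assumes "indecomposable sc X" "indecomposable sc Y" "irreducible_mor sc X Y F"
  shows "AR_walk sc X Y 1"
  unfolding AR_walk_def
  by (rule exI[of _ "[(iso_class sc X, iso_class sc Y)]"])
    (simp add: pre_digraph.awalk_def pre_digraph.cas.simps iso_class_in_AR_verts[OF assms(1)]
      arc_in_AR_arcs[OF assms] AR_quiver_simps(3,4))

lemma AR_walk_trans:
  assumes "AR_walk sc X Y m" "AR_walk sc Y Z n"
  shows "AR_walk sc X Z (m + n)"
proof -
  obtain p q where "pre_digraph.awalk (AR_quiver sc) (iso_class sc X) p (iso_class sc Y)" "length p = m"
    "pre_digraph.awalk (AR_quiver sc) (iso_class sc Y) q (iso_class sc Z)" "length q = n"
    using assms by (auto simp: AR_walk_def)
  then show ?thesis unfolding AR_walk_def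
    by (intro exI[of _ "p @ q"]) (auto intro: wf_digraph.awalk_appendI[OF wf_AR_quiver])
qed

lemma mult_split_identity:
  assumes "F \<in> mhom X Z" "G \<in> mhom Z Y" "I1 \<in> mhom Z1 Z" "P1 \<in> mhom Z Z1" "I2 \<in> mhom Z2 Z" "P2 \<in> mhom Z Z2"
    and s: "I1 * P1 + I2 * P2 = 1\<^sub>m (mdim Z)"
  shows "G * F = (G * I1) * (P1 * F) + (G * I2) * (P2 * F)"
proof -
  note d = assms(1-6)[THEN mhom_dims(1)] assms(1-6)[THEN mhom_dims(2)]
  have "G * F = G * ((I1 * P1 + I2 * P2) * F)" by (simp only: s) (simp add: d mult_mat_one_left)
  also have "\<dots> = (G * I1) * (P1 * F) + (G * I2) * (P2 * F)"
    by (simp add: d mult_mat_add_left mult_mat_add_right mult_mat_assoc)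
  finally show ?thesis .
qed

text \<open>The middle module \<open>Z\<close> is decomposed. At an indecomposable summand either
  one of the two factors lies one power deeper, and then so does the composite, or an irreducible
  morphism to \<open>Y\<close> prolongs a path that starts at \<open>X\<close>.\<close>

lemma rad_power_comp_walk:
  assumes Z: "right_module sc Z" and X: "indecomposable sc X" and Y: "indecomposable sc Y"
    and IH: "\<And>Y F. indecomposable sc Y \<Longrightarrow> rad_power sc m X Y F \<Longrightarrow> rad_power sc (Suc m) X Y F \<or> AR_walk sc X Y m"
    and F: "rad_power sc m X Z F" and G: "G \<in> mrad Z Y"
  shows "rad_power sc (Suc (Suc m)) X Y (G * F) \<or> AR_walk sc X Y (Suc m)"
  using Z F G
proof (induction arbitrary: F G rule: module_induct)
  case (zero Z)
  note mX = indecomposableD(1)[OF X] and mY = indecomposableD(1)[OF Y]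
  have "G * F = 0\<^sub>m (mdim Y) (mdim X)"
    by (rule eq_matI)
      (simp_all add: scalar_prod_def mhom_dims[OF rad_power_mhom[OF zero(3) mX zero(1)]] mhom_dims[OF mradD(1)[OF zero(4)]] zero(2))
  then show ?case using rad_power_zero_mat[OF mX mY] by simp
next
  case (indecomposable Z)
  note mX = indecomposableD(1)[OF X] and mY = indecomposableD(1)[OF Y] and mZ = indecomposableD(1)[OF indecomposable(1)]
  from IH[OF indecomposable(1,2)] show ?case
  proof
    assume "rad_power sc (Suc m) X Z F"
    from rad_power.comp[OF this mZ indecomposable(3)] show ?thesis by blast
  next
    assume w: "AR_walk sc X Z m"
    show ?thesis
    proof (cases "rad_power sc 2 Z Y G")
      case True
      from rad_power_mult[OF this indecomposable(2) mX mZ mY] show ?thesis by (simp add: numeral_2_eq_2)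
    next
      case False
      from AR_walk_trans[OF w AR_walk_arrow[OF indecomposable(1) Y irreducible_of_mrad[OF indecomposable(1) Y indecomposable(3) False]]]
      show ?thesis by simp
    qed
  qed
next
  case (split Z Z1 Z2 I1 P1 I2 P2)
  note mX = indecomposableD(1)[OF X] and mY = indecomposableD(1)[OF Y]
  note FH = rad_power_mhom[OF split.prems(1) mX split.hyps(1)] and GH = mradD(1)[OF split.prems(2)]
  have 1: "rad_power sc (Suc (Suc m)) X Y ((G * I1) * (P1 * F)) \<or> AR_walk sc X Y (Suc m)"
    by (rule split.IH(1)[OF rad_power_mult_left[OF split.prems(1) mX split.hyps(1,2) split.hyps(5)]
          mrad_mult_right[OF split.hyps(2,1) mY split.prems(2) split.hyps(4)]])
  have 2: "rad_power sc (Suc (Suc m)) X Y ((G * I2) * (P2 * F)) \<or> AR_walk sc X Y (Suc m)"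
    by (rule split.IH(2)[OF rad_power_mult_left[OF split.prems(1) mX split.hyps(1,3) split.hyps(7)]
          mrad_mult_right[OF split.hyps(3,1) mY split.prems(2) split.hyps(6)]])
  have "G * F = (G * I1) * (P1 * F) + (G * I2) * (P2 * F)"
    by (rule mult_split_identity[OF FH GH split.hyps(4-8)])
  then show ?case using 1 2 rad_power.add by (metis (no_types, lifting))
qed

text \<open>The disjunction is what survives sums: either some summand provides the path, or all
  summands lie one power deeper and so does their sum.\<close>

lemma rad_power_walk:
  assumes X: "indecomposable sc X" and Y: "indecomposable sc Y" and F: "rad_power sc m X Y F"
  shows "rad_power sc (Suc m) X Y F \<or> AR_walk sc X Y m"
  using Y F
proof (induction m arbitrary: Y F)
  case 0
  note mX = indecomposableD(1)[OF X] and mY = indecomposableD(1)[OF 0(1)]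
  have F: "F \<in> mhom X Y" by (rule rad_power_mhom[OF 0(2) mX mY])
  show ?case
  proof (cases "is_iso X Y F")
    case True
    then have "isomorphic X Y" unfolding isomorphic_def by blast
    then show ?thesis using AR_walk_zero[OF X mY] by blast
  next
    case False
    from rad_power_one[OF mX mrad_of_not_iso[OF X 0(1) F False]] show ?thesis by simp
  qed
next
  case (Suc m)
  have "rad_power sc (Suc n) X Y F \<or> AR_walk sc X Y n"
    if "rad_power sc n X' Y F" "n = Suc m" "X' = X" "indecomposable sc Y" for n X' F Y
    using that
  proof (induction rule: rad_power.induct)
    case (comp n X' Z F G Y)
    then show ?case using rad_power_comp_walk[OF comp.hyps(2) X comp.prems(3) Suc.IH] by simp
  next
    case (add n X' Y F F')
    then show ?case using rad_power.add by blast
  qed simp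
  from this[OF Suc.prems(2) refl refl Suc.prems(1)] show ?case .
qed

text \<open>For \<open>K = mhom\<close> this is membership in the subfunctor of Hom(X, _) generated
  by the morphisms in \<open>gs\<close>; for \<open>K = mrad\<close> the coefficients are radical,
  which gives the radical of that subfunctor. Nakayama's lemma compares the two.\<close>

primrec generated_by :: "(('a, 'k :: field) rmod \<Rightarrow> ('a, 'k) rmod \<Rightarrow> 'k mat set) \<Rightarrow> ('a, 'k) rmod \<Rightarrow>
    (('a, 'k) rmod \<times> 'k mat) list \<Rightarrow> ('a, 'k) rmod \<Rightarrow> 'k mat \<Rightarrow> bool" where
  "generated_by K X [] Y F \<longleftrightarrow> F = 0\<^sub>m (mdim Y) (mdim X)"
| "generated_by K X (g # gs) Y F \<longleftrightarrow>
     (\<exists>G R. G \<in> K (fst g) Y \<and> generated_by K X gs Y R \<and> F = G * snd g + R)"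

lemma generated_by_dims:
  assumes "generated_by K X gs Y F"
  shows "F \<in> carrier_mat (mdim Y) (mdim X)"
  using assms
proof (induction gs arbitrary: F)
  case (Cons g gs)
  then obtain G R where *: "generated_by K X gs Y R" "F = G * snd g + R" by auto
  with Cons.IH[OF *(1)] show ?case by auto
qed simp

lemma generated_by_zero:
  assumes "right_module sc X" "right_module sc Y"
    "\<And>g. g \<in> set gs \<Longrightarrow> right_module sc (fst g) \<and> snd g \<in> mhom X (fst g)"
    "\<And>Z. right_module sc Z \<Longrightarrow> 0\<^sub>m (mdim Y) (mdim Z) \<in> K Z Y"
  shows "generated_by K X gs Y (0\<^sub>m (mdim Y) (mdim X))"
  using assms(3)
proof (induction gs)
  case (Cons g gs)
  then have g: "right_module sc (fst g)" "snd g \<in> mhom X (fst g)" by auto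
  have "0\<^sub>m (mdim Y) (mdim (fst g)) * snd g + 0\<^sub>m (mdim Y) (mdim X) = 0\<^sub>m (mdim Y) (mdim X)"
    by (simp add: mult_mat_zero_left mhom_dims[OF g(2)])
  then show ?case using Cons assms(4)[OF g(1)] by (metis generated_by.simps(2) list.set_intros(2))
qed simp

lemma generated_by_add:
  assumes "right_module sc X" "right_module sc Y"
    "\<And>g. g \<in> set gs \<Longrightarrow> right_module sc (fst g) \<and> snd g \<in> mhom X (fst g)"
    "\<And>Z A B. right_module sc Z \<Longrightarrow> A \<in> K Z Y \<Longrightarrow> B \<in> K Z Y \<Longrightarrow> A + B \<in> K Z Y"
    "\<And>Z. K Z Y \<subseteq> mhom Z Y"
    and "generated_by K X gs Y F" "generated_by K X gs Y F'"
  shows "generated_by K X gs Y (F + F')"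
  using assms(3,6,7)
proof (induction gs arbitrary: F F')
  case (Cons g gs)
  obtain G R where 1: "G \<in> K (fst g) Y" "generated_by K X gs Y R" "F = G * snd g + R" using Cons.prems(2) by auto
  obtain G' R' where 2: "G' \<in> K (fst g) Y" "generated_by K X gs Y R'" "F' = G' * snd g + R'" using Cons.prems(3) by auto
  have g: "right_module sc (fst g)" "snd g \<in> mhom X (fst g)" using Cons.prems(1) by auto
  have h: "G \<in> mhom (fst g) Y" "G' \<in> mhom (fst g) Y" using 1 2 assms(5) by blast+
  note d = mhom_dims[OF h(1)] mhom_dims[OF h(2)] mhom_dims[OF g(2)] carrier_matD[OF generated_by_dims[OF 1(2)]]
    carrier_matD[OF generated_by_dims[OF 2(2)]]
  have "F + F' = (G + G') * snd g + (R + R')"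
    unfolding 1(3) 2(3) by (rule eq_matI) (simp_all add: d mult_mat_add_left del: index_mult_mat(1))
  moreover have "G + G' \<in> K (fst g) Y" using assms(4)[OF g(1) 1(1) 2(1)] .
  moreover have "generated_by K X gs Y (R + R')" using Cons.IH[OF _ 1(2) 2(2)] Cons.prems(1) by simp
  ultimately show ?case unfolding generated_by.simps by blast
qed simp

lemma generated_by_mult:
  assumes "right_module sc X" "right_module sc Y" "right_module sc Z"
    "\<And>g. g \<in> set gs \<Longrightarrow> right_module sc (fst g) \<and> snd g \<in> mhom X (fst g)"
    "\<And>W A. right_module sc W \<Longrightarrow> A \<in> mhom W Y \<Longrightarrow> H * A \<in> K W Z" "H \<in> mhom Y Z"
    and "generated_by mhom X gs Y F"
  shows "generated_by K X gs Z (H * F)"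
  using assms(4,7)
proof (induction gs arbitrary: F)
  case Nil
  then show ?case using mhom_dims[OF assms(6)] by (simp add: mult_mat_zero_right)
next
  case (Cons g gs)
  obtain G R where 1: "G \<in> mhom (fst g) Y" "generated_by mhom X gs Y R" "F = G * snd g + R" using Cons.prems(2) by auto
  have g: "right_module sc (fst g)" "snd g \<in> mhom X (fst g)" using Cons.prems(1) by auto
  note d = mhom_dims[OF 1(1)] mhom_dims[OF g(2)] carrier_matD[OF generated_by_dims[OF 1(2)]] mhom_dims[OF assms(6)]
  have "H * F = (H * G) * snd g + H * R"
    unfolding 1(3) by (simp add: d mult_mat_add_right mult_mat_assoc)
  moreover have "generated_by K X gs Z (H * R)" using Cons.IH[OF _ 1(2)] Cons.prems(1) by simp
  ultimately show ?case using assms(5)[OF g(1) 1(1)] unfolding generated_by.simps by blast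
qed

lemma generated_by_mono:
  assumes "generated_by K X gs Y F" "\<And>Z. K Z Y \<subseteq> L Z Y"
  shows "generated_by L X gs Y F"
  using assms(1)
proof (induction gs arbitrary: F)
  case (Cons g gs)
  then obtain G R where "G \<in> K (fst g) Y" "generated_by K X gs Y R" "F = G * snd g + R" by auto
  then show ?case using Cons.IH assms(2) unfolding generated_by.simps by blast
qed simp

lemma generated_by_member:
  assumes "right_module sc X" "right_module sc Y"
    "\<And>g. g \<in> set gs \<Longrightarrow> right_module sc (fst g) \<and> snd g \<in> mhom X (fst g)"
    "(Y, v) \<in> set gs"
  shows "generated_by mhom X gs Y v"
  using assms(3,4)
proof (induction gs)
  case (Cons g gs)
  have v: "v \<in> mhom X Y" using Cons.prems(1)[OF Cons.prems(2)] by simp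
  have gm: "right_module sc (fst g)" "snd g \<in> mhom X (fst g)" using Cons.prems by auto
  show ?case
  proof (cases "(Y, v) = g")
    case True
    have "generated_by mhom X gs Y (0\<^sub>m (mdim Y) (mdim X))"
      by (rule generated_by_zero[where K = mhom and gs = gs, OF assms(1,2) Cons.prems(1)[OF list.set_intros(2)] mhom_zero[OF _ assms(2)]])
    moreover have "v = 1\<^sub>m (mdim Y) * v + 0\<^sub>m (mdim Y) (mdim X)"
      by (simp add: mhom_dims[OF v] mult_mat_one_left add_mat_simps)
    ultimately show ?thesis using mhom_one[OF assms(2)] unfolding generated_by.simps True[symmetric] fst_conv snd_conv
      by (intro exI conjI)
  next
    case False
    then have "(Y, v) \<in> set gs" using Cons.prems(2) by simp
    then have "generated_by mhom X gs Y v" using Cons.IH[OF Cons.prems(1)[OF list.set_intros(2)]] by blast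
    moreover have "v = 0\<^sub>m (mdim Y) (mdim (fst g)) * snd g + v"
      by (simp add: mhom_dims[OF v] mhom_dims[OF gm(2)] mult_mat_zero_left add_mat_simps)
    ultimately show ?thesis using mhom_zero[OF gm(1) assms(2)] unfolding generated_by.simps by (intro exI conjI)
  qed
qed simp

text \<open>In a composite \<open>G * F\<close> with \<open>G\<close> radical and \<open>F\<close>
  in the \<open>N\<close>-th power, \<open>F\<close> is generated by \<open>gs\<close>, so that
  \<open>G * F\<close> has radical coefficients. Generation is given at indecomposable targets and
  is extended to all \<open>Z\<close> by decomposition.\<close>

lemma generated_by_rad_power_Suc:
  assumes X: "right_module sc X" and Y: "right_module sc Y"
    and gs: "\<And>g. g \<in> set gs \<Longrightarrow> right_module sc (fst g) \<and> snd g \<in> mhom X (fst g)"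
    and gen: "\<And>Z F. indecomposable sc Z \<Longrightarrow> rad_power sc N X Z F \<Longrightarrow> generated_by mhom X gs Z F"
    and F: "rad_power sc (Suc N) X Y F"
  shows "generated_by mrad X gs Y F"
proof -
  have rad_comp: "generated_by mrad X gs Y (G * F)"
    if Z: "right_module sc Z" and F: "rad_power sc N X Z F" and G: "G \<in> mrad Z Y" and Y: "right_module sc Y" for Z F G Y
  proof -
    have "generated_by mhom X gs Z F"
      using Z F
    proof (induction arbitrary: F rule: module_induct)
      case (zero Z)
      have "F = 0\<^sub>m (mdim Z) (mdim X)"
        using mhom_dims[OF rad_power_mhom[OF zero(3) X zero(1)]] zero(2) by (intro eq_matI) simp_all
      then show ?case
        using generated_by_zero[where K = mhom and gs = gs, OF X zero(1) gs mhom_zero[OF _ zero(1)]] by simp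
    next
      case (indecomposable Z)
      then show ?case by (intro gen)
    next
      case (split Z Z1 Z2 I1 P1 I2 P2)
      note FH = rad_power_mhom[OF split.prems X split.hyps(1)]
      have 1: "generated_by mhom X gs Z (I1 * (P1 * F))"
        by (rule generated_by_mult[where K = mhom, OF X split.hyps(2) split.hyps(1) gs mhom_mult[OF _ split.hyps(2,1) _ split.hyps(4)] split.hyps(4)
            split.IH(1)[OF rad_power_mult_left[OF split.prems X split.hyps(1,2,5)]]])
      have 2: "generated_by mhom X gs Z (I2 * (P2 * F))"
        by (rule generated_by_mult[where K = mhom, OF X split.hyps(3) split.hyps(1) gs mhom_mult[OF _ split.hyps(3,1) _ split.hyps(6)] split.hyps(6)
            split.IH(2)[OF rad_power_mult_left[OF split.prems X split.hyps(1,3,7)]]])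
      have "F = I1 * (P1 * F) + I2 * (P2 * F)"
        using mult_split_identity[OF FH mhom_one[OF split.hyps(1)] split.hyps(4-8)]
        by (simp add: mhom_dims[OF FH] mhom_dims[OF split.hyps(4)] mhom_dims[OF split.hyps(6)] mult_mat_one_left)
      then show ?case
        using generated_by_add[where K = mhom, OF X split.hyps(1) gs mhom_add[OF _ split.hyps(1)] subset_refl 1 2] by simp
    qed
    then show ?thesis
      by (intro generated_by_mult[where K = mrad, OF X Z Y gs mrad_mult_right[OF _ Z Y G] mradD(1)[OF G]])
  qed
  have "generated_by mrad X gs Y F" if "rad_power sc n X' Y F" "n = Suc N" "X' = X" "right_module sc Y" for n X' Y F
    using that
  proof (induction rule: rad_power.induct)
    case (comp n X' Z F G Y)
    show ?case using rad_comp[of Z F G Y] comp by simp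
  next
    case (add n X' Y F F')
    have "mrad W Y \<subseteq> mhom W Y" for W :: "('b, 'a) rmod" using mradD(1) by blast
    from generated_by_add[where K = mrad, OF X add.prems(3) gs mrad_add[OF _ add.prems(3)] this add.IH(1)[OF add.prems] add.IH(2)[OF add.prems]]
    show ?case by simp
  qed simp
  from this[OF F refl refl Y] show ?thesis .
qed

text \<open>Nakayama's lemma for the functor \<open>rad\<^sup>N (X, _)\<close>: a generator \<open>v\<close> satisfies \<open>v = j v + \<dots>\<close> with \<open>j\<close>
  radical, so it can be dropped because \<open>1 - j\<close> is invertible.\<close>

lemma rad_power_stable_zero:
  assumes X: "right_module sc X"
    and stable: "\<And>Z F. indecomposable sc Z \<Longrightarrow> rad_power sc N X Z F \<Longrightarrow> rad_power sc (Suc N) X Z F"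
    and gs: "\<And>g. g \<in> set gs \<Longrightarrow> indecomposable sc (fst g) \<and> rad_power sc N X (fst g) (snd g)"
    and gen: "\<And>Z F. indecomposable sc Z \<Longrightarrow> rad_power sc N X Z F \<Longrightarrow> generated_by mhom X gs Z F"
    and Y: "indecomposable sc Y" and F: "rad_power sc N X Y F"
  shows "F = 0\<^sub>m (mdim Y) (mdim X)"
  using gs gen
proof (induction gs)
  case Nil
  then show ?case using Y F by simp
next
  case (Cons g gs)
  have gm: "right_module sc (fst h) \<and> snd h \<in> mhom X (fst h)" if "h \<in> set (g # gs)" for h
    using Cons.prems(1)[OF that] rad_power_mhom X indecomposableD(1) by blast
  note gm' = gm[OF list.set_intros(2)]
  let ?Y = "fst g" and ?v = "snd g"
  have g: "indecomposable sc ?Y" "rad_power sc N X ?Y ?v" using Cons.prems(1)[of g] by simp_all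
  note mY = indecomposableD(1)[OF g(1)] and vh = gm[OF list.set_intros(1), THEN conjunct2]
  have "generated_by mrad X (g # gs) ?Y ?v"
    by (rule generated_by_rad_power_Suc[OF X mY gm Cons.prems(2) stable[OF g]])
  then have "\<exists>J R. J \<in> mrad ?Y ?Y \<and> generated_by mrad X gs ?Y R \<and> ?v = J * ?v + R" unfolding generated_by.simps .
  then obtain J R where J: "J \<in> mrad ?Y ?Y" and R: "generated_by mrad X gs ?Y R" and v: "?v = J * ?v + R"
    by (elim exE conjE) (rule that; assumption)
  have mm: "mrad W ?Y \<subseteq> mhom W ?Y" for W using mradD(1) by blast
  have R': "generated_by mhom X gs ?Y R" by (rule generated_by_mono[where K = mrad and L = mhom, OF R mm])
  obtain U where U: "U \<in> mhom ?Y ?Y" "U * (1\<^sub>m (mdim ?Y) - 1\<^sub>m (mdim ?Y) * J) = 1\<^sub>m (mdim ?Y)"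
    using mradD(2)[OF J mhom_one[OF mY]] by (elim is_isoE)
  note d = mhom_dims[OF vh] mhom_dims[OF mradD(1)[OF J]] mhom_dims[OF U(1)] carrier_matD[OF generated_by_dims[OF R]]
  have "(1\<^sub>m (mdim ?Y) - J) * ?v = ?v - J * ?v" by (simp add: d mult_mat_diff_left mult_mat_one_left)
  also have "\<dots> = R" using arg_cong[OF v, of "\<lambda>M. M - J * ?v"]
    by (intro eq_matI) (simp_all add: d del: index_mult_mat(1))
  finally have e: "(1\<^sub>m (mdim ?Y) - J) * ?v = R" .
  have "U * R = (U * (1\<^sub>m (mdim ?Y) - 1\<^sub>m (mdim ?Y) * J)) * ?v"
    unfolding e[symmetric] by (simp add: d mult_mat_assoc mult_mat_one_left)
  then have vU: "?v = U * R" unfolding U(2) by (simp add: d mult_mat_one_left)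
  have gv: "generated_by mhom X gs ?Y ?v"
    unfolding vU by (rule generated_by_mult[where K = mhom, OF X mY mY gm' mhom_mult[OF _ mY mY _ U(1)] U(1) R'])
  show ?case
  proof (rule Cons.IH)
    show "indecomposable sc (fst h) \<and> rad_power sc N X (fst h) (snd h)" if "h \<in> set gs" for h
      using Cons.prems(1) that by simp
    fix Z F assume Z: "indecomposable sc Z" "rad_power sc N X Z F"
    note mZ = indecomposableD(1)[OF Z(1)]
    from Cons.prems(2)[OF Z] obtain G S where G: "G \<in> mhom ?Y Z" and S: "generated_by mhom X gs Z S" and F: "F = G * ?v + S"
      unfolding generated_by.simps by (elim exE conjE) (rule that; assumption)
    have "generated_by mhom X gs Z (G * ?v)"
      by (rule generated_by_mult[where K = mhom, OF X mY mZ gm' mhom_mult[OF _ mY mZ _ G] G gv])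
    from generated_by_add[where K = mhom, OF X mZ gm' mhom_add[OF _ mZ] subset_refl this S]
    show "generated_by mhom X gs Z F" by (simp add: F)
  qed
qed

text \<open>The scalars of a linear combination are realised as scalar endomorphisms of
  \<open>Z\<close>.\<close>

lemma generated_by_span:
  assumes X: "right_module sc X" and Z: "right_module sc Z"
    and gs: "\<And>g. g \<in> set gs \<Longrightarrow> right_module sc (fst g) \<and> snd g \<in> mhom X (fst g)"
    and x: "x \<in> fun_vs.span (mat_fun ` {v. (Z, v) \<in> set gs})"
  shows "\<exists>A. generated_by mhom X gs Z A \<and> mat_fun A = x"
  using x
proof (induction rule: fun_vs.span_induct_alt)
  case base
  have "generated_by mhom X gs Z (0\<^sub>m (mdim Z) (mdim X))"
    by (rule generated_by_zero[where K = mhom, OF X Z gs mhom_zero[OF _ Z]])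
  then show ?case using mat_fun_zero by blast
next
  case (step c x y)
  then obtain v A where v: "(Z, v) \<in> set gs" "x = mat_fun v" and A: "generated_by mhom X gs Z A" "mat_fun A = y" by blast
  have gv: "generated_by mhom X gs Z v" by (rule generated_by_member[OF X Z gs v(1)])
  have cd: "v \<in> carrier_mat (mdim Z) (mdim X)" by (rule generated_by_dims[OF gv])
  have cI: "c \<cdot>\<^sub>m 1\<^sub>m (mdim Z) \<in> mhom Z Z" by (rule mhom_smult[OF Z Z mhom_one[OF Z]])
  have "generated_by mhom X gs Z ((c \<cdot>\<^sub>m 1\<^sub>m (mdim Z)) * v)"
    by (rule generated_by_mult[where K = mhom, OF X Z Z gs mhom_mult[OF _ Z Z _ cI] cI gv])
  also have "(c \<cdot>\<^sub>m 1\<^sub>m (mdim Z)) * v = c \<cdot>\<^sub>m v"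
    using cd by (simp add: mult_mat_smult_left mult_mat_one_left)
  finally have g: "generated_by mhom X gs Z (c \<cdot>\<^sub>m v)" .
  have "generated_by mhom X gs Z (c \<cdot>\<^sub>m v + A)"
    by (rule generated_by_add[where K = mhom, OF X Z gs mhom_add[OF _ Z] subset_refl g A(1)])
  moreover have "mat_fun (c \<cdot>\<^sub>m v + A) = fun_scale c x + y"
    using mat_fun_add[OF generated_by_dims[OF g] generated_by_dims[OF A(1)]]
    unfolding mat_fun_smult v(2) A(2) .
  ultimately show ?case by blast
qed

text \<open>For each of the finitely many isomorphism classes a finite spanning set at one
  representative is taken; a morphism to any indecomposable is carried to the representative and
  back.\<close>

lemma finite_generators:
  fixes sc :: "'k :: field \<Rightarrow> 'a :: ring_1 \<Rightarrow> 'a"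
  assumes fin: "representation_finite sc" and X: "right_module sc X"
  shows "\<exists>gs. (\<forall>g\<in>set gs. indecomposable sc (fst g) \<and> rad_power sc N X (fst g) (snd g)) \<and>
    (\<forall>Z F. indecomposable sc Z \<and> rad_power sc N X Z F \<longrightarrow> generated_by mhom X gs Z F)"
proof -
  define C where "C = {iso_class sc X |X. indecomposable sc X}"
  have finC: "finite C" using fin by (simp add: representation_finite_def C_def)
  define rep where "rep c = (SOME Z. indecomposable sc Z \<and> iso_class sc Z = c)" for c
  have rep: "indecomposable sc (rep c) \<and> iso_class sc (rep c) = c" if c: "c \<in> C" for c
  proof -
    from c obtain Z where "indecomposable sc Z \<and> iso_class sc Z = c" unfolding C_def by blast
    then show ?thesis unfolding rep_def by (rule someI)
  qed
  have "\<exists>B. finite B \<and> B \<subseteq> {v. rad_power sc N X (rep c) v} \<and>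
      mat_fun ` {v. rad_power sc N X (rep c) v} \<subseteq> fun_vs.span (mat_fun ` B)" if c: "c \<in> C" for c
  proof -
    have mZ: "right_module sc (rep c)" using rep[OF c] indecomposableD(1) by blast
    obtain T where T: "finite T" "\<forall>A\<in>carrier_mat (mdim (rep c)) (mdim X). mat_fun (A :: 'k mat) \<in> fun_vs.span T"
      using mat_fun_finite_dim[of "mdim (rep c)" "mdim X"] by (elim exE conjE) (rule that; assumption)
    have "mat_fun ` {v. rad_power sc N X (rep c) v} \<subseteq> fun_vs.span T"
    proof (rule image_subsetI, clarsimp simp del: split_paired_All)
      fix v assume "rad_power sc N X (rep c) v"
      then have "v \<in> mhom X (rep c)" using rad_power_mhom X mZ by blast
      then have "v \<in> carrier_mat (mdim (rep c)) (mdim X)" by (intro carrier_matI) (simp_all add: mhom_dims)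
      then show "mat_fun v \<in> fun_vs.span T" using T(2) by blast
    qed
    from fun_vs.finite_spanning_subset[OF T(1) this] obtain B' where
      B': "B' \<subseteq> mat_fun ` {v. rad_power sc N X (rep c) v}" "finite B'"
        "mat_fun ` {v. rad_power sc N X (rep c) v} \<subseteq> fun_vs.span B'" by blast
    from finite_subset_image[OF B'(2,1)] obtain B where
      "B \<subseteq> {v. rad_power sc N X (rep c) v}" "finite B" "B' = mat_fun ` B" by blast
    with B'(3) show ?thesis by blast
  qed
  then have "\<forall>c\<in>C. \<exists>B. finite B \<and> B \<subseteq> {v. rad_power sc N X (rep c) v} \<and>
      mat_fun ` {v. rad_power sc N X (rep c) v} \<subseteq> fun_vs.span (mat_fun ` B)" by blast
  from bchoice[OF this] obtain B where B0: "\<forall>c\<in>C. finite (B c) \<and> B c \<subseteq> {v. rad_power sc N X (rep c) v} \<and>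
      mat_fun ` {v. rad_power sc N X (rep c) v} \<subseteq> fun_vs.span (mat_fun ` B c)" by (elim exE) (rule that)
  note B = bspec[OF B0]
  have "finite (\<Union>c\<in>C. Pair (rep c) ` B c)"
    by (intro finite_UN_I finC finite_imageI) (rule B[THEN conjunct1])
  from finite_list[OF this] obtain gs where gs: "set gs = (\<Union>c\<in>C. Pair (rep c) ` B c)" by (elim exE) (rule that)
  have gs1: "indecomposable sc (fst g) \<and> rad_power sc N X (fst g) (snd g)" if "g \<in> set gs" for g
  proof -
    from that obtain c v where c: "c \<in> C" "v \<in> B c" "g = (rep c, v)" unfolding gs by (elim UN_E imageE) (rule that)
    then have "v \<in> {v. rad_power sc N X (rep c) v}" using B[OF c(1)] by (elim conjE) (rule subsetD)
    then show ?thesis using rep[OF c(1)] c(3) by simp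
  qed
  have gs2: "right_module sc (fst g) \<and> snd g \<in> mhom X (fst g)" if "g \<in> set gs" for g
    using gs1[OF that] indecomposableD(1) rad_power_mhom X by blast
  have "generated_by mhom X gs Z F" if Z: "indecomposable sc Z" and F: "rad_power sc N X Z F" for Z F
  proof -
    note mZ = indecomposableD(1)[OF Z]
    have c: "iso_class sc Z \<in> C" using Z unfolding C_def by blast
    let ?R = "rep (iso_class sc Z)"
    have R: "indecomposable sc ?R" "iso_class sc ?R = iso_class sc Z" using rep[OF c] by blast+
    note mR = indecomposableD(1)[OF R(1)]
    have "isomorphic ?R Z" by (rule iso_class_eqD[OF mR mZ R(2)])
    then obtain \<psi> \<psi>' where \<psi>: "\<psi> \<in> mhom ?R Z" "\<psi>' \<in> mhom Z ?R" "\<psi> * \<psi>' = 1\<^sub>m (mdim Z)"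
      unfolding isomorphic_def is_iso_def by (elim exE conjE bexE) (rule that; assumption)
    have F': "rad_power sc N X ?R (\<psi>' * F)" by (rule rad_power_mult_left[OF F X mZ mR \<psi>(2)])
    have "mat_fun (\<psi>' * F) \<in> fun_vs.span (mat_fun ` B (iso_class sc Z))" using B[OF c] F' by blast
    also have "\<dots> \<subseteq> fun_vs.span (mat_fun ` {v. (?R, v) \<in> set gs})"
      using c by (intro fun_vs.span_mono image_mono) (auto simp: gs)
    finally obtain A where A: "generated_by mhom X gs ?R A" "mat_fun A = mat_fun (\<psi>' * F)"
      using generated_by_span[OF X mR gs2] by blast
    have "\<psi>' * F \<in> carrier_mat (mdim ?R) (mdim X)"
      by (rule carrier_matI) (simp_all add: mhom_dims[OF \<psi>(2)] mhom_dims[OF rad_power_mhom[OF F X mZ]])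
    then have "A = \<psi>' * F" using mat_fun_inject[OF generated_by_dims[OF A(1)]] A(2) by blast
    with A(1) have gR: "generated_by mhom X gs ?R (\<psi>' * F)" by simp
    have "generated_by mhom X gs Z (\<psi> * (\<psi>' * F))"
      by (rule generated_by_mult[where K = mhom, OF X mR mZ gs2 mhom_mult[OF _ mR mZ _ \<psi>(1)] \<psi>(1) gR])
    also have "\<psi> * (\<psi>' * F) = (\<psi> * \<psi>') * F"
      by (rule mult_mat_assoc[symmetric]) (simp_all add: mhom_dims[OF \<psi>(1)] mhom_dims[OF \<psi>(2)] mhom_dims[OF rad_power_mhom[OF F X mZ]])
    also have "\<dots> = F" unfolding \<psi>(3) by (simp add: mult_mat_one_left mhom_dims[OF rad_power_mhom[OF F X mZ]])
    finally show ?thesis .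
  qed
  with gs1 show ?thesis by blast
qed

section \<open>Paths obtained from morphisms and from extensions\<close>

locale directed_modules =
  fixes sc :: "'k :: field \<Rightarrow> 'a :: ring_1 \<Rightarrow> 'a"
  assumes rep_finite: "representation_finite sc"
    and with_length: "component_with_length (AR_quiver sc)"
begin

lemma AR_walk_unique: "AR_walk sc X Y m \<Longrightarrow> AR_walk sc X Y n \<Longrightarrow> m = n"
  using with_length unfolding component_with_length_def AR_walk_def by blast

lemma AR_walk_closed: "indecomposable sc X \<Longrightarrow> AR_walk sc X X m \<Longrightarrow> m = 0"
  using AR_walk_unique AR_walk_zero[of sc X X] isomorphic_refl indecomposableD(1) by blast

lemma AR_walk_bound:
  assumes "AR_walk sc X Y n"
  shows "n \<le> card (verts (AR_quiver sc))"
proof -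
  interpret wf_digraph "AR_quiver sc" by (rule wf_AR_quiver)
  obtain p where p: "awalk (iso_class sc X) p (iso_class sc Y)" "length p = n"
    using assms by (auto simp: AR_walk_def)
  have fin: "finite (verts (AR_quiver sc))"
    using rep_finite by (simp add: AR_quiver_simps representation_finite_def)
  have dist: "distinct (awalk_verts (iso_class sc X) p)"
  proof (rule ccontr)
    assume "\<not> ?thesis"
    from awalk_not_distinct_decomp[OF p(1) this] obtain q r s w where
      "awalk w r w" "r \<noteq> []" by (auto simp: closed_w_def)
    moreover from this have "awalk w [] w" by (simp add: awalk_Nil_iff awalk_hd_in_verts)
    ultimately show False using with_length unfolding component_with_length_def by (metis length_0_conv)
  qed
  have "set (awalk_verts (iso_class sc X) p) \<subseteq> verts (AR_quiver sc)" using p(1) by auto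
  from card_mono[OF fin this] show ?thesis
    using distinct_card[OF dist] by (simp add: length_awalk_verts p(2))
qed

text \<open>One more than the number of isomorphism classes of indecomposables, hence larger than
  the length of any path.\<close>

abbreviation "radical_bound \<equiv> Suc (card (verts (AR_quiver sc)))"

lemma rad_power_vanishes_indecomposable:
  assumes X: "indecomposable sc X" and Y: "indecomposable sc Y" and F: "rad_power sc radical_bound X Y F"
  shows "F = 0\<^sub>m (mdim Y) (mdim X)"
proof -
  \<comment> \<open>No path has length \<open>radical_bound\<close>, so
    \<open>rad_power_walk\<close> always yields its first alternative.\<close>
  have stable: "rad_power sc (Suc radical_bound) X Z F" if "indecomposable sc Z" "rad_power sc radical_bound X Z F" for Z F
    using rad_power_walk[OF X that] AR_walk_bound by fastforce
  note mX = indecomposableD(1)[OF X]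
  obtain gs where gs: "\<forall>g\<in>set gs. indecomposable sc (fst g) \<and> rad_power sc radical_bound X (fst g) (snd g)"
    "\<forall>Z F. indecomposable sc Z \<and> rad_power sc radical_bound X Z F \<longrightarrow> generated_by mhom X gs Z F"
    using finite_generators[OF rep_finite mX, of radical_bound] by (elim exE conjE) (rule that; assumption)
  show ?thesis
    by (rule rad_power_stable_zero[OF mX stable bspec[OF gs(1)] gs(2)[THEN spec, THEN spec, THEN mp, OF conjI] Y F])
qed

text \<open>If no power containing \<open>F\<close> came with a path of its length, \<open>F\<close>
  could be lifted from power to power up to \<open>radical_bound\<close>, where everything
  vanishes.\<close>

lemma rad_power_nonzero_walk:
  assumes X: "indecomposable sc X" and Y: "indecomposable sc Y" and F: "rad_power sc m X Y F"
    and nz: "F \<noteq> 0\<^sub>m (mdim Y) (mdim X)"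
  shows "\<exists>n\<ge>m. rad_power sc n X Y F \<and> AR_walk sc X Y n"
proof (rule ccontr)
  assume c: "\<not> ?thesis"
  have "rad_power sc (m + j) X Y F" for j
  proof (induction j)
    case (Suc j)
    have "\<not> AR_walk sc X Y (m + j)" using c Suc.IH by auto
    then show ?case using rad_power_walk[OF X Y Suc.IH] by simp
  qed (simp add: F)
  from rad_power_antimono[OF indecomposableD(1)[OF X] indecomposableD(1)[OF Y] _ this[of radical_bound], of radical_bound]
  show False using rad_power_vanishes_indecomposable[OF X Y] nz by simp
qed

lemma nonzero_hom_walk:
  assumes X: "indecomposable sc X" and Y: "indecomposable sc Y" and F: "F \<in> mhom X Y" "F \<noteq> 0\<^sub>m (mdim Y) (mdim X)"
  shows "\<exists>n. rad_power sc n X Y F \<and> AR_walk sc X Y n"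
  using rad_power_nonzero_walk[OF X Y rad_power.zero[OF F(1)] F(2)] by blast

lemma nonzero_noniso_walk:
  assumes X: "indecomposable sc X" and Y: "indecomposable sc Y" and F: "F \<in> mhom X Y" "F \<noteq> 0\<^sub>m (mdim Y) (mdim X)"
    and n: "\<not> split_mono X Y F"
  shows "\<exists>n\<ge>1. AR_walk sc X Y n"
  using rad_power_nonzero_walk[OF X Y rad_power_one[OF indecomposableD(1)[OF X] mrad_of_not_split_mono[OF X indecomposableD(1)[OF Y] F(1) n]] F(2)]
  by blast

text \<open>If at each indecomposable summand the component of \<open>F\<close> or that of
  \<open>G\<close> vanishes, a sum \<open>D\<close> of projections onto summands with vanishing
  \<open>G\<close> fixes \<open>F\<close> and is killed by \<open>G\<close>.\<close>

lemma summand_or_endomorphism: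
  assumes E: "right_module sc E" and X: "right_module sc X" and Y: "right_module sc Y"
    and F: "F \<in> mhom X E" and G: "G \<in> mhom E Y"
  shows "(\<exists>Z I P. indecomposable sc Z \<and> I \<in> mhom Z E \<and> P \<in> mhom E Z \<and> P * I = 1\<^sub>m (mdim Z) \<and>
      P * F \<noteq> 0\<^sub>m (mdim Z) (mdim X) \<and> G * I \<noteq> 0\<^sub>m (mdim Y) (mdim Z)) \<or>
    (\<exists>D. D \<in> mhom E E \<and> D * F = F \<and> G * D = 0\<^sub>m (mdim Y) (mdim E))"
  using E F G
proof (induction arbitrary: F G rule: module_induct)
  case (zero E)
  have F: "1\<^sub>m (mdim E) * F = F" by (rule mult_mat_one_left) (rule mhom_dims[OF zero(3)])
  have "G * 1\<^sub>m (mdim E) = G" by (rule mult_mat_one_right) (rule mhom_dims[OF zero(4)])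
  also have "\<dots> = 0\<^sub>m (mdim Y) (mdim E)"
    by (rule eq_matI) (simp_all add: mhom_dims[OF zero(4)] zero(2))
  finally have G: "G * 1\<^sub>m (mdim E) = 0\<^sub>m (mdim Y) (mdim E)" .
  show ?case by (rule disjI2, rule exI[of _ "1\<^sub>m (mdim E)"]) (intro conjI F G mhom_one[OF zero(1)])
next
  case (indecomposable E)
  note mE = indecomposableD(1)[OF indecomposable(1)]
  note d = mhom_dims[OF indecomposable(2)] mhom_dims[OF indecomposable(3)]
  show ?case
  proof (cases "F = 0\<^sub>m (mdim E) (mdim X) \<or> G = 0\<^sub>m (mdim Y) (mdim E)")
    case True
    then show ?thesis
    proof
      assume F0: "F = 0\<^sub>m (mdim E) (mdim X)"
      show ?thesis
        by (intro disjI2 exI[of _ "0\<^sub>m (mdim E) (mdim E)"] conjI mhom_zero[OF mE mE])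
          (simp_all add: F0 mult_mat_zero_left mult_mat_zero_right d)
    next
      assume G0: "G = 0\<^sub>m (mdim Y) (mdim E)"
      show ?thesis
        by (intro disjI2 exI[of _ "1\<^sub>m (mdim E)"] conjI mhom_one[OF mE])
          (simp_all add: G0 mult_mat_one_left mult_mat_one_right d)
    qed
  next
    case False
    then show ?thesis
      by (intro disjI1 exI[of _ E] exI[of _ "1\<^sub>m (mdim E)"] conjI indecomposable(1) mhom_one[OF mE])
        (simp_all add: mult_mat_one_left mult_mat_one_right d)
  qed
next
  case (split E E1 E2 I1 P1 I2 P2)
  note m = split.hyps(1-3)
  note h = split.hyps(4-7) split.prems
  note d = h[THEN mhom_dims(1)] h[THEN mhom_dims(2)]
  have lift: ?case
    if Ei: "right_module sc Ei" and I: "I \<in> mhom Ei E" and P: "P \<in> mhom E Ei" and PI: "P * I = 1\<^sub>m (mdim Ei)"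
      and ex: "\<exists>Z J Q. indecomposable sc Z \<and> J \<in> mhom Z Ei \<and> Q \<in> mhom Ei Z \<and> Q * J = 1\<^sub>m (mdim Z) \<and>
        Q * (P * F) \<noteq> 0\<^sub>m (mdim Z) (mdim X) \<and> G * I * J \<noteq> 0\<^sub>m (mdim Y) (mdim Z)" for Ei I P
  proof -
    obtain Z J Q where Z: "indecomposable sc Z" "J \<in> mhom Z Ei" "Q \<in> mhom Ei Z" "Q * J = 1\<^sub>m (mdim Z)"
        "Q * (P * F) \<noteq> 0\<^sub>m (mdim Z) (mdim X)" "G * I * J \<noteq> 0\<^sub>m (mdim Y) (mdim Z)"
      using ex by (elim exE conjE) (rule that; assumption)
    note d' = mhom_dims[OF I] mhom_dims[OF P] mhom_dims[OF Z(2)] mhom_dims[OF Z(3)]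
    have "(Q * P) * (I * J) = Q * ((P * I) * J)" by (simp add: d' mult_mat_assoc)
    also have "\<dots> = 1\<^sub>m (mdim Z)" unfolding PI using Z(4) by (simp add: d' mult_mat_one_left)
    finally have "(Q * P) * (I * J) = 1\<^sub>m (mdim Z)" .
    moreover have "(Q * P) * F \<noteq> 0\<^sub>m (mdim Z) (mdim X)" "G * (I * J) \<noteq> 0\<^sub>m (mdim Y) (mdim Z)"
      using Z(5,6) by (simp_all add: d d' mult_mat_assoc)
    ultimately show ?thesis
      by (intro disjI1 exI[of _ Z] exI[of _ "I * J"] exI[of _ "Q * P"] conjI Z(1)
          mhom_mult[OF indecomposableD(1)[OF Z(1)] Ei m(1) Z(2) I] mhom_mult[OF m(1) Ei indecomposableD(1)[OF Z(1)] P Z(3)])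
  qed
  from split.IH(1)[OF mhom_mult[OF X m(1,2) h(5) h(2)] mhom_mult[OF m(2,1) Y h(1) h(6)]] show ?case
  proof
    assume "\<exists>D. D \<in> mhom E1 E1 \<and> D * (P1 * F) = P1 * F \<and> G * I1 * D = 0\<^sub>m (mdim Y) (mdim E1)"
    then obtain D1 where D1: "D1 \<in> mhom E1 E1" "D1 * (P1 * F) = P1 * F" "G * I1 * D1 = 0\<^sub>m (mdim Y) (mdim E1)"
      by (elim exE conjE) (rule that; assumption)
    from split.IH(2)[OF mhom_mult[OF X m(1,3) h(5) h(4)] mhom_mult[OF m(3,1) Y h(3) h(6)]] show ?case
    proof
      assume "\<exists>D. D \<in> mhom E2 E2 \<and> D * (P2 * F) = P2 * F \<and> G * I2 * D = 0\<^sub>m (mdim Y) (mdim E2)"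
      then obtain D2 where D2: "D2 \<in> mhom E2 E2" "D2 * (P2 * F) = P2 * F" "G * I2 * D2 = 0\<^sub>m (mdim Y) (mdim E2)"
        by (elim exE conjE) (rule that; assumption)
      note d' = mhom_dims[OF D1(1)] mhom_dims[OF D2(1)]
      let ?D = "I1 * (D1 * P1) + I2 * (D2 * P2)"
      have D: "?D \<in> mhom E E"
        by (intro mhom_add[OF m(1) m(1)] mhom_mult[OF m(1,2,1)] mhom_mult[OF m(1,2,2)] mhom_mult[OF m(1,3,1)]
            mhom_mult[OF m(1,3,3)] h D1(1) D2(1))
      have "?D * F = I1 * (D1 * (P1 * F)) + I2 * (D2 * (P2 * F))"
        by (simp add: d d' mult_mat_add_left mult_mat_assoc)
      also have "\<dots> = (I1 * P1 + I2 * P2) * F"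
        unfolding D1(2) D2(2) by (simp add: d d' mult_mat_add_left mult_mat_assoc)
      finally have DF: "?D * F = F" unfolding split.hyps(8) by (simp add: d mult_mat_one_left)
      have "G * ?D = (G * I1 * D1) * P1 + (G * I2 * D2) * P2"
        by (simp add: d d' mult_mat_add_right mult_mat_assoc)
      also have "\<dots> = 0\<^sub>m (mdim Y) (mdim E)"
        unfolding D1(3) D2(3) by (simp add: d d' mult_mat_zero_left add_mat_simps)
      finally show ?thesis by (intro disjI2 exI[of _ ?D] conjI D DF)
    qed (rule lift[OF m(3) h(3) h(4) split.hyps(10)])
  qed (rule lift[OF m(2) h(1) h(2) split.hyps(9)])
qed

text \<open>A non-split extension \<open>0 \<rightarrow> X \<rightarrow> E \<rightarrow> Y \<rightarrow> 0\<close> yields a path from \<open>X\<close> to \<open>Y\<close> through a summand of \<open>E\<close>.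
  The matrices \<open>R\<close> and \<open>S\<close> express linear exactness.\<close>

lemma extension_walk:
  assumes X: "indecomposable sc X" and E: "right_module sc E" and Y: "indecomposable sc Y"
    and F: "F \<in> mhom X E" and G: "G \<in> mhom E Y"
    and R: "R \<in> carrier_mat (mdim X) (mdim E)" and S: "S \<in> carrier_mat (mdim E) (mdim Y)"
    and RF: "R * F = 1\<^sub>m (mdim X)" and ex: "F * R + S * G = 1\<^sub>m (mdim E)"
    and ns: "\<not> split_mono X E F"
  shows "\<exists>n\<ge>1. AR_walk sc X Y n"
proof -
  note mX = indecomposableD(1)[OF X] and mY = indecomposableD(1)[OF Y]
  note d = mhom_dims[OF F] mhom_dims[OF G] carrier_matD[OF R] carrier_matD[OF S]
  from summand_or_endomorphism[OF E mX mY F G] show ?thesis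
  proof
    assume "\<exists>D. D \<in> mhom E E \<and> D * F = F \<and> G * D = 0\<^sub>m (mdim Y) (mdim E)"
    then obtain D where D: "D \<in> mhom E E" "D * F = F" "G * D = 0\<^sub>m (mdim Y) (mdim E)"
      by (elim exE conjE) (rule that; assumption)
    note dD = mhom_dims[OF D(1)]
    \<comment> \<open>By exactness \<open>G * D = 0\<close> puts the image of \<open>D\<close> into
      that of \<open>F\<close>, so that \<open>D\<close> factors as
      \<open>F * (R * D)\<close>.\<close>
    have "D = (F * R + S * G) * D" unfolding ex by (simp add: dD mult_mat_one_left)
    also have "\<dots> = F * (R * D) + S * (G * D)" by (simp add: d dD mult_mat_add_left mult_mat_assoc)
    finally have FRD: "F * (R * D) = D" unfolding D(3) by (simp add: d dD mult_mat_zero_right add_mat_simps)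
    \<comment> \<open>\<open>R\<close> is merely linear; \<open>R * D\<close> is a homomorphism
      because \<open>D = F * (R * D)\<close> is one and \<open>R * F = 1\<close>.\<close>
    have "R * D \<in> mhom E X"
    proof (rule mhomI)
      fix a
      have "R * D * mact E a = R * (D * mact E a)"
        by (rule mult_mat_assoc) (simp_all add: d dD mact_dims[OF E])
      also have "\<dots> = R * ((mact E a * F) * (R * D))"
        unfolding mhom_comm[OF D(1)] by (subst mult_mat_assoc) (simp_all add: d dD mact_dims[OF E] FRD)
      also have "\<dots> = (R * F) * (mact X a * (R * D))"
        unfolding mhom_comm[OF F, symmetric] by (simp add: d dD mact_dims[OF mX] mult_mat_assoc)
      finally show "R * D * mact E a = mact X a * (R * D)"
        unfolding RF by (simp add: d dD mact_dims[OF mX] mult_mat_one_left)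
    qed (simp_all add: d dD)
    moreover have "R * D * F = 1\<^sub>m (mdim X)"
      by (subst mult_mat_assoc) (simp_all add: d dD D(2) RF)
    ultimately show ?thesis using split_monoI[OF F] ns by blast
  next
    assume "\<exists>Z I P. indecomposable sc Z \<and> I \<in> mhom Z E \<and> P \<in> mhom E Z \<and> P * I = 1\<^sub>m (mdim Z) \<and>
      P * F \<noteq> 0\<^sub>m (mdim Z) (mdim X) \<and> G * I \<noteq> 0\<^sub>m (mdim Y) (mdim Z)"
    then obtain Z I P where Z: "indecomposable sc Z" "I \<in> mhom Z E" "P \<in> mhom E Z"
        "P * F \<noteq> 0\<^sub>m (mdim Z) (mdim X)" "G * I \<noteq> 0\<^sub>m (mdim Y) (mdim Z)"
      by (elim exE conjE) (rule that; assumption)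
    note mZ = indecomposableD(1)[OF Z(1)]
    have PF: "P * F \<in> mhom X Z" by (rule mhom_mult[OF mX E mZ F Z(3)])
    have "\<not> split_mono X Z (P * F)"
    proof
      assume "split_mono X Z (P * F)"
      then obtain K where K: "K \<in> mhom Z X" "K * (P * F) = 1\<^sub>m (mdim X)"
        unfolding split_mono_def by (elim conjE bexE) (rule that; assumption)
      have "K * P * F = 1\<^sub>m (mdim X)"
        by (subst mult_mat_assoc) (simp_all add: K(2) d mhom_dims[OF Z(3)] mhom_dims[OF K(1)])
      then show False using split_monoI[OF F mhom_mult[OF E mZ mX Z(3) K(1)]] ns by blast
    qed
    from nonzero_noniso_walk[OF X Z(1) PF Z(4) this] obtain n where n: "n \<ge> 1" "AR_walk sc X Z n" by blast
    from nonzero_hom_walk[OF Z(1) Y mhom_mult[OF mZ E mY Z(2) G] Z(5)] obtain n' where "AR_walk sc Z Y n'" by blast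
    from AR_walk_trans[OF n(2) this] n(1) show ?thesis by (intro exI[of _ "n + n'"]) simp
  qed
qed

end

section \<open>The path basis of a monomial algebra\<close>

definition contains_relation :: "'b list set \<Rightarrow> 'b list \<Rightarrow> bool" where
  "contains_relation R l \<longleftrightarrow> (\<exists>r\<in>R. sublist r l)"

lemma contains_relation_append:
  assumes "contains_relation R l"
  shows "contains_relation R (k @ l @ m)"
proof -
  obtain r a b where "r \<in> R" "l = a @ r @ b" using assms by (auto simp: contains_relation_def sublist_def)
  then have "r \<in> R" "k @ l @ m = (k @ a) @ r @ (b @ m)" by auto
  then show ?thesis unfolding contains_relation_def sublist_def by blast
qed

definition nonzero_paths :: "('v, 'b) pre_digraph \<Rightarrow> 'b list set \<Rightarrow> ('v, 'b) qpath set" where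
  "nonzero_paths Q R = {p \<in> qpaths Q. \<not> contains_relation R (snd p)}"

text \<open>An algebra with a multiplicative basis \<open>bs\<close> given by the paths of a quiver that contain no
  relation from \<open>R\<close>; \<open>co a p\<close> is the coordinate of \<open>a\<close> at the basis path \<open>p\<close>.\<close>

locale path_basis = fd_algebra sc + fin_digraph Q
  for sc :: "'k :: alg_closed_field \<Rightarrow> 'a :: ring_1 \<Rightarrow> 'a" and Q :: "('v, 'b) pre_digraph" +
  fixes R :: "'b list set" and bs :: "('v, 'b) qpath \<Rightarrow> 'a" and co :: "'a \<Rightarrow> ('v, 'b) qpath \<Rightarrow> 'k"
  assumes rel_length: "r \<in> R \<Longrightarrow> 2 \<le> length r"
    and finite_nonzero_paths: "finite (nonzero_paths Q R)"
    and bs_mult: "p \<in> qpaths Q \<Longrightarrow> q \<in> qpaths Q \<Longrightarrow>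
      bs p * bs q = (if path_end Q q = fst p then bs (fst q, snd q @ snd p) else 0)"
    and bs_zero: "p \<in> qpaths Q \<Longrightarrow> contains_relation R (snd p) \<Longrightarrow> bs p = 0"
    and co_add: "p \<in> nonzero_paths Q R \<Longrightarrow> co (a + b) p = co a p + co b p"
    and co_scale: "p \<in> nonzero_paths Q R \<Longrightarrow> co (sc c a) p = c * co a p"
    and co_bs: "p \<in> nonzero_paths Q R \<Longrightarrow> q \<in> nonzero_paths Q R \<Longrightarrow> co (bs q) p = (if p = q then 1 else 0)"
    and expand: "a = (\<Sum>p\<in>nonzero_paths Q R. sc (co a p) (bs p))"
    and one_eq: "1 = (\<Sum>v\<in>verts Q. bs (v, []))"

locale monomial_presentation = fd_algebra sc + fin_digraph Q
  for sc :: "'k :: alg_closed_field \<Rightarrow> 'a :: ring_1 \<Rightarrow> 'a" and Q :: "('v, 'b) pre_digraph" +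
  fixes I :: "(('v, 'b) qpath \<Rightarrow>\<^sub>0 'k) set" and \<phi> :: "(('v, 'b) qpath \<Rightarrow>\<^sub>0 'k) \<Rightarrow> 'a"
    and \<chi> :: "('v, 'b) qpath set"
  assumes adm: "admissible_ideal Q I"
    and pres: "algebra_presentation sc Q I \<phi>"
    and gens: "minimal_path_generators Q I \<chi>"
begin

abbreviation "rels \<equiv> snd ` \<chi>"

definition bs :: "('v, 'b) qpath \<Rightarrow> 'a" where "bs p = \<phi> (Poly_Mapping.single p 1)"

lemma single_in_path_algebra: "p \<in> qpaths Q \<Longrightarrow> Poly_Mapping.single p r \<in> path_algebra Q"
  by (auto simp: path_algebra_def)

lemma zero_in_path_algebra: "0 \<in> path_algebra Q" by (simp add: path_algebra_def)

lemma add_in_path_algebra: "c \<in> path_algebra Q \<Longrightarrow> d \<in> path_algebra Q \<Longrightarrow> c + d \<in> path_algebra Q"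
  unfolding path_algebra_def using Poly_Mapping.keys_add[of c d] by blast

lemma lookup_path_scale: "Poly_Mapping.lookup (path_scale r c) p = r * Poly_Mapping.lookup c p"
  by (auto simp: path_scale_def Poly_Mapping.map.rep_eq when_def)

lemma scale_in_path_algebra: "c \<in> path_algebra Q \<Longrightarrow> path_scale r c \<in> path_algebra Q"
  unfolding path_algebra_def by (auto simp: in_keys_iff lookup_path_scale)

lemma path_mult_single:
  fixes r s :: 'k
  shows "path_mult Q (Poly_Mapping.single p r) (Poly_Mapping.single q s) =
    (if path_end Q q = fst p then Poly_Mapping.single (fst q, snd q @ snd p) (r * s) else 0)"
  by (cases "r = 0"; cases "s = 0") (auto simp: path_mult_def)

lemma ideal: "path_ideal Q I" using adm by (simp add: admissible_ideal_def)

lemma generators_in_ideal: "\<gamma> \<in> \<chi> \<Longrightarrow> Poly_Mapping.single \<gamma> 1 \<in> I"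
  using gens unfolding minimal_path_generators_def generated_ideal_def by blast

lemma generated_ideal_eq: "generated_ideal Q \<chi> = I"
  using gens by (simp add: minimal_path_generators_def)

lemma generators_paths: "\<gamma> \<in> \<chi> \<Longrightarrow> \<gamma> \<in> qpaths Q"
  using gens unfolding minimal_path_generators_def by blast

lemma generator_length: "\<gamma> \<in> \<chi> \<Longrightarrow> 2 \<le> length (snd \<gamma>)"
  using generators_in_ideal[of \<gamma>] adm unfolding admissible_ideal_def arrow_ideal_power_def by fastforce

lemma qpaths_iff: "p \<in> qpaths Q \<longleftrightarrow> awalk (fst p) (snd p) (path_end Q p)"
proof
  assume "p \<in> qpaths Q"
  then obtain v where v: "awalk (fst p) (snd p) v" by (auto simp: qpaths_def)
  then have "path_end Q p = v" by (elim awalkE)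
  with v show "awalk (fst p) (snd p) (path_end Q p)" by simp
next
  assume "awalk (fst p) (snd p) (path_end Q p)"
  then have "\<exists>v. awalk (fst p) (snd p) v" by (rule exI)
  then show "p \<in> qpaths Q" unfolding qpaths_def by (cases p) simp
qed

lemma qpaths_append:
  assumes "p \<in> qpaths Q" "q \<in> qpaths Q" "path_end Q q = fst p"
  shows "(fst q, snd q @ snd p) \<in> qpaths Q" "path_end Q (fst q, snd q @ snd p) = path_end Q p"
proof -
  have "awalk (fst q) (snd q @ snd p) (path_end Q p)"
    using assms by (intro awalk_appendI[of _ _ "fst p"]) (simp_all add: qpaths_iff)
  then show "(fst q, snd q @ snd p) \<in> qpaths Q" "path_end Q (fst q, snd q @ snd p) = path_end Q p"
    by (auto simp: qpaths_def elim: awalkE)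
qed

text \<open>Membership in an ideal generated by paths can be read off the support: the combinations
  of paths containing a generator form an ideal, and each such path is a generator multiplied by
  paths on both sides.\<close>

lemma monomial_ideal: "I = {c \<in> path_algebra Q. \<forall>p\<in>Poly_Mapping.keys c. contains_relation rels (snd p)}" (is "I = ?J")
proof
  have J: "path_ideal Q ?J"
    unfolding path_ideal_def
  proof (intro conjI ballI)
    show "?J \<subseteq> path_algebra Q" "0 \<in> ?J" by (auto simp: zero_in_path_algebra)
    fix x assume x: "x \<in> ?J"
    {
      fix y assume "y \<in> ?J"
      with x show "x + y \<in> ?J" using add_in_path_algebra Poly_Mapping.keys_add[of x y] by blast
    }
    fix c :: "('v, 'b) qpath \<Rightarrow>\<^sub>0 'k" assume c: "c \<in> path_algebra Q"
    have keys: "Poly_Mapping.keys (path_mult Q d e) \<subseteq>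
        {(fst q, snd q @ snd p) |p q. p \<in> Poly_Mapping.keys d \<and> q \<in> Poly_Mapping.keys e \<and> path_end Q q = fst p}"
      for d e :: "('v, 'b) qpath \<Rightarrow>\<^sub>0 'k"
    proof
      fix z assume "z \<in> Poly_Mapping.keys (path_mult Q d e)"
      from subsetD[OF Poly_Mapping.keys_sum this[unfolded path_mult_def]]
      obtain p where p: "p \<in> Poly_Mapping.keys d" "z \<in> Poly_Mapping.keys (\<Sum>q\<in>Poly_Mapping.keys e.
         if path_end Q q = fst p then Poly_Mapping.single (fst q, snd q @ snd p)
            (Poly_Mapping.lookup d p * Poly_Mapping.lookup e q) else 0)"
        by (elim UN_E) (rule that)
      from subsetD[OF Poly_Mapping.keys_sum p(2)] obtain q where q: "q \<in> Poly_Mapping.keys e" "z \<in> Poly_Mapping.keys (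
         if path_end Q q = fst p then Poly_Mapping.single (fst q, snd q @ snd p)
            (Poly_Mapping.lookup d p * Poly_Mapping.lookup e q) else 0)"
        by (elim UN_E) (rule that)
      then have "path_end Q q = fst p \<and> z = (fst q, snd q @ snd p)" by (auto split: if_splits)
      with p(1) q(1) show "z \<in> {(fst q, snd q @ snd p) |p q. p \<in> Poly_Mapping.keys d \<and> q \<in> Poly_Mapping.keys e \<and> path_end Q q = fst p}"
        by blast
    qed
    have "\<forall>z\<in>Poly_Mapping.keys (path_mult Q c x). z \<in> qpaths Q \<and> contains_relation rels (snd z)"
    proof
      fix z assume "z \<in> Poly_Mapping.keys (path_mult Q c x)"
      from subsetD[OF keys this] obtain p q where z: "z = (fst q, snd q @ snd p)"
        and pq: "p \<in> Poly_Mapping.keys c" "q \<in> Poly_Mapping.keys x" "path_end Q q = fst p" by blast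
      have "p \<in> qpaths Q" "q \<in> qpaths Q" and r: "contains_relation rels (snd q)"
        using c x pq unfolding path_algebra_def by blast+
      from qpaths_append(1)[OF this(1,2) pq(3)] contains_relation_append[OF r, of "[]" "snd p"]
      show "z \<in> qpaths Q \<and> contains_relation rels (snd z)" unfolding z by simp
    qed
    then show "path_mult Q c x \<in> ?J" unfolding path_algebra_def by blast
    have "\<forall>z\<in>Poly_Mapping.keys (path_mult Q x c). z \<in> qpaths Q \<and> contains_relation rels (snd z)"
    proof
      fix z assume "z \<in> Poly_Mapping.keys (path_mult Q x c)"
      from subsetD[OF keys this] obtain p q where z: "z = (fst q, snd q @ snd p)"
        and pq: "p \<in> Poly_Mapping.keys x" "q \<in> Poly_Mapping.keys c" "path_end Q q = fst p" by blast
      have "p \<in> qpaths Q" "q \<in> qpaths Q" and r: "contains_relation rels (snd p)"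
        using c x pq unfolding path_algebra_def by blast+
      from qpaths_append(1)[OF this(1,2) pq(3)] contains_relation_append[OF r, of "snd q" "[]"]
      show "z \<in> qpaths Q \<and> contains_relation rels (snd z)" unfolding z by simp
    qed
    then show "path_mult Q x c \<in> ?J" unfolding path_algebra_def by blast
  qed
  have g: "Poly_Mapping.single \<gamma> 1 \<in> ?J" if "\<gamma> \<in> \<chi>" for \<gamma>
    using that single_in_path_algebra[OF generators_paths[OF that]] by (auto simp: contains_relation_def)
  have "generated_ideal Q \<chi> \<subseteq> ?J"
    unfolding generated_ideal_def by (rule Inter_lower, rule CollectI, rule conjI, rule J, rule ballI, rule g)
  then show "I \<subseteq> ?J" unfolding generated_ideal_eq .
next
  have single: "Poly_Mapping.single p r \<in> I" if p: "p \<in> qpaths Q" "contains_relation rels (snd p)" for p r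
  proof -
    obtain \<gamma> where \<gamma>: "\<gamma> \<in> \<chi>" "sublist (snd \<gamma>) (snd p)" using p by (auto simp: contains_relation_def)
    then obtain a b where ab: "snd p = a @ snd \<gamma> @ b" by (auto simp: sublist_def)
    have ne: "snd \<gamma> \<noteq> []" using generator_length[OF \<gamma>(1)] by auto
    have w: "awalk (fst p) (a @ snd \<gamma> @ b) (path_end Q p)" using p(1) ab by (simp add: qpaths_iff)
    let ?u = "awlast (fst p) a"
    have w2: "awalk (fst p) a ?u" "awalk ?u (snd \<gamma>) (awlast ?u (snd \<gamma>))" "awalk (awlast ?u (snd \<gamma>)) b (path_end Q p)"
      using w by simp_all
    \<comment> \<open>A nonempty list of arrows determines where it starts, so the occurrence of
      \<open>snd \<gamma>\<close> inside of \<open>p\<close> is the path \<open>\<gamma>\<close>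
      itself.\<close>
    have fg: "fst \<gamma> = ?u"
    proof -
      have "awalk (fst \<gamma>) (snd \<gamma>) (path_end Q \<gamma>)" using generators_paths[OF \<gamma>(1)] by (simp add: qpaths_iff)
      then show ?thesis using w2(2) ne by (cases "snd \<gamma>") (auto simp: awalk_Cons_iff)
    qed
    let ?e = "path_end Q \<gamma>"
    have pa: "(fst p, a) \<in> qpaths Q" "(?e, b) \<in> qpaths Q" using w2 fg by (auto simp: qpaths_def)
    have "Poly_Mapping.single p r = path_mult Q (Poly_Mapping.single (?e, b) r)
        (path_mult Q (Poly_Mapping.single \<gamma> 1) (Poly_Mapping.single (fst p, a) 1))"
    proof -
      have "awlast (fst p) (a @ snd \<gamma>) = ?e" using fg by (simp add: awlast_append)
      then show ?thesis using fg ab by (cases p) (simp add: path_mult_single)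
    qed
    then show ?thesis
      using ideal generators_in_ideal[OF \<gamma>(1)] single_in_path_algebra[OF pa(1)] single_in_path_algebra[OF pa(2)]
      unfolding path_ideal_def by metis
  qed
  show "?J \<subseteq> I"
  proof
    fix c assume c: "c \<in> ?J"
    have "(\<Sum>p\<in>S. Poly_Mapping.single p (Poly_Mapping.lookup c p)) \<in> I" if "finite S" "S \<subseteq> Poly_Mapping.keys c" for S
      using that
    proof (induction S rule: finite_induct)
      case empty then show ?case using ideal by (simp add: path_ideal_def)
    next
      case (insert p S)
      then have "p \<in> qpaths Q" "contains_relation rels (snd p)" using c by (auto simp: path_algebra_def)
      from single[OF this] have "Poly_Mapping.single p (Poly_Mapping.lookup c p) \<in> I" .
      with insert ideal show ?case by (simp add: path_ideal_def)
    qed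
    from this[of "Poly_Mapping.keys c"]
    have "(\<Sum>p\<in>Poly_Mapping.keys c. Poly_Mapping.single p (Poly_Mapping.lookup c p)) \<in> I" by simp
    moreover have "(\<Sum>p\<in>Poly_Mapping.keys c. Poly_Mapping.single p (Poly_Mapping.lookup c p)) = c"
      by (rule poly_mapping_eqI) (auto simp: lookup_sum lookup_single when_def in_keys_iff)
    ultimately show "c \<in> I" by simp
  qed
qed

abbreviation "npaths \<equiv> nonzero_paths Q rels"

text \<open>The admissible ideal contains all sufficiently long paths, and a finite quiver has
  finitely many shorter ones.\<close>

lemma finite_npaths: "finite npaths"
proof -
  obtain m where m: "arrow_ideal_power Q m \<subseteq> I" using adm unfolding admissible_ideal_def by blast
  have len: "length (snd p) < m" if "p \<in> npaths" for p
  proof (rule ccontr)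
    assume "\<not> ?thesis"
    then have "Poly_Mapping.single p 1 \<in> arrow_ideal_power Q m"
      using that by (auto simp: arrow_ideal_power_def nonzero_paths_def single_in_path_algebra)
    then have "Poly_Mapping.single p (1 :: 'k) \<in> I" using m by blast
    then show False using that by (subst (asm) monomial_ideal) (auto simp: nonzero_paths_def)
  qed
  have "npaths \<subseteq> verts Q \<times> {xs. set xs \<subseteq> arcs Q \<and> length xs \<le> m}"
  proof
    fix p assume p: "p \<in> npaths"
    then have "awalk (fst p) (snd p) (path_end Q p)" by (simp add: nonzero_paths_def qpaths_iff)
    then show "p \<in> verts Q \<times> {xs. set xs \<subseteq> arcs Q \<and> length xs \<le> m}"
      using len[OF p] by (cases p) (auto simp: awalk_def)
  qed
  from finite_subset[OF this finite_cartesian_product[OF finite_verts finite_lists_length_le[OF finite_arcs]]]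
  show ?thesis .
qed

lemma phi_add: "c \<in> path_algebra Q \<Longrightarrow> d \<in> path_algebra Q \<Longrightarrow> \<phi> (c + d) = \<phi> c + \<phi> d"
  and phi_mult: "c \<in> path_algebra Q \<Longrightarrow> d \<in> path_algebra Q \<Longrightarrow> \<phi> (path_mult Q c d) = \<phi> c * \<phi> d"
  and phi_scale: "c \<in> path_algebra Q \<Longrightarrow> \<phi> (path_scale r c) = sc r (\<phi> c)"
  and phi_one: "\<phi> (path_one Q) = 1"
  and phi_surj: "\<phi> ` path_algebra Q = UNIV"
  and phi_ker: "{c \<in> path_algebra Q. \<phi> c = 0} = I"
  using pres unfolding algebra_presentation_def by blast+

lemma phi_zero: "\<phi> 0 = 0" using phi_ker ideal unfolding path_ideal_def by blast

lemma phi_sum: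
  assumes "finite S" "\<And>s. s \<in> S \<Longrightarrow> f s \<in> path_algebra Q"
  shows "(\<Sum>s\<in>S. f s) \<in> path_algebra Q \<and> \<phi> (\<Sum>s\<in>S. f s) = (\<Sum>s\<in>S. \<phi> (f s))"
  using assms by (induction S rule: finite_induct)
    (auto simp: phi_zero zero_in_path_algebra add_in_path_algebra phi_add)

text \<open>Coefficients of an arbitrarily chosen preimage. Two preimages differ by an element of
  \<open>I\<close>, whose support meets no path of \<open>npaths\<close>, so on those paths the
  choice does not matter.\<close>

definition co :: "'a \<Rightarrow> ('v, 'b) qpath \<Rightarrow> 'k" where
  "co a = Poly_Mapping.lookup (SOME c. c \<in> path_algebra Q \<and> \<phi> c = a)"

lemma co_phi:
  assumes c: "c \<in> path_algebra Q" and p: "p \<in> npaths"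
  shows "co (\<phi> c) p = Poly_Mapping.lookup c p"
proof -
  define d where "d = (SOME d. d \<in> path_algebra Q \<and> \<phi> d = \<phi> c)"
  have d: "d \<in> path_algebra Q \<and> \<phi> d = \<phi> c" unfolding d_def by (rule someI[of _ c]) (simp add: c)
  let ?e = "c + path_scale (-1) d"
  have "?e \<in> path_algebra Q" using c d by (intro add_in_path_algebra scale_in_path_algebra) auto
  moreover have "\<phi> ?e = 0"
    using d c phi_add[OF c scale_in_path_algebra, of d "-1"] by (simp add: phi_scale)
  ultimately have "?e \<in> I" using phi_ker by blast
  then have "p \<notin> Poly_Mapping.keys ?e" using p unfolding monomial_ideal by (auto simp: nonzero_paths_def)
  then show ?thesis by (simp add: in_keys_iff lookup_add lookup_path_scale co_def d_def)
qed

lemma phi_expand: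
  assumes c: "c \<in> path_algebra Q"
  shows "\<phi> c = (\<Sum>p\<in>npaths. sc (Poly_Mapping.lookup c p) (bs p))"
proof -
  let ?K = "Poly_Mapping.keys c"
  have q: "p \<in> qpaths Q" if "p \<in> ?K" for p using that c by (auto simp: path_algebra_def)
  have s: "\<phi> (Poly_Mapping.single p r) = sc r (bs p)" if "p \<in> qpaths Q" for p r
  proof -
    have "Poly_Mapping.single p r = path_scale r (Poly_Mapping.single p 1)"
      by (rule poly_mapping_eqI) (simp add: lookup_path_scale lookup_single when_def)
    then show ?thesis using phi_scale[OF single_in_path_algebra[OF that]] by (simp add: bs_def)
  qed
  have z: "bs p = 0" if "p \<in> qpaths Q" "p \<notin> npaths" for p
  proof -
    have "Poly_Mapping.single p (1 :: 'k) \<in> I"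
      using that by (subst monomial_ideal) (auto simp: nonzero_paths_def single_in_path_algebra)
    then show ?thesis using phi_ker by (auto simp: bs_def)
  qed
  have "c = (\<Sum>p\<in>?K. Poly_Mapping.single p (Poly_Mapping.lookup c p))"
    by (rule poly_mapping_eqI) (auto simp: lookup_sum lookup_single when_def in_keys_iff)
  then have "\<phi> c = \<phi> (\<Sum>p\<in>?K. Poly_Mapping.single p (Poly_Mapping.lookup c p))" by (rule arg_cong)
  also have "\<dots> = (\<Sum>p\<in>?K. \<phi> (Poly_Mapping.single p (Poly_Mapping.lookup c p)))"
    using phi_sum[of ?K "\<lambda>p. Poly_Mapping.single p (Poly_Mapping.lookup c p)"] single_in_path_algebra q finite_keys by blast
  also have "\<dots> = (\<Sum>p\<in>?K. sc (Poly_Mapping.lookup c p) (bs p))"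
    by (intro sum.cong refl s q)
  also have "\<dots> = (\<Sum>p\<in>?K \<inter> npaths. sc (Poly_Mapping.lookup c p) (bs p))"
    by (rule sum.mono_neutral_right) (auto simp: z q scale_zero_right)
  also have "\<dots> = (\<Sum>p\<in>npaths. sc (Poly_Mapping.lookup c p) (bs p))"
    by (rule sum.mono_neutral_left) (auto simp: finite_npaths in_keys_iff scale_zero_left)
  finally show ?thesis .
qed

sublocale path_basis sc Q rels bs co
proof
  show "2 \<le> length r" if "r \<in> rels" for r using that generator_length by auto
  show "finite npaths" by (rule finite_npaths)
  fix p q :: "('v, 'b) qpath" and a b :: 'a and c :: 'k
  show "bs p * bs q = (if path_end Q q = fst p then bs (fst q, snd q @ snd p) else 0)"
    if "p \<in> qpaths Q" "q \<in> qpaths Q"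
    using phi_mult[OF that[THEN single_in_path_algebra], of 1 1]
    by (cases "path_end Q q = fst p") (simp_all add: bs_def path_mult_single phi_zero)
  show "bs p = 0" if "p \<in> qpaths Q" "contains_relation rels (snd p)"
  proof -
    have "Poly_Mapping.single p (1 :: 'k) \<in> I"
      using that by (subst monomial_ideal) (auto simp: single_in_path_algebra)
    then show ?thesis using phi_ker by (auto simp: bs_def)
  qed
  have "a \<in> \<phi> ` path_algebra Q" "b \<in> \<phi> ` path_algebra Q" unfolding phi_surj by (rule UNIV_I)+
  then obtain x y where x: "x \<in> path_algebra Q" "\<phi> x = a" and y: "y \<in> path_algebra Q" "\<phi> y = b" by blast
  show "co (a + b) p = co a p + co b p" if "p \<in> npaths"
    using co_phi[OF add_in_path_algebra[OF x(1) y(1)] that] co_phi[OF x(1) that] co_phi[OF y(1) that]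
    by (simp add: phi_add x y lookup_add)
  show "co (sc c a) p = c * co a p" if "p \<in> npaths"
    using co_phi[OF scale_in_path_algebra[OF x(1)] that] co_phi[OF x(1) that]
    by (simp add: phi_scale x lookup_path_scale)
  show "co (bs q) p = (if p = q then 1 else 0)" if "p \<in> npaths" "q \<in> npaths"
    using co_phi[OF single_in_path_algebra that(1), of q 1] that(2)
    by (auto simp: bs_def nonzero_paths_def lookup_single when_def)
  show "a = (\<Sum>p\<in>npaths. sc (co a p) (bs p))"
    using phi_expand[OF x(1)] co_phi[OF x(1)] by (simp add: x(2))
  show "1 = (\<Sum>v\<in>verts Q. bs (v, []))"
  proof -
    have "(v, []) \<in> qpaths Q" if "v \<in> verts Q" for v using that by (auto simp: qpaths_def awalk_Nil_iff)
    then have "\<phi> (\<Sum>v\<in>verts Q. Poly_Mapping.single (v, []) 1) = (\<Sum>v\<in>verts Q. \<phi> (Poly_Mapping.single (v, []) 1))"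
      using phi_sum[of "verts Q" "\<lambda>v. Poly_Mapping.single (v, []) 1"] single_in_path_algebra finite_verts by blast
    then show ?thesis using phi_one by (simp add: path_one_def bs_def)
  qed
qed

text \<open>If \<open>\<gamma>\<close> contained another generator, it would lie in the ideal
  generated by the others and could be dropped from \<open>\<chi>\<close>.\<close>

lemma minimal_relation:
  assumes "\<gamma> \<in> \<chi>" "\<gamma>' \<in> \<chi>" "sublist (snd \<gamma>') (snd \<gamma>)"
  shows "\<gamma>' = \<gamma>"
proof (rule ccontr)
  assume n: "\<gamma>' \<noteq> \<gamma>"
  have "I \<subseteq> generated_ideal Q (\<chi> - {\<gamma>})"
    unfolding generated_ideal_def
  proof (intro Inter_greatest)
    fix J :: "(('v, 'b) qpath \<Rightarrow>\<^sub>0 'k) set"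
    assume "J \<in> {I. path_ideal Q I \<and> (\<forall>p\<in>\<chi> - {\<gamma>}. Poly_Mapping.single p 1 \<in> I)}"
    then have J: "path_ideal Q J" "\<And>p. p \<in> \<chi> - {\<gamma>} \<Longrightarrow> Poly_Mapping.single p 1 \<in> J" by auto
    have g': "Poly_Mapping.single \<gamma>' 1 \<in> J" using J(2) assms n by blast
    obtain a b where ab: "snd \<gamma> = a @ snd \<gamma>' @ b" using assms(3) by (auto simp: sublist_def)
    have w: "awalk (fst \<gamma>) (a @ snd \<gamma>' @ b) (path_end Q \<gamma>)" using generators_paths[OF assms(1)] ab by (simp add: qpaths_iff)
    let ?u = "awlast (fst \<gamma>) a"
    have w2: "awalk (fst \<gamma>) a ?u" "awalk ?u (snd \<gamma>') (awlast ?u (snd \<gamma>'))" "awalk (awlast ?u (snd \<gamma>')) b (path_end Q \<gamma>)"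
      using w by simp_all
    have fg: "fst \<gamma>' = ?u"
    proof -
      have "awalk (fst \<gamma>') (snd \<gamma>') (path_end Q \<gamma>')" using generators_paths[OF assms(2)] by (simp add: qpaths_iff)
      then show ?thesis using w2(2) generator_length[OF assms(2)] by (cases "snd \<gamma>'") (auto simp: awalk_Cons_iff)
    qed
    let ?e = "path_end Q \<gamma>'"
    have pa: "(fst \<gamma>, a) \<in> qpaths Q" "(?e, b) \<in> qpaths Q" using w2 fg by (auto simp: qpaths_def)
    have "Poly_Mapping.single \<gamma> (1 :: 'k) = path_mult Q (Poly_Mapping.single (?e, b) 1)
        (path_mult Q (Poly_Mapping.single \<gamma>' 1) (Poly_Mapping.single (fst \<gamma>, a) 1))"
    proof -
      have "awlast (fst \<gamma>) (a @ snd \<gamma>') = ?e" using fg by (simp add: awlast_append)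
      then show ?thesis using fg ab by (cases \<gamma>) (simp add: path_mult_single)
    qed
    then have "Poly_Mapping.single \<gamma> 1 \<in> J"
      using J(1) g' single_in_path_algebra[OF pa(1)] single_in_path_algebra[OF pa(2)]
      unfolding path_ideal_def by metis
    then have "\<forall>p\<in>\<chi>. Poly_Mapping.single p 1 \<in> J" using J(2) by blast
    then have "generated_ideal Q \<chi> \<subseteq> J" using J(1) unfolding generated_ideal_def by blast
    then show "I \<subseteq> J" unfolding generated_ideal_eq .
  qed
  moreover have "generated_ideal Q (\<chi> - {\<gamma>}) \<subseteq> generated_ideal Q \<chi>"
    unfolding generated_ideal_def by (intro Inter_anti_mono) blast
  ultimately show False using gens assms(1) unfolding minimal_path_generators_def by blast
qed

end

section \<open>Modules with a basis partially permuted by the arrows\<close>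

text \<open>Indexing by the members of lists instead of positions turns products over distinct lists
  into sums over basis elements.\<close>

definition kmat :: "'y list \<Rightarrow> 'x list \<Rightarrow> ('y \<Rightarrow> 'x \<Rightarrow> 'k :: field) \<Rightarrow> 'k mat" where
  "kmat ys xs K = mat (length ys) (length xs) (\<lambda>(i,j). K (ys ! i) (xs ! j))"

lemma kmat_dims [simp]: "dim_row (kmat ys xs K) = length ys" "dim_col (kmat ys xs K) = length xs"
  by (auto simp: kmat_def)

lemma kmat_carrier: "kmat ys xs K \<in> carrier_mat (length ys) (length xs)"
  by (rule carrier_matI) simp_all

lemma kmat_index: "i < length ys \<Longrightarrow> j < length xs \<Longrightarrow> kmat ys xs K $$ (i,j) = K (ys ! i) (xs ! j)"
  by (simp add: kmat_def)

lemma sum_nth_distinct: "distinct ys \<Longrightarrow> (\<Sum>i = 0..<length ys. f (ys ! i)) = (\<Sum>y\<in>set ys. f y)"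
  by (rule sum.reindex_bij_betw[OF bij_betw_nth]) auto

lemma kmat_mult:
  assumes "distinct ys"
  shows "kmat zs ys K * kmat ys xs L = kmat zs xs (\<lambda>z x. \<Sum>y\<in>set ys. K z y * L y x)"
  by (rule eq_matI)
    (auto simp: scalar_prod_def kmat_index sum_nth_distinct[OF assms, of "\<lambda>y. K _ y * L y _"])

lemma kmat_cong: "(\<And>y x. y \<in> set ys \<Longrightarrow> x \<in> set xs \<Longrightarrow> K y x = L y x) \<Longrightarrow> kmat ys xs K = kmat ys xs L"
  by (rule eq_matI) (simp_all add: kmat_index)

lemma kmat_eqD:
  assumes "kmat ys xs K = kmat ys xs L" "y \<in> set ys" "x \<in> set xs"
  shows "K y x = L y x"
proof -
  obtain i j where ij: "i < length ys" "y = ys ! i" "j < length xs" "x = xs ! j"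
    using assms(2,3) by (auto simp: in_set_conv_nth)
  have "kmat ys xs K $$ (i,j) = kmat ys xs L $$ (i,j)" by (simp only: assms(1))
  then show ?thesis using ij by (simp add: kmat_index)
qed

lemma kmat_one: "distinct xs \<Longrightarrow> kmat xs xs (\<lambda>y x. if y = x then 1 else 0) = 1\<^sub>m (length xs)"
  by (rule eq_matI) (simp_all add: kmat_index nth_eq_iff_index_eq)

lemma kmat_add: "kmat ys xs K + kmat ys xs L = kmat ys xs (\<lambda>y x. K y x + L y x)"
  by (rule eq_matI) (simp_all add: kmat_index)

lemma kmat_smult: "c \<cdot>\<^sub>m kmat ys xs K = kmat ys xs (\<lambda>y x. c * K y x)"
  by (rule eq_matI) (simp_all add: kmat_index)

lemma kmat_exhaust:
  assumes "F \<in> carrier_mat (length ys) (length xs)" "distinct ys" "distinct xs"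
  obtains K where "F = kmat ys xs K"
proof
  let ?iy = "the_inv_into {..<length ys} ((!) ys)" and ?ix = "the_inv_into {..<length xs} ((!) xs)"
  have i: "?iy (ys ! i) = i" if "i < length ys" for i
    using assms(2) that by (intro the_inv_into_f_f) (auto simp: inj_on_nth)
  have j: "?ix (xs ! i) = i" if "i < length xs" for i
    using assms(3) that by (intro the_inv_into_f_f) (auto simp: inj_on_nth)
  show "F = kmat ys xs (\<lambda>y x. F $$ (?iy y, ?ix x))"
    by (rule eq_matI) (use assms(1) in \<open>auto simp: kmat_index i j\<close>)
qed

lemma mat_as_kmat: "dim_row A = m \<Longrightarrow> dim_col A = n \<Longrightarrow> A = kmat [0..<m] [0..<n] (\<lambda>i j. A $$ (i,j))"
  by (rule eq_matI) (simp_all add: kmat_index)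

lemma sum_option_bind:
  assumes "finite S" "\<And>z. o' = Some z \<Longrightarrow> z \<in> S"
  shows "(\<Sum>z\<in>S. g z * (if o' = Some z then 1 else 0 :: 'k :: field)) = (case o' of None \<Rightarrow> 0 | Some z \<Rightarrow> g z)"
    "(\<Sum>z\<in>S. (if o' = Some z then 1 else 0 :: 'k :: field) * g z) = (case o' of None \<Rightarrow> 0 | Some z \<Rightarrow> g z)"
proof -
  show "(\<Sum>z\<in>S. g z * (if o' = Some z then 1 else 0 :: 'k :: field)) = (case o' of None \<Rightarrow> 0 | Some z \<Rightarrow> g z)"
  proof (cases o')
    case (Some w)
    then have "(\<Sum>z\<in>S. g z * (if o' = Some z then 1 else 0 :: 'k)) = (\<Sum>z\<in>S. if z = w then g z else 0)"
      by (intro sum.cong) auto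
    then show ?thesis using Some assms by simp
  qed simp
  then show "(\<Sum>z\<in>S. (if o' = Some z then 1 else 0 :: 'k :: field) * g z) = (case o' of None \<Rightarrow> 0 | Some z \<Rightarrow> g z)"
    by (simp add: mult.commute)
qed

text \<open>The list is worked off from its end: the last arrow of a path is the leftmost factor of
  the product and meets an element of a right module first.\<close>

primrec run :: "('x \<Rightarrow> 'b \<Rightarrow> 'x option) \<Rightarrow> 'x \<Rightarrow> 'b list \<Rightarrow> 'x option" where
  "run st x [] = Some x"
| "run st x (\<beta> # l) = Option.bind (run st x l) (\<lambda>y. st y \<beta>)"

lemma run_append: "run st x (k @ l) = Option.bind (run st x l) (\<lambda>y. run st y k)"
  by (induction k) (auto simp: Option.bind_assoc)

definition enum_list :: "'x set \<Rightarrow> 'x list" where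
  "enum_list S = (SOME xs. distinct xs \<and> set xs = S)"

lemma enum_list: "finite S \<Longrightarrow> distinct (enum_list S)" "finite S \<Longrightarrow> set (enum_list S) = S"
  using someI_ex[of "\<lambda>xs. distinct xs \<and> set xs = S"] finite_distinct_list[of S] unfolding enum_list_def by blast+

context path_basis begin

abbreviation "N \<equiv> nonzero_paths Q R"

lemma awalk_awlast: "awalk u l v \<Longrightarrow> awlast u l = v"
  by (elim awalkE)

lemma qpaths_iff: "(u, l) \<in> qpaths Q \<longleftrightarrow> awalk u l (awlast u l)"
  using awalk_awlast by (auto simp: qpaths_def)

lemma awalk_start_unique: "awalk u l v \<Longrightarrow> awalk u' l v \<Longrightarrow> u = u'"
  by (cases l) (auto simp: awalk_Cons_iff awalk_Nil_iff)

lemma trivial_path: "v \<in> verts Q \<Longrightarrow> (v, []) \<in> N"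
  using rel_length[of "[]"] by (auto simp: nonzero_paths_def qpaths_def awalk_Nil_iff contains_relation_def)

lemma arrow_path: "\<beta> \<in> arcs Q \<Longrightarrow> (tail Q \<beta>, [\<beta>]) \<in> N"
proof -
  assume b: "\<beta> \<in> arcs Q"
  have "\<not> contains_relation R [\<beta>]"
  proof
    assume "contains_relation R [\<beta>]"
    then obtain r where r: "r \<in> R" "sublist r [\<beta>]" by (auto simp: contains_relation_def)
    from sublist_length_le[OF r(2)] rel_length[OF r(1)] show False by simp
  qed
  then show ?thesis using b by (auto simp: nonzero_paths_def qpaths_def awalk_Cons_iff awalk_Nil_iff)
qed

text \<open>Linear functionals on the algebra; through \<open>lin_ext\<close>, identities between
  matrix entries need checking only on basis paths.\<close>

definition lin :: "('a \<Rightarrow> 'k) \<Rightarrow> bool" where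
  "lin f \<longleftrightarrow> (\<forall>a b. f (a + b) = f a + f b) \<and> (\<forall>c a. f (sc c a) = c * f a)"

lemma lin_zero: "lin f \<Longrightarrow> f 0 = 0"
  unfolding lin_def by (metis scale_zero_left mult_zero_left)

lemma lin_expand: assumes "lin f" shows "f a = (\<Sum>p\<in>N. co a p * f (bs p))"
proof -
  have "f (\<Sum>p\<in>S. sc (co a p) (bs p)) = (\<Sum>p\<in>S. co a p * f (bs p))" if "finite S" for S
    using that by (induction S rule: finite_induct) (use assms in \<open>auto simp: lin_def lin_zero[OF assms]\<close>)
  from this[OF finite_nonzero_paths] show ?thesis by (simp flip: expand)
qed

lemma lin_ext: "lin f \<Longrightarrow> lin g \<Longrightarrow> (\<And>p. p \<in> N \<Longrightarrow> f (bs p) = g (bs p)) \<Longrightarrow> f a = g a"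
  by (simp add: lin_expand[of f a] lin_expand[of g a])

lemma mhom_pathsI:
  assumes X: "right_module sc X" and Y: "right_module sc Y" and d: "dim_row F = mdim Y" "dim_col F = mdim X"
    and c: "\<And>p. p \<in> N \<Longrightarrow> F * mact X (bs p) = mact Y (bs p) * F"
  shows "F \<in> mhom X Y"
proof (rule mhomI[OF d])
  fix a
  note dd = d mact_dims[OF X] mact_dims[OF Y]
  show "F * mact X a = mact Y a * F"
  proof (rule eq_matI)
    fix i j assume "i < dim_row (mact Y a * F)" "j < dim_col (mact Y a * F)"
    then have ij: "i < mdim Y" "j < mdim X" by (simp_all add: dd)
    have "lin (\<lambda>a. (F * mact X a) $$ (i,j))" "lin (\<lambda>a. (mact Y a * F) $$ (i,j))"
      unfolding lin_def mact_simps[OF X] mact_simps[OF Y]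
      using ij by (simp_all add: dd mult_mat_add_right mult_mat_add_left mult_mat_smult_left mult_mat_smult_right del: index_mult_mat(1))
    from lin_ext[OF this] c show "(F * mact X a) $$ (i,j) = (mact Y a * F) $$ (i,j)" by simp
  qed (simp_all add: dd)
qed

definition act :: "('x \<Rightarrow> 'v) \<Rightarrow> ('x \<Rightarrow> 'b \<Rightarrow> 'x option) \<Rightarrow> 'x \<Rightarrow> ('v, 'b) qpath \<Rightarrow> 'x option" where
  "act vx st x p = (if path_end Q p = vx x then run st x (snd p) else None)"

text \<open>A module with a finite basis \<open>xs\<close> on which the arrows act as partial maps; \<open>vx x\<close> is the vertex
  of the basis element \<open>x\<close>. As the algebra acts from the right and the first arrow of a path is its
  rightmost factor, an arrow leads from its head to its tail.\<close>

definition step_system :: "'x list \<Rightarrow> ('x \<Rightarrow> 'v) \<Rightarrow> ('x \<Rightarrow> 'b \<Rightarrow> 'x option) \<Rightarrow> bool" where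
  "step_system xs vx st \<longleftrightarrow> distinct xs \<and> (\<forall>x\<in>set xs. vx x \<in> verts Q) \<and>
    (\<forall>x\<in>set xs. \<forall>\<beta> y. st x \<beta> = Some y \<longrightarrow> y \<in> set xs \<and> \<beta> \<in> arcs Q \<and> head Q \<beta> = vx x \<and> tail Q \<beta> = vx y) \<and>
    (\<forall>x\<in>set xs. \<forall>l y. run st x l = Some y \<longrightarrow> \<not> contains_relation R l)"

definition smod :: "'x list \<Rightarrow> ('x \<Rightarrow> 'v) \<Rightarrow> ('x \<Rightarrow> 'b \<Rightarrow> 'x option) \<Rightarrow> ('a, 'k) rmod" where
  "smod xs vx st = (length xs, \<lambda>a. kmat xs xs (\<lambda>y x. \<Sum>p\<in>N. co a p * (if act vx st x p = Some y then 1 else 0)))"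

lemma smod_dim [simp]: "mdim (smod xs vx st) = length xs" by (simp add: smod_def)

lemma run_awalk:
  assumes s: "step_system xs vx st" and x: "x \<in> set xs" and r: "run st x l = Some y"
  shows "y \<in> set xs \<and> awalk (vx y) l (vx x)"
  using r
proof (induction l arbitrary: y)
  case Nil then show ?case using s x by (auto simp: awalk_Nil_iff step_system_def)
next
  case (Cons \<beta> l)
  then obtain z where z: "run st x l = Some z" "st z \<beta> = Some y" by (auto simp: bind_eq_Some_conv)
  from Cons.IH[OF z(1)] have zz: "z \<in> set xs" "awalk (vx z) l (vx x)" by auto
  with z(2) s have "y \<in> set xs" "\<beta> \<in> arcs Q" "head Q \<beta> = vx z" "tail Q \<beta> = vx y" unfolding step_system_def by blast+
  with zz show ?case by (simp add: awalk_Cons_iff)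
qed

lemma act_awalk:
  assumes "step_system xs vx st" "x \<in> set xs" "p \<in> qpaths Q" "act vx st x p = Some y"
  shows "y \<in> set xs" "vx y = fst p" "vx x = path_end Q p"
proof -
  have r: "run st x (snd p) = Some y" "path_end Q p = vx x" using assms(4) by (auto simp: act_def split: if_splits)
  from run_awalk[OF assms(1,2) r(1)] have y: "y \<in> set xs" "awalk (vx y) (snd p) (vx x)" by auto
  show "y \<in> set xs" "vx x = path_end Q p" using y r by auto
  have "awalk (fst p) (snd p) (vx x)" using assms(3) r(2) by (cases p) (simp add: qpaths_iff)
  from awalk_start_unique[OF y(2) this] show "vx y = fst p" .
qed

text \<open>Mirrors \<open>bs_mult\<close>: acting by \<open>p\<close> and then by \<open>q\<close>
  is acting by the product of \<open>p\<close> and \<open>q\<close>, whose path traverses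
  \<open>q\<close> first.\<close>

lemma act_compose:
  assumes s: "step_system xs vx st" and x: "x \<in> set xs" and pq: "p \<in> qpaths Q" "q \<in> qpaths Q"
  shows "Option.bind (act vx st x p) (\<lambda>y. act vx st y q) =
    (if path_end Q q = fst p then act vx st x (fst q, snd q @ snd p) else None)"
proof (cases "path_end Q q = fst p")
  case True
  have "path_end Q (fst q, snd q @ snd p) = path_end Q p" using True by (simp add: awlast_append)
  moreover have "Option.bind (run st x (snd p)) (\<lambda>y. act vx st y q) = Option.bind (run st x (snd p)) (\<lambda>y. run st y (snd q))"
    if e: "path_end Q p = vx x"
  proof (cases "run st x (snd p)")
    case (Some y)
    then have "act vx st x p = Some y" using e by (simp add: act_def)
    from act_awalk(2)[OF s x pq(1) this] show ?thesis using Some True by (simp add: act_def)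
  qed simp
  ultimately show ?thesis using True by (simp add: act_def run_append)
next
  case False
  have "act vx st y q = None" if "act vx st x p = Some y" for y
    using act_awalk(2)[OF s x pq(1) that] False by (simp add: act_def)
  then show ?thesis using False by (cases "act vx st x p") auto
qed

lemma lin_coord_sum: "lin (\<lambda>a. \<Sum>p\<in>N. co a p * f p)"
  unfolding lin_def
proof (intro conjI allI)
  fix a b show "(\<Sum>p\<in>N. co (a + b) p * f p) = (\<Sum>p\<in>N. co a p * f p) + (\<Sum>p\<in>N. co b p * f p)"
    unfolding sum.distrib[symmetric] by (intro sum.cong refl) (simp add: co_add distrib_right)
next
  fix c a show "(\<Sum>p\<in>N. co (sc c a) p * f p) = c * (\<Sum>p\<in>N. co a p * f p)"
    unfolding sum_distrib_left by (intro sum.cong refl) (simp add: co_scale mult.assoc)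
qed

lemma coord_sum_bs:
  assumes p: "p \<in> qpaths Q" and f: "p \<notin> N \<Longrightarrow> f p = 0"
  shows "(\<Sum>q\<in>N. co (bs p) q * f q) = f p"
proof (cases "p \<in> N")
  case True
  have "(\<Sum>q\<in>N. co (bs p) q * f q) = (\<Sum>q\<in>N. if q = p then f q else 0)"
    by (intro sum.cong refl) (simp add: co_bs True)
  then show ?thesis using True finite_nonzero_paths by simp
next
  case False
  then have "bs p = 0" using p bs_zero by (auto simp: nonzero_paths_def)
  then show ?thesis using lin_zero[OF lin_coord_sum[of f]] f[OF False] by simp
qed

lemma step_system_nonzero:
  assumes "step_system xs vx st" "x \<in> set xs" "p \<in> qpaths Q" "p \<notin> N"
  shows "act vx st x p = None"
  using assms unfolding step_system_def nonzero_paths_def act_def by (cases "run st x (snd p)") auto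

lemma smod_act:
  assumes s: "step_system xs vx st" and p: "p \<in> qpaths Q"
  shows "mact (smod xs vx st) (bs p) = kmat xs xs (\<lambda>y x. if act vx st x p = Some y then 1 else 0)"
  unfolding smod_def snd_conv
  by (intro kmat_cong coord_sum_bs[OF p]) (simp add: step_system_nonzero[OF s _ p])

text \<open>Multiplicativity is bilinear in the two algebra elements, hence a matter of two basis
  paths, where it is \<open>act_compose\<close>. The unit is the sum of the trivial paths, exactly
  one of which fixes a given basis element.\<close>

lemma smod_right_module:
  assumes s: "step_system xs vx st"
  shows "right_module sc (smod xs vx st)"
proof -
  let ?M = "smod xs vx st"
  define K where "K = (\<lambda>a y x. \<Sum>p\<in>N. co a p * (if act vx st x p = Some y then 1 else 0))"
  have M: "mact ?M a = kmat xs xs (K a)" for a by (simp add: smod_def K_def)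
  have linK: "lin (\<lambda>a. K a y x)" for y x unfolding K_def by (rule lin_coord_sum)
  have Kb: "K (bs p) y x = (if act vx st x p = Some y then 1 else 0)" if "x \<in> set xs" "p \<in> qpaths Q" for p x y
    unfolding K_def using step_system_nonzero[OF s that] by (intro coord_sum_bs[OF that(2)]) simp
  have dist: "distinct xs" and vx: "\<And>x. x \<in> set xs \<Longrightarrow> vx x \<in> verts Q" using s by (auto simp: step_system_def)
  have Nq: "p \<in> qpaths Q" if "p \<in> N" for p using that by (simp add: nonzero_paths_def)
  have mult: "K (a * b) z x = (\<Sum>y\<in>set xs. K b z y * K a y x)" if x: "x \<in> set xs" and z: "z \<in> set xs" for a b x z
  proof -
    have l1: "lin (\<lambda>a. K (a * b) z x)" for b
      using linK[of z x] unfolding lin_def by (simp add: distrib_right scale_mult_left)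
    have l2: "lin (\<lambda>b. K (a * b) z x)" for a
      using linK[of z x] unfolding lin_def by (simp add: distrib_left scale_mult_right)
    have l3: "lin (\<lambda>a. \<Sum>y\<in>set xs. K b z y * K a y x)" for b
      using linK[of _ x] unfolding lin_def by (simp add: distrib_left sum.distrib sum_distrib_left mult.left_commute)
    have l4: "lin (\<lambda>b. \<Sum>y\<in>set xs. K b z y * K a y x)" for a
      using linK[of z] unfolding lin_def by (simp add: distrib_right sum.distrib sum_distrib_left mult.assoc)
    show ?thesis
    proof (rule lin_ext[OF l1 l3])
      fix p assume p: "p \<in> N"
      show "K (bs p * b) z x = (\<Sum>y\<in>set xs. K b z y * K (bs p) y x)"
      proof (rule lin_ext[OF l2 l4])
        fix q assume q: "q \<in> N"
        note pq = Nq[OF p] Nq[OF q]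
        have ap: "act vx st x p = Some y \<Longrightarrow> y \<in> set xs" for y using act_awalk(1)[OF s x pq(1)] by blast
        have "(\<Sum>y\<in>set xs. K (bs q) z y * K (bs p) y x) =
            (case act vx st x p of None \<Rightarrow> 0 | Some y \<Rightarrow> K (bs q) z y)"
          unfolding Kb[OF x pq(1)] by (rule sum_option_bind(1)) (use ap in auto)
        also have "\<dots> = (if Option.bind (act vx st x p) (\<lambda>y. act vx st y q) = Some z then 1 else 0)"
          by (cases "act vx st x p") (auto simp: Kb[OF ap pq(2)])
        also have "\<dots> = K (bs p * bs q) z x"
          unfolding act_compose[OF s x pq] bs_mult[OF pq]
        proof (cases "path_end Q q = fst p")
          case True
          have "awalk (fst q) (snd q @ snd p) (path_end Q p)"
            using pq True by (cases p, cases q) (auto simp: qpaths_iff intro: awalk_appendI)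
          then have "(fst q, snd q @ snd p) \<in> qpaths Q" by (auto simp: qpaths_def)
          then show "(if (if path_end Q q = fst p then act vx st x (fst q, snd q @ snd p) else None) = Some z then 1 else 0)
              = K (if path_end Q q = fst p then bs (fst q, snd q @ snd p) else 0) z x"
            using True by (simp add: Kb[OF x])
        qed (simp add: lin_zero[OF linK])
        finally show "K (bs p * bs q) z x = (\<Sum>y\<in>set xs. K (bs q) z y * K (bs p) y x)" by simp
      qed
    qed
  qed
  show ?thesis
    unfolding right_module_def
  proof (intro conjI allI)
    fix a b c
    show "mact ?M a \<in> carrier_mat (mdim ?M) (mdim ?M)" by (simp add: M kmat_carrier)
    show "mact ?M (a + b) = mact ?M a + mact ?M b"
      unfolding M kmat_add by (rule kmat_cong) (use linK in \<open>simp add: lin_def\<close>)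
    show "mact ?M (sc c a) = c \<cdot>\<^sub>m mact ?M a"
      unfolding M kmat_smult by (rule kmat_cong) (use linK in \<open>simp add: lin_def\<close>)
    show "mact ?M (a * b) = mact ?M b * mact ?M a"
      unfolding M kmat_mult[OF dist] by (intro kmat_cong mult)
    have "K 1 y x = (if y = x then 1 else 0)" if "y \<in> set xs" "x \<in> set xs" for y x
    proof -
      have "K (\<Sum>v\<in>S. bs (v, [])) y x = (\<Sum>v\<in>S. K (bs (v, [])) y x)" if "finite S" for S
        using that by (induction S rule: finite_induct) (use linK lin_zero[OF linK] in \<open>auto simp: lin_def\<close>)
      from this[OF finite_verts] have "K 1 y x = (\<Sum>v\<in>verts Q. K (bs (v, [])) y x)" by (simp flip: one_eq)
      also have "\<dots> = (\<Sum>v\<in>verts Q. if v = vx x then (if y = x then 1 else 0) else 0)"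
        by (intro sum.cong refl) (auto simp: Kb[OF that(2)] act_def qpaths_iff awalk_Nil_iff)
      finally show ?thesis using vx[OF that(2)] by simp
    qed
    then show "mact ?M 1 = 1\<^sub>m (mdim ?M)"
      unfolding M smod_dim by (subst kmat_one[OF dist, symmetric]) (rule kmat_cong)
  qed
qed

text \<open>The entry at \<open>z\<close> and \<open>x\<close> of the intertwining equation for
  \<open>p\<close>. On the source side \<open>p\<close> leads from \<open>x\<close> to at most one
  basis element, so that sum collapses.\<close>

lemma smod_homD:
  assumes A: "step_system xs vx st" and B: "step_system ys vy sy"
    and F: "kmat ys xs K \<in> mhom (smod xs vx st) (smod ys vy sy)"
    and p: "p \<in> qpaths Q" and x: "x \<in> set xs" and z: "z \<in> set ys"
  shows "(case act vx st x p of None \<Rightarrow> 0 | Some y \<Rightarrow> K z y) = (\<Sum>y\<in>set ys. (if act vy sy y p = Some z then 1 else 0) * K y x)"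
proof -
  have "kmat ys xs K * mact (smod xs vx st) (bs p) = mact (smod ys vy sy) (bs p) * kmat ys xs K" by (rule mhom_comm[OF F])
  moreover have "distinct xs" "distinct ys" using A B by (auto simp: step_system_def)
  ultimately have "kmat ys xs (\<lambda>z x. \<Sum>y\<in>set xs. K z y * (if act vx st x p = Some y then 1 else 0)) =
      kmat ys xs (\<lambda>z x. \<Sum>y\<in>set ys. (if act vy sy y p = Some z then 1 else 0) * K y x)"
    by (simp add: smod_act[OF A p] smod_act[OF B p] kmat_mult)
  from kmat_eqD[OF this z x] show ?thesis
    using sum_option_bind(1)[of "set xs" "act vx st x p" "K z"] act_awalk(1)[OF A x p] by simp
qed

lemma smod_homI:
  assumes A: "step_system xs vx st" and B: "step_system ys vy sy"
    and e: "\<And>p x z. p \<in> N \<Longrightarrow> x \<in> set xs \<Longrightarrow> z \<in> set ys \<Longrightarrow>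
      (case act vx st x p of None \<Rightarrow> 0 | Some y \<Rightarrow> K z y) = (\<Sum>y\<in>set ys. (if act vy sy y p = Some z then 1 else 0) * K y x)"
  shows "kmat ys xs K \<in> mhom (smod xs vx st) (smod ys vy sy)"
proof (rule mhom_pathsI[OF smod_right_module[OF A] smod_right_module[OF B]])
  fix p assume p: "p \<in> N"
  then have pq: "p \<in> qpaths Q" by (simp add: nonzero_paths_def)
  have dist: "distinct xs" "distinct ys" using A B by (auto simp: step_system_def)
  show "kmat ys xs K * mact (smod xs vx st) (bs p) = mact (smod ys vy sy) (bs p) * kmat ys xs K"
    unfolding smod_act[OF A pq] smod_act[OF B pq] kmat_mult[OF dist(1)] kmat_mult[OF dist(2)]
  proof (rule kmat_cong)
    fix z x assume z: "z \<in> set ys" and x: "x \<in> set xs"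
    show "(\<Sum>y\<in>set xs. K z y * (if act vx st x p = Some y then 1 else 0)) = (\<Sum>y\<in>set ys. (if act vy sy y p = Some z then 1 else 0) * K y x)"
      using e[OF p x z] sum_option_bind(1)[of "set xs" "act vx st x p" "K z"] act_awalk(1)[OF A x pq] by simp
  qed
qed simp_all

lemma indecomposable_scalar_endos:
  fixes M :: "('a, 'k) rmod"
  assumes M: "right_module sc M" "mdim M \<noteq> 0"
    and sc: "\<And>F. F \<in> mhom M M \<Longrightarrow> \<exists>c. F = c \<cdot>\<^sub>m 1\<^sub>m (mdim M)"
  shows "indecomposable sc M"
proof (rule indecomposableI[OF M])
  fix E assume E: "E \<in> mhom M M" "E * E = E"
  obtain c where c: "E = c \<cdot>\<^sub>m 1\<^sub>m (mdim M)" using sc[OF E(1)] by blast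
  have "c \<cdot>\<^sub>m (c \<cdot>\<^sub>m 1\<^sub>m (mdim M)) = c \<cdot>\<^sub>m (1\<^sub>m (mdim M) :: 'k mat)"
    using E(2) unfolding c by (simp add: mult_mat_smult_left mult_mat_smult_right)
  from arg_cong[OF this, of "\<lambda>A. A $$ (0,0)"] M(2) have "c * c = c" by simp
  then have "c = 0 \<or> c = 1" by simp
  then show "E = 0\<^sub>m (mdim M) (mdim M) \<or> E = 1\<^sub>m (mdim M)" by (auto simp: c intro!: eq_matI)
qed

lemma nonzero_pathsD: "p \<in> N \<Longrightarrow> p \<in> qpaths Q" "p \<in> N \<Longrightarrow> \<not> contains_relation R (snd p)"
  by (simp_all add: nonzero_paths_def)

lemma qpaths_awalk: "p \<in> qpaths Q \<Longrightarrow> awalk (fst p) (snd p) (path_end Q p)"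
  by (cases p) (simp add: qpaths_iff)

section \<open>Quotients of the projectives, and the injectives\<close>

definition pstep :: "('v, 'b) qpath set \<Rightarrow> ('v, 'b) qpath \<Rightarrow> 'b \<Rightarrow> ('v, 'b) qpath option" where
  "pstep T x \<beta> = (if head Q \<beta> = fst x \<and> (tail Q \<beta>, \<beta> # snd x) \<in> T then Some (tail Q \<beta>, \<beta> # snd x) else None)"

text \<open>\<open>T\<close> is closed under dropping the first arrow, so the nonzero paths to
  \<open>a\<close> outside of \<open>T\<close> span a submodule of \<open>P\<^sub>a\<close>, and
  \<open>pmod T\<close> is the quotient by it. The choice \<open>T = ppaths a\<close> gives
  \<open>P\<^sub>a\<close> itself.\<close>

definition rooted :: "('v, 'b) qpath set \<Rightarrow> 'v \<Rightarrow> bool" where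
  "rooted T a \<longleftrightarrow> a \<in> verts Q \<and> T \<subseteq> N \<and> (\<forall>p\<in>T. path_end Q p = a) \<and> (a, []) \<in> T \<and>
     (\<forall>u \<beta> s. (u, \<beta> # s) \<in> T \<longrightarrow> (head Q \<beta>, s) \<in> T)"

abbreviation pmod :: "('v, 'b) qpath set \<Rightarrow> ('a, 'k) rmod" where
  "pmod T \<equiv> smod (enum_list T) fst (pstep T)"

lemma rooted_finite: "rooted T a \<Longrightarrow> finite T"
  unfolding rooted_def using finite_nonzero_paths finite_subset by blast

lemma rooted_awalk: "rooted T a \<Longrightarrow> (u, l) \<in> T \<Longrightarrow> awalk u l a"
  unfolding rooted_def using nonzero_pathsD(1) qpaths_iff by fastforce

lemma prun_result:
  assumes "rooted T a" "x \<in> T" "run (pstep T) x l = Some y"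
  shows "snd y = l @ snd x \<and> y \<in> T"
  using assms(3)
proof (induction l arbitrary: y)
  case Nil then show ?case using assms(2) by simp
next
  case (Cons \<beta> l)
  then obtain z where z: "run (pstep T) x l = Some z" "pstep T z \<beta> = Some y" by (auto simp: bind_eq_Some_conv)
  with Cons.IH[OF z(1)] show ?case by (auto simp: pstep_def split: if_splits)
qed

lemma prun:
  assumes T: "rooted T a" and x: "(u, s) \<in> T" and y: "(u', l @ s) \<in> T"
  shows "run (pstep T) (u, s) l = Some (u', l @ s)"
  using y
proof (induction l arbitrary: u')
  case Nil
  then show ?case using awalk_start_unique[OF rooted_awalk[OF T x] rooted_awalk[OF T]] by simp
next
  case (Cons \<beta> l)
  then have "(head Q \<beta>, l @ s) \<in> T" using T by (simp add: rooted_def)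
  from Cons.IH[OF this] have "run (pstep T) (u, s) l = Some (head Q \<beta>, l @ s)" .
  moreover have "tail Q \<beta> = u'" using rooted_awalk[OF T Cons.prems] by (simp add: awalk_Cons_iff)
  then have "pstep T (head Q \<beta>, l @ s) \<beta> = Some (u', \<beta> # l @ s)" using Cons.prems by (simp add: pstep_def)
  ultimately show ?case by simp
qed

lemma rooted_step_system:
  assumes T: "rooted T a"
  shows "step_system (enum_list T) fst (pstep T)"
  unfolding step_system_def enum_list(2)[OF rooted_finite[OF T]]
proof (intro conjI ballI allI impI enum_list(1)[OF rooted_finite[OF T]])
  fix x assume x: "x \<in> T"
  show "fst x \<in> verts Q" using rooted_awalk[OF T, of "fst x" "snd x"] x by (auto simp: awalk_hd_in_verts)
  fix l y assume "run (pstep T) x l = Some y"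
  from prun_result[OF T x this] have "snd y = l @ snd x" "y \<in> N" using T by (auto simp: rooted_def)
  then show "\<not> contains_relation R l" using nonzero_pathsD(2)[of y] contains_relation_append[of R l "[]" "snd x"] by auto
next
  fix x \<beta> y assume x: "x \<in> T" and y: "pstep T x \<beta> = Some y"
  then have *: "head Q \<beta> = fst x" "(tail Q \<beta>, \<beta> # snd x) \<in> T" "y = (tail Q \<beta>, \<beta> # snd x)" by (auto simp: pstep_def split: if_splits)
  from rooted_awalk[OF T *(2)] have "\<beta> \<in> arcs Q" by (simp add: awalk_Cons_iff)
  with * show "y \<in> T" "\<beta> \<in> arcs Q" "head Q \<beta> = fst x" "tail Q \<beta> = fst y" by auto
qed

lemma act_root:
  assumes T: "rooted T a" and p: "p \<in> T"
  shows "act fst (pstep T) (a, []) p = Some p"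
proof -
  have "(a, []) \<in> T" "path_end Q p = a" using T p by (auto simp: rooted_def)
  then show ?thesis using prun[OF T, of a "[]" "fst p" "snd p"] p by (simp add: act_def)
qed

lemma act_trivial: "act vx st x (v, []) = (if vx x = v then Some x else None)"
  by (auto simp: act_def)

text \<open>The trivial path generates \<open>pmod T\<close>, so an endomorphism is determined by
  the image of it. This image is fixed by the idempotent at \<open>a\<close>, and
  \<open>only\<close> leaves the scalar multiples of the generator.\<close>

lemma pmod_indecomposable:
  assumes T: "rooted T a" and only: "\<And>p. p \<in> T \<Longrightarrow> fst p = a \<Longrightarrow> p = (a, [])"
  shows "indecomposable sc (pmod T)"
proof (rule indecomposable_scalar_endos)
  let ?xs = "enum_list T" and ?t = "(a, [])"
  note S = rooted_step_system[OF T] and e = enum_list[OF rooted_finite[OF T]]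
  have t: "?t \<in> T" and TN: "T \<subseteq> N" using T by (simp_all add: rooted_def)
  have Tq: "p \<in> qpaths Q" if "p \<in> T" for p using nonzero_pathsD(1) subsetD[OF TN that] .
  note av = Tq[OF t]
  show "right_module sc (pmod T)" by (rule smod_right_module[OF S])
  show "mdim (pmod T) \<noteq> 0" using t e(2) by fastforce
  fix F assume F: "F \<in> mhom (pmod T) (pmod T)"
  have Fc: "F \<in> carrier_mat (length ?xs) (length ?xs)" by (rule carrier_matI) (simp_all add: mhom_dims[OF F])
  obtain K where K: "F = kmat ?xs ?xs K" by (rule kmat_exhaust[OF Fc e(1) e(1)])
  note hD = smod_homD[OF S S F[unfolded K], unfolded e(2)]
  have K0: "K z ?t = 0" if z: "z \<in> T" "z \<noteq> ?t" for z
  proof -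
    have "K z ?t = (\<Sum>y\<in>T. (if act fst (pstep T) y (a, []) = Some z then 1 else 0) * K y ?t)"
      using hD[OF av t z(1)] by (simp add: act_trivial)
    also have "\<dots> = 0" using only z by (intro sum.neutral ballI) (auto simp: act_trivial)
    finally show ?thesis .
  qed
  have "K z p = K ?t ?t * (if z = p then 1 else 0)" if z: "z \<in> T" and p: "p \<in> T" for z p
  proof -
    have "K z p = (\<Sum>y\<in>T. (if act fst (pstep T) y p = Some z then 1 else 0) * K y ?t)"
      using hD[OF Tq[OF p] t z] by (simp add: act_root[OF T p])
    also have "\<dots> = (\<Sum>y\<in>T. if y = ?t then (if z = p then 1 else 0) * K ?t ?t else 0)"
      by (intro sum.cong refl) (auto simp: K0 act_root[OF T p])
    finally show ?thesis using t rooted_finite[OF T] by (simp add: mult.commute)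
  qed
  then have "F = kmat ?xs ?xs (\<lambda>z p. K ?t ?t * (if z = p then 1 else 0))"
    unfolding K by (intro kmat_cong) (simp add: e(2))
  then have "F = K ?t ?t \<cdot>\<^sub>m 1\<^sub>m (mdim (pmod T))"
    unfolding kmat_smult[symmetric] kmat_one[OF e(1)] by simp
  then show "\<exists>c. F = c \<cdot>\<^sub>m 1\<^sub>m (mdim (pmod T))" by blast
qed

definition ppaths :: "'v \<Rightarrow> ('v, 'b) qpath set" where
  "ppaths a = {p \<in> N. path_end Q p = a}"

lemma rooted_ppaths:
  assumes "a \<in> verts Q"
  shows "rooted (ppaths a) a"
  unfolding rooted_def ppaths_def
proof (intro conjI allI impI)
  show "(a, []) \<in> {p \<in> N. path_end Q p = a}" using trivial_path[OF assms] by simp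
  fix u \<beta> s assume "(u, \<beta> # s) \<in> {p \<in> N. path_end Q p = a}"
  then have p: "(u, \<beta> # s) \<in> N" "awlast u (\<beta> # s) = a" by auto
  from nonzero_pathsD(1)[OF p(1)] p(2) have w: "awalk (head Q \<beta>) s a" by (auto simp: qpaths_iff awalk_Cons_iff)
  have "\<not> contains_relation R s" using nonzero_pathsD(2)[OF p(1)] contains_relation_append[of R s "[\<beta>]" "[]"] by auto
  then show "(head Q \<beta>, s) \<in> {p \<in> N. path_end Q p = a}" using w awalk_awlast[OF w] by (auto simp: nonzero_paths_def qpaths_def)
qed (use assms in auto)

text \<open>\<open>pmod (sufs p)\<close> is the uniserial module with top at the end of \<open>p\<close> and socle at its start.\<close>

definition sufs :: "('v, 'b) qpath \<Rightarrow> ('v, 'b) qpath set" where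
  "sufs p = {x \<in> qpaths Q. suffix (snd x) (snd p) \<and> path_end Q x = path_end Q p}"

lemma rooted_sufs:
  assumes p: "p \<in> N"
  shows "rooted (sufs p) (path_end Q p)" "p \<in> sufs p"
proof -
  have w: "awalk (fst p) (snd p) (path_end Q p)" using nonzero_pathsD(1)[OF p] by (cases p) (simp add: qpaths_iff)
  show "p \<in> sufs p" using nonzero_pathsD(1)[OF p] by (simp add: sufs_def)
  show "rooted (sufs p) (path_end Q p)"
    unfolding rooted_def
  proof (intro conjI ballI allI impI subsetI)
    show v: "path_end Q p \<in> verts Q" using w by (rule awalk_last_in_verts)
    show "(path_end Q p, []) \<in> sufs p" using nonzero_pathsD(1)[OF trivial_path[OF v]] by (simp add: sufs_def)
    fix x assume x: "x \<in> sufs p"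
    then show "path_end Q x = path_end Q p" by (simp add: sufs_def)
    from x obtain k where k: "snd p = k @ snd x" by (auto simp: sufs_def suffix_def)
    have "\<not> contains_relation R (snd x)"
      using nonzero_pathsD(2)[OF p] contains_relation_append[of R "snd x" k "[]"] k by auto
    then show "x \<in> N" using x by (simp add: sufs_def nonzero_paths_def)
  next
    fix u \<beta> s assume "(u, \<beta> # s) \<in> sufs p"
    then have x: "(u, \<beta> # s) \<in> qpaths Q" "suffix (\<beta> # s) (snd p)" "awlast u (\<beta> # s) = path_end Q p" by (auto simp: sufs_def)
    then have a: "awalk (head Q \<beta>) s (path_end Q p)" by (auto simp: qpaths_iff awalk_Cons_iff)
    have "suffix s (snd p)" using x(2) by (rule suffix_ConsD)
    then show "(head Q \<beta>, s) \<in> sufs p" using a awalk_awlast[OF a] by (auto simp: sufs_def qpaths_def)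
  qed
qed

text \<open>A path \<open>p\<close> that starts at \<open>a\<close> stands for the functional dual to it, on which an arrow acts by
  cancelling the last arrow of \<open>p\<close>; so \<open>imod a\<close> is \<open>D (A e\<^sub>a)\<close>.\<close>

definition ipaths :: "'v \<Rightarrow> ('v, 'b) qpath set" where
  "ipaths a = {p \<in> N. fst p = a}"

definition istep :: "('v, 'b) qpath \<Rightarrow> 'b \<Rightarrow> ('v, 'b) qpath option" where
  "istep x \<beta> = (if snd x \<noteq> [] \<and> last (snd x) = \<beta> then Some (fst x, butlast (snd x)) else None)"

abbreviation imod :: "'v \<Rightarrow> ('a, 'k) rmod" where
  "imod a \<equiv> smod (enum_list (ipaths a)) (path_end Q) istep"

lemma irun: "run istep x l = Some y \<longleftrightarrow> fst y = fst x \<and> snd x = snd y @ l"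
proof (induction l arbitrary: y)
  case Nil then show ?case by (cases x; cases y) auto
next
  case (Cons \<beta> l)
  have "run istep x (\<beta> # l) = Some y \<longleftrightarrow> (\<exists>z. run istep x l = Some z \<and> istep z \<beta> = Some y)"
    by (simp add: bind_eq_Some_conv)
  also have "\<dots> \<longleftrightarrow> (\<exists>z. fst z = fst x \<and> snd x = snd z @ l \<and> istep z \<beta> = Some y)" by (simp only: Cons.IH) auto
  also have "\<dots> \<longleftrightarrow> fst y = fst x \<and> snd x = snd y @ \<beta> # l"
  proof
    assume "\<exists>z. fst z = fst x \<and> snd x = snd z @ l \<and> istep z \<beta> = Some y"
    then obtain z where z: "fst z = fst x" "snd x = snd z @ l" "snd z \<noteq> []" "last (snd z) = \<beta>" "y = (fst z, butlast (snd z))"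
      by (auto simp: istep_def split: if_splits)
    have yz: "fst y = fst z" "snd y = butlast (snd z)" using z(5) by simp_all
    have zy: "snd z = snd y @ [\<beta>]" unfolding yz z(4)[symmetric] by (simp add: z(3))
    show "fst y = fst x \<and> snd x = snd y @ \<beta> # l" unfolding z(2) zy yz(1) z(1) by simp
  next
    assume "fst y = fst x \<and> snd x = snd y @ \<beta> # l"
    then show "\<exists>z. fst z = fst x \<and> snd x = snd z @ l \<and> istep z \<beta> = Some y"
      by (intro exI[of _ "(fst x, snd y @ [\<beta>])"]) (simp add: istep_def prod_eq_iff)
  qed
  finally show ?case .
qed

lemma finite_ipaths: "finite (ipaths a)" using finite_nonzero_paths by (simp add: ipaths_def)

lemma imod_step_system: "step_system (enum_list (ipaths a)) (path_end Q) istep"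
  unfolding step_system_def enum_list(2)[OF finite_ipaths]
proof (intro conjI ballI allI impI enum_list(1)[OF finite_ipaths])
  fix x assume x: "x \<in> ipaths a"
  then have N: "x \<in> N" by (simp add: ipaths_def)
  note w = qpaths_awalk[OF nonzero_pathsD(1)[OF N]]
  show "path_end Q x \<in> verts Q" by (rule awalk_last_in_verts[OF w])
  show "\<not> contains_relation R l" if "run istep x l = Some y" for l y
    using that nonzero_pathsD(2)[OF N] contains_relation_append[of R l "snd y" "[]"] by (auto simp: irun)
  fix \<beta> y assume "istep x \<beta> = Some y"
  then have xy: "fst y = fst x" "snd x = snd y @ [\<beta>]" using irun[of x "[\<beta>]" y] by simp_all
  have w': "awalk (fst y) (snd y) (tail Q \<beta>)" "\<beta> \<in> arcs Q" "head Q \<beta> = path_end Q x"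
    using w unfolding xy(2) xy(1)[symmetric] by (auto simp: awalk_Cons_iff awlast_append)
  have "\<not> contains_relation R (snd y)"
    using nonzero_pathsD(2)[OF N] contains_relation_append[of R "snd y" "[]" "[\<beta>]"] xy by auto
  then show "y \<in> ipaths a" using w'(1) x xy by (cases y) (auto simp: ipaths_def nonzero_paths_def qpaths_def)
  show "\<beta> \<in> arcs Q" "head Q \<beta> = path_end Q x" "tail Q \<beta> = path_end Q y" using w' awalk_awlast[OF w'(1)] by auto
qed

text \<open>Dual to \<open>pmod_indecomposable\<close>: an endomorphism is determined by its
  coordinate at the socle element \<open>(a, [])\<close>, because a basis path is carried there by
  that path and by no other basis path of \<open>ipaths a\<close>.\<close>

lemma imod_indecomposable:
  assumes a: "a \<in> verts Q" and only: "\<And>p. p \<in> ipaths a \<Longrightarrow> path_end Q p = a \<Longrightarrow> p = (a, [])"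
  shows "indecomposable sc (imod a)"
proof (rule indecomposable_scalar_endos)
  let ?xs = "enum_list (ipaths a)" and ?s = "(a, [])"
  note S = imod_step_system[of a] and e = enum_list[OF finite_ipaths[of a]]
  have s: "?s \<in> ipaths a" using trivial_path[OF a] by (simp add: ipaths_def)
  have Tq: "p \<in> qpaths Q" if "p \<in> ipaths a" for p using nonzero_pathsD(1)[of p] that by (simp add: ipaths_def)
  show "right_module sc (imod a)" by (rule smod_right_module[OF S])
  show "mdim (imod a) \<noteq> 0" using s e(2) by fastforce
  fix F assume F: "F \<in> mhom (imod a) (imod a)"
  have Fc: "F \<in> carrier_mat (length ?xs) (length ?xs)" by (rule carrier_matI) (simp_all add: mhom_dims[OF F])
  obtain K where K: "F = kmat ?xs ?xs K" by (rule kmat_exhaust[OF Fc e(1) e(1)])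
  note hD = smod_homD[OF S S F[unfolded K], unfolded e(2)]
  have K0: "K ?s x = 0" if x: "x \<in> ipaths a" "x \<noteq> ?s" for x
  proof -
    have "path_end Q x \<noteq> a" using only[OF x(1)] x(2) by blast
    then have "0 = (\<Sum>y\<in>ipaths a. (if act (path_end Q) istep y (a, []) = Some ?s then 1 else 0) * K y x)"
      using hD[OF Tq[OF s] x(1) s] by (simp add: act_trivial)
    also have "\<dots> = (\<Sum>y\<in>ipaths a. if y = ?s then K y x else 0)"
      by (intro sum.cong refl) (auto simp: act_trivial)
    finally show ?thesis using s finite_ipaths by simp
  qed
  have act_s: "act (path_end Q) istep y w = Some ?s \<longleftrightarrow> y = w" if "y \<in> ipaths a" "w \<in> ipaths a" for y w
    using that by (cases y; cases w) (auto simp: act_def irun ipaths_def)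
  have "K w x = K ?s ?s * (if w = x then 1 else 0)" if w: "w \<in> ipaths a" and x: "x \<in> ipaths a" for w x
  proof -
    have "(case act (path_end Q) istep x w of None \<Rightarrow> 0 | Some y \<Rightarrow> K ?s y) =
        (\<Sum>y\<in>ipaths a. (if act (path_end Q) istep y w = Some ?s then 1 else 0) * K y x)"
      by (rule hD[OF Tq[OF w] x s])
    also have "\<dots> = (\<Sum>y\<in>ipaths a. if y = w then K y x else 0)"
      by (intro sum.cong refl) (simp add: act_s[OF _ w])
    also have "\<dots> = K w x" using w finite_ipaths by simp
    finally have "K w x = (case act (path_end Q) istep x w of None \<Rightarrow> 0 | Some y \<Rightarrow> K ?s y)" by simp
    also have "\<dots> = K ?s ?s * (if w = x then 1 else 0)"
    proof (cases "act (path_end Q) istep x w")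
      case None then show ?thesis using act_s[OF x w] by auto
    next
      case (Some y)
      then have "y \<in> ipaths a" using act_awalk(1)[OF S _ Tq[OF w]] x by (simp add: e(2))
      then show ?thesis using Some act_s[OF x w] K0[of y] by auto
    qed
    finally show ?thesis .
  qed
  then have "F = kmat ?xs ?xs (\<lambda>z p. K ?s ?s * (if z = p then 1 else 0))"
    unfolding K by (intro kmat_cong) (simp add: e(2))
  then have "F = K ?s ?s \<cdot>\<^sub>m 1\<^sub>m (mdim (imod a))"
    unfolding kmat_smult[symmetric] kmat_one[OF e(1)] by simp
  then show "\<exists>c. F = c \<cdot>\<^sub>m 1\<^sub>m (mdim (imod a))" by blast
qed

end

text \<open>The extension of the uniserial module \<open>pmod (sufs q)\<close> by \<open>pmod (sufs p)\<close> in which the arrow \<open>\<delta>\<close>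
  additionally leads from the suffix \<open>q0\<close> of \<open>q\<close> to the basis element \<open>z\<close> of the submodule.\<close>

definition (in path_basis) estep ::
  "('v, 'b) qpath \<Rightarrow> ('v, 'b) qpath \<Rightarrow> 'b list \<Rightarrow> 'b \<Rightarrow> ('v, 'b) qpath \<Rightarrow>
    ('v, 'b) qpath + ('v, 'b) qpath \<Rightarrow> 'b \<Rightarrow> (('v, 'b) qpath + ('v, 'b) qpath) option" where
  "estep p q q0 \<delta> z e \<beta> = (case e of
     Inl x \<Rightarrow> map_option Inl (pstep (sufs p) x \<beta>)
   | Inr x \<Rightarrow> if \<beta> = \<delta> \<and> snd x = q0 then Some (Inl z) else map_option Inr (pstep (sufs q) x \<beta>))"

text \<open>The path \<open>w @ \<delta> # q0\<close> realises the gluing: it starts like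
  \<open>p\<close>, crosses by \<open>\<delta>\<close> and ends like \<open>q\<close>, and as it is
  nonzero the crossing violates no relation. By \<open>q_branch\<close> the arrow
  \<open>\<delta>\<close> does not already act at \<open>q0\<close> inside the module of
  \<open>q\<close>; \<open>p_branch\<close> prevents the extension from splitting.\<close>

locale path_extension = path_basis sc Q R bs co
  for sc :: "'k :: alg_closed_field \<Rightarrow> 'a :: ring_1 \<Rightarrow> 'a" and Q :: "('v, 'b) pre_digraph" and R bs co +
  fixes p q :: "('v, 'b) qpath" and q0 w p' :: "'b list" and \<delta> :: 'b and z :: "('v, 'b) qpath"
  assumes p: "p \<in> N" and q: "q \<in> N" and q0: "suffix q0 (snd q)" and p': "snd p = w @ p'"
    and z_def: "z = (tail Q \<delta>, p')"
    and \<kappa>: "(fst p, w @ \<delta> # q0) \<in> N" "awlast (fst p) (w @ \<delta> # q0) = path_end Q q"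
    and q_branch: "\<not> suffix (\<delta> # q0) (snd q)" and p_branch: "\<not> prefix (\<delta> # q0) p'"
begin

abbreviation "st \<equiv> estep p q q0 \<delta> z"
abbreviation "ve \<equiv> case_sum fst fst :: ('v, 'b) qpath + ('v, 'b) qpath \<Rightarrow> 'v"
abbreviation "ps \<equiv> enum_list (sufs p)"
abbreviation "qs \<equiv> enum_list (sufs q)"
abbreviation "es \<equiv> map Inl ps @ map Inr qs"

lemmas Tp = rooted_sufs[OF p] and Tq = rooted_sufs[OF q]
lemmas ep = enum_list[OF rooted_finite[OF Tp(1)]] and eq = enum_list[OF rooted_finite[OF Tq(1)]]

lemma set_es: "set es = Inl ` sufs p \<union> Inr ` sufs q" by (simp add: ep eq)

lemma distinct_es: "distinct es"
  using ep(1) eq(1) by (auto simp: distinct_map inj_on_def)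

lemma \<kappa>_walk: "awalk (fst p) w (tail Q \<delta>)" "\<delta> \<in> arcs Q" "awalk (head Q \<delta>) q0 (path_end Q q)"
  using qpaths_awalk[OF nonzero_pathsD(1)[OF \<kappa>(1)]] awalk_awlast \<kappa>(2) by (auto simp: awalk_Cons_iff)

lemma z_in: "z \<in> sufs p"
proof -
  have "awalk (fst p) (w @ p') (path_end Q p)" using qpaths_awalk[OF nonzero_pathsD(1)[OF p]] by (simp add: p')
  then have "awalk (awlast (fst p) w) p' (path_end Q p)" by simp
  then have a: "awalk (tail Q \<delta>) p' (path_end Q p)" using awalk_awlast[OF \<kappa>_walk(1)] by simp
  then show ?thesis using awalk_awlast[OF a] p' by (auto simp: z_def sufs_def qpaths_def suffix_def)
qed

lemma q0_vertex:
  assumes "x \<in> sufs q" "snd x = q0"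
  shows "fst x = head Q \<delta>"
proof -
  have "(fst x, snd x) \<in> sufs q" using assms(1) by simp
  from rooted_awalk[OF Tq(1) this] have "awalk (fst x) q0 (path_end Q q)" unfolding assms(2) .
  then show ?thesis by (rule awalk_start_unique[OF _ \<kappa>_walk(3)])
qed

lemma q_not_step: "x \<in> sufs q \<Longrightarrow> snd x = q0 \<Longrightarrow> pstep (sufs q) x \<delta> = None"
  using q_branch by (auto simp: pstep_def sufs_def)

lemma run_Inl: "run st (Inl x) l = map_option Inl (run (pstep (sufs p)) x l)"
proof (induction l)
  case (Cons \<beta> l)
  then show ?case by (cases "run (pstep (sufs p)) x l") (simp_all add: estep_def)
qed simp

lemma run_Inr:
  assumes x: "x \<in> sufs q" and r: "run st (Inr x) l = Some e"
  shows "(\<exists>y. e = Inr y \<and> run (pstep (sufs q)) x l = Some y) \<or>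
    (\<exists>y l1 l2. e = Inl y \<and> l = l2 @ \<delta> # l1 \<and> l1 @ snd x = q0 \<and> run (pstep (sufs p)) z l2 = Some y)"
  using r
proof (induction l arbitrary: e)
  case (Cons \<beta> l)
  then obtain f where f: "run st (Inr x) l = Some f" "st f \<beta> = Some e" by (auto simp: bind_eq_Some_conv)
  from Cons.IH[OF f(1)] show ?case
  proof (elim disjE exE conjE)
    fix y assume y: "f = Inr y" "run (pstep (sufs q)) x l = Some y"
    from prun_result[OF Tq(1) x y(2)] have yl: "snd y = l @ snd x" by simp
    show ?thesis
    proof (cases "\<beta> = \<delta> \<and> snd y = q0")
      case True
      then have "e = Inl z" using f(2) y(1) by (simp add: estep_def)
      then show ?thesis using True yl by (intro disjI2 exI[of _ z] exI[of _ l] exI[of _ "[]"]) simp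
    next
      case False
      then show ?thesis using f(2) y by (auto simp: estep_def)
    qed
  next
    fix y l1 l2 assume y: "f = Inl y" "l = l2 @ \<delta> # l1" "l1 @ snd x = q0" "run (pstep (sufs p)) z l2 = Some y"
    with f(2) obtain y' where "e = Inl y'" "pstep (sufs p) y \<beta> = Some y'" by (auto simp: estep_def)
    with y show ?thesis by (intro disjI2 exI[of _ y'] exI[of _ l1] exI[of _ "\<beta> # l2"]) simp
  qed
qed simp

lemma run_Inr_Inr: "x \<in> sufs q \<Longrightarrow> run (pstep (sufs q)) x l = Some y \<Longrightarrow> run st (Inr x) l = Some (Inr y)"
proof (induction l arbitrary: y)
  case (Cons \<beta> l)
  then obtain f where f: "run (pstep (sufs q)) x l = Some f" "pstep (sufs q) f \<beta> = Some y" by (auto simp: bind_eq_Some_conv)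
  have "\<not> (\<beta> = \<delta> \<and> snd f = q0)" using q_not_step[of f] f(2) prun_result[OF Tq(1) Cons.prems(1) f(1)] by auto
  then have "st (Inr f) \<beta> = Some (Inr y)" using f(2) by (simp add: estep_def)
  then show ?case using Cons.IH[OF Cons.prems(1) f(1)] by simp
qed simp

lemma system: "step_system es ve st"
  unfolding step_system_def set_es
proof (intro conjI ballI allI impI distinct_es)
  fix e assume e: "e \<in> Inl ` sufs p \<union> Inr ` sufs q"
  note Sp = rooted_step_system[OF Tp(1), unfolded step_system_def ep(2)]
    and Sq = rooted_step_system[OF Tq(1), unfolded step_system_def eq(2)]
  have Sp': "y \<in> sufs p \<and> \<beta> \<in> arcs Q \<and> head Q \<beta> = fst x \<and> tail Q \<beta> = fst y"
    if "x \<in> sufs p" "pstep (sufs p) x \<beta> = Some y" for x y \<beta> using Sp that by blast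
  have Sq': "y \<in> sufs q \<and> \<beta> \<in> arcs Q \<and> head Q \<beta> = fst x \<and> tail Q \<beta> = fst y"
    if "x \<in> sufs q" "pstep (sufs q) x \<beta> = Some y" for x y \<beta> using Sq that by blast
  show "ve e \<in> verts Q" using e Sp Sq by auto
  show "\<not> contains_relation R l" if r: "run st e l = Some f" for l f
  proof (cases e)
    case (Inl x)
    then show ?thesis using e r Sp by (auto simp: run_Inl)
  next
    case (Inr x)
    then have x: "x \<in> sufs q" using e by auto
    from run_Inr[OF x r[unfolded Inr]] show ?thesis
    proof (elim disjE exE conjE)
      fix y assume "run (pstep (sufs q)) x l = Some y"
      then show ?thesis using Sq x by blast
    next
      fix y l1 l2 assume y: "l = l2 @ \<delta> # l1" "l1 @ snd x = q0" "run (pstep (sufs p)) z l2 = Some y"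
      from prun_result[OF Tp(1) z_in y(3)] have "snd y = l2 @ p'" "y \<in> sufs p" by (auto simp: z_def)
      \<comment> \<open>After the crossing the run follows \<open>w\<close> backwards, so the whole
        list \<open>l\<close> is part of the nonzero path \<open>w @ \<delta> # q0\<close>.\<close>
      then have "suffix (l2 @ p') (w @ p')" by (simp add: sufs_def p')
      then obtain k where "w = k @ l2" by (auto simp: suffix_def)
      then have "w @ \<delta> # q0 = k @ l @ snd x" using y by simp
      then show ?thesis using nonzero_pathsD(2)[OF \<kappa>(1)] contains_relation_append[of R l k "snd x"] by auto
    qed
  qed
  fix \<beta> f assume f: "st e \<beta> = Some f"
  have "f \<in> Inl ` sufs p \<union> Inr ` sufs q \<and> \<beta> \<in> arcs Q \<and> head Q \<beta> = ve e \<and> tail Q \<beta> = ve f"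
  proof (cases e)
    case (Inl x)
    then obtain y where y: "f = Inl y" "pstep (sufs p) x \<beta> = Some y" "x \<in> sufs p" using e f by (auto simp: estep_def)
    from Sp'[OF y(3,2)] show ?thesis unfolding y(1) Inl by simp
  next
    case (Inr x)
    then have x: "x \<in> sufs q" using e by auto
    show ?thesis
    proof (cases "\<beta> = \<delta> \<and> snd x = q0")
      case True
      then have "f = Inl z" using f Inr by (simp add: estep_def)
      then show ?thesis using True q0_vertex[OF x] z_in \<kappa>_walk(2) Inr by (simp add: z_def)
    next
      case False
      then obtain y where y: "f = Inr y" "pstep (sufs q) x \<beta> = Some y" using f Inr by (auto simp: estep_def)
      from Sq'[OF x y(2)] show ?thesis unfolding y(1) Inr by simp
    qed
  qed
  then show "f \<in> Inl ` sufs p \<union> Inr ` sufs q" "\<beta> \<in> arcs Q" "head Q \<beta> = ve e" "tail Q \<beta> = ve f" by blast+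
qed

abbreviation "E \<equiv> smod es ve st"
abbreviation "F \<equiv> kmat es ps (\<lambda>e x. if e = Inl x then 1 else 0 :: 'k)"
abbreviation "G \<equiv> kmat qs es (\<lambda>y e. if e = Inr y then 1 else 0 :: 'k)"
abbreviation "Rt \<equiv> kmat ps es (\<lambda>x e. if e = Inl x then 1 else 0 :: 'k)"
abbreviation "St \<equiv> kmat es qs (\<lambda>e y. if e = Inr y then 1 else 0 :: 'k)"

lemmas Sp = rooted_step_system[OF Tp(1)] and Sq = rooted_step_system[OF Tq(1)]

lemma sum_Inl:
  fixes g :: "_ \<Rightarrow> 'k"
  assumes "x \<in> sufs p"
  shows "(\<Sum>e\<in>set es. if e = Inl x then g e else 0) = g (Inl x)"
proof -
  have "Inl x \<in> set es" using assms by (simp add: ep(2))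
  then show ?thesis unfolding sum.delta[OF finite_set] by (rule if_P)
qed

lemma F_hom: "F \<in> mhom (pmod (sufs p)) E"
proof (rule smod_homI[OF Sp system], unfold ep(2))
  fix r x e assume r: "r \<in> N" and x: "x \<in> sufs p"
  have "act ve st (Inl x) r = map_option Inl (act fst (pstep (sufs p)) x r)" by (simp add: act_def run_Inl)
  moreover have "(\<Sum>y\<in>set es. (if act ve st y r = Some e then 1 else 0) * (if y = Inl x then 1 else 0 :: 'k))
      = (if act ve st (Inl x) r = Some e then 1 else 0)"
  proof -
    have "(\<Sum>y\<in>set es. (if act ve st y r = Some e then 1 else 0) * (if y = Inl x then 1 else 0 :: 'k))
      = (\<Sum>y\<in>set es. if y = Inl x then (if act ve st y r = Some e then 1 else 0) else 0)"
      by (intro sum.cong refl) auto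
    then show ?thesis by (simp only: sum_Inl[OF x])
  qed
  ultimately show "(case act fst (pstep (sufs p)) x r of None \<Rightarrow> 0 | Some y \<Rightarrow> if e = Inl y then 1 else 0) =
      (\<Sum>y\<in>set es. (if act ve st y r = Some e then 1 else 0) * (if y = Inl x then 1 else 0 :: 'k))"
    by (cases "act fst (pstep (sufs p)) x r") (auto simp del: set_append)
qed

lemma G_hom: "G \<in> mhom E (pmod (sufs q))"
proof (rule smod_homI[OF system Sq], unfold eq(2))
  fix r e y assume r: "r \<in> N" and e: "e \<in> set es" and y: "y \<in> sufs q"
  show "(case act ve st e r of None \<Rightarrow> 0 | Some f \<Rightarrow> if f = Inr y then 1 else 0) =
      (\<Sum>x\<in>sufs q. (if act fst (pstep (sufs q)) x r = Some y then 1 else 0) * (if e = Inr x then 1 else 0 :: 'k))"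
  proof (cases e)
    case (Inl x)
    then have "act ve st e r = map_option Inl (act fst (pstep (sufs p)) x r)" by (simp add: act_def run_Inl)
    then show ?thesis using Inl by (cases "act fst (pstep (sufs p)) x r") simp_all
  next
    case (Inr x)
    then have x: "x \<in> sufs q" using e by (auto simp: ep(2) eq(2))
    have "act ve st e r = Some (Inr y) \<longleftrightarrow> act fst (pstep (sufs q)) x r = Some y"
      using run_Inr[OF x, of "snd r" "Inr y"] run_Inr_Inr[OF x, of "snd r" y] Inr by (auto simp: act_def)
    moreover have "(\<Sum>x'\<in>sufs q. (if act fst (pstep (sufs q)) x' r = Some y then 1 else 0) * (if e = Inr x' then 1 else 0 :: 'k))
       = (\<Sum>x'\<in>sufs q. if x' = x then (if act fst (pstep (sufs q)) x' r = Some y then 1 else 0) else 0)"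
      using Inr by (intro sum.cong refl) auto
    ultimately show ?thesis using x rooted_finite[OF Tq(1)] by (cases "act ve st e r") auto
  qed
qed

lemma RF: "Rt * F = 1\<^sub>m (mdim (pmod (sufs p)))"
proof -
  have "(\<Sum>e\<in>set es. (if e = Inl y then 1 else 0) * (if e = Inl x then 1 else 0 :: 'k)) = (if y = x then 1 else 0)"
    if "x \<in> sufs p" for x y
  proof -
    have "(\<Sum>e\<in>set es. (if e = Inl y then 1 else 0) * (if e = Inl x then 1 else 0 :: 'k)) =
        (\<Sum>e\<in>set es. if e = Inl x then (if y = x then 1 else 0) else 0)"
      by (intro sum.cong refl) auto
    then show ?thesis by (simp only: sum_Inl[OF that])
  qed
  then show ?thesis unfolding smod_dim kmat_mult[OF distinct_es]
    by (subst kmat_one[OF ep(1), symmetric]) (rule kmat_cong, simp add: ep(2))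
qed

lemma exact: "F * Rt + St * G = 1\<^sub>m (mdim E)"
proof -
  have "(\<Sum>x\<in>sufs p. (if e = Inl x then 1 else 0) * (if f = Inl x then 1 else 0)) +
      (\<Sum>y\<in>sufs q. (if e = Inr y then 1 else 0) * (if f = Inr y then 1 else 0)) = (if e = f then 1 else 0 :: 'k)"
    if "f \<in> set es" for e f
  proof (cases f)
    case (Inl x)
    then have "(\<Sum>x'\<in>sufs p. (if e = Inl x' then 1 else 0) * (if f = Inl x' then 1 else 0 :: 'k)) =
      (\<Sum>x'\<in>sufs p. if x' = x then (if e = f then 1 else 0) else 0)" by (intro sum.cong refl) auto
    then show ?thesis using Inl that rooted_finite[OF Tp(1)] by (auto simp: ep(2) eq(2))
  next
    case (Inr y)
    then have "(\<Sum>x'\<in>sufs q. (if e = Inr x' then 1 else 0) * (if f = Inr x' then 1 else 0 :: 'k)) =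
      (\<Sum>x'\<in>sufs q. if x' = y then (if e = f then 1 else 0) else 0)" by (intro sum.cong refl) auto
    then show ?thesis using Inr that rooted_finite[OF Tq(1)] by (auto simp: ep(2) eq(2))
  qed
  then show ?thesis unfolding smod_dim kmat_mult[OF ep(1)] kmat_mult[OF eq(1)] kmat_add
    by (subst kmat_one[OF distinct_es, symmetric]) (rule kmat_cong, simp add: ep(2) eq(2))
qed

text \<open>The path \<open>\<delta> # q0\<close> leads from the top of the quotient to
  \<open>z\<close>. A retraction would send that top to a combination of basis elements of the
  submodule, from one of which the same path leads to \<open>z\<close>; this is what
  \<open>p_branch\<close> excludes.\<close>

lemma not_split: "\<not> split_mono (pmod (sufs p)) E F"
proof
  assume "split_mono (pmod (sufs p)) E F"
  then obtain H where H: "H \<in> mhom E (pmod (sufs p))" "H * F = 1\<^sub>m (mdim (pmod (sufs p)))"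
    unfolding split_mono_def by (elim conjE bexE) (rule that; assumption)
  have Hc: "H \<in> carrier_mat (length ps) (length es)" by (rule carrier_matI) (simp_all add: mhom_dims[OF H(1)])
  obtain K where K: "H = kmat ps es K" by (rule kmat_exhaust[OF Hc ep(1) distinct_es])
  have "kmat ps ps (\<lambda>y x. \<Sum>e\<in>set es. K y e * (if e = Inl x then 1 else 0)) = kmat ps ps (\<lambda>y x. if y = x then 1 else 0)"
    using H(2) unfolding K kmat_mult[OF distinct_es] smod_dim kmat_one[OF ep(1)] .
  from kmat_eqD[OF this, of z z] have "(\<Sum>e\<in>set es. K z e * (if e = Inl z then 1 else 0)) = 1"
    using z_in by (simp add: ep(2))
  also have "(\<Sum>e\<in>set es. K z e * (if e = Inl z then 1 else 0)) = (\<Sum>e\<in>set es. if e = Inl z then K z e else 0)"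
    by (intro sum.cong refl) simp
  finally have Kz: "K z (Inl z) = 1" by (simp only: sum_Inl[OF z_in])
  let ?t = "(path_end Q q, [])" and ?r = "(tail Q \<delta>, \<delta> # q0)"
  have rw: "awalk (tail Q \<delta>) (\<delta> # q0) (path_end Q q)" using \<kappa>_walk by (simp add: awalk_Cons_iff)
  then have r: "?r \<in> qpaths Q" "path_end Q ?r = path_end Q q" using awalk_awlast[OF rw] by (auto simp: qpaths_def)
  have t: "?t \<in> sufs q" using Tq(1) by (simp add: rooted_def)
  have h0: "(head Q \<delta>, q0) \<in> sufs q"
    using \<kappa>_walk(3) awalk_awlast[OF \<kappa>_walk(3)] q0 by (auto simp: sufs_def qpaths_def)
  have "run (pstep (sufs q)) ?t q0 = Some (head Q \<delta>, q0)"
    using prun[OF Tq(1) t, of "head Q \<delta>" q0] h0 by simp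
  from run_Inr_Inr[OF t this] have "run st (Inr ?t) (\<delta> # q0) = Some (Inl z)" by (simp add: estep_def)
  then have a: "act ve st (Inr ?t) ?r = Some (Inl z)" using r(2) by (simp add: act_def)
  have none: "act fst (pstep (sufs p)) y ?r \<noteq> Some z" if y: "y \<in> sufs p" for y
  proof
    assume "act fst (pstep (sufs p)) y ?r = Some z"
    then have "run (pstep (sufs p)) y (\<delta> # q0) = Some z" by (simp add: act_def split: if_splits)
    from prun_result[OF Tp(1) y this] have "p' = (\<delta> # q0) @ snd y" by (simp add: z_def)
    then show False using p_branch by (auto simp: prefix_def)
  qed
  have "K z (Inl z) = (\<Sum>y\<in>sufs p. (if act fst (pstep (sufs p)) y ?r = Some z then 1 else 0) * K y (Inr ?t))"
    using smod_homD[OF system Sp H(1)[unfolded K] r(1), of "Inr ?t" z, unfolded ep(2)] t z_in a by (simp add: ep(2) eq(2))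
  also have "\<dots> = 0" by (intro sum.neutral ballI) (simp add: none)
  finally show False using Kz by simp
qed

end

context path_basis begin

lemma path_extension_walk:
  assumes dir: "directed_modules sc"
    and pN: "(u, w @ p') \<in> N" "indecomposable sc (pmod (sufs (u, w @ p')))"
    and qN: "q \<in> N" "indecomposable sc (pmod (sufs q))"
    and q0: "suffix q0 (snd q)" and \<kappa>: "(u, w @ \<delta> # q0) \<in> N" "awlast u (w @ \<delta> # q0) = path_end Q q"
    and br: "\<not> suffix (\<delta> # q0) (snd q)" "\<not> prefix (\<delta> # q0) p'"
  shows "\<exists>n\<ge>1. AR_walk sc (pmod (sufs (u, w @ p'))) (pmod (sufs q)) n"
proof -
  interpret directed_modules sc by (rule dir)
  interpret path_extension sc Q R bs co "(u, w @ p')" q q0 w p' \<delta> "(tail Q \<delta>, p')"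
    by unfold_locales (use assms in auto)
  show ?thesis
    by (rule extension_walk[OF pN(2) smod_right_module[OF system] qN(2) F_hom G_hom _ _ RF exact not_split])
      (unfold smod_dim, rule kmat_carrier, rule kmat_carrier)
qed

end

section \<open>Acyclicity of the quiver and its consequences\<close>

locale directed_path_basis = path_basis sc Q R bs co + directed_modules sc
  for sc :: "'k :: alg_closed_field \<Rightarrow> 'a :: ring_1 \<Rightarrow> 'a" and Q :: "('v, 'b) pre_digraph" and R bs co
begin

lemma simple_indecomposable:
  assumes "v \<in> verts Q"
  shows "indecomposable sc (pmod (sufs (v, [])))"
proof -
  note p = trivial_path[OF assms]
  have "rooted (sufs (v, [])) v" using rooted_sufs(1)[OF p] by simp
  then show ?thesis by (rule pmod_indecomposable) (auto simp: sufs_def)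
qed

text \<open>The instance with trivial \<open>p\<close>, \<open>q\<close>, \<open>w\<close> and
  \<open>q0\<close>: an arrow glues the simple modules at its two ends to a non-split
  extension.\<close>

lemma arrow_simple_walk:
  assumes b: "\<beta> \<in> arcs Q"
  shows "\<exists>n\<ge>1. AR_walk sc (pmod (sufs (tail Q \<beta>, []))) (pmod (sufs (head Q \<beta>, []))) n"
proof -
  note t = tail_in_verts[OF b] and h = head_in_verts[OF b]
  have "\<exists>n\<ge>1. AR_walk sc (pmod (sufs (tail Q \<beta>, [] @ []))) (pmod (sufs (head Q \<beta>, []))) n"
    by (rule path_extension_walk[where \<delta> = \<beta> and ?q0.0 = "[]"])
      (use trivial_path[OF t] trivial_path[OF h] simple_indecomposable[OF t] simple_indecomposable[OF h] arrow_path[OF b]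
        in \<open>simp_all add: directed_modules_axioms\<close>)
  then show ?thesis by simp
qed

lemma path_simple_walk:
  assumes "awalk u l v" "l \<noteq> []"
  shows "\<exists>n\<ge>1. AR_walk sc (pmod (sufs (u, []))) (pmod (sufs (v, []))) n"
  using assms
proof (induction l arbitrary: u)
  case (Cons \<beta> l)
  then have b: "\<beta> \<in> arcs Q" "tail Q \<beta> = u" "awalk (head Q \<beta>) l v" by (auto simp: awalk_Cons_iff)
  from arrow_simple_walk[OF b(1)] b(2) obtain n where n: "n \<ge> 1" "AR_walk sc (pmod (sufs (u, []))) (pmod (sufs (head Q \<beta>, []))) n" by auto
  show ?case
  proof (cases "l = []")
    case True
    then show ?thesis using n b(3) by (auto simp: awalk_Nil_iff)
  next
    case False
    from Cons.IH[OF b(3) False] obtain m where "AR_walk sc (pmod (sufs (head Q \<beta>, []))) (pmod (sufs (v, []))) m" by blast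
    from AR_walk_trans[OF n(2) this] n(1) show ?thesis by (intro exI[of _ "n + m"]) simp
  qed
qed simp

lemma acyclic: "awalk u l u \<Longrightarrow> l = []"
  using path_simple_walk[of u l u] AR_walk_closed[OF simple_indecomposable[of u]] awalk_hd_in_verts[of u l u] by fastforce

lemma rooted_indecomposable:
  assumes T: "rooted T a"
  shows "indecomposable sc (pmod T)"
proof (rule pmod_indecomposable[OF T])
  fix p assume p: "p \<in> T" "fst p = a"
  have "(fst p, snd p) \<in> T" using p(1) by simp
  from rooted_awalk[OF T this] p(2) have "snd p = []" using acyclic by blast
  then show "p = (a, [])" using p(2) by (simp add: prod_eq_iff)
qed

lemma injective_indecomposable:
  assumes a: "a \<in> verts Q"
  shows "indecomposable sc (imod a)"
proof (rule imod_indecomposable[OF a])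
  fix p assume p: "p \<in> ipaths a" "path_end Q p = a"
  have pa: "p \<in> N" "fst p = a" using p(1) by (simp_all add: ipaths_def)
  from qpaths_awalk[OF nonzero_pathsD(1)[OF pa(1)]] have "awalk (fst p) (snd p) a" unfolding p(2) .
  then have "snd p = []" using acyclic unfolding pa(2) by blast
  then show "p = (a, [])" using pa(2) by (simp add: prod_eq_iff)
qed

end

section \<open>Morphisms out of projectives and into injectives\<close>

context path_basis begin

lemma mact_zero:
  assumes M: "right_module sc M"
  shows "mact M 0 = 0\<^sub>m (mdim M) (mdim M)"
proof -
  have "mact M 0 = mact M (sc 0 0)" by (simp add: scale_zero_left)
  also have "\<dots> = 0 \<cdot>\<^sub>m mact M 0" by (rule mact_simps(2)[OF M])
  also have "\<dots> = 0\<^sub>m (mdim M) (mdim M)" by (rule eq_matI) (simp_all add: mact_dims[OF M])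
  finally show ?thesis .
qed

lemma mact_bs_mult:
  assumes M: "right_module sc M" and pq: "p \<in> qpaths Q" "q \<in> qpaths Q"
  shows "mact M (bs q) * mact M (bs p) =
    (if path_end Q q = fst p then mact M (bs (fst q, snd q @ snd p)) else 0\<^sub>m (mdim M) (mdim M))"
  unfolding mact_simps(3)[OF M, symmetric] bs_mult[OF pq] by (simp add: mact_zero[OF M])

lemma qpaths_compose:
  assumes "p \<in> qpaths Q" "q \<in> qpaths Q" "path_end Q q = fst p"
  shows "(fst q, snd q @ snd p) \<in> qpaths Q" "path_end Q (fst q, snd q @ snd p) = path_end Q p"
proof -
  have "awalk (fst q) (snd q @ snd p) (path_end Q p)"
    using qpaths_awalk[OF assms(1)] qpaths_awalk[OF assms(2)] assms(3) by (intro awalk_appendI[of _ _ "fst p"]) simp_all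
  then show "(fst q, snd q @ snd p) \<in> qpaths Q" "path_end Q (fst q, snd q @ snd p) = path_end Q p"
    using awalk_awlast by (auto simp: qpaths_def)
qed

lemma finite_ppaths: "finite (ppaths a)" using finite_nonzero_paths by (simp add: ppaths_def)

abbreviation "proj a \<equiv> pmod (ppaths a)"

text \<open>The morphism \<open>P\<^sub>a \<rightarrow> M\<close> with value \<open>V e\<^sub>a\<close> at the generator, for a column vector \<open>V\<close>, and dually the
  morphism \<open>M \<rightarrow> I\<^sub>a\<close> given by a linear form \<open>W\<close>.\<close>

definition yon :: "('a, 'k) rmod \<Rightarrow> 'v \<Rightarrow> 'k mat \<Rightarrow> 'k mat" where
  "yon M a V = kmat [0..<mdim M] (enum_list (ppaths a)) (\<lambda>i x. (mact M (bs x) * V) $$ (i,0))"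

definition coyon :: "('a, 'k) rmod \<Rightarrow> 'v \<Rightarrow> 'k mat \<Rightarrow> 'k mat" where
  "coyon M a W = kmat (enum_list (ipaths a)) [0..<mdim M] (\<lambda>y j. (W * mact M (bs y)) $$ (0,j))"

lemma mact_kmat_mult:
  assumes M: "right_module sc M" and V: "dim_row V = mdim M" "dim_col V = 1"
  shows "mact M a * kmat [0..<mdim M] xs (\<lambda>i x. (mact M (f x) * V) $$ (i,0)) =
    kmat [0..<mdim M] xs (\<lambda>i x. (mact M a * (mact M (f x) * V)) $$ (i,0))"
proof -
  note d = mact_dims[OF M]
  have "mact M a * kmat [0..<mdim M] xs (\<lambda>i x. (mact M (f x) * V) $$ (i,0)) =
      kmat [0..<mdim M] [0..<mdim M] (\<lambda>i j. mact M a $$ (i,j)) * kmat [0..<mdim M] xs (\<lambda>i x. (mact M (f x) * V) $$ (i,0))"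
    using mat_as_kmat[of "mact M a" "mdim M" "mdim M"] d by simp
  also have "\<dots> = kmat [0..<mdim M] xs (\<lambda>i x. \<Sum>k\<in>set [0..<mdim M]. mact M a $$ (i,k) * (mact M (f x) * V) $$ (k,0))"
    by (rule kmat_mult) simp
  also have "\<dots> = kmat [0..<mdim M] xs (\<lambda>i x. (mact M a * (mact M (f x) * V)) $$ (i,0))"
    by (rule kmat_cong) (simp add: index_mult_mat(1)[of _ "mact M a"] scalar_prod_def[of "row (mact M a) _"] V d del: index_mult_mat(1))
  finally show ?thesis .
qed

lemma act_ppaths:
  assumes a: "a \<in> verts Q" and x: "x \<in> ppaths a" and p: "p \<in> qpaths Q"
  shows "act fst (pstep (ppaths a)) x p =
    (if path_end Q p = fst x \<and> (fst p, snd p @ snd x) \<in> N then Some (fst p, snd p @ snd x) else None)"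
proof -
  note T = rooted_ppaths[OF a]
  have xq: "x \<in> qpaths Q" "path_end Q x = a" using x nonzero_pathsD(1) by (auto simp: ppaths_def)
  show ?thesis
  proof (cases "path_end Q p = fst x \<and> (fst p, snd p @ snd x) \<in> N")
    case True
    then have "(fst p, snd p @ snd x) \<in> ppaths a" using qpaths_compose(2)[OF xq(1) p] xq(2) by (simp add: ppaths_def)
    then show ?thesis using prun[OF T, of "fst x" "snd x" "fst p" "snd p"] x True by (simp add: act_def)
  next
    case False
    have "act fst (pstep (ppaths a)) x p = None"
    proof (cases "act fst (pstep (ppaths a)) x p")
      case (Some y)
      then have r: "path_end Q p = fst x" "run (pstep (ppaths a)) x (snd p) = Some y" by (auto simp: act_def split: if_splits)
      have "x \<in> set (enum_list (ppaths a))" using x by (simp add: enum_list finite_ppaths)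
      from act_awalk(2)[OF rooted_step_system[OF T] this p Some] prun_result[OF T x r(2)]
      have "y = (fst p, snd p @ snd x)" "y \<in> N" by (auto simp: ppaths_def prod_eq_iff)
      with r(1) False show ?thesis by simp
    qed
    with False show ?thesis by auto
  qed
qed

lemma yon_hom:
  assumes M: "right_module sc M" and a: "a \<in> verts Q" and V: "V \<in> carrier_mat (mdim M) 1"
  shows "yon M a V \<in> mhom (proj a) M"
proof -
  note S = rooted_step_system[OF rooted_ppaths[OF a]] and e = enum_list[OF finite_ppaths[of a]] and d = mact_dims[OF M]
  have dV: "dim_row V = mdim M" "dim_col V = 1" using V by auto
  show ?thesis
  proof (rule mhom_pathsI[OF smod_right_module[OF S] M])
    fix p assume "p \<in> N"
    then have p: "p \<in> qpaths Q" by (rule nonzero_pathsD)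
    show "yon M a V * mact (proj a) (bs p) = mact M (bs p) * yon M a V"
      unfolding yon_def mact_kmat_mult[OF M dV] smod_act[OF S p] kmat_mult[OF e(1)] e(2)
    proof (rule kmat_cong, unfold e(2))
      fix i x assume i: "i \<in> set [0..<mdim M]" and x: "x \<in> ppaths a"
      have xq: "x \<in> qpaths Q" "path_end Q x = a" using x nonzero_pathsD(1) by (auto simp: ppaths_def)
      have "(\<Sum>y\<in>ppaths a. (mact M (bs y) * V) $$ (i,0) * (if act fst (pstep (ppaths a)) x p = Some y then 1 else 0)) =
          (case act fst (pstep (ppaths a)) x p of None \<Rightarrow> 0 | Some y \<Rightarrow> (mact M (bs y) * V) $$ (i,0))"
        using act_awalk(1)[OF S _ p, of x] x by (intro sum_option_bind(1) finite_ppaths) (simp add: e(2))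
      also have "\<dots> = (mact M (bs p) * mact M (bs x) * V) $$ (i,0)"
      proof (cases "path_end Q p = fst x \<and> (fst p, snd p @ snd x) \<in> N")
        case True
        then show ?thesis unfolding act_ppaths[OF a x p] mact_bs_mult[OF M xq(1) p] by simp
      next
        case False
        have z: "mact M (bs p) * mact M (bs x) = 0\<^sub>m (mdim M) (mdim M)"
        proof (cases "path_end Q p = fst x")
          case True
          with False have "bs (fst p, snd p @ snd x) = 0"
            using qpaths_compose(1)[OF xq(1) p True] by (intro bs_zero) (auto simp: nonzero_paths_def)
          then show ?thesis unfolding mact_bs_mult[OF M xq(1) p] by (simp add: True mact_zero[OF M])
        qed (simp add: mact_bs_mult[OF M xq(1) p])
        have "(0\<^sub>m (mdim M) (mdim M) * V) $$ (i,0) = 0" using i dV by (subst mult_mat_zero_left) simp_all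
        then show ?thesis unfolding act_ppaths[OF a x p] z using False by auto
      qed
      also have "mact M (bs p) * mact M (bs x) * V = mact M (bs p) * (mact M (bs x) * V)"
        by (rule mult_mat_assoc) (simp_all add: d dV)
      finally show "(\<Sum>y\<in>ppaths a. (mact M (bs y) * V) $$ (i,0) * (if act fst (pstep (ppaths a)) x p = Some y then 1 else 0)) =
        (mact M (bs p) * (mact M (bs x) * V)) $$ (i,0)" .
    qed
  qed (simp_all add: yon_def)
qed

lemma kmat_mact_mult:
  assumes M: "right_module sc M" and W: "dim_row W = 1" "dim_col W = mdim M"
  shows "kmat ys [0..<mdim M] (\<lambda>y j. (W * mact M (f y)) $$ (0,j)) * mact M a =
    kmat ys [0..<mdim M] (\<lambda>y j. (W * mact M (f y) * mact M a) $$ (0,j))"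
proof -
  note d = mact_dims[OF M]
  have "kmat ys [0..<mdim M] (\<lambda>y j. (W * mact M (f y)) $$ (0,j)) * mact M a =
      kmat ys [0..<mdim M] (\<lambda>y j. (W * mact M (f y)) $$ (0,j)) * kmat [0..<mdim M] [0..<mdim M] (\<lambda>i j. mact M a $$ (i,j))"
    using mat_as_kmat[of "mact M a" "mdim M" "mdim M"] d by simp
  also have "\<dots> = kmat ys [0..<mdim M] (\<lambda>y j. \<Sum>k\<in>set [0..<mdim M]. (W * mact M (f y)) $$ (0,k) * mact M a $$ (k,j))"
    by (rule kmat_mult) simp
  also have "\<dots> = kmat ys [0..<mdim M] (\<lambda>y j. (W * mact M (f y) * mact M a) $$ (0,j))"
    by (rule kmat_cong) (simp add: W d scalar_prod_def)
  finally show ?thesis .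
qed

lemma coyon_hom:
  assumes M: "right_module sc M" and a: "a \<in> verts Q" and W: "W \<in> carrier_mat 1 (mdim M)"
  shows "coyon M a W \<in> mhom M (imod a)"
proof -
  note S = imod_step_system[of a] and e = enum_list[OF finite_ipaths[of a]] and d = mact_dims[OF M]
  have dW: "dim_row W = 1" "dim_col W = mdim M" using W by auto
  show ?thesis
  proof (rule mhom_pathsI[OF M smod_right_module[OF S]])
    fix p assume "p \<in> N"
    then have p: "p \<in> qpaths Q" by (rule nonzero_pathsD)
    show "coyon M a W * mact M (bs p) = mact (imod a) (bs p) * coyon M a W"
      unfolding coyon_def kmat_mact_mult[OF M dW] smod_act[OF S p] kmat_mult[OF e(1)] e(2)
    proof (rule kmat_cong, unfold e(2))
      fix y j assume y: "y \<in> ipaths a" and j: "j \<in> set [0..<mdim M]"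
      have yq: "y \<in> qpaths Q" "fst y = a" using y nonzero_pathsD(1) by (auto simp: ipaths_def)
      \<comment> \<open>The only path that can be cut down to \<open>y\<close> by \<open>p\<close>:
        first \<open>y\<close>, then \<open>p\<close>.\<close>
      let ?z = "(fst y, snd y @ snd p)"
      have az: "act (path_end Q) istep z p = Some y \<longleftrightarrow> z = ?z \<and> path_end Q y = fst p" if z: "z \<in> ipaths a" for z
      proof
        assume A: "act (path_end Q) istep z p = Some y"
        have "z \<in> set (enum_list (ipaths a))" using z by (simp add: e(2))
        from act_awalk(2)[OF S this p A] A show "z = ?z \<and> path_end Q y = fst p"
          by (auto simp: act_def irun prod_eq_iff split: if_splits)
      next
        assume "z = ?z \<and> path_end Q y = fst p"
        then show "act (path_end Q) istep z p = Some y"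
          using qpaths_compose(2)[OF p yq(1)] by (auto simp: act_def irun)
      qed
      have "(\<Sum>z\<in>ipaths a. (if act (path_end Q) istep z p = Some y then 1 else 0) * (W * mact M (bs z)) $$ (0,j)) =
          (\<Sum>z\<in>ipaths a. if z = ?z then (if path_end Q y = fst p then (W * mact M (bs z)) $$ (0,j) else 0) else 0)"
        by (intro sum.cong refl) (simp add: az)
      also have "\<dots> = (if ?z \<in> ipaths a then (if path_end Q y = fst p then (W * mact M (bs ?z)) $$ (0,j) else 0) else 0)"
        by (rule sum.delta[OF finite_ipaths])
      also have "\<dots> = (W * (mact M (bs y) * mact M (bs p))) $$ (0,j)"
      proof (cases "path_end Q y = fst p")
        case True
        show ?thesis
        proof (cases "?z \<in> N")
          case False
          then have "bs ?z = 0" using qpaths_compose(1)[OF p yq(1) True] by (intro bs_zero) (auto simp: nonzero_paths_def)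
          then show ?thesis unfolding mact_bs_mult[OF M p yq(1)] using True False j dW
            by (simp add: ipaths_def mact_zero[OF M] mult_mat_zero_right del: index_mult_mat(1))
        qed (use True yq(2) in \<open>simp add: mact_bs_mult[OF M p yq(1)] ipaths_def\<close>)
      next
        case False
        then show ?thesis unfolding mact_bs_mult[OF M p yq(1)] using j dW
          by (simp add: mult_mat_zero_right del: index_mult_mat(1))
      qed
      also have "W * (mact M (bs y) * mact M (bs p)) = W * mact M (bs y) * mact M (bs p)"
        by (rule mult_mat_assoc[symmetric]) (simp_all add: d dW)
      finally show "(W * mact M (bs y) * mact M (bs p)) $$ (0,j) =
        (\<Sum>z\<in>ipaths a. (if act (path_end Q) istep z p = Some y then 1 else 0) * (W * mact M (bs z)) $$ (0,j))" by simp
    qed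
  qed (simp_all add: coyon_def)
qed

end

section \<open>Indecomposable projective and injective modules\<close>

lemma mult_mat_vec_unit: "j < dim_col A \<Longrightarrow> i < dim_row A \<Longrightarrow> (A *\<^sub>v unit_vec (dim_col A) j) $ i = (A $$ (i,j) :: 'k :: semiring_1)"
  by (simp add: scalar_prod_right_unit)

lemma mat_eq_vecI:
  fixes A B :: "'k :: semiring_1 mat"
  assumes "A \<in> carrier_mat m n" "B \<in> carrier_mat m n" "\<And>v. v \<in> carrier_vec n \<Longrightarrow> A *\<^sub>v v = B *\<^sub>v v"
  shows "A = B"
proof (rule eq_matI)
  fix i j assume "i < dim_row B" "j < dim_col B"
  then have ij: "i < m" "j < n" using assms(2) by auto
  then have "(A *\<^sub>v unit_vec n j) $ i = (B *\<^sub>v unit_vec n j) $ i" using assms(3)[of "unit_vec n j"] by simp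
  then show "A $$ (i,j) = B $$ (i,j)"
    using mult_mat_vec_unit[of j A i] mult_mat_vec_unit[of j B i] assms(1,2) ij by auto
qed (use assms in auto)

lemma linear_map_mat:
  fixes g :: "'k :: field vec \<Rightarrow> 'k vec"
  assumes c: "\<And>v. v \<in> carrier_vec n \<Longrightarrow> g v \<in> carrier_vec m"
    and add: "\<And>v w. v \<in> carrier_vec n \<Longrightarrow> w \<in> carrier_vec n \<Longrightarrow> g (v + w) = g v + g w"
    and smult: "\<And>c v. v \<in> carrier_vec n \<Longrightarrow> g (c \<cdot>\<^sub>v v) = c \<cdot>\<^sub>v g v"
  shows "\<exists>A\<in>carrier_mat m n. \<forall>v\<in>carrier_vec n. g v = A *\<^sub>v v"
proof (rule bexI[where x = "mat m n (\<lambda>(i,j). g (unit_vec n j) $ i)"], rule ballI)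
  let ?A = "mat m n (\<lambda>(i,j). g (unit_vec n j) $ i)"
  show A: "?A \<in> carrier_mat m n" by simp
  fix v :: "'k vec" assume v: "v \<in> carrier_vec n"
  \<comment> \<open>\<open>t k\<close> keeps the first \<open>k\<close> coordinates of
    \<open>v\<close>, so that the induction adds one unit vector at a time.\<close>
  define t where "t k = vec n (\<lambda>i. if i < k then v $ i else 0)" for k
  have tc: "t k \<in> carrier_vec n" for k by (simp add: t_def)
  have gt: "g (t k) = ?A *\<^sub>v t k" if "k \<le> n" for k
    using that
  proof (induction k)
    case 0
    have t0: "t 0 = 0\<^sub>v n" by (auto simp: t_def)
    have "g (0 \<cdot>\<^sub>v 0\<^sub>v n) = 0 \<cdot>\<^sub>v g (0\<^sub>v n)" by (rule smult) simp
    also have "0 \<cdot>\<^sub>v 0\<^sub>v n = (0\<^sub>v n :: 'k vec)" by auto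
    also have "0 \<cdot>\<^sub>v g (0\<^sub>v n) = 0\<^sub>v m" using c[of "0\<^sub>v n"] by auto
    finally show ?case unfolding t0 using A by auto
  next
    case (Suc k)
    then have k: "k < n" by simp
    have e: "t (Suc k) = t k + v $ k \<cdot>\<^sub>v unit_vec n k"
    proof (rule eq_vecI)
      fix i assume "i < dim_vec (t k + v $ k \<cdot>\<^sub>v unit_vec n k)"
      then have i: "i < n" by simp
      then show "t (Suc k) $ i = (t k + v $ k \<cdot>\<^sub>v unit_vec n k) $ i"
        using k by (cases "i = k") (simp_all add: t_def less_Suc_eq)
    qed (simp add: t_def)
    have u: "g (unit_vec n k) = ?A *\<^sub>v unit_vec n k"
    proof (rule eq_vecI)
      fix i assume "i < dim_vec (?A *\<^sub>v unit_vec n k)"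
      then have "i < m" by simp
      then show "g (unit_vec n k) $ i = (?A *\<^sub>v unit_vec n k) $ i"
        using k mult_mat_vec_unit[of k ?A i] by simp
    qed (use c[of "unit_vec n k"] in simp)
    have "g (t (Suc k)) = g (t k) + v $ k \<cdot>\<^sub>v g (unit_vec n k)"
      unfolding e by (subst add) (simp_all add: tc smult)
    also have "\<dots> = ?A *\<^sub>v t k + v $ k \<cdot>\<^sub>v (?A *\<^sub>v unit_vec n k)" using Suc u by simp
    also have "v $ k \<cdot>\<^sub>v (?A *\<^sub>v unit_vec n k) = ?A *\<^sub>v (v $ k \<cdot>\<^sub>v unit_vec n k)"
      by (rule mult_mat_vec[symmetric, OF A]) simp
    also have "?A *\<^sub>v t k + ?A *\<^sub>v (v $ k \<cdot>\<^sub>v unit_vec n k) = ?A *\<^sub>v t (Suc k)"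
      unfolding e by (rule mult_add_distrib_mat_vec[symmetric, OF A tc]) simp
    finally show ?case .
  qed
  have "t n = v" using v by (auto simp: t_def)
  with gt[of n] show "g v = ?A *\<^sub>v v" by simp
qed

text \<open>One coordinate map followed by the inverse of the other is linear, hence a matrix.
  Together with \<open>coordinatizes_transfer\<close>, the modules coordinatizing a structure form a
  full isomorphism class as soon as there is one.\<close>

lemma coordinatizes_isomorphic:
  fixes M M' :: "('a :: ring_1, 'k :: field) rmod"
  assumes m: "right_module sc M" "right_module sc M'"
    and c: "coordinatizes M V pl sm ac" "coordinatizes M' V pl sm ac"
  shows "isomorphic M M'"
proof -
  have carr: "mact M a \<in> carrier_mat (mdim M) (mdim M)" "mact M' a \<in> carrier_mat (mdim M') (mdim M')" for a
    using m[THEN mact_dims(1)] m[THEN mact_dims(2)] by (auto intro: carrier_matI)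
  \<comment> \<open>Used twice with the two modules exchanged, for the isomorphism and for its
    inverse.\<close>
  have ex: "\<exists>A\<in>carrier_mat (mdim Y) (mdim X). \<forall>v\<in>carrier_vec (mdim X). \<theta>' (A *\<^sub>v v) = \<theta> v"
    if \<theta>: "bij_betw \<theta> (carrier_vec (mdim X)) V"
      "\<forall>v\<in>carrier_vec (mdim X). \<forall>w\<in>carrier_vec (mdim X). \<theta> (v + w) = pl (\<theta> v) (\<theta> w)"
      "\<forall>c. \<forall>v\<in>carrier_vec (mdim X). \<theta> (c \<cdot>\<^sub>v v) = sm c (\<theta> v)"
    and \<theta>': "bij_betw \<theta>' (carrier_vec (mdim Y)) V"
      "\<forall>v\<in>carrier_vec (mdim Y). \<forall>w\<in>carrier_vec (mdim Y). \<theta>' (v + w) = pl (\<theta>' v) (\<theta>' w)"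
      "\<forall>c. \<forall>v\<in>carrier_vec (mdim Y). \<theta>' (c \<cdot>\<^sub>v v) = sm c (\<theta>' v)"
    for X Y :: "('a, 'k) rmod" and \<theta> \<theta>'
  proof -
    define g where "g v = the_inv_into (carrier_vec (mdim Y)) \<theta>' (\<theta> v)" for v
    have g: "g v \<in> carrier_vec (mdim Y) \<and> \<theta>' (g v) = \<theta> v" if "v \<in> carrier_vec (mdim X)" for v
      using f_the_inv_into_f_bij_betw[OF \<theta>'(1)] the_inv_into_into[OF bij_betw_imp_inj_on[OF \<theta>'(1)]] bij_betw_imp_surj_on[OF \<theta>'(1)]
        bij_betwE[OF \<theta>(1)] that unfolding g_def by auto
    note inj = inj_onD[OF bij_betw_imp_inj_on[OF \<theta>'(1)]]
    have ga: "g (v + w) = g v + g w" if "v \<in> carrier_vec (mdim X)" "w \<in> carrier_vec (mdim X)" for v w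
      by (rule inj) (use that g \<theta>(2) \<theta>'(2) in simp_all)
    have gs: "g (c \<cdot>\<^sub>v v) = c \<cdot>\<^sub>v g v" if "v \<in> carrier_vec (mdim X)" for c v
      by (rule inj) (use that g \<theta>(3) \<theta>'(3) in simp_all)
    have "\<exists>A\<in>carrier_mat (mdim Y) (mdim X). \<forall>v\<in>carrier_vec (mdim X). g v = A *\<^sub>v v"
    proof (rule linear_map_mat)
      show "g v \<in> carrier_vec (mdim Y)" if "v \<in> carrier_vec (mdim X)" for v using g[OF that] by (rule conjunct1)
    qed (rule ga gs, assumption+)+
    then obtain A where "A \<in> carrier_mat (mdim Y) (mdim X)" "\<forall>v\<in>carrier_vec (mdim X). g v = A *\<^sub>v v"
      by (elim bexE) (rule that; assumption)
    then show ?thesis using g by (intro bexI[of _ A]) auto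
  qed
  obtain \<theta> where \<theta>: "bij_betw \<theta> (carrier_vec (mdim M)) V"
      "\<forall>v\<in>carrier_vec (mdim M). \<forall>w\<in>carrier_vec (mdim M). \<theta> (v + w) = pl (\<theta> v) (\<theta> w)"
      "\<forall>c. \<forall>v\<in>carrier_vec (mdim M). \<theta> (c \<cdot>\<^sub>v v) = sm c (\<theta> v)"
      "\<forall>a. \<forall>v\<in>carrier_vec (mdim M). \<theta> (mact M a *\<^sub>v v) = ac (\<theta> v) a"
    using c(1) unfolding coordinatizes_def by blast
  obtain \<theta>' where \<theta>': "bij_betw \<theta>' (carrier_vec (mdim M')) V"
      "\<forall>v\<in>carrier_vec (mdim M'). \<forall>w\<in>carrier_vec (mdim M'). \<theta>' (v + w) = pl (\<theta>' v) (\<theta>' w)"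
      "\<forall>c. \<forall>v\<in>carrier_vec (mdim M'). \<theta>' (c \<cdot>\<^sub>v v) = sm c (\<theta>' v)"
      "\<forall>a. \<forall>v\<in>carrier_vec (mdim M'). \<theta>' (mact M' a *\<^sub>v v) = ac (\<theta>' v) a"
    using c(2) unfolding coordinatizes_def by blast
  obtain A where A: "A \<in> carrier_mat (mdim M') (mdim M)" "\<forall>v\<in>carrier_vec (mdim M). \<theta>' (A *\<^sub>v v) = \<theta> v"
    using ex[OF \<theta>(1-3) \<theta>'(1-3)] by blast
  obtain B where B: "B \<in> carrier_mat (mdim M) (mdim M')" "\<forall>v\<in>carrier_vec (mdim M'). \<theta> (B *\<^sub>v v) = \<theta>' v"
    using ex[OF \<theta>'(1-3) \<theta>(1-3)] by blast
  note inj = inj_onD[OF bij_betw_imp_inj_on[OF \<theta>(1)]] and inj' = inj_onD[OF bij_betw_imp_inj_on[OF \<theta>'(1)]]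
  have BA: "B * A = 1\<^sub>m (mdim M)"
  proof (rule mat_eq_vecI)
    fix v :: "'k vec" assume v: "v \<in> carrier_vec (mdim M)"
    have "B *\<^sub>v (A *\<^sub>v v) = v" by (rule inj) (use A B v in auto)
    then show "B * A *\<^sub>v v = 1\<^sub>m (mdim M) *\<^sub>v v" using A B v by simp
  qed (use A B in auto)
  have AB: "A * B = 1\<^sub>m (mdim M')"
  proof (rule mat_eq_vecI)
    fix v :: "'k vec" assume v: "v \<in> carrier_vec (mdim M')"
    have "A *\<^sub>v (B *\<^sub>v v) = v" by (rule inj') (use A B v in auto)
    then show "A * B *\<^sub>v v = 1\<^sub>m (mdim M') *\<^sub>v v" using A B v by simp
  qed (use A B in auto)
  have Ah: "A \<in> mhom M M'"
  proof (rule mhomI)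
    fix a
    show "A * mact M a = mact M' a * A"
    proof (rule mat_eq_vecI[OF mult_carrier_mat[OF A(1) carr(1)] mult_carrier_mat[OF carr(2) A(1)]])
      fix v :: "'k vec" assume v: "v \<in> carrier_vec (mdim M)"
      have "A *\<^sub>v (mact M a *\<^sub>v v) = mact M' a *\<^sub>v (A *\<^sub>v v)"
      proof (rule inj')
        have "mact M a *\<^sub>v v \<in> carrier_vec (mdim M)" using carr(1)[of a] v by simp
        moreover have "A *\<^sub>v v \<in> carrier_vec (mdim M')" using A(1) v by simp
        ultimately show "\<theta>' (A *\<^sub>v (mact M a *\<^sub>v v)) = \<theta>' (mact M' a *\<^sub>v (A *\<^sub>v v))"
          using A(2) \<theta>(4) \<theta>'(4) v by simp
      qed (use A carr[of a] v in auto)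
      then show "A * mact M a *\<^sub>v v = mact M' a * A *\<^sub>v v"
        unfolding assoc_mult_mat_vec[OF A(1) carr(1) v] assoc_mult_mat_vec[OF carr(2) A(1) v] .
    qed
  qed (use A(1) in auto)
  show ?thesis unfolding isomorphic_def using is_isoI[OF Ah mhom_inverse[OF Ah carr BA AB] BA AB] by blast
qed

lemma coordinatizes_transfer:
  fixes M M' :: "('a :: ring_1, 'k :: field) rmod"
  assumes m: "right_module sc M" "right_module sc M'" and c: "coordinatizes M V pl sm ac" and i: "isomorphic M M'"
  shows "coordinatizes M' V pl sm ac"
proof -
  obtain \<theta> where \<theta>: "bij_betw \<theta> (carrier_vec (mdim M)) V"
      "\<forall>v\<in>carrier_vec (mdim M). \<forall>w\<in>carrier_vec (mdim M). \<theta> (v + w) = pl (\<theta> v) (\<theta> w)"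
      "\<forall>c. \<forall>v\<in>carrier_vec (mdim M). \<theta> (c \<cdot>\<^sub>v v) = sm c (\<theta> v)"
      "\<forall>a. \<forall>v\<in>carrier_vec (mdim M). \<theta> (mact M a *\<^sub>v v) = ac (\<theta> v) a"
    using c unfolding coordinatizes_def by blast
  obtain F G where F: "F \<in> mhom M M'" and G: "G \<in> mhom M' M" and GF: "G * F = 1\<^sub>m (mdim M)" and FG: "F * G = 1\<^sub>m (mdim M')"
    using i unfolding isomorphic_def is_iso_def by (elim exE conjE bexE) (rule that; assumption)
  have cF: "F \<in> carrier_mat (mdim M') (mdim M)" and cG: "G \<in> carrier_mat (mdim M) (mdim M')"
    by (auto intro!: carrier_matI simp: mhom_dims[OF F] mhom_dims[OF G])
  have carr: "mact M a \<in> carrier_mat (mdim M) (mdim M)" "mact M' a \<in> carrier_mat (mdim M') (mdim M')" for a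
    using m[THEN mact_dims(1)] m[THEN mact_dims(2)] by (auto intro: carrier_matI)
  have GFv: "G *\<^sub>v (F *\<^sub>v v) = v" if "v \<in> carrier_vec (mdim M)" for v
    using that assoc_mult_mat_vec[OF cG cF that] GF by simp
  have FGv: "F *\<^sub>v (G *\<^sub>v v) = v" if "v \<in> carrier_vec (mdim M')" for v
    using that assoc_mult_mat_vec[OF cF cG that] FG by simp
  have bij: "bij_betw (\<lambda>v. G *\<^sub>v v) (carrier_vec (mdim M')) (carrier_vec (mdim M))"
    by (rule bij_betw_byWitness[where f' = "\<lambda>v. F *\<^sub>v v"]) (use FGv GFv cF cG in auto)
  have Gc: "G *\<^sub>v v \<in> carrier_vec (mdim M)" if "v \<in> carrier_vec (mdim M')" for v using that cG by simp
  show ?thesis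
    unfolding coordinatizes_def
  proof (intro exI[of _ "\<lambda>v. \<theta> (G *\<^sub>v v)"] conjI ballI allI)
    show "bij_betw (\<lambda>v. \<theta> (G *\<^sub>v v)) (carrier_vec (mdim M')) V"
      using bij_betw_trans[OF bij \<theta>(1)] by (simp add: o_def)
    fix v :: "'k vec" assume v: "v \<in> carrier_vec (mdim M')"
    show "\<theta> (G *\<^sub>v (v + w)) = pl (\<theta> (G *\<^sub>v v)) (\<theta> (G *\<^sub>v w))" if w: "w \<in> carrier_vec (mdim M')" for w
      using \<theta>(2) Gc[OF v] Gc[OF w] mult_add_distrib_mat_vec[OF cG v w] by simp
    show "\<theta> (G *\<^sub>v (c \<cdot>\<^sub>v v)) = sm c (\<theta> (G *\<^sub>v v))" for c
      using \<theta>(3) Gc[OF v] mult_mat_vec[OF cG v] by simp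
    show "\<theta> (G *\<^sub>v (mact M' a *\<^sub>v v)) = ac (\<theta> (G *\<^sub>v v)) a" for a
    proof -
      have "G *\<^sub>v (mact M' a *\<^sub>v v) = (G * mact M' a) *\<^sub>v v" using assoc_mult_mat_vec[OF cG carr(2) v] by simp
      also have "\<dots> = (mact M a * G) *\<^sub>v v" by (simp only: mhom_comm[OF G])
      also have "\<dots> = mact M a *\<^sub>v (G *\<^sub>v v)" using assoc_mult_mat_vec[OF carr(1) cG v] by simp
      finally show ?thesis using \<theta>(4) Gc[OF v] by simp
    qed
  qed
qed

lemma kmat_mult_vec_index:
  assumes "i < length ys" "v \<in> carrier_vec (length xs)"
  shows "(kmat ys xs K *\<^sub>v v) $ i = (\<Sum>j = 0..<length xs. K (ys ! i) (xs ! j) * v $ j)"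
  using assms by (simp add: scalar_prod_def kmat_index)

section \<open>The concrete projectives and injectives as the modules of the statement\<close>

context path_basis begin

lemma co_zero: "p \<in> N \<Longrightarrow> co 0 p = 0"
  using co_scale[of p 0 0] by (simp add: scale_zero_left)

lemma co_sum: "p \<in> N \<Longrightarrow> co (\<Sum>i\<in>S. f i) p = (\<Sum>i\<in>S. co (f i) p)"
  by (induction S rule: infinite_finite_induct) (auto simp: co_add co_zero)

lemma co_ext: "(\<And>p. p \<in> N \<Longrightarrow> co a p = co b p) \<Longrightarrow> a = b"
  by (subst expand[of a], subst expand[of b]) (rule sum.cong, auto)

lemma lin_co_left: "p \<in> N \<Longrightarrow> lin (\<lambda>b. co (c * b) p)" "p \<in> N \<Longrightarrow> lin (\<lambda>b. co (b * c) p)"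
  by (simp_all add: lin_def co_add co_scale distrib_left distrib_right scale_mult_left scale_mult_right)

lemma lin_sum_mult:
  assumes "\<And>i. i \<in> S \<Longrightarrow> lin (f i)"
  shows "lin (\<lambda>b. \<Sum>i\<in>S. f i b * c i)" "lin (\<lambda>b. \<Sum>i\<in>S. c i * f i b)"
  using assms unfolding lin_def
  by (auto simp: sum.distrib[symmetric] sum_distrib_left algebra_simps intro!: sum.cong)

lemma lin_mact_entry:
  assumes M: "right_module sc M" and "i < mdim M" "v \<in> carrier_vec (mdim M)"
  shows "lin (\<lambda>b. (mact M b *\<^sub>v v) $ i)"
  using assms(2,3) unfolding lin_def mact_simps[OF M]
  by (auto simp: mact_dims[OF M] scalar_prod_def sum.distrib[symmetric] sum_distrib_left algebra_simps)

text \<open>It exhibits the paths ending at \<open>a\<close> as a basis of \<open>e A\<close>, and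
  those starting at \<open>a\<close> as a basis of \<open>A e\<close>, for the idempotent
  \<open>e\<close> at \<open>a\<close>.\<close>

lemma co_idem_mult:
  assumes a: "a \<in> verts Q" and p: "p \<in> N"
  shows "co (bs (a, []) * x) p = (if path_end Q p = a then co x p else 0)"
    "co (x * bs (a, [])) p = (if fst p = a then co x p else 0)"
proof -
  have e: "(a, []) \<in> qpaths Q" using trivial_path[OF a] by (rule nonzero_pathsD)
  have l: "lin (\<lambda>x. if path_end Q p = a then co x p else 0)" "lin (\<lambda>x. if fst p = a then co x p else 0)"
    by (simp_all add: lin_def co_add co_scale p)
  show "co (bs (a, []) * x) p = (if path_end Q p = a then co x p else 0)"
  proof (rule lin_ext[OF lin_co_left(1)[OF p] l(1)])
    fix q assume "q \<in> N"
    then show "co (bs (a, []) * bs q) p = (if path_end Q p = a then co (bs q) p else 0)"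
      using bs_mult[OF e nonzero_pathsD(1)] by (auto simp: co_bs p co_zero)
  qed
  show "co (x * bs (a, [])) p = (if fst p = a then co x p else 0)"
  proof (rule lin_ext[OF lin_co_left(2)[OF p] l(2)])
    fix q assume "q \<in> N"
    then show "co (bs q * bs (a, [])) p = (if fst p = a then co (bs q) p else 0)"
      using bs_mult[OF nonzero_pathsD(1) e] by (cases q) (auto simp: co_bs p co_zero)
  qed
qed

text \<open>The nonzero paths ending at \<open>a\<close> are a basis of \<open>e A\<close>, and
  \<open>act_ppaths\<close> describes on them the multiplication of \<open>bs_mult\<close>.\<close>

lemma proj_coordinatizes:
  assumes a: "a \<in> verts Q"
  shows "coordinatizes (proj a) (range (\<lambda>x. bs (a, []) * x)) (+) sc (*)"
proof -
  let ?xs = "enum_list (ppaths a)" and ?e = "bs (a, [])"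
  let ?n = "length ?xs"
  note S = rooted_step_system[OF rooted_ppaths[OF a]] and en = enum_list[OF finite_ppaths[of a]]
  note M = smod_right_module[OF S]
  have xT: "?xs ! i \<in> ppaths a" if "i < ?n" for i using en(2) nth_mem[OF that] by simp
  have xN: "?xs ! i \<in> N" "path_end Q (?xs ! i) = a" if "i < ?n" for i using xT[OF that] by (auto simp: ppaths_def)
  define \<theta> where "\<theta> v = (\<Sum>i = 0..<?n. sc (v $ i) (bs (?xs ! i)))" for v
  have co\<theta>: "co (\<theta> v) (?xs ! i) = v $ i" if i: "i < ?n" for v i
  proof -
    have "co (\<theta> v) (?xs ! i) = (\<Sum>j = 0..<?n. if j = i then v $ j else 0)"
      unfolding \<theta>_def co_sum[OF xN(1)[OF i]]
      by (intro sum.cong refl) (use xN(1) i en(1) in \<open>auto simp: co_scale co_bs nth_eq_iff_index_eq\<close>)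
    then show ?thesis using i by simp
  qed
  have co\<theta>0: "co (\<theta> v) p = 0" if p: "p \<in> N" "p \<notin> ppaths a" for v p
    unfolding \<theta>_def co_sum[OF p(1)]
    by (rule sum.neutral) (use xN(1) xT p in \<open>auto simp: co_scale co_bs\<close>)
  have range: "\<theta> v \<in> range (\<lambda>x. ?e * x)" for v
  proof -
    have "\<theta> v = ?e * \<theta> v"
      by (rule co_ext) (auto simp: co_idem_mult(1)[OF a] co\<theta>0 ppaths_def)
    then show ?thesis by (rule range_eqI)
  qed
  have inv: "\<theta> (vec ?n (\<lambda>i. co y (?xs ! i))) = y" if y: "y = ?e * x" for x y
  proof (rule co_ext)
    fix p assume p: "p \<in> N"
    show "co (\<theta> (vec ?n (\<lambda>i. co y (?xs ! i)))) p = co y p"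
    proof (cases "p \<in> ppaths a")
      case True
      then have "p \<in> set ?xs" by (simp add: en(2))
      then obtain i where "i < ?n" "p = ?xs ! i" by (auto simp: in_set_conv_nth)
      then show ?thesis by (simp add: co\<theta>)
    next
      case False
      then show ?thesis using p by (simp add: co\<theta>0[OF p False] y co_idem_mult(1)[OF a p] ppaths_def)
    qed
  qed
  have bij: "bij_betw \<theta> (carrier_vec ?n) (range (\<lambda>x. ?e * x))"
  proof (rule bij_betw_byWitness[where f' = "\<lambda>y. vec ?n (\<lambda>i. co y (?xs ! i))"])
    show "\<forall>v\<in>carrier_vec ?n. vec ?n (\<lambda>i. co (\<theta> v) (?xs ! i)) = v" by (auto simp: co\<theta>)
  qed (use range inv in auto)
  have act: "\<theta> (mact (proj a) b *\<^sub>v v) = \<theta> v * b" if v: "v \<in> carrier_vec ?n" for b v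
  proof (rule co_ext)
    fix r assume r: "r \<in> N"
    have l1: "lin (\<lambda>b. co (\<theta> (mact (proj a) b *\<^sub>v v)) r)"
    proof -
      have "lin (\<lambda>b. \<Sum>i = 0..<?n. (mact (proj a) b *\<^sub>v v) $ i * co (bs (?xs ! i)) r)"
        by (intro lin_sum_mult(1) lin_mact_entry[OF M]) (simp_all add: v)
      then show ?thesis unfolding \<theta>_def co_sum[OF r] co_scale[OF r] .
    qed
    \<comment> \<open>Both sides are linear in \<open>b\<close>, so \<open>b\<close> may be a basis
      path; exchanging the sums then reduces the claim to products of two basis paths.\<close>
    show "co (\<theta> (mact (proj a) b *\<^sub>v v)) r = co (\<theta> v * b) r"
    proof (rule lin_ext[OF l1 lin_co_left(1)[OF r]])
      fix p assume "p \<in> N"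
      then have p: "p \<in> qpaths Q" by (rule nonzero_pathsD)
      let ?A = "act fst (pstep (ppaths a))"
      have m: "(mact (proj a) (bs p) *\<^sub>v v) $ i = (\<Sum>j = 0..<?n. (if ?A (?xs ! j) p = Some (?xs ! i) then 1 else 0) * v $ j)"
        if "i < ?n" for i unfolding smod_act[OF S p] by (rule kmat_mult_vec_index[OF that v])
      have "co (\<theta> (mact (proj a) (bs p) *\<^sub>v v)) r =
          (\<Sum>i = 0..<?n. \<Sum>j = 0..<?n. v $ j * ((if ?A (?xs ! j) p = Some (?xs ! i) then 1 else 0) * co (bs (?xs ! i)) r))"
        unfolding \<theta>_def co_sum[OF r] co_scale[OF r]
        by (intro sum.cong refl) (simp add: m sum_distrib_right mult.assoc mult.left_commute)
      also have "\<dots> = (\<Sum>j = 0..<?n. v $ j * (\<Sum>i = 0..<?n. (if ?A (?xs ! j) p = Some (?xs ! i) then 1 else 0) * co (bs (?xs ! i)) r))"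
        unfolding sum_distrib_left by (rule sum.swap)
      also have "\<dots> = (\<Sum>j = 0..<?n. v $ j * co (bs (?xs ! j) * bs p) r)"
      proof (intro sum.cong refl arg_cong2[where f = "(*)"])
        fix j assume "j \<in> {0..<?n}"
        then have j: "j < ?n" by simp
        have xq: "?xs ! j \<in> qpaths Q" using xN(1)[OF j] by (rule nonzero_pathsD)
        have "(\<Sum>i = 0..<?n. (if ?A (?xs ! j) p = Some (?xs ! i) then 1 else 0) * co (bs (?xs ! i)) r) =
            (\<Sum>x\<in>set ?xs. (if ?A (?xs ! j) p = Some x then 1 else 0) * co (bs x) r)"
          by (rule sum_nth_distinct[OF en(1), of "\<lambda>x. (if ?A (?xs ! j) p = Some x then 1 else 0) * co (bs x) r"])
        also have "\<dots> = (case ?A (?xs ! j) p of None \<Rightarrow> 0 | Some x \<Rightarrow> co (bs x) r)"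
          using act_awalk(1)[OF S nth_mem[OF j] p] by (intro sum_option_bind(2)) simp_all
        also have "\<dots> = co (bs (?xs ! j) * bs p) r"
          unfolding act_ppaths[OF a xT[OF j] p] bs_mult[OF xq p]
        proof (cases "path_end Q p = fst (?xs ! j)")
          case True
          let ?z = "(fst p, snd p @ snd (?xs ! j))"
          have "bs ?z = 0" if "?z \<notin> N"
            using qpaths_compose(1)[OF xq p True] that by (intro bs_zero) (simp_all add: nonzero_paths_def)
          then show "(case if path_end Q p = fst (?xs ! j) \<and> ?z \<in> N then Some ?z else None of None \<Rightarrow> 0 | Some x \<Rightarrow> co (bs x) r) =
              co (if path_end Q p = fst (?xs ! j) then bs ?z else 0) r"
            using True r by (cases "?z \<in> N") (simp_all add: co_zero)
        qed (simp add: co_zero r)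
        finally show "(\<Sum>i = 0..<?n. (if ?A (?xs ! j) p = Some (?xs ! i) then 1 else 0) * co (bs (?xs ! i)) r) = co (bs (?xs ! j) * bs p) r" .
      qed
      also have "\<dots> = co (\<theta> v * bs p) r"
        by (simp add: \<theta>_def sum_distrib_right co_sum[OF r] scale_mult_left co_scale[OF r])
      finally show "co (\<theta> (mact (proj a) (bs p) *\<^sub>v v)) r = co (\<theta> v * bs p) r" .
    qed
  qed
  show ?thesis
    unfolding coordinatizes_def smod_dim
  proof (intro exI[of _ \<theta>] conjI ballI allI bij)
    fix v :: "'k vec" assume v: "v \<in> carrier_vec ?n"
    show "\<theta> (v + w) = \<theta> v + \<theta> w" if "w \<in> carrier_vec ?n" for w
      using v that by (simp add: \<theta>_def sum.distrib[symmetric] scale_left_distrib)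
    show "\<theta> (c \<cdot>\<^sub>v v) = sc c (\<theta> v)" for c
      using v by (simp add: \<theta>_def scale_sum_right)
    show "\<theta> (mact (proj a) b *\<^sub>v v) = \<theta> v * b" for b by (rule act[OF v])
  qed
qed

lemma projective_at_eq:
  assumes a: "a \<in> verts Q"
  shows "projective_at sc (bs (a, [])) = iso_class sc (proj a)"
proof -
  note M = smod_right_module[OF rooted_step_system[OF rooted_ppaths[OF a]]] and c = proj_coordinatizes[OF a]
  show ?thesis unfolding projective_at_def iso_class_def
    using coordinatizes_isomorphic[OF M _ c] coordinatizes_transfer[OF M _ c] by blast
qed

text \<open>Transposition: cancelling \<open>p\<close> at the end of \<open>y\<close> is dual to
  left multiplication by \<open>p\<close>, which appends \<open>p\<close> to a path.\<close>

lemma act_ipaths: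
  assumes y: "y \<in> ipaths a" and p: "p \<in> N"
  shows "(case act (path_end Q) istep y p of None \<Rightarrow> 0 | Some z \<Rightarrow> co x z) = co (bs p * x) y"
proof -
  have yN: "y \<in> N" and yq: "y \<in> qpaths Q" using y nonzero_pathsD(1) by (auto simp: ipaths_def)
  have pq: "p \<in> qpaths Q" using p by (rule nonzero_pathsD)
  note S = imod_step_system[of a] and en = enum_list[OF finite_ipaths[of a]]
  have zN: "z \<in> N" if "act (path_end Q) istep y p = Some z" for z
  proof -
    have "z \<in> ipaths a" using act_awalk(1)[OF S _ pq that] y by (simp add: en)
    then show ?thesis by (simp add: ipaths_def)
  qed
  have l: "lin (\<lambda>x. case act (path_end Q) istep y p of None \<Rightarrow> 0 | Some z \<Rightarrow> co x z)"
    using zN by (auto simp: lin_def co_add co_scale split: option.split)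
  show ?thesis
  proof (rule lin_ext[OF l lin_co_left(1)[OF yN]])
    fix q assume q: "q \<in> N"
    then have qq: "q \<in> qpaths Q" by (rule nonzero_pathsD)
    have "(case act (path_end Q) istep y p of None \<Rightarrow> 0 | Some z \<Rightarrow> co (bs q) z) =
        (if act (path_end Q) istep y p = Some q then 1 else 0)"
      using zN q by (auto simp: co_bs split: option.split)
    also have "act (path_end Q) istep y p = Some q \<longleftrightarrow> path_end Q q = fst p \<and> y = (fst q, snd q @ snd p)"
    proof
      assume A: "act (path_end Q) istep y p = Some q"
      then have r: "run istep y (snd p) = Some q" by (auto simp: act_def split: if_splits)
      have "path_end Q q = fst p" using act_awalk(2)[OF S _ pq A] y by (simp add: en)
      then show "path_end Q q = fst p \<and> y = (fst q, snd q @ snd p)"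
        using r unfolding irun by (simp add: prod_eq_iff)
    next
      assume A: "path_end Q q = fst p \<and> y = (fst q, snd q @ snd p)"
      then have "path_end Q y = path_end Q p" using qpaths_compose(2)[OF pq qq] by simp
      then show "act (path_end Q) istep y p = Some q" using A irun[of y "snd p" q] by (simp add: act_def)
    qed
    also have "(if path_end Q q = fst p \<and> y = (fst q, snd q @ snd p) then 1 else 0) = co (bs p * bs q) y"
      unfolding bs_mult[OF pq qq]
    proof (cases "path_end Q q = fst p")
      case True
      let ?z = "(fst q, snd q @ snd p)"
      show "(if path_end Q q = fst p \<and> y = ?z then 1 else 0) = co (if path_end Q q = fst p then bs ?z else 0) y"
      proof (cases "?z \<in> N")
        case True
        then show ?thesis using yN by (auto simp: co_bs co_zero)
      next
        case False
        then have "bs ?z = 0" using qpaths_compose(1)[OF pq qq True] by (intro bs_zero) (auto simp: nonzero_paths_def)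
        moreover have "y \<noteq> ?z" using False yN by blast
        ultimately show ?thesis using yN by (simp add: co_zero)
      qed
    qed (use yN in \<open>simp add: co_zero\<close>)
    finally show "(case act (path_end Q) istep y p of None \<Rightarrow> 0 | Some z \<Rightarrow> co (bs q) z) = co (bs p * bs q) y" .
  qed
qed

text \<open>The basis path \<open>y\<close> stands for the functional that takes the coefficient at
  \<open>y\<close>; \<open>act_ipaths\<close> turns \<open>(f b) x = f (b x)\<close> into the
  cancellation of arrows.\<close>

lemma imod_coordinatizes:
  assumes a: "a \<in> verts Q"
  defines "L \<equiv> range (\<lambda>x. x * bs (a, []))"
  shows "coordinatizes (imod a) (functionals_on sc L) (\<lambda>f g x. f x + g x) (\<lambda>c f x. c * f x)
           (\<lambda>f b x. if x \<in> L then f (b * x) else 0)"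
proof -
  let ?xs = "enum_list (ipaths a)" and ?e = "bs (a, [])"
  let ?n = "length ?xs"
  note S = imod_step_system[of a] and en = enum_list[OF finite_ipaths[of a]]
  note M = smod_right_module[OF S]
  have xT: "?xs ! i \<in> ipaths a" if "i < ?n" for i using nth_mem[OF that] by (simp add: en)
  then have xN: "?xs ! i \<in> N" if "i < ?n" for i using that by (simp add: ipaths_def)
  have eq: "(a, []) \<in> qpaths Q" using trivial_path[OF a] by (rule nonzero_pathsD)
  have L_add: "x + y \<in> L" if "x \<in> L" "y \<in> L" for x y
  proof -
    from that obtain x' y' where "x = x' * ?e" "y = y' * ?e" unfolding L_def by blast
    then have "x + y = (x' + y') * ?e" by (simp add: distrib_right)
    then show ?thesis unfolding L_def by (rule range_eqI)
  qed
  have L_scale: "sc c x \<in> L" if "x \<in> L" for c x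
  proof -
    from that obtain x' where "x = x' * ?e" unfolding L_def by blast
    then have "sc c x = sc c x' * ?e" by (simp add: scale_mult_left)
    then show ?thesis unfolding L_def by (rule range_eqI)
  qed
  have L_mult: "b * x \<in> L" if "x \<in> L" for b x
  proof -
    from that obtain x' where "x = x' * ?e" unfolding L_def by blast
    then have "b * x = (b * x') * ?e" by (simp add: mult.assoc)
    then show ?thesis unfolding L_def by (rule range_eqI)
  qed
  have L_bs: "bs p \<in> L" if "p \<in> ipaths a" for p
  proof -
    have "p \<in> qpaths Q" "fst p = a" using that nonzero_pathsD(1) by (auto simp: ipaths_def)
    then have "bs p = bs p * ?e" using bs_mult[OF _ eq, of p] by (cases p) simp
    then show ?thesis unfolding L_def by (rule range_eqI)
  qed
  have L_0: "0 \<in> L" unfolding L_def by (rule range_eqI[of _ _ 0]) simp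
  have L_co: "co x p = 0" if "x \<in> L" "p \<in> N" "p \<notin> ipaths a" for x p
  proof -
    from that(1) obtain x' where x: "x = x' * ?e" unfolding L_def by blast
    show ?thesis unfolding x co_idem_mult(2)[OF a that(2)] using that(2,3) by (simp add: ipaths_def)
  qed
  have L_expand: "x = (\<Sum>p\<in>ipaths a. sc (co x p) (bs p))" if "x \<in> L" for x
  proof -
    have "(\<Sum>p\<in>N. sc (co x p) (bs p)) = (\<Sum>p\<in>ipaths a. sc (co x p) (bs p))"
    proof (rule sum.mono_neutral_right[OF finite_nonzero_paths])
      show "\<forall>p\<in>N - ipaths a. sc (co x p) (bs p) = 0" using L_co[OF that] by simp
    qed (auto simp: ipaths_def)
    then show ?thesis using expand[of x] by simp
  qed
  have f_sum: "f (\<Sum>p\<in>P. sc (c p) (bs p)) = (\<Sum>p\<in>P. c p * f (bs p)) \<and> (\<Sum>p\<in>P. sc (c p) (bs p)) \<in> L"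
    if f: "f \<in> functionals_on sc L" and P: "finite P" "P \<subseteq> ipaths a" for f c P
    using P
  proof (induction P rule: finite_induct)
    case empty
    have "f (sc 0 0) = 0 * f 0" using f L_0 unfolding functionals_on_def by blast
    then show ?case using L_0 by simp
  next
    case (insert p P)
    then have p: "bs p \<in> L" "sc (c p) (bs p) \<in> L" using L_bs L_scale by auto
    have "f (sc (c p) (bs p)) = c p * f (bs p)" using f p(1) unfolding functionals_on_def by blast
    moreover have "f (sc (c p) (bs p) + (\<Sum>p\<in>P. sc (c p) (bs p))) = f (sc (c p) (bs p)) + f (\<Sum>p\<in>P. sc (c p) (bs p))"
      using f p(2) insert unfolding functionals_on_def by blast
    ultimately show ?case using insert p(2) L_add by auto
  qed
  define \<theta> where "\<theta> v = (\<lambda>x. if x \<in> L then (\<Sum>i = 0..<?n. v $ i * co x (?xs ! i)) else 0)" for v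
  have \<theta>_bs: "\<theta> v (bs (?xs ! i)) = v $ i" if i: "i < ?n" for v i
  proof -
    have "\<theta> v (bs (?xs ! i)) = (\<Sum>j = 0..<?n. v $ j * co (bs (?xs ! i)) (?xs ! j))"
      unfolding \<theta>_def using L_bs[OF xT[OF i]] by simp
    also have "\<dots> = (\<Sum>j = 0..<?n. if j = i then v $ j else 0)"
      by (intro sum.cong refl) (use xN i en(1) in \<open>auto simp: co_bs nth_eq_iff_index_eq\<close>)
    finally have "\<theta> v (bs (?xs ! i)) = (\<Sum>j = 0..<?n. if j = i then v $ j else 0)" .
    then show ?thesis using i by simp
  qed
  have \<theta>_mem: "\<theta> v \<in> functionals_on sc L" for v
    unfolding functionals_on_def \<theta>_def using L_add L_scale xN
    by (auto simp: co_add co_scale sum.distrib[symmetric] sum_distrib_left algebra_simps intro!: sum.cong)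
  have inv: "\<theta> (vec ?n (\<lambda>i. f (bs (?xs ! i)))) = f" if f: "f \<in> functionals_on sc L" for f
  proof
    fix x
    show "\<theta> (vec ?n (\<lambda>i. f (bs (?xs ! i)))) x = f x"
    proof (cases "x \<in> L")
      case True
      have "\<theta> (vec ?n (\<lambda>i. f (bs (?xs ! i)))) x = (\<Sum>i = 0..<?n. f (bs (?xs ! i)) * co x (?xs ! i))"
        using True by (simp add: \<theta>_def)
      also have "\<dots> = (\<Sum>p\<in>set ?xs. f (bs p) * co x p)"
        by (rule sum_nth_distinct[OF en(1), of "\<lambda>p. f (bs p) * co x p"])
      also have "\<dots> = (\<Sum>p\<in>ipaths a. co x p * f (bs p))" by (simp add: en(2) mult.commute)
      also have "\<dots> = f (\<Sum>p\<in>ipaths a. sc (co x p) (bs p))" using f_sum[OF f finite_ipaths, of a "co x"] by simp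
      finally show ?thesis using L_expand[OF True] by simp
    next
      case False
      then show ?thesis using f by (simp add: \<theta>_def functionals_on_def)
    qed
  qed
  have bij: "bij_betw \<theta> (carrier_vec ?n) (functionals_on sc L)"
  proof (rule bij_betw_byWitness[where f' = "\<lambda>f. vec ?n (\<lambda>i. f (bs (?xs ! i)))"])
    show "\<forall>v\<in>carrier_vec ?n. vec ?n (\<lambda>i. \<theta> v (bs (?xs ! i))) = v" by (auto simp: \<theta>_bs)
  qed (use \<theta>_mem inv in auto)
  have act: "\<theta> (mact (imod a) b *\<^sub>v v) x = \<theta> v (b * x)" if v: "v \<in> carrier_vec ?n" and x: "x \<in> L" for b v x
  proof -
    let ?f = "\<lambda>b. \<Sum>i = 0..<?n. (mact (imod a) b *\<^sub>v v) $ i * co x (?xs ! i)"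
    let ?g = "\<lambda>b. \<Sum>i = 0..<?n. v $ i * co (b * x) (?xs ! i)"
    have l1: "lin ?f"
      by (intro lin_sum_mult(1) lin_mact_entry[OF M]) (simp_all add: v)
    have l2: "lin ?g"
      by (intro lin_sum_mult(2) lin_co_left(2) xN) simp
    have "?f b = ?g b"
    proof (rule lin_ext[OF l1 l2])
      fix p assume p: "p \<in> N"
      then have pq: "p \<in> qpaths Q" by (rule nonzero_pathsD)
      let ?A = "act (path_end Q) istep"
      have m: "(mact (imod a) (bs p) *\<^sub>v v) $ i = (\<Sum>j = 0..<?n. (if ?A (?xs ! j) p = Some (?xs ! i) then 1 else 0) * v $ j)"
        if "i < ?n" for i unfolding smod_act[OF S pq] by (rule kmat_mult_vec_index[OF that v])
      have "?f (bs p) =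
          (\<Sum>i = 0..<?n. \<Sum>j = 0..<?n. v $ j * ((if ?A (?xs ! j) p = Some (?xs ! i) then 1 else 0) * co x (?xs ! i)))"
        by (intro sum.cong refl) (simp add: m sum_distrib_right mult.assoc mult.left_commute)
      also have "\<dots> = (\<Sum>j = 0..<?n. v $ j * (\<Sum>i = 0..<?n. (if ?A (?xs ! j) p = Some (?xs ! i) then 1 else 0) * co x (?xs ! i)))"
        unfolding sum_distrib_left by (rule sum.swap)
      also have "\<dots> = ?g (bs p)"
      proof (intro sum.cong refl arg_cong2[where f = "(*)"])
        fix j assume "j \<in> {0..<?n}"
        then have j: "j < ?n" by simp
        have "(\<Sum>i = 0..<?n. (if ?A (?xs ! j) p = Some (?xs ! i) then 1 else 0) * co x (?xs ! i)) =
            (\<Sum>z\<in>set ?xs. (if ?A (?xs ! j) p = Some z then 1 else 0) * co x z)"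
          by (rule sum_nth_distinct[OF en(1), of "\<lambda>z. (if ?A (?xs ! j) p = Some z then 1 else 0) * co x z"])
        also have "\<dots> = (case ?A (?xs ! j) p of None \<Rightarrow> 0 | Some z \<Rightarrow> co x z)"
          using act_awalk(1)[OF S nth_mem[OF j] pq] by (intro sum_option_bind(2)) simp_all
        also have "\<dots> = co (bs p * x) (?xs ! j)" by (rule act_ipaths[OF xT[OF j] p])
        finally show "(\<Sum>i = 0..<?n. (if ?A (?xs ! j) p = Some (?xs ! i) then 1 else 0) * co x (?xs ! i)) = co (bs p * x) (?xs ! j)" .
      qed
      finally show "?f (bs p) = ?g (bs p)" .
    qed
    then show ?thesis using x L_mult[OF x] by (simp add: \<theta>_def)
  qed
  show ?thesis
    unfolding coordinatizes_def smod_dim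
  proof (intro exI[of _ \<theta>] conjI ballI allI bij)
    fix v :: "'k vec" assume v: "v \<in> carrier_vec ?n"
    show "\<theta> (v + w) = (\<lambda>x. \<theta> v x + \<theta> w x)" if "w \<in> carrier_vec ?n" for w
      using v that by (auto simp: \<theta>_def sum.distrib[symmetric] algebra_simps intro!: ext)
    show "\<theta> (c \<cdot>\<^sub>v v) = (\<lambda>x. c * \<theta> v x)" for c
      using v by (auto simp: \<theta>_def sum_distrib_left mult.assoc intro!: ext)
    show "\<theta> (mact (imod a) b *\<^sub>v v) = (\<lambda>x. if x \<in> L then \<theta> v (b * x) else 0)" for b
      using act[OF v] by (auto simp: \<theta>_def)
  qed
qed

lemma injective_at_eq:
  assumes a: "a \<in> verts Q"
  shows "injective_at sc (bs (a, [])) = iso_class sc (imod a)"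
proof -
  note M = smod_right_module[OF imod_step_system[of a]] and c = imod_coordinatizes[OF a]
  show ?thesis unfolding injective_at_def iso_class_def Let_def
    using coordinatizes_isomorphic[OF M _ c] coordinatizes_transfer[OF M _ c] by blast
qed

lemma trivial_index_ppaths:
  assumes "a \<in> verts Q"
  shows "\<exists>r<length (enum_list (ppaths a)). enum_list (ppaths a) ! r = (a, [])"
proof -
  have "(a, []) \<in> set (enum_list (ppaths a))"
    unfolding enum_list(2)[OF finite_ppaths] using trivial_path[OF assms] by (simp add: ppaths_def)
  then show ?thesis by (auto simp: in_set_conv_nth)
qed

lemma trivial_index_ipaths:
  assumes "a \<in> verts Q"
  shows "\<exists>r<length (enum_list (ipaths a)). enum_list (ipaths a) ! r = (a, [])"
proof -
  have "(a, []) \<in> set (enum_list (ipaths a))"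
    unfolding enum_list(2)[OF finite_ipaths] using trivial_path[OF assms] by (simp add: ipaths_def)
  then show ?thesis by (auto simp: in_set_conv_nth)
qed

lemma proj_idem_nonzero:
  assumes a: "a \<in> verts Q"
  shows "mact (proj a) (bs (a, [])) \<noteq> 0\<^sub>m (mdim (proj a)) (mdim (proj a))"
proof -
  note S = rooted_step_system[OF rooted_ppaths[OF a]]
  have e: "(a, []) \<in> qpaths Q" using trivial_path[OF a] nonzero_pathsD(1) by auto
  obtain r where r: "r < length (enum_list (ppaths a))" "enum_list (ppaths a) ! r = (a, [])"
    using trivial_index_ppaths[OF a] by blast
  have "mact (proj a) (bs (a, [])) $$ (r,r) = 1"
    unfolding smod_act[OF S e] using r by (simp add: kmat_index act_trivial)
  then show ?thesis using r(1) by (intro notI) simp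
qed

text \<open>\<open>V\<close> and \<open>W\<close> are unit vectors at a nonzero entry of
  \<open>e F\<close>, where \<open>e\<close> is the action of the idempotent. The entry of the
  composite at the two trivial paths is \<open>W e F e V\<close>, and this is the chosen entry,
  since \<open>F\<close> commutes with \<open>e\<close>.\<close>

lemma yon_coyon_nonzero:
  assumes X: "right_module sc X" and Y: "right_module sc Y" and F: "F \<in> mhom X Y" and a: "a \<in> verts Q"
    and nz: "mact Y (bs (a, [])) * F \<noteq> 0\<^sub>m (mdim Y) (mdim X)"
  shows "\<exists>V W. V \<in> carrier_mat (mdim X) 1 \<and> W \<in> carrier_mat 1 (mdim Y) \<and>
    coyon Y a W * F * yon X a V \<noteq> 0\<^sub>m (mdim (imod a)) (mdim (proj a))"
proof -
  note d = mact_dims[OF X] mact_dims[OF Y] mhom_dims[OF F]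
  have e: "(a, []) \<in> qpaths Q" using trivial_path[OF a] by (rule nonzero_pathsD)
  let ?F = "mact Y (bs (a, [])) * F"
  have "\<exists>i j. i < mdim Y \<and> j < mdim X \<and> ?F $$ (i,j) \<noteq> 0"
  proof (rule ccontr)
    assume "\<not> ?thesis"
    then have "?F = 0\<^sub>m (mdim Y) (mdim X)" by (intro eq_matI) (auto simp: d)
    with nz show False by simp
  qed
  then obtain i j where ij: "i < mdim Y" "j < mdim X" "?F $$ (i,j) \<noteq> 0" by blast
  define V :: "'k mat" where "V = mat (mdim X) 1 (\<lambda>(k,_). if k = j then 1 else 0)"
  define W :: "'k mat" where "W = mat 1 (mdim Y) (\<lambda>(_,k). if k = i then 1 else 0)"
  have V: "V \<in> carrier_mat (mdim X) 1" and W: "W \<in> carrier_mat 1 (mdim Y)" by (simp_all add: V_def W_def)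
  have Wp: "(W * A) $$ (0,k) = A $$ (i,k)" if "dim_row A = mdim Y" "k < dim_col A" for A :: "'k mat" and k
    using that ij(1) by (simp add: W_def scalar_prod_def if_distrib[of "\<lambda>x. x * _"] sum.delta cong: if_cong)
  have Vp: "(A * V) $$ (k,0) = A $$ (k,j)" if "dim_col A = mdim X" "k < dim_row A" for A :: "'k mat" and k
    using that ij(2) by (simp add: V_def scalar_prod_def if_distrib[of "\<lambda>x. _ * x"] sum.delta' sum.delta cong: if_cong)
  let ?ys = "enum_list (ipaths a)" and ?xs = "enum_list (ppaths a)"
  note enp = enum_list[OF finite_ppaths[of a]] and eni = enum_list[OF finite_ipaths[of a]]
  have "(a, []) \<in> set ?ys" "(a, []) \<in> set ?xs"
    unfolding enp(2) eni(2) using trivial_path[OF a] by (simp_all add: ipaths_def ppaths_def)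
  then obtain r s where rs: "r < length ?ys" "?ys ! r = (a, [])" "s < length ?xs" "?xs ! s = (a, [])"
    by (auto simp: in_set_conv_nth)
  have "(coyon Y a W * F * yon X a V) $$ (r,s) = (\<Sum>l = 0..<mdim X. (\<Sum>k = 0..<mdim Y. mact Y (bs (a, [])) $$ (i,k) * F $$ (k,l)) * mact X (bs (a, [])) $$ (l,j))"
    using rs by (simp add: coyon_def yon_def d scalar_prod_def kmat_index Wp Vp del: index_mult_mat(1) add: index_mult_mat(1)[of r "_ * _"] index_mult_mat(1)[of r "kmat _ _ _"])
  also have "\<dots> = (?F * mact X (bs (a, []))) $$ (i,j)"
    using ij by (simp add: d scalar_prod_def)
  also have "?F * mact X (bs (a, [])) = mact Y (bs (a, [])) * (F * mact X (bs (a, [])))"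
    by (rule mult_mat_assoc) (simp_all add: d)
  also have "\<dots> = mact Y (bs (a, [])) * (mact Y (bs (a, [])) * F)" by (simp only: mhom_comm[OF F])
  also have "\<dots> = (mact Y (bs (a, [])) * mact Y (bs (a, []))) * F"
    by (rule mult_mat_assoc[symmetric]) (simp_all add: d)
  also have "mact Y (bs (a, [])) * mact Y (bs (a, [])) = mact Y (bs (a, []))"
    unfolding mact_bs_mult[OF Y e e] by simp
  finally have "(coyon Y a W * F * yon X a V) $$ (r,s) \<noteq> 0" using ij(3) by simp
  then have "coyon Y a W * F * yon X a V \<noteq> 0\<^sub>m (mdim (imod a)) (mdim (proj a))"
    using rs by (intro notI) simp
  then show ?thesis using V W by (intro exI conjI)
qed

text \<open>The idempotents at the vertices add up to 1, so they cannot all annihilate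
  \<open>F\<close>.\<close>

lemma nonzero_at_vertex:
  assumes Y: "right_module sc Y" and F: "dim_row F = mdim Y" "F \<noteq> 0\<^sub>m (mdim Y) (dim_col F)"
  shows "\<exists>a\<in>verts Q. mact Y (bs (a, [])) * F \<noteq> 0\<^sub>m (mdim Y) (dim_col F)"
proof (rule ccontr)
  assume c: "\<not> ?thesis"
  have "mact Y (\<Sum>v\<in>P. bs (v, [])) * F = 0\<^sub>m (mdim Y) (dim_col F)" if "finite P" "P \<subseteq> verts Q" for P
    using that
  proof (induction P rule: finite_induct)
    case empty
    then show ?case by (simp add: mact_zero[OF Y] mult_mat_zero_left F(1))
  next
    case (insert v P)
    have "mact Y (bs (v, [])) * F = 0\<^sub>m (mdim Y) (dim_col F)" using c insert by blast
    then show ?case using insert F(1) by (simp add: mact_simps(1)[OF Y] mact_dims[OF Y] mult_mat_add_left)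
  qed
  from this[OF finite_verts subset_refl] have "mact Y 1 * F = 0\<^sub>m (mdim Y) (dim_col F)" unfolding one_eq .
  with F show False unfolding mact_simps(4)[OF Y] by (simp add: left_mult_one_mat')
qed

lemma coyon_yon_hom:
  assumes X: "right_module sc X" and Y: "right_module sc Y" and F: "F \<in> mhom X Y" and a: "a \<in> verts Q"
    and V: "V \<in> carrier_mat (mdim X) 1" and W: "W \<in> carrier_mat 1 (mdim Y)"
  shows "coyon Y a W * F * yon X a V \<in> mhom (proj a) (imod a)"
proof -
  have P: "right_module sc (proj a)" by (rule smod_right_module[OF rooted_step_system[OF rooted_ppaths[OF a]]])
  have I: "right_module sc (imod a)" by (rule smod_right_module[OF imod_step_system])
  show ?thesis
    by (rule mhom_mult[OF P X I yon_hom[OF X a V] mhom_mult[OF X Y I F coyon_hom[OF Y a W]]])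
qed

lemma proj_inj_nonzero_hom:
  assumes a: "a \<in> verts Q"
  shows "\<exists>G\<in>mhom (proj a) (imod a). G \<noteq> 0\<^sub>m (mdim (imod a)) (mdim (proj a))"
proof -
  note P = smod_right_module[OF rooted_step_system[OF rooted_ppaths[OF a]]]
  have nz: "mact (proj a) (bs (a, [])) * 1\<^sub>m (mdim (proj a)) \<noteq> 0\<^sub>m (mdim (proj a)) (mdim (proj a))"
    using proj_idem_nonzero[OF a] by (simp add: right_mult_one_mat' mact_dims[OF P])
  have one: "1\<^sub>m (mdim (proj a)) \<in> mhom (proj a) (proj a)" by (rule mhom_one[OF P])
  from yon_coyon_nonzero[OF P P one a nz] obtain V W where
    VW: "V \<in> carrier_mat (mdim (proj a)) 1" "W \<in> carrier_mat 1 (mdim (proj a))"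
      "coyon (proj a) a W * 1\<^sub>m (mdim (proj a)) * yon (proj a) a V \<noteq> 0\<^sub>m (mdim (imod a)) (mdim (proj a))"
    by (elim exE conjE) (rule that; assumption)
  show ?thesis
    by (rule bexI[where x = "coyon (proj a) a W * 1\<^sub>m (mdim (proj a)) * yon (proj a) a V"])
      (rule VW(3), rule coyon_yon_hom[OF P P one a VW(1,2)])
qed

end

section \<open>Irreducible morphisms given by arrows\<close>

text \<open>Serves to discard the one column in which an intertwining equation may fail, in
  \<open>corrected_hom_left\<close>.\<close>

lemma mult_mat_agree_left:
  fixes D D' h :: "'k :: semiring_0 mat"
  assumes "dim_row D = dim_row D'" "dim_col D = dim_row h" "dim_col D' = dim_row h"
    and "\<And>i j. i < dim_row D' \<Longrightarrow> j < dim_row h \<Longrightarrow> j \<noteq> r \<Longrightarrow> D $$ (i,j) = D' $$ (i,j)"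
    and "\<And>k. k < dim_col h \<Longrightarrow> h $$ (r,k) = 0"
  shows "D * h = D' * h"
proof (rule eq_matI)
  fix i k assume "i < dim_row (D' * h)" "k < dim_col (D' * h)"
  then have ik: "i < dim_row D'" "k < dim_col h" by simp_all
  have "(\<Sum>j = 0..<dim_row h. D $$ (i,j) * h $$ (j,k)) = (\<Sum>j = 0..<dim_row h. D' $$ (i,j) * h $$ (j,k))"
  proof (rule sum.cong[OF refl])
    fix j assume "j \<in> {0..<dim_row h}"
    then show "D $$ (i,j) * h $$ (j,k) = D' $$ (i,j) * h $$ (j,k)"
      using assms(4)[OF ik(1), of j] assms(5)[OF ik(2)] by (cases "j = r") auto
  qed
  then show "(D * h) $$ (i,k) = (D' * h) $$ (i,k)" using ik assms(1-3) by (simp add: scalar_prod_def)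
qed (use assms in auto)

lemma mult_mat_agree_right:
  fixes D D' g :: "'k :: semiring_0 mat"
  assumes "dim_col D = dim_col D'" "dim_row D = dim_col g" "dim_row D' = dim_col g"
    and "\<And>i j. i < dim_col g \<Longrightarrow> j < dim_col D' \<Longrightarrow> i \<noteq> s \<Longrightarrow> D $$ (i,j) = D' $$ (i,j)"
    and "\<And>k. k < dim_row g \<Longrightarrow> g $$ (k,s) = 0"
  shows "g * D = g * D'"
proof (rule eq_matI)
  fix k j assume "k < dim_row (g * D')" "j < dim_col (g * D')"
  then have kj: "k < dim_row g" "j < dim_col D'" by simp_all
  have "(\<Sum>i = 0..<dim_col g. g $$ (k,i) * D $$ (i,j)) = (\<Sum>i = 0..<dim_col g. g $$ (k,i) * D' $$ (i,j))"
  proof (rule sum.cong[OF refl])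
    fix i assume "i \<in> {0..<dim_col g}"
    then show "g $$ (k,i) * D $$ (i,j) = g $$ (k,i) * D' $$ (i,j)"
      using assms(4)[OF _ kj(2), of i] assms(5)[OF kj(1)] by (cases "i = s") auto
  qed
  then show "(g * D) $$ (k,j) = (g * D') $$ (k,j)" using kj assms(1-3) by (simp add: scalar_prod_def)
qed (use assms in auto)

context path_basis begin

text \<open>For a matrix with entries 0 and 1 the intertwining equation becomes an equivalence of
  two existence statements, as \<open>inj\<close> leaves at most one nonzero term in the
  sum.\<close>

lemma indicator_intertwining:
  assumes A: "step_system xs vx st" and x: "x \<in> set xs" and p: "p \<in> N"
    and inj: "\<And>y y'. y \<in> set ys \<Longrightarrow> y' \<in> set ys \<Longrightarrow> act vy sy y p = Some z \<Longrightarrow> act vy sy y' p = Some z \<Longrightarrow> y = y'"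
    and iff: "(\<exists>y. act vx st x p = Some y \<and> T z y) \<longleftrightarrow> (\<exists>y\<in>set ys. act vy sy y p = Some z \<and> T y x)"
  shows "(case act vx st x p of None \<Rightarrow> 0 | Some y \<Rightarrow> (if T z y then 1 else 0 :: 'k)) =
    (\<Sum>y\<in>set ys. (if act vy sy y p = Some z then 1 else 0) * (if T y x then 1 else 0))"
proof -
  have "(\<Sum>y\<in>set ys. (if act vy sy y p = Some z then 1 else 0) * (if T y x then 1 else 0)) =
      (if \<exists>y\<in>set ys. act vy sy y p = Some z \<and> T y x then 1 else 0 :: 'k)"
  proof (cases "\<exists>y\<in>set ys. act vy sy y p = Some z \<and> T y x")
    case True
    then obtain w where w: "w \<in> set ys" "act vy sy w p = Some z" "T w x" by blast
    have "(\<Sum>y\<in>set ys. (if act vy sy y p = Some z then 1 else 0) * (if T y x then 1 else 0)) =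
        (\<Sum>y\<in>set ys. if y = w then 1 else 0 :: 'k)"
    proof (intro sum.cong refl)
      fix y assume y: "y \<in> set ys"
      show "(if act vy sy y p = Some z then 1 else 0) * (if T y x then 1 else 0) = (if y = w then 1 else 0 :: 'k)"
      proof (cases "y = w")
        case False
        then have "act vy sy y p \<noteq> Some z" using inj[OF y w(1) _ w(2)] by blast
        then show ?thesis using False by simp
      qed (simp add: w(2,3))
    qed
    also have "\<dots> = 1" using w(1) by simp
    finally show ?thesis by (simp only: True if_True)
  next
    case False
    have "(\<Sum>y\<in>set ys. (if act vy sy y p = Some z then 1 else 0) * (if T y x then 1 else 0)) = (0 :: 'k)"
      by (rule sum.neutral) (use False in \<open>simp split: if_split\<close>)
    then show ?thesis by (simp only: False if_False)
  qed
  also have "(if \<exists>y\<in>set ys. act vy sy y p = Some z \<and> T y x then 1 else 0 :: 'k) =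
      (case act vx st x p of None \<Rightarrow> 0 | Some y \<Rightarrow> (if T z y then 1 else 0))"
    unfolding iff[symmetric] by (cases "act vx st x p") simp_all
  finally show ?thesis by simp
qed

text \<open>A linear map that commutes with the action except at one basis element becomes a homomorphism
  when composed with one that avoids this basis element.\<close>

lemma corrected_hom_left:
  assumes A: "step_system xs vx st" and B: "step_system ys vy sy" and Z: "right_module sc Z"
    and h: "h \<in> mhom Z (smod xs vx st)" and r: "r < length xs"
    and h0: "\<And>j. j < mdim Z \<Longrightarrow> h $$ (r,j) = 0"
    and e: "\<And>p x z. p \<in> N \<Longrightarrow> x \<in> set xs \<Longrightarrow> x \<noteq> xs ! r \<Longrightarrow> z \<in> set ys \<Longrightarrow>
      (case act vx st x p of None \<Rightarrow> 0 | Some y \<Rightarrow> K z y) = (\<Sum>y\<in>set ys. (if act vy sy y p = Some z then 1 else 0) * K y x)"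
  shows "kmat ys xs K * h \<in> mhom Z (smod ys vy sy)"
proof (rule mhom_pathsI[OF Z smod_right_module[OF B]])
  note d = mhom_dims[OF h] mact_dims[OF Z] mact_dims[OF smod_right_module[OF A]] mact_dims[OF smod_right_module[OF B]]
  have dist: "distinct xs" "distinct ys" using A B by (auto simp: step_system_def)
  fix p assume p: "p \<in> N"
  then have pq: "p \<in> qpaths Q" by (rule nonzero_pathsD)
  let ?W = "kmat ys xs K" and ?X = "mact (smod xs vx st) (bs p)" and ?Y = "mact (smod ys vy sy) (bs p)"
  have "?W * ?X * h = ?Y * ?W * h"
  proof (rule mult_mat_agree_left)
    fix i j assume "i < dim_row (?Y * ?W)" "j < dim_row h" and jr: "j \<noteq> r"
    then have ij: "i < length ys" "j < length xs" by (simp_all add: d)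
    have n: "xs ! j \<noteq> xs ! r" using dist(1) ij(2) r jr by (simp add: nth_eq_iff_index_eq)
    show "(?W * ?X) $$ (i,j) = (?Y * ?W) $$ (i,j)"
      unfolding smod_act[OF A pq] smod_act[OF B pq] kmat_mult[OF dist(1)] kmat_mult[OF dist(2)] kmat_index[OF ij]
        e[OF p nth_mem[OF ij(2)] n nth_mem[OF ij(1)], symmetric]
      using act_awalk(1)[OF A nth_mem[OF ij(2)] pq] by (intro sum_option_bind(1)) simp_all
  qed (simp_all add: d h0)
  then have e1: "?W * (?X * h) = ?Y * (?W * h)"
    by (simp add: mult_mat_assoc d)
  show "?W * h * mact Z (bs p) = ?Y * (?W * h)"
    unfolding e1[symmetric] mhom_comm[OF h, symmetric] by (rule mult_mat_assoc) (simp_all add: d)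
qed (simp_all add: mhom_dims[OF h])

lemma corrected_hom_right:
  assumes A: "step_system xs vx st" and B: "step_system ys vy sy" and Z: "right_module sc Z"
    and g: "g \<in> mhom (smod ys vy sy) Z" and s: "s < length ys"
    and g0: "\<And>i. i < mdim Z \<Longrightarrow> g $$ (i,s) = 0"
    and e: "\<And>p x z. p \<in> N \<Longrightarrow> x \<in> set xs \<Longrightarrow> z \<in> set ys \<Longrightarrow> z \<noteq> ys ! s \<Longrightarrow>
      (case act vx st x p of None \<Rightarrow> 0 | Some y \<Rightarrow> K z y) = (\<Sum>y\<in>set ys. (if act vy sy y p = Some z then 1 else 0) * K y x)"
  shows "g * kmat ys xs K \<in> mhom (smod xs vx st) Z"
proof (rule mhom_pathsI[OF smod_right_module[OF A] Z])
  note d = mhom_dims[OF g] mact_dims[OF Z] mact_dims[OF smod_right_module[OF A]] mact_dims[OF smod_right_module[OF B]]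
  have dist: "distinct xs" "distinct ys" using A B by (auto simp: step_system_def)
  fix p assume p: "p \<in> N"
  then have pq: "p \<in> qpaths Q" by (rule nonzero_pathsD)
  let ?W = "kmat ys xs K" and ?X = "mact (smod xs vx st) (bs p)" and ?Y = "mact (smod ys vy sy) (bs p)"
  have "g * (?W * ?X) = g * (?Y * ?W)"
  proof (rule mult_mat_agree_right)
    fix i j assume "i < dim_col g" "j < dim_col (?Y * ?W)" and is': "i \<noteq> s"
    then have ij: "i < length ys" "j < length xs" by (simp_all add: d)
    have n: "ys ! i \<noteq> ys ! s" using dist(2) ij(1) s is' by (simp add: nth_eq_iff_index_eq)
    show "(?W * ?X) $$ (i,j) = (?Y * ?W) $$ (i,j)"
      unfolding smod_act[OF A pq] smod_act[OF B pq] kmat_mult[OF dist(1)] kmat_mult[OF dist(2)] kmat_index[OF ij]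
        e[OF p nth_mem[OF ij(2)] nth_mem[OF ij(1)] n, symmetric]
      using act_awalk(1)[OF A nth_mem[OF ij(2)] pq] by (intro sum_option_bind(1)) simp_all
  qed (simp_all add: d g0)
  moreover have "g * (?Y * ?W) = (g * ?Y) * ?W" by (rule mult_mat_assoc[symmetric]) (simp_all add: d)
  ultimately have e1: "g * (?W * ?X) = (mact Z (bs p) * g) * ?W" by (simp only: mhom_comm[OF g])
  have "g * ?W * ?X = g * (?W * ?X)" by (rule mult_mat_assoc) (simp_all add: d)
  also have "\<dots> = mact Z (bs p) * (g * ?W)" unfolding e1 by (rule mult_mat_assoc) (simp_all add: d)
  finally show "g * ?W * ?X = mact Z (bs p) * (g * ?W)" .
qed (simp_all add: mhom_dims[OF g])

lemma nonzero_subpath: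
  assumes "(u, k @ l @ m) \<in> N"
  shows "(awlast u k, l) \<in> N" "path_end Q (awlast u k, l) = awlast u (k @ l)"
proof -
  from nonzero_pathsD(1)[OF assms] have w: "awalk (awlast u k) l (awlast (awlast u k) l)"
    by (simp add: qpaths_iff)
  moreover have "\<not> contains_relation R l"
    using nonzero_pathsD(2)[OF assms] contains_relation_append[of R l k m] by auto
  ultimately show "(awlast u k, l) \<in> N" by (simp add: nonzero_paths_def qpaths_iff)
  show "path_end Q (awlast u k, l) = awlast u (k @ l)" by (simp add: awlast_append)
qed

lemma act_ppaths_iff:
  assumes "a \<in> verts Q" "x \<in> ppaths a" "p \<in> N"
  shows "act fst (pstep (ppaths a)) x p = Some y \<longleftrightarrow> path_end Q p = fst x \<and> y = (fst p, snd p @ snd x) \<and> y \<in> N"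
  unfolding act_ppaths[OF assms(1,2) nonzero_pathsD(1)[OF assms(3)]] by auto

lemma act_ipaths_iff:
  "act (path_end Q) istep x p = Some y \<longleftrightarrow> path_end Q p = path_end Q x \<and> fst y = fst x \<and> snd x = snd y @ snd p"
  unfolding act_def by (auto simp: irun)

text \<open>Left multiplication by \<open>\<beta>\<close>, from \<open>P\<close> at the tail to
  \<open>P\<close> at the head: in the order of products it appends \<open>\<beta>\<close> at the
  end of a path.\<close>

definition lmult :: "'b \<Rightarrow> 'k mat" where
  "lmult \<beta> = kmat (enum_list (ppaths (head Q \<beta>))) (enum_list (ppaths (tail Q \<beta>)))
     (\<lambda>y x. if y = (fst x, snd x @ [\<beta>]) then 1 else 0)"

text \<open>The transpose of right multiplication by \<open>\<beta>\<close>, which puts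
  \<open>\<beta>\<close> in front of a path; on dual basis elements it therefore cancels a first
  arrow \<open>\<beta>\<close>.\<close>

definition lmult_dual :: "'b \<Rightarrow> 'k mat" where
  "lmult_dual \<beta> = kmat (enum_list (ipaths (head Q \<beta>))) (enum_list (ipaths (tail Q \<beta>)))
     (\<lambda>y x. if x = (tail Q \<beta>, \<beta> # snd y) then 1 else 0)"

lemma lmult_hom:
  assumes \<beta>: "\<beta> \<in> arcs Q"
  shows "lmult \<beta> \<in> mhom (proj (tail Q \<beta>)) (proj (head Q \<beta>))"
  unfolding lmult_def
proof (rule smod_homI)
  let ?a = "head Q \<beta>" and ?b = "tail Q \<beta>"
  note v = head_in_verts[OF \<beta>] tail_in_verts[OF \<beta>]
  show A: "step_system (enum_list (ppaths ?b)) fst (pstep (ppaths ?b))" by (rule rooted_step_system[OF rooted_ppaths[OF v(2)]])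
  show "step_system (enum_list (ppaths ?a)) fst (pstep (ppaths ?a))" by (rule rooted_step_system[OF rooted_ppaths[OF v(1)]])
  fix p x z assume p: "p \<in> N" and x': "x \<in> set (enum_list (ppaths ?b))" and z': "z \<in> set (enum_list (ppaths ?a))"
  note en = enum_list(2)[OF finite_ppaths]
  have x: "x \<in> ppaths ?b" and z: "z \<in> ppaths ?a" using x' z' by (simp_all add: en)
  show "(case act fst (pstep (ppaths ?b)) x p of None \<Rightarrow> 0 | Some y \<Rightarrow> (if z = (fst y, snd y @ [\<beta>]) then 1 else 0 :: 'k)) =
      (\<Sum>y\<in>set (enum_list (ppaths ?a)). (if act fst (pstep (ppaths ?a)) y p = Some z then 1 else 0) *
        (if y = (fst x, snd x @ [\<beta>]) then 1 else 0))"
  proof (rule indicator_intertwining[OF A x' p], unfold en)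
    fix y y' assume "y \<in> ppaths ?a" "y' \<in> ppaths ?a" "act fst (pstep (ppaths ?a)) y p = Some z" "act fst (pstep (ppaths ?a)) y' p = Some z"
    then show "y = y'" by (simp add: act_ppaths_iff[OF v(1) _ p] prod_eq_iff)
  next
    show "(\<exists>y. act fst (pstep (ppaths ?b)) x p = Some y \<and> z = (fst y, snd y @ [\<beta>])) \<longleftrightarrow>
      (\<exists>y\<in>ppaths ?a. act fst (pstep (ppaths ?a)) y p = Some z \<and> y = (fst x, snd x @ [\<beta>]))"
    proof
      assume "\<exists>y. act fst (pstep (ppaths ?b)) x p = Some y \<and> z = (fst y, snd y @ [\<beta>])"
      then have e: "path_end Q p = fst x" "z = (fst p, snd p @ snd x @ [\<beta>])"
        using act_ppaths_iff[OF v(2) x p] by auto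
      have zN: "(fst p, snd p @ (snd x @ [\<beta>]) @ []) \<in> N" "path_end Q z = ?a" using z e(2) by (auto simp: ppaths_def)
      from nonzero_subpath[OF zN(1)] e(1) zN(2)[unfolded e(2)]
      have y: "(fst x, snd x @ [\<beta>]) \<in> ppaths ?a" by (simp add: ppaths_def)
      moreover have "act fst (pstep (ppaths ?a)) (fst x, snd x @ [\<beta>]) p = Some z"
        using zN(1) e by (simp add: act_ppaths_iff[OF v(1) y p])
      ultimately show "\<exists>y\<in>ppaths ?a. act fst (pstep (ppaths ?a)) y p = Some z \<and> y = (fst x, snd x @ [\<beta>])"
        by (intro bexI[of _ "(fst x, snd x @ [\<beta>])"] conjI refl)
    next
      assume "\<exists>y\<in>ppaths ?a. act fst (pstep (ppaths ?a)) y p = Some z \<and> y = (fst x, snd x @ [\<beta>])"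
      then have y: "(fst x, snd x @ [\<beta>]) \<in> ppaths ?a" and A: "act fst (pstep (ppaths ?a)) (fst x, snd x @ [\<beta>]) p = Some z"
        by simp_all
      from A[unfolded act_ppaths_iff[OF v(1) y p]]
      have e: "path_end Q p = fst x" "z = (fst p, snd p @ snd x @ [\<beta>])" by simp_all
      then have "(fst p, [] @ (snd p @ snd x) @ [\<beta>]) \<in> N" using z by (simp add: ppaths_def)
      from nonzero_subpath(1)[OF this] have "act fst (pstep (ppaths ?b)) x p = Some (fst p, snd p @ snd x)"
        using e(1) by (simp add: act_ppaths_iff[OF v(2) x p])
      then show "\<exists>y. act fst (pstep (ppaths ?b)) x p = Some y \<and> z = (fst y, snd y @ [\<beta>])" using e(2) by auto
    qed
  qed
qed

lemma lmult_dual_hom: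
  assumes \<beta>: "\<beta> \<in> arcs Q"
  shows "lmult_dual \<beta> \<in> mhom (imod (tail Q \<beta>)) (imod (head Q \<beta>))"
  unfolding lmult_dual_def
proof (rule smod_homI[OF imod_step_system imod_step_system])
  let ?a = "head Q \<beta>" and ?b = "tail Q \<beta>"
  fix p x z assume p: "p \<in> N" and x': "x \<in> set (enum_list (ipaths ?b))" and z': "z \<in> set (enum_list (ipaths ?a))"
  note en = enum_list(2)[OF finite_ipaths]
  have x: "x \<in> ipaths ?b" and z: "z \<in> ipaths ?a" using x' z' by (simp_all add: en)
  show "(case act (path_end Q) istep x p of None \<Rightarrow> 0 | Some y \<Rightarrow> (if y = (?b, \<beta> # snd z) then 1 else 0 :: 'k)) =
      (\<Sum>y\<in>set (enum_list (ipaths ?a)). (if act (path_end Q) istep y p = Some z then 1 else 0) *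
        (if x = (?b, \<beta> # snd y) then 1 else 0))"
  proof (rule indicator_intertwining[OF imod_step_system x' p, where T = "\<lambda>y x. x = (?b, \<beta> # snd y)"], unfold en)
    fix y y' assume "act (path_end Q) istep y p = Some z" "act (path_end Q) istep y' p = Some z"
    then show "y = y'" by (simp add: act_ipaths_iff prod_eq_iff)
  next
    show "(\<exists>y. act (path_end Q) istep x p = Some y \<and> y = (?b, \<beta> # snd z)) \<longleftrightarrow>
      (\<exists>y\<in>ipaths ?a. act (path_end Q) istep y p = Some z \<and> x = (?b, \<beta> # snd y))"
    proof
      assume "\<exists>y. act (path_end Q) istep x p = Some y \<and> y = (?b, \<beta> # snd z)"
      then have e: "path_end Q p = path_end Q x" "x = (?b, \<beta> # snd z @ snd p)"
        by (auto simp: act_ipaths_iff prod_eq_iff)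
      then have "(?b, [\<beta>] @ (snd z @ snd p) @ []) \<in> N" using x by (simp add: ipaths_def)
      from nonzero_subpath(1)[OF this] have "(?a, snd z @ snd p) \<in> ipaths ?a" by (simp add: ipaths_def)
      moreover have "act (path_end Q) istep (?a, snd z @ snd p) p = Some z"
        using e z by (simp add: act_ipaths_iff ipaths_def)
      ultimately show "\<exists>y\<in>ipaths ?a. act (path_end Q) istep y p = Some z \<and> x = (?b, \<beta> # snd y)"
        using e(2) by (intro bexI[of _ "(?a, snd z @ snd p)"]) simp_all
    next
      assume "\<exists>y\<in>ipaths ?a. act (path_end Q) istep y p = Some z \<and> x = (?b, \<beta> # snd y)"
      then show "\<exists>y. act (path_end Q) istep x p = Some y \<and> y = (?b, \<beta> # snd z)"
        by (auto simp: act_ipaths_iff ipaths_def)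
    qed
  qed
qed

lemma not_split_epi_of_row:
  assumes r: "r < mdim Y" "\<And>j. j < mdim X \<Longrightarrow> F $$ (r,j) = 0"
  shows "\<not> split_epi X Y F"
proof
  assume "split_epi X Y F"
  then obtain G where F: "F \<in> mhom X Y" and G: "G \<in> mhom Y X" and FG: "F * G = 1\<^sub>m (mdim Y)"
    unfolding split_epi_def by (elim conjE bexE) (rule that; assumption)
  have "(F * G) $$ (r,r) = 0"
    using r by (simp add: scalar_prod_def mhom_dims[OF F] mhom_dims[OF G])
  then show False unfolding FG using r(1) by simp
qed

lemma not_split_mono_of_col:
  assumes s: "s < mdim X" "\<And>i. i < mdim Y \<Longrightarrow> F $$ (i,s) = 0"
  shows "\<not> split_mono X Y F"
proof
  assume "split_mono X Y F"
  then obtain G where F: "F \<in> mhom X Y" and G: "G \<in> mhom Y X" and GF: "G * F = 1\<^sub>m (mdim X)"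
    unfolding split_mono_def by (elim conjE bexE) (rule that; assumption)
  have "(G * F) $$ (s,s) = 0"
    using s by (simp add: scalar_prod_def mhom_dims[OF F] mhom_dims[OF G])
  then show False unfolding GF using s(1) by simp
qed

end

context directed_path_basis begin

lemma proj_indecomposable: "a \<in> verts Q \<Longrightarrow> indecomposable sc (proj a)"
  by (rule rooted_indecomposable[OF rooted_ppaths])

lemma nonsplit_endo_zero:
  assumes X: "indecomposable sc X" and F: "F \<in> mrad X Z" and Z: "right_module sc Z" and G: "G \<in> mhom Z X"
  shows "G * F = 0\<^sub>m (mdim X) (mdim X)"
proof (rule ccontr)
  note mX = indecomposableD(1)[OF X]
  assume n: "G * F \<noteq> 0\<^sub>m (mdim X) (mdim X)"
  have "rad_power sc 1 X X (G * F)" by (rule rad_power_mult_left[OF rad_power_one[OF mX F] mX Z mX G])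
  from rad_power_nonzero_walk[OF X X this n] AR_walk_closed[OF X] show False by fastforce
qed

lemma nonsplit_endo_zero':
  assumes X: "indecomposable sc X" and F: "F \<in> mrad Z X" and Z: "right_module sc Z" and G: "G \<in> mhom X Z"
  shows "F * G = 0\<^sub>m (mdim X) (mdim X)"
proof (rule ccontr)
  note mX = indecomposableD(1)[OF X]
  assume n: "F * G \<noteq> 0\<^sub>m (mdim X) (mdim X)"
  have "rad_power sc (0 + 1) X X (F * G)"
    by (rule rad_power_mult[OF rad_power_one[OF Z F] rad_power.zero[OF G] mX Z mX])
  then have "rad_power sc 1 X X (F * G)" by simp
  from rad_power_nonzero_walk[OF X X this n] AR_walk_closed[OF X] show False by fastforce
qed

text \<open>The image of \<open>h\<close> avoids the top of \<open>P\<^sub>a\<close>: for each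
  column of \<open>h\<close>, the composite with the matching map \<open>yon\<close> is a radical
  endomorphism of \<open>P\<^sub>a\<close>, hence zero, and its entry at the trivial path is the
  entry of \<open>h\<close> in question.\<close>

lemma proj_row_zero:
  assumes a: "a \<in> verts Q" and Z: "right_module sc Z" and h: "h \<in> mhom Z (proj a)" and n: "\<not> split_epi Z (proj a) h"
    and r: "r < length (enum_list (ppaths a))" "enum_list (ppaths a) ! r = (a, [])" and j: "j < mdim Z"
  shows "h $$ (r,j) = 0"
proof -
  note P = indecomposableD(1)[OF proj_indecomposable[OF a]]
  have rad: "h \<in> mrad Z (proj a)" by (rule mrad_of_not_split_epi[OF proj_indecomposable[OF a] Z h n])
  note S = rooted_step_system[OF rooted_ppaths[OF a]] and en = enum_list[OF finite_ppaths[of a]]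
  have e: "(a, []) \<in> qpaths Q" using trivial_path[OF a] by (rule nonzero_pathsD)
  define V :: "'k mat" where "V = mat (mdim Z) 1 (\<lambda>(k,_). if k = j then 1 else 0)"
  have V: "V \<in> carrier_mat (mdim Z) 1" by (simp add: V_def)
  have Vp: "(A * V) $$ (k,0) = A $$ (k,j)" if "dim_col A = mdim Z" "k < dim_row A" for A :: "'k mat" and k
    using that j by (simp add: V_def scalar_prod_def if_distrib[of "\<lambda>x. _ * x"] sum.delta' sum.delta cong: if_cong)
  note d = mhom_dims[OF h] mact_dims[OF Z] mact_dims[OF P]
  let ?e = "bs (a, [])"
  have "0 = (h * yon Z a V) $$ (r,r)"
    unfolding nonsplit_endo_zero'[OF proj_indecomposable[OF a] rad Z yon_hom[OF Z a V]] using r(1) by simp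
  also have "\<dots> = (\<Sum>i = 0..<mdim Z. h $$ (r,i) * mact Z ?e $$ (i,j))"
    using r by (simp add: yon_def scalar_prod_def d kmat_index Vp del: index_mult_mat(1) add: index_mult_mat(1)[of r h])
  also have "\<dots> = (h * mact Z ?e) $$ (r,j)" using r(1) j by (simp add: scalar_prod_def d)
  also have "\<dots> = (mact (proj a) ?e * h) $$ (r,j)" by (simp only: mhom_comm[OF h])
  also have "\<dots> = (\<Sum>i = 0..<length (enum_list (ppaths a)). mact (proj a) ?e $$ (r,i) * h $$ (i,j))"
    using r(1) j by (simp add: scalar_prod_def d)
  also have "\<dots> = (\<Sum>i = 0..<length (enum_list (ppaths a)). if i = r then h $$ (i,j) else 0)"
  proof (intro sum.cong refl)
    fix i assume "i \<in> {0..<length (enum_list (ppaths a))}"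
    then have i: "i < length (enum_list (ppaths a))" by simp
    have "mact (proj a) ?e $$ (r,i) = (if i = r then 1 else 0)"
      unfolding smod_act[OF S e] kmat_index[OF r(1) i] act_trivial
      using r(2) nth_eq_iff_index_eq[OF en(1) i r(1)] by (cases "i = r") simp_all
    then show "mact (proj a) ?e $$ (r,i) * h $$ (i,j) = (if i = r then h $$ (i,j) else 0)" by simp
  qed
  also have "\<dots> = h $$ (r,j)" using r(1) by simp
  finally show ?thesis by simp
qed

text \<open>Dual to \<open>proj_row_zero\<close>: \<open>g\<close> kills the socle of
  \<open>I\<^sub>b\<close>.\<close>

lemma inj_col_zero:
  assumes b: "b \<in> verts Q" and Z: "right_module sc Z" and g: "g \<in> mhom (imod b) Z" and n: "\<not> split_mono (imod b) Z g"
    and s: "s < length (enum_list (ipaths b))" "enum_list (ipaths b) ! s = (b, [])" and i: "i < mdim Z"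
  shows "g $$ (i,s) = 0"
proof -
  note P = indecomposableD(1)[OF injective_indecomposable[OF b]]
  have rad: "g \<in> mrad (imod b) Z" by (rule mrad_of_not_split_mono[OF injective_indecomposable[OF b] Z g n])
  note S = imod_step_system[of b] and en = enum_list[OF finite_ipaths[of b]]
  have e: "(b, []) \<in> qpaths Q" using trivial_path[OF b] by (rule nonzero_pathsD)
  define W :: "'k mat" where "W = mat 1 (mdim Z) (\<lambda>(_,k). if k = i then 1 else 0)"
  have W: "W \<in> carrier_mat 1 (mdim Z)" by (simp add: W_def)
  have Wp: "(W * A) $$ (0,k) = A $$ (i,k)" if "dim_row A = mdim Z" "k < dim_col A" for A :: "'k mat" and k
    using that i by (simp add: W_def scalar_prod_def if_distrib[of "\<lambda>x. x * _"] sum.delta cong: if_cong)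
  note d = mhom_dims[OF g] mact_dims[OF Z] mact_dims[OF P]
  let ?e = "bs (b, [])" and ?n = "length (enum_list (ipaths b))"
  have "0 = (coyon Z b W * g) $$ (s,s)"
    unfolding nonsplit_endo_zero[OF injective_indecomposable[OF b] rad Z coyon_hom[OF Z b W]] using s(1) by simp
  also have "\<dots> = (\<Sum>k = 0..<mdim Z. mact Z ?e $$ (i,k) * g $$ (k,s))"
    using s by (simp add: coyon_def scalar_prod_def d kmat_index Wp del: index_mult_mat(1) add: index_mult_mat(1)[of s "kmat _ _ _"])
  also have "\<dots> = (mact Z ?e * g) $$ (i,s)" using s(1) i by (simp add: scalar_prod_def d)
  also have "\<dots> = (g * mact (imod b) ?e) $$ (i,s)" by (simp only: mhom_comm[OF g])
  also have "\<dots> = (\<Sum>k = 0..<?n. g $$ (i,k) * mact (imod b) ?e $$ (k,s))"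
    using s(1) i by (simp add: scalar_prod_def d)
  also have "\<dots> = (\<Sum>k = 0..<?n. if k = s then g $$ (i,k) else 0)"
  proof (intro sum.cong refl)
    fix k assume "k \<in> {0..<?n}"
    then have k: "k < ?n" by simp
    have "mact (imod b) ?e $$ (k,s) = (if k = s then 1 else 0)"
      unfolding smod_act[OF S e] kmat_index[OF k s(1)] act_trivial
      using s(2) nth_eq_iff_index_eq[OF en(1) k s(1)] by (cases "k = s") simp_all
    then show "g $$ (i,k) * mact (imod b) ?e $$ (k,s) = (if k = s then g $$ (i,k) else 0)" by simp
  qed
  also have "\<dots> = g $$ (i,s)" using s(1) by simp
  finally show ?thesis by simp
qed

end

context path_basis begin

text \<open>A relation inside of \<open>x\<close> followed by \<open>\<beta>\<close> either lies in
  \<open>x\<close> or ends with that \<open>\<beta>\<close>.\<close>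

lemma rmult_nonzero:
  assumes "\<beta> \<in> arcs Q" "\<And>r. r \<in> R \<Longrightarrow> last r \<noteq> \<beta>" "x \<in> ppaths (tail Q \<beta>)"
  shows "(fst x, snd x @ [\<beta>]) \<in> ppaths (head Q \<beta>)"
proof -
  have x: "x \<in> N" "path_end Q x = tail Q \<beta>" using assms(3) by (simp_all add: ppaths_def)
  have "(tail Q \<beta>, [\<beta>]) \<in> qpaths Q" "path_end Q (tail Q \<beta>, [\<beta>]) = head Q \<beta>" using nonzero_pathsD(1)[OF arrow_path[OF assms(1)]] by auto
  from qpaths_compose[OF this(1) nonzero_pathsD(1)[OF x(1)]] x(2) this(2)
  have q: "(fst x, snd x @ [\<beta>]) \<in> qpaths Q" "path_end Q (fst x, snd x @ [\<beta>]) = head Q \<beta>" by simp_all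
  have "\<not> contains_relation R (snd x @ [\<beta>])"
  proof
    assume "contains_relation R (snd x @ [\<beta>])"
    then obtain r k m where r: "r \<in> R" "snd x @ [\<beta>] = k @ r @ m" by (auto simp: contains_relation_def sublist_def)
    have "r \<noteq> []" using rel_length[OF r(1)] by auto
    show False
    proof (cases m rule: rev_cases)
      case Nil
      then have "last (k @ r) = \<beta>" using r(2) by (metis append_Nil2 last_snoc)
      then show False using assms(2)[OF r(1)] \<open>r \<noteq> []\<close> by simp
    next
      case (snoc m' \<gamma>)
      then have "snd x = k @ r @ m'" using r(2) by simp
      then have "contains_relation R (snd x)" using r(1) by (auto simp: contains_relation_def sublist_def)
      then show False using nonzero_pathsD(2)[OF x(1)] by simp
    qed
  qed
  then show ?thesis using q by (simp add: ppaths_def nonzero_paths_def)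
qed

lemma lmult_nonzero:
  assumes "\<beta> \<in> arcs Q" "\<And>r. r \<in> R \<Longrightarrow> hd r \<noteq> \<beta>" "x \<in> ipaths (head Q \<beta>)"
  shows "(tail Q \<beta>, \<beta> # snd x) \<in> ipaths (tail Q \<beta>)"
proof -
  have x: "x \<in> N" "fst x = head Q \<beta>" using assms(3) by (simp_all add: ipaths_def)
  have "(tail Q \<beta>, [\<beta>]) \<in> qpaths Q" using nonzero_pathsD(1)[OF arrow_path[OF assms(1)]] by auto
  from qpaths_compose(1)[OF nonzero_pathsD(1)[OF x(1)] this] x(2)
  have q: "(tail Q \<beta>, \<beta> # snd x) \<in> qpaths Q" by simp
  have "\<not> contains_relation R (\<beta> # snd x)"
  proof
    assume "contains_relation R (\<beta> # snd x)"
    then obtain r k m where r: "r \<in> R" "\<beta> # snd x = k @ r @ m" by (auto simp: contains_relation_def sublist_def)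
    have n: "r \<noteq> []" using rel_length[OF r(1)] by auto
    show False
    proof (cases k)
      case Nil
      then have "hd r = \<beta>" using r(2) n by (metis append_Nil hd_append2 list.sel(1))
      then show False using assms(2)[OF r(1)] by simp
    next
      case (Cons \<gamma> k')
      then have "snd x = k' @ r @ m" using r(2) by simp
      then have "contains_relation R (snd x)" using r(1) by (auto simp: contains_relation_def sublist_def)
      then show False using nonzero_pathsD(2)[OF x(1)] by simp
    qed
  qed
  then show ?thesis using q by (simp add: ipaths_def nonzero_paths_def)
qed

lemma lmult_row:
  assumes "r < length (enum_list (ppaths (head Q \<beta>)))" "enum_list (ppaths (head Q \<beta>)) ! r = (head Q \<beta>, [])"
    and "j < length (enum_list (ppaths (tail Q \<beta>)))"
  shows "lmult \<beta> $$ (r,j) = 0"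
  using assms by (simp add: lmult_def kmat_index)

lemma lmult_dual_col:
  assumes "s < length (enum_list (ipaths (tail Q \<beta>)))" "enum_list (ipaths (tail Q \<beta>)) ! s = (tail Q \<beta>, [])"
    and "i < length (enum_list (ipaths (head Q \<beta>)))"
  shows "lmult_dual \<beta> $$ (i,s) = 0"
  using assms by (simp add: lmult_dual_def kmat_index)

lemma kmat_nonzero:
  assumes "y \<in> set ys" "x \<in> set xs" "K y x \<noteq> 0"
  shows "kmat ys xs K \<noteq> 0\<^sub>m (length ys) (length xs)"
proof
  assume e: "kmat ys xs K = 0\<^sub>m (length ys) (length xs)"
  have "kmat ys xs K = kmat ys xs (\<lambda>_ _. 0)" unfolding e by (rule eq_matI) (simp_all add: kmat_index)
  from kmat_eqD[OF this assms(1,2)] assms(3) show False by simp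
qed

end

context directed_path_basis begin

text \<open>\<open>lmult\<close> misses the generator of its target, so it is no split epimorphism,
  and a split monomorphism between indecomposables would be an isomorphism; it is nonzero as it
  sends the trivial path to \<open>\<beta>\<close>. This gives some positive length, where
  \<open>lmult_irreducible\<close> will give length 1.\<close>

lemma proj_arrow_walk:
  assumes \<beta>: "\<beta> \<in> arcs Q"
  shows "\<exists>n\<ge>1. AR_walk sc (proj (tail Q \<beta>)) (proj (head Q \<beta>)) n" "\<not> split_epi (proj (tail Q \<beta>)) (proj (head Q \<beta>)) (lmult \<beta>)"
    "\<not> split_mono (proj (tail Q \<beta>)) (proj (head Q \<beta>)) (lmult \<beta>)"
proof -
  note v = head_in_verts[OF \<beta>] tail_in_verts[OF \<beta>]
  note ind = proj_indecomposable[OF v(1)] proj_indecomposable[OF v(2)]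
  obtain r where r: "r < length (enum_list (ppaths (head Q \<beta>)))" "enum_list (ppaths (head Q \<beta>)) ! r = (head Q \<beta>, [])"
    using trivial_index_ppaths[OF v(1)] by blast
  show ne: "\<not> split_epi (proj (tail Q \<beta>)) (proj (head Q \<beta>)) (lmult \<beta>)"
    by (rule not_split_epi_of_row) (use r lmult_row[OF r] in simp_all)
  show nm: "\<not> split_mono (proj (tail Q \<beta>)) (proj (head Q \<beta>)) (lmult \<beta>)"
  proof
    assume "split_mono (proj (tail Q \<beta>)) (proj (head Q \<beta>)) (lmult \<beta>)"
    from split_mono_indecomposable_iso[OF ind(2,1) this] have "split_epi (proj (tail Q \<beta>)) (proj (head Q \<beta>)) (lmult \<beta>)"
      unfolding is_iso_def by (elim conjE bexE) (rule split_epiI)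
    with ne show False ..
  qed
  have "lmult \<beta> \<noteq> 0\<^sub>m (mdim (proj (head Q \<beta>))) (mdim (proj (tail Q \<beta>)))"
    unfolding lmult_def smod_dim
  proof (rule kmat_nonzero, unfold enum_list(2)[OF finite_ppaths])
    show "(tail Q \<beta>, [\<beta>]) \<in> ppaths (head Q \<beta>)" "(tail Q \<beta>, []) \<in> ppaths (tail Q \<beta>)"
      using arrow_path[OF \<beta>] trivial_path[OF v(2)] by (simp_all add: ppaths_def)
  qed simp
  from nonzero_noniso_walk[OF ind(2,1) lmult_hom[OF \<beta>] this nm]
  show "\<exists>n\<ge>1. AR_walk sc (proj (tail Q \<beta>)) (proj (head Q \<beta>)) n" .
qed

lemma inj_arrow_walk:
  assumes \<beta>: "\<beta> \<in> arcs Q"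
  shows "\<exists>n\<ge>1. AR_walk sc (imod (tail Q \<beta>)) (imod (head Q \<beta>)) n" "\<not> split_mono (imod (tail Q \<beta>)) (imod (head Q \<beta>)) (lmult_dual \<beta>)"
    "\<not> split_epi (imod (tail Q \<beta>)) (imod (head Q \<beta>)) (lmult_dual \<beta>)"
proof -
  note v = head_in_verts[OF \<beta>] tail_in_verts[OF \<beta>]
  note ind = injective_indecomposable[OF v(1)] injective_indecomposable[OF v(2)]
  obtain s where s: "s < length (enum_list (ipaths (tail Q \<beta>)))" "enum_list (ipaths (tail Q \<beta>)) ! s = (tail Q \<beta>, [])"
    using trivial_index_ipaths[OF v(2)] by blast
  show nm: "\<not> split_mono (imod (tail Q \<beta>)) (imod (head Q \<beta>)) (lmult_dual \<beta>)"
    by (rule not_split_mono_of_col) (use s lmult_dual_col[OF s] in simp_all)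
  show "\<not> split_epi (imod (tail Q \<beta>)) (imod (head Q \<beta>)) (lmult_dual \<beta>)"
  proof
    assume "split_epi (imod (tail Q \<beta>)) (imod (head Q \<beta>)) (lmult_dual \<beta>)"
    then obtain G where G: "G \<in> mhom (imod (head Q \<beta>)) (imod (tail Q \<beta>))" "lmult_dual \<beta> * G = 1\<^sub>m (mdim (imod (head Q \<beta>)))"
      unfolding split_epi_def by (elim conjE bexE) (rule that; assumption)
    have "split_mono (imod (head Q \<beta>)) (imod (tail Q \<beta>)) G" by (rule split_monoI[OF G(1) lmult_dual_hom[OF \<beta>] G(2)])
    from split_mono_indecomposable_iso[OF ind(1,2) this] obtain H where H: "H \<in> mhom (imod (tail Q \<beta>)) (imod (head Q \<beta>))"
      "G * H = 1\<^sub>m (mdim (imod (tail Q \<beta>)))" unfolding is_iso_def by (elim conjE bexE) (rule that; assumption)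
    note d = mhom_dims[OF G(1)] mhom_dims[OF H(1)] mhom_dims[OF lmult_dual_hom[OF \<beta>]]
    have "lmult_dual \<beta> = lmult_dual \<beta> * (G * H)" unfolding H(2) by (simp add: d mult_mat_one_right)
    also have "\<dots> = 1\<^sub>m (mdim (imod (head Q \<beta>))) * H" by (rule mat_assoc_eq[OF G(2)]) (simp_all add: d)
    also have "\<dots> = H" by (rule mult_mat_one_left) (simp add: d)
    finally have "G * lmult_dual \<beta> = 1\<^sub>m (mdim (imod (tail Q \<beta>)))" using H(2) by simp
    from split_monoI[OF lmult_dual_hom[OF \<beta>] G(1) this] nm show False by simp
  qed
  have "lmult_dual \<beta> \<noteq> 0\<^sub>m (mdim (imod (head Q \<beta>))) (mdim (imod (tail Q \<beta>)))"
    unfolding lmult_dual_def smod_dim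
  proof (rule kmat_nonzero, unfold enum_list(2)[OF finite_ipaths])
    show "(head Q \<beta>, []) \<in> ipaths (head Q \<beta>)" "(tail Q \<beta>, [\<beta>]) \<in> ipaths (tail Q \<beta>)"
      using arrow_path[OF \<beta>] trivial_path[OF v(1)] by (simp_all add: ipaths_def)
  qed simp
  from nonzero_noniso_walk[OF ind(2,1) lmult_dual_hom[OF \<beta>] this nm]
  show "\<exists>n\<ge>1. AR_walk sc (imod (tail Q \<beta>)) (imod (head Q \<beta>)) n" .
qed

text \<open>If \<open>h : Z \<rightarrow> P\<^sub>a\<close> is not a split epimorphism, its image avoids the generator, so cancelling \<open>\<beta>\<close> at the end of
  paths defines a homomorphism on the image and yields a left inverse of \<open>G\<close>.\<close>

lemma lmult_irreducible:
  assumes \<beta>: "\<beta> \<in> arcs Q" and nl: "\<And>r. r \<in> R \<Longrightarrow> last r \<noteq> \<beta>"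
  shows "irreducible_mor sc (proj (tail Q \<beta>)) (proj (head Q \<beta>)) (lmult \<beta>)"
  unfolding irreducible_mor_def
proof (intro conjI allI impI lmult_hom[OF \<beta>] proj_arrow_walk(2,3)[OF \<beta>])
  let ?a = "head Q \<beta>" and ?b = "tail Q \<beta>"
  let ?as = "enum_list (ppaths ?a)" and ?bs = "enum_list (ppaths ?b)"
  note v = head_in_verts[OF \<beta>] tail_in_verts[OF \<beta>]
  note en = enum_list[OF finite_ppaths]
  note A = rooted_step_system[OF rooted_ppaths[OF v(1)]] and B = rooted_step_system[OF rooted_ppaths[OF v(2)]]
  fix Z G h assume *: "right_module sc Z \<and> G \<in> mhom (proj ?b) Z \<and> h \<in> mhom Z (proj ?a) \<and> lmult \<beta> = h * G"
  note Z = conjunct1[OF *] and G = conjunct1[OF conjunct2[OF *]] and h = conjunct1[OF conjunct2[OF conjunct2[OF *]]]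
    and hG = conjunct2[OF conjunct2[OF conjunct2[OF *]]]
  obtain r where r: "r < length ?as" "?as ! r = (?a, [])" using trivial_index_ppaths[OF v(1)] by blast
  show "split_mono (proj ?b) Z G \<or> split_epi Z (proj ?a) h"
  proof (rule disjCI)
    assume ne: "\<not> split_epi Z (proj ?a) h"
    define K :: "('v, 'b) qpath \<Rightarrow> ('v, 'b) qpath \<Rightarrow> 'k" where "K y x = (if x = (fst y, snd y @ [\<beta>]) then 1 else 0)" for y x
    have W: "kmat ?bs ?as K * h \<in> mhom Z (proj ?b)"
    proof (rule corrected_hom_left[OF A B Z h r(1) proj_row_zero[OF v(1) Z h ne r]])
      fix p x z assume p: "p \<in> N" and x': "x \<in> set ?as" and xr: "x \<noteq> ?as ! r" and z': "z \<in> set ?bs"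
      have x: "x \<in> ppaths ?a" and z: "z \<in> ppaths ?b" using x' z' by (simp_all add: en)
      \<comment> \<open>The excluded element is the trivial path. For any other \<open>x\<close> the
        arrow to be cancelled belongs to \<open>x\<close> and not to \<open>p\<close>, which is why
        cancelling commutes with the action there.\<close>
      have xn: "snd x \<noteq> []"
        using xr x unfolding r(2) by (cases x) (auto simp: ppaths_def)
      show "(case act fst (pstep (ppaths ?a)) x p of None \<Rightarrow> 0 | Some y \<Rightarrow> K z y) =
          (\<Sum>y\<in>set ?bs. (if act fst (pstep (ppaths ?b)) y p = Some z then 1 else 0) * K y x)"
        unfolding K_def
      proof (rule indicator_intertwining[OF A x' p, where T = "\<lambda>y x. x = (fst y, snd y @ [\<beta>])"], unfold en)
        fix y y' assume "y \<in> ppaths ?b" "y' \<in> ppaths ?b" "act fst (pstep (ppaths ?b)) y p = Some z" "act fst (pstep (ppaths ?b)) y' p = Some z"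
        then show "y = y'" by (simp add: act_ppaths_iff[OF v(2) _ p] prod_eq_iff)
      next
        show "(\<exists>y. act fst (pstep (ppaths ?a)) x p = Some y \<and> y = (fst z, snd z @ [\<beta>])) \<longleftrightarrow>
          (\<exists>y\<in>ppaths ?b. act fst (pstep (ppaths ?b)) y p = Some z \<and> x = (fst y, snd y @ [\<beta>]))"
        proof
          assume "\<exists>y. act fst (pstep (ppaths ?a)) x p = Some y \<and> y = (fst z, snd z @ [\<beta>])"
          then have e: "path_end Q p = fst x" "fst z = fst p" "snd z @ [\<beta>] = snd p @ snd x"
            by (auto simp: act_ppaths_iff[OF v(1) x p])
          define y where "y = (fst x, butlast (snd x))"
          have l: "last (snd x) = \<beta>" using arg_cong[OF e(3), of last] xn by simp
          have xy: "x = (fst y, snd y @ [\<beta>])" using xn l by (simp add: y_def prod_eq_iff flip: l)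
          then have xy': "fst x = fst y" "snd x = snd y @ [\<beta>]" by simp_all
          have zz: "z = (fst p, snd p @ snd y)" using e(2,3) xy' by (simp add: prod_eq_iff)
          then have "(fst p, snd p @ snd y @ []) \<in> N" "path_end Q z = ?b" using z by (simp_all add: ppaths_def)
          from nonzero_subpath[OF this(1)] this(2) e(1) xy'(1) zz have y: "y \<in> ppaths ?b" by (simp add: ppaths_def)
          have "act fst (pstep (ppaths ?b)) y p = Some z"
            using z zz e(1) xy'(1) unfolding act_ppaths_iff[OF v(2) y p] by (simp add: ppaths_def)
          then show "\<exists>y\<in>ppaths ?b. act fst (pstep (ppaths ?b)) y p = Some z \<and> x = (fst y, snd y @ [\<beta>])"
            using y xy by (intro bexI[of _ y] conjI)
        next
          assume "\<exists>y\<in>ppaths ?b. act fst (pstep (ppaths ?b)) y p = Some z \<and> x = (fst y, snd y @ [\<beta>])"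
          then obtain y where y: "y \<in> ppaths ?b" "act fst (pstep (ppaths ?b)) y p = Some z" "x = (fst y, snd y @ [\<beta>])" by blast
          from y(2)[unfolded act_ppaths_iff[OF v(2) y(1) p]]
          have e: "path_end Q p = fst y" "z = (fst p, snd p @ snd y)" by simp_all
          have "(fst z, snd z @ [\<beta>]) \<in> N" using rmult_nonzero[OF \<beta> nl z] by (simp add: ppaths_def)
          then have "act fst (pstep (ppaths ?a)) x p = Some (fst z, snd z @ [\<beta>])"
            unfolding act_ppaths_iff[OF v(1) x p] using e y(3) by simp
          then show "\<exists>y. act fst (pstep (ppaths ?a)) x p = Some y \<and> y = (fst z, snd z @ [\<beta>])" by simp
        qed
      qed
    qed
    \<comment> \<open>By \<open>rmult_nonzero\<close> appending \<open>\<beta>\<close> loses no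
      path, so cancelling it afterwards is the identity.\<close>
    have "kmat ?bs ?as K * lmult \<beta> = kmat ?bs ?bs (\<lambda>z x. if z = x then 1 else 0)"
      unfolding lmult_def kmat_mult[OF en(1)] en(2)
    proof (rule kmat_cong, unfold en(2))
      fix z x assume z: "z \<in> ppaths ?b" and x: "x \<in> ppaths ?b"
      have "(\<Sum>y\<in>ppaths ?a. K z y * (if y = (fst x, snd x @ [\<beta>]) then 1 else 0)) =
          (\<Sum>y\<in>ppaths ?a. if y = (fst x, snd x @ [\<beta>]) then K z y else 0)"
        by (intro sum.cong refl) simp
      also have "\<dots> = K z (fst x, snd x @ [\<beta>])" using rmult_nonzero[OF \<beta> nl x] by (simp add: finite_ppaths)
      also have "\<dots> = (if z = x then 1 else 0)" unfolding K_def by (simp add: prod_eq_iff eq_commute)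
      finally show "(\<Sum>y\<in>ppaths ?a. K z y * (if y = (fst x, snd x @ [\<beta>]) then 1 else 0)) = (if z = x then 1 else 0)" .
    qed
    then have one: "kmat ?bs ?as K * (h * G) = 1\<^sub>m (mdim (proj ?b))"
      unfolding hG kmat_one[OF en(1)] by simp
    have "kmat ?bs ?as K * h * G = 1\<^sub>m (mdim (proj ?b))"
      unfolding one[symmetric] by (rule mult_mat_assoc) (simp_all add: mhom_dims[OF h] mhom_dims[OF G])
    then show "split_mono (proj ?b) Z G" by (rule split_monoI[OF G W])
  qed
qed

text \<open>Dual to \<open>lmult_irreducible\<close>: unless \<open>g\<close> is a split
  monomorphism it kills the socle of the injective at the tail, so that putting
  \<open>\<beta>\<close> in front of paths, followed by \<open>g\<close>, is a homomorphism, and it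
  is a right inverse of \<open>h\<close>.\<close>

lemma lmult_dual_irreducible:
  assumes \<beta>: "\<beta> \<in> arcs Q" and nf: "\<And>r. r \<in> R \<Longrightarrow> hd r \<noteq> \<beta>"
  shows "irreducible_mor sc (imod (tail Q \<beta>)) (imod (head Q \<beta>)) (lmult_dual \<beta>)"
  unfolding irreducible_mor_def
proof (intro conjI allI impI lmult_dual_hom[OF \<beta>] inj_arrow_walk(2,3)[OF \<beta>])
  let ?a = "head Q \<beta>" and ?b = "tail Q \<beta>"
  let ?as = "enum_list (ipaths ?a)" and ?bs = "enum_list (ipaths ?b)"
  note v = head_in_verts[OF \<beta>] tail_in_verts[OF \<beta>]
  note en = enum_list[OF finite_ipaths]
  fix Z g h assume *: "right_module sc Z \<and> g \<in> mhom (imod ?b) Z \<and> h \<in> mhom Z (imod ?a) \<and> lmult_dual \<beta> = h * g"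
  note Z = conjunct1[OF *] and g = conjunct1[OF conjunct2[OF *]] and h = conjunct1[OF conjunct2[OF conjunct2[OF *]]]
    and hg = conjunct2[OF conjunct2[OF conjunct2[OF *]]]
  obtain s where s: "s < length ?bs" "?bs ! s = (?b, [])" using trivial_index_ipaths[OF v(2)] by blast
  have "split_epi Z (imod ?a) h" if nm: "\<not> split_mono (imod ?b) Z g"
  proof -
    define K :: "('v, 'b) qpath \<Rightarrow> ('v, 'b) qpath \<Rightarrow> 'k" where "K y x = (if y = (?b, \<beta> # snd x) then 1 else 0)" for y x
    have W: "g * kmat ?bs ?as K \<in> mhom (imod ?a) Z"
    proof (rule corrected_hom_right[OF imod_step_system imod_step_system Z g s(1) inj_col_zero[OF v(2) Z g nm s]])
      fix p x z assume p: "p \<in> N" and x': "x \<in> set ?as" and z': "z \<in> set ?bs" and zs: "z \<noteq> ?bs ! s"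
      have x: "x \<in> ipaths ?a" and z: "z \<in> ipaths ?b" using x' z' by (simp_all add: en)
      have fx: "fst x = ?a" and fz: "fst z = ?b" using x z by (simp_all add: ipaths_def)
      have zn: "snd z \<noteq> []" using zs fz unfolding s(2) by (simp add: prod_eq_iff)
      show "(case act (path_end Q) istep x p of None \<Rightarrow> 0 | Some y \<Rightarrow> K z y) =
          (\<Sum>y\<in>set ?bs. (if act (path_end Q) istep y p = Some z then 1 else 0) * K y x)"
        unfolding K_def
      proof (rule indicator_intertwining[OF imod_step_system x' p, where T = "\<lambda>y x. y = (?b, \<beta> # snd x)"], unfold en)
        fix y y' assume "act (path_end Q) istep y p = Some z" "act (path_end Q) istep y' p = Some z"
        then show "y = y'" by (simp add: act_ipaths_iff prod_eq_iff)
      next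
        show "(\<exists>y. act (path_end Q) istep x p = Some y \<and> z = (?b, \<beta> # snd y)) \<longleftrightarrow>
          (\<exists>y\<in>ipaths ?b. act (path_end Q) istep y p = Some z \<and> y = (?b, \<beta> # snd x))"
        proof
          assume "\<exists>y. act (path_end Q) istep x p = Some y \<and> z = (?b, \<beta> # snd y)"
          then obtain y where e: "path_end Q p = path_end Q x" "snd x = snd y @ snd p" "z = (?b, \<beta> # snd y)"
            by (auto simp: act_ipaths_iff)
          have "act (path_end Q) istep (?b, \<beta> # snd x) p = Some z"
            using e fx by (simp add: act_ipaths_iff)
          then show "\<exists>y\<in>ipaths ?b. act (path_end Q) istep y p = Some z \<and> y = (?b, \<beta> # snd x)"
            using lmult_nonzero[OF \<beta> nf x] by (intro bexI[of _ "(?b, \<beta> # snd x)"] conjI refl)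
        next
          assume "\<exists>y\<in>ipaths ?b. act (path_end Q) istep y p = Some z \<and> y = (?b, \<beta> # snd x)"
          then have "act (path_end Q) istep (?b, \<beta> # snd x) p = Some z" by blast
          then have e: "path_end Q p = path_end Q x" "\<beta> # snd x = snd z @ snd p"
            using fx by (simp_all add: act_ipaths_iff)
          from zn e(2) obtain z' where z': "snd z = \<beta> # z'" "snd x = z' @ snd p" by (cases "snd z") auto
          have "act (path_end Q) istep x p = Some (?a, z')"
            using e(1) z'(2) fx by (simp add: act_ipaths_iff)
          moreover have "z = (?b, \<beta> # snd (?a, z'))" using fz z'(1) by (simp add: prod_eq_iff)
          ultimately show "\<exists>y. act (path_end Q) istep x p = Some y \<and> z = (?b, \<beta> # snd y)" by (intro exI conjI)
        qed
      qed
    qed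
    have "lmult_dual \<beta> * kmat ?bs ?as K = kmat ?as ?as (\<lambda>z x. if z = x then 1 else 0)"
      unfolding lmult_dual_def kmat_mult[OF en(1)] en(2)
    proof (rule kmat_cong, unfold en(2))
      fix z x assume z: "z \<in> ipaths ?a" and x: "x \<in> ipaths ?a"
      then have f: "fst z = fst x" by (simp add: ipaths_def)
      have "(\<Sum>y\<in>ipaths ?b. (if y = (?b, \<beta> # snd z) then 1 else 0) * K y x) =
          (\<Sum>y\<in>ipaths ?b. if y = (?b, \<beta> # snd z) then K y x else 0)"
        by (intro sum.cong refl) simp
      also have "\<dots> = K (?b, \<beta> # snd z) x" using lmult_nonzero[OF \<beta> nf z] by (simp add: finite_ipaths)
      also have "\<dots> = (if z = x then 1 else 0)" unfolding K_def using f by (simp add: prod_eq_iff)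
      finally show "(\<Sum>y\<in>ipaths ?b. (if y = (?b, \<beta> # snd z) then 1 else 0) * K y x) = (if z = x then 1 else 0)" .
    qed
    then have one: "(h * g) * kmat ?bs ?as K = 1\<^sub>m (mdim (imod ?a))"
      unfolding hg kmat_one[OF en(1)] by simp
    have "h * (g * kmat ?bs ?as K) = 1\<^sub>m (mdim (imod ?a))"
      unfolding one[symmetric] by (rule mult_mat_assoc[symmetric]) (simp_all add: mhom_dims[OF h] mhom_dims[OF g])
    then show ?thesis by (rule split_epiI[OF h W])
  qed
  then show "split_mono (imod ?b) Z g \<or> split_epi Z (imod ?a) h" by blast
qed

text \<open>The number \<open>r\<^sub>a\<close>. By \<open>proj_inj_walks\<close> the maximum in
  \<open>proj_inj_length\<close> is taken over the singleton of this number.\<close>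

definition level :: "'v \<Rightarrow> nat" where
  "level a = (THE n. AR_walk sc (proj a) (imod a) n)"

lemma level_eq: "AR_walk sc (proj a) (imod a) n \<Longrightarrow> level a = n"
  unfolding level_def by (rule the_equality) (auto intro: AR_walk_unique)

lemma level:
  assumes a: "a \<in> verts Q"
  shows "AR_walk sc (proj a) (imod a) (level a)"
    "\<exists>F. rad_power sc (level a) (proj a) (imod a) F \<and> F \<noteq> 0\<^sub>m (mdim (imod a)) (mdim (proj a))"
proof -
  obtain F where F: "F \<in> mhom (proj a) (imod a)" "F \<noteq> 0\<^sub>m (mdim (imod a)) (mdim (proj a))"
    using proj_inj_nonzero_hom[OF a] by (elim bexE) (rule that; assumption)
  obtain n where n: "rad_power sc n (proj a) (imod a) F" "AR_walk sc (proj a) (imod a) n"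
    using nonzero_hom_walk[OF proj_indecomposable[OF a] injective_indecomposable[OF a] F] by blast
  show "AR_walk sc (proj a) (imod a) (level a)" using n(2) level_eq[OF n(2)] by simp
  show "\<exists>F. rad_power sc (level a) (proj a) (imod a) F \<and> F \<noteq> 0\<^sub>m (mdim (imod a)) (mdim (proj a))"
    using n(1) level_eq[OF n(2)] F(2) by (intro exI[of _ F]) simp
qed

lemma proj_inj_walks:
  assumes a: "a \<in> verts Q"
  shows "Max {length p |p. pre_digraph.awalk (AR_quiver sc) (projective_at sc (bs (a, []))) p (injective_at sc (bs (a, [])))} = level a"
proof -
  have "{length p |p. pre_digraph.awalk (AR_quiver sc) (projective_at sc (bs (a, []))) p (injective_at sc (bs (a, [])))} =
      {n. AR_walk sc (proj a) (imod a) n}"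
    unfolding projective_at_eq[OF a] injective_at_eq[OF a] AR_walk_def by blast
  also have "\<dots> = {level a}" using level(1)[OF a] level_eq by blast
  finally show ?thesis by simp
qed

text \<open>Composition with \<open>coyon\<close> and \<open>yon\<close> stays in the
  \<open>m\<close>-th power and moves the question to a pair \<open>P\<^sub>a\<close>,
  \<open>I\<^sub>a\<close>.\<close>

lemma rad_power_level:
  assumes X: "right_module sc X" and Y: "right_module sc Y" and F: "rad_power sc m X Y F" and nz: "F \<noteq> 0\<^sub>m (mdim Y) (mdim X)"
  shows "\<exists>a\<in>verts Q. m \<le> level a"
proof -
  note Fh = rad_power_mhom[OF F X Y]
  note d = mhom_dims[OF Fh]
  obtain a where a: "a \<in> verts Q" "mact Y (bs (a, [])) * F \<noteq> 0\<^sub>m (mdim Y) (mdim X)"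
    using nonzero_at_vertex[OF Y d(1), unfolded d(2), OF nz] by (elim bexE) (rule that; assumption)
  obtain V W where V: "V \<in> carrier_mat (mdim X) 1" and W: "W \<in> carrier_mat 1 (mdim Y)"
    and n: "coyon Y a W * F * yon X a V \<noteq> 0\<^sub>m (mdim (imod a)) (mdim (proj a))"
    using yon_coyon_nonzero[OF X Y Fh a] by (elim exE conjE) (rule that; assumption)
  note P = indecomposableD(1)[OF proj_indecomposable[OF a(1)]] and I = indecomposableD(1)[OF injective_indecomposable[OF a(1)]]
  have "rad_power sc m X (imod a) (coyon Y a W * F)"
    by (rule rad_power_mult_left[OF F X Y I coyon_hom[OF Y a(1) W]])
  from rad_power_mult[OF this rad_power.zero[OF yon_hom[OF X a(1) V]] P X I]
  have "rad_power sc m (proj a) (imod a) (coyon Y a W * F * yon X a V)" by simp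
  from rad_power_nonzero_walk[OF proj_indecomposable[OF a(1)] injective_indecomposable[OF a(1)] this n]
  obtain n where "n \<ge> m" "AR_walk sc (proj a) (imod a) n" by blast
  then show ?thesis using level_eq a(1) by blast
qed

text \<open>By \<open>rad_power_level\<close> a nonvanishing power is bounded by some level;
  conversely a nonzero morphism in the power \<open>level a\<close> keeps that power from vanishing.
  The added 1 is the step from the last nonzero power to the first zero one.\<close>

lemma nilpotency_index_eq:
  assumes "verts Q \<noteq> {}"
  shows "nilpotency_index sc = Suc (Max (level ` verts Q))"
proof -
  have "rad_power_vanishes sc m \<longleftrightarrow> (\<forall>a\<in>verts Q. level a < m)" for m
  proof
    assume v: "rad_power_vanishes sc m"
    show "\<forall>a\<in>verts Q. level a < m"
    proof (rule ballI, rule ccontr)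
      fix a assume a: "a \<in> verts Q" and "\<not> level a < m"
      then have "m \<le> level a" by simp
      obtain F where F: "rad_power sc (level a) (proj a) (imod a) F" "F \<noteq> 0\<^sub>m (mdim (imod a)) (mdim (proj a))"
        using level(2)[OF a] by (elim exE conjE) (rule that; assumption)
      note m = indecomposableD(1)[OF proj_indecomposable[OF a]] indecomposableD(1)[OF injective_indecomposable[OF a]]
      from rad_power_antimono[OF m \<open>m \<le> level a\<close> F(1)] v m F(2) show False unfolding rad_power_vanishes_def by blast
    qed
  next
    assume l: "\<forall>a\<in>verts Q. level a < m"
    show "rad_power_vanishes sc m" unfolding rad_power_vanishes_def
    proof (intro allI impI, rule ccontr)
      fix X Y :: "('a, 'k) rmod" and F assume *: "right_module sc X \<and> right_module sc Y \<and> rad_power sc m X Y F" and n: "F \<noteq> 0\<^sub>m (mdim Y) (mdim X)"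
      from rad_power_level[OF conjunct1[OF *] conjunct1[OF conjunct2[OF *]] conjunct2[OF conjunct2[OF *]] n] l show False by fastforce
    qed
  qed
  then have "nilpotency_index sc = (LEAST m. 1 \<le> m \<and> (\<forall>a\<in>verts Q. level a < m))" unfolding nilpotency_index_def by simp
  also have "\<dots> = Suc (Max (level ` verts Q))"
  proof (rule Least_equality)
    show "1 \<le> Suc (Max (level ` verts Q)) \<and> (\<forall>a\<in>verts Q. level a < Suc (Max (level ` verts Q)))"
      by (simp add: less_Suc_eq_le)
    fix m assume m: "1 \<le> m \<and> (\<forall>a\<in>verts Q. level a < m)"
    have "Max (level ` verts Q) \<in> level ` verts Q" using assms by (intro Max_in) simp_all
    then show "Suc (Max (level ` verts Q)) \<le> m" using m by auto
  qed
  finally show ?thesis .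
qed

lemma level_tail_le:
  assumes \<beta>: "\<beta> \<in> arcs Q" and nl: "\<And>r. r \<in> R \<Longrightarrow> last r \<noteq> \<beta>"
  shows "level (tail Q \<beta>) \<le> level (head Q \<beta>)"
proof -
  note v = head_in_verts[OF \<beta>] tail_in_verts[OF \<beta>]
  have "AR_walk sc (proj (tail Q \<beta>)) (proj (head Q \<beta>)) 1"
    by (rule AR_walk_arrow[OF proj_indecomposable[OF v(2)] proj_indecomposable[OF v(1)] lmult_irreducible[OF \<beta> nl]])
  from AR_walk_trans[OF this level(1)[OF v(1)]] have 1: "AR_walk sc (proj (tail Q \<beta>)) (imod (head Q \<beta>)) (1 + level (head Q \<beta>))" .
  obtain n where n: "n \<ge> 1" "AR_walk sc (imod (tail Q \<beta>)) (imod (head Q \<beta>)) n" using inj_arrow_walk(1)[OF \<beta>] by blast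
  \<comment> \<open>Two paths from the projective at the tail to the injective at the head give
    \<open>1 + level (head Q \<beta>) = level (tail Q \<beta>) + n\<close>.\<close>
  from AR_walk_unique[OF 1 AR_walk_trans[OF level(1)[OF v(2)] n(2)]] n(1) show ?thesis by simp
qed

lemma level_head_le:
  assumes \<beta>: "\<beta> \<in> arcs Q" and nf: "\<And>r. r \<in> R \<Longrightarrow> hd r \<noteq> \<beta>"
  shows "level (head Q \<beta>) \<le> level (tail Q \<beta>)"
proof -
  note v = head_in_verts[OF \<beta>] tail_in_verts[OF \<beta>]
  have "AR_walk sc (imod (tail Q \<beta>)) (imod (head Q \<beta>)) 1"
    by (rule AR_walk_arrow[OF injective_indecomposable[OF v(2)] injective_indecomposable[OF v(1)] lmult_dual_irreducible[OF \<beta> nf]])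
  from AR_walk_trans[OF level(1)[OF v(2)] this] have 1: "AR_walk sc (proj (tail Q \<beta>)) (imod (head Q \<beta>)) (level (tail Q \<beta>) + 1)" .
  obtain n where n: "n \<ge> 1" "AR_walk sc (proj (tail Q \<beta>)) (proj (head Q \<beta>)) n" using proj_arrow_walk(1)[OF \<beta>] by blast
  from AR_walk_unique[OF 1 AR_walk_trans[OF n(2) level(1)[OF v(1)]]] n(1) show ?thesis by simp
qed

end

section \<open>Connectedness\<close>

lemma connected_constant:
  assumes c: "Digraph_Component.connected G" and uv: "u \<in> verts G" "v \<in> verts G"
    and inv: "\<And>e. e \<in> arcs G \<Longrightarrow> P (tail G e) \<longleftrightarrow> P (head G e)"
  shows "P u \<longleftrightarrow> P v"
proof -
  have "u \<rightarrow>\<^sup>*\<^bsub>with_proj (mk_symmetric G)\<^esub> v"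
    using c uv unfolding Digraph_Component.connected_def strongly_connected_def by simp
  then have "(u, v) \<in> rtrancl_on (verts G) (parcs (mk_symmetric G))" by (simp add: reachable_def)
  then show ?thesis
  proof (induction rule: rtrancl_on_induct)
    case (step x y)
    then have "(x, y) \<in> parcs (mk_symmetric G)" by simp
    then have "P x \<longleftrightarrow> P y" using inv unfolding parcs_mk_symmetric by blast
    with step show ?case by simp
  qed simp
qed

context directed_path_basis begin

text \<open>The zero map factors into zero maps through \<open>X\<close>, neither of which splits as
  \<open>X\<close> and \<open>Y\<close> are nonzero.\<close>

lemma irreducible_nonzero:
  assumes X: "indecomposable sc X" and Y: "indecomposable sc Y" and F: "irreducible_mor sc X Y F"
  shows "F \<noteq> 0\<^sub>m (mdim Y) (mdim X)"
proof
  assume F0: "F = 0\<^sub>m (mdim Y) (mdim X)"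
  note m = indecomposableD(1)[OF X] indecomposableD(1)[OF Y] and n = indecomposableD(2)[OF X] indecomposableD(2)[OF Y]
  have e: "F = 0\<^sub>m (mdim Y) (mdim X) * 0\<^sub>m (mdim X) (mdim X)" unfolding F0 by (simp add: mult_mat_zero_right)
  have z: "0\<^sub>m (mdim X) (mdim X) \<in> mhom X X" "0\<^sub>m (mdim Y) (mdim X) \<in> mhom X Y" by (rule mhom_zero; rule m)+
  have "split_mono X X (0\<^sub>m (mdim X) (mdim X)) \<or> split_epi X Y (0\<^sub>m (mdim Y) (mdim X))"
    using F m(1) z e unfolding irreducible_mor_def by blast
  moreover have "\<not> split_mono X X (0\<^sub>m (mdim X) (mdim X))" by (rule not_split_mono_of_col[of 0]) (use n in simp_all)
  moreover have "\<not> split_epi X Y (0\<^sub>m (mdim Y) (mdim X))" by (rule not_split_epi_of_row[of 0]) (use n in simp_all)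
  ultimately show False by blast
qed

text \<open>The sum of the idempotents at a union of connected components of \<open>Q\<close> is central, so it acts
  as \<open>0\<close> or \<open>1\<close> on every indecomposable module, and equally on the two ends of an arrow of the
  Auslander-Reiten quiver.\<close>

lemma quiver_connected:
  assumes D: "D \<subseteq> verts Q" "D \<noteq> {}" and closed: "\<And>\<beta>. \<beta> \<in> arcs Q \<Longrightarrow> tail Q \<beta> \<in> D \<longleftrightarrow> head Q \<beta> \<in> D"
  shows "D = verts Q"
proof -
  define \<epsilon> where "\<epsilon> = (\<Sum>v\<in>D. bs (v, []))"
  have fD: "finite D" using D(1) finite_verts finite_subset by blast
  have tq: "(v, []) \<in> qpaths Q" if "v \<in> verts Q" for v using trivial_path[OF that] by (rule nonzero_pathsD)
  have eb: "\<epsilon> * bs p = (if path_end Q p \<in> D then bs p else 0)" if p: "p \<in> qpaths Q" for p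
  proof -
    have "\<epsilon> * bs p = (\<Sum>v\<in>D. if path_end Q p = v then bs p else 0)"
      unfolding \<epsilon>_def sum_distrib_right
      using D(1) by (intro sum.cong refl) (use bs_mult[OF tq p] in auto)
    then show ?thesis using fD by simp
  qed
  have be: "bs p * \<epsilon> = (if fst p \<in> D then bs p else 0)" if p: "p \<in> qpaths Q" for p
  proof -
    have "bs p * \<epsilon> = (\<Sum>v\<in>D. if v = fst p then bs p else 0)"
      unfolding \<epsilon>_def sum_distrib_left
      using D(1) by (intro sum.cong refl) (use bs_mult[OF p tq] in \<open>cases p, auto\<close>)
    then show ?thesis using fD by simp
  qed
  have walk: "u \<in> D \<longleftrightarrow> v \<in> D" if "awalk u l v" for u l v
    using that
  proof (induction l arbitrary: u)
    case (Cons \<beta> l)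
    then show ?case using closed by (auto simp: awalk_Cons_iff)
  qed (simp add: awalk_Nil_iff)
  have central: "\<epsilon> * b = b * \<epsilon>" for b
  proof (rule co_ext)
    fix r assume r: "r \<in> N"
    show "co (\<epsilon> * b) r = co (b * \<epsilon>) r"
    proof (rule lin_ext[OF lin_co_left[OF r]])
      fix p assume "p \<in> N"
      then have p: "p \<in> qpaths Q" by (rule nonzero_pathsD)
      show "co (\<epsilon> * bs p) r = co (bs p * \<epsilon>) r" unfolding eb[OF p] be[OF p] using walk[OF qpaths_awalk[OF p]] by simp
    qed
  qed
  have idem: "\<epsilon> * \<epsilon> = \<epsilon>"
  proof -
    have "\<epsilon> * \<epsilon> = (\<Sum>v\<in>D. \<epsilon> * bs (v, []))" by (simp add: \<epsilon>_def sum_distrib_left)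
    also have "\<dots> = (\<Sum>v\<in>D. bs (v, []))" using D(1) tq by (intro sum.cong refl) (simp add: eb subset_iff)
    finally show ?thesis by (simp add: \<epsilon>_def)
  qed
  have dich: "mact M \<epsilon> = 0\<^sub>m (mdim M) (mdim M) \<or> mact M \<epsilon> = 1\<^sub>m (mdim M)" if M: "indecomposable sc M" for M
  proof (rule indecomposable_idempotent[OF M])
    note m = indecomposableD(1)[OF M]
    show "mact M \<epsilon> \<in> mhom M M"
      by (rule mhomI) (simp_all add: mact_dims[OF m] central flip: mact_simps(3)[OF m])
    show "mact M \<epsilon> * mact M \<epsilon> = mact M \<epsilon>" by (simp add: idem flip: mact_simps(3)[OF m])
  qed
  have nonzero_eq: "mact X \<epsilon> = 1\<^sub>m (mdim X) \<longleftrightarrow> mact Y \<epsilon> = 1\<^sub>m (mdim Y)"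
    if X: "indecomposable sc X" and Y: "indecomposable sc Y" and F: "F \<in> mhom X Y" "F \<noteq> 0\<^sub>m (mdim Y) (mdim X)" for X Y F
  proof
    note d = mhom_dims[OF F(1)] and c = mhom_comm[OF F(1), of \<epsilon>]
    {
      assume 1: "mact X \<epsilon> = 1\<^sub>m (mdim X)"
      show "mact Y \<epsilon> = 1\<^sub>m (mdim Y)"
      proof (rule ccontr)
        assume "mact Y \<epsilon> \<noteq> 1\<^sub>m (mdim Y)"
        then have "mact Y \<epsilon> = 0\<^sub>m (mdim Y) (mdim Y)" using dich[OF Y] by blast
        with c 1 d have "F = 0\<^sub>m (mdim Y) (mdim X)" by (simp add: mult_mat_one_right mult_mat_zero_left)
        with F(2) show False ..
      qed
    }
    {
      assume 1: "mact Y \<epsilon> = 1\<^sub>m (mdim Y)"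
      show "mact X \<epsilon> = 1\<^sub>m (mdim X)"
      proof (rule ccontr)
        assume "mact X \<epsilon> \<noteq> 1\<^sub>m (mdim X)"
        then have "mact X \<epsilon> = 0\<^sub>m (mdim X) (mdim X)" using dich[OF X] by blast
        with c 1 d have "F = 0\<^sub>m (mdim Y) (mdim X)" by (simp add: mult_mat_one_left mult_mat_zero_right)
        with F(2) show False ..
      qed
    }
  qed
  \<comment> \<open>The property of a class that the central idempotent acts as 1 on it; one member
    decides for all.\<close>
  define P where "P K \<longleftrightarrow> (\<exists>X\<in>K. mact X \<epsilon> = 1\<^sub>m (mdim X))" for K :: "('a, 'k) rmod set"
  have P: "P (iso_class sc X) \<longleftrightarrow> mact X \<epsilon> = 1\<^sub>m (mdim X)" if X: "indecomposable sc X" for X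
  proof
    note m = indecomposableD(1)[OF X]
    assume "P (iso_class sc X)"
    then obtain Y where Y: "right_module sc Y" "isomorphic X Y" "mact Y \<epsilon> = 1\<^sub>m (mdim Y)"
      unfolding P_def iso_class_def by (elim bexE) (rule that; simp)
    obtain F G where F: "F \<in> mhom X Y" and G: "G \<in> mhom Y X" and GF: "G * F = 1\<^sub>m (mdim X)"
      using Y(2) unfolding isomorphic_def is_iso_def by (elim exE conjE bexE) (rule that; assumption)
    note d = mhom_dims[OF F] mhom_dims[OF G] mact_dims[OF m] mact_dims[OF Y(1)]
    have "mact X \<epsilon> = 1\<^sub>m (mdim X) * mact X \<epsilon>" by (simp add: mult_mat_one_left d)
    also have "\<dots> = G * (F * mact X \<epsilon>)" unfolding GF[symmetric] by (rule mult_mat_assoc) (simp_all add: d)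
    also have "F * mact X \<epsilon> = F" unfolding mhom_comm[OF F] Y(3) by (simp add: mult_mat_one_left d)
    finally show "mact X \<epsilon> = 1\<^sub>m (mdim X)" unfolding GF .
  next
    assume "mact X \<epsilon> = 1\<^sub>m (mdim X)"
    then show "P (iso_class sc X)"
      unfolding P_def iso_class_def using isomorphic_refl indecomposableD(1)[OF X] by (intro bexI[of _ X]) simp_all
  qed
  have arcs: "P (tail (AR_quiver sc) e) \<longleftrightarrow> P (head (AR_quiver sc) e)" if "e \<in> arcs (AR_quiver sc)" for e
  proof -
    from that obtain X Y F where e: "e = (iso_class sc X, iso_class sc Y)" and X: "indecomposable sc X" and Y: "indecomposable sc Y"
      and F: "irreducible_mor sc X Y F" by (rule AR_arcE)
    have "F \<in> mhom X Y" using F by (simp add: irreducible_mor_def)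
    from nonzero_eq[OF X Y this irreducible_nonzero[OF X Y F]] show ?thesis
      unfolding e AR_quiver_simps by (simp add: P[OF X] P[OF Y])
  qed
  have proj: "P (iso_class sc (proj a)) \<longleftrightarrow> a \<in> D" if a: "a \<in> verts Q" for a
  proof -
    note ind = proj_indecomposable[OF a] and nz = proj_idem_nonzero[OF a]
    note m = indecomposableD(1)[OF ind]
    note d = mact_dims[OF m]
    \<comment> \<open>The idempotent at \<open>a\<close> acts nontrivially on
      \<open>P\<^sub>a\<close>, and its product with \<open>\<epsilon>\<close> is itself or zero
      according to whether \<open>a\<close> lies in \<open>D\<close>.\<close>
    have e: "mact (proj a) \<epsilon> * mact (proj a) (bs (a, [])) = mact (proj a) (if a \<in> D then bs (a, []) else 0)"
      using be[OF tq[OF a]] by (simp flip: mact_simps(3)[OF m])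
    show ?thesis unfolding P[OF ind]
    proof
      assume "mact (proj a) \<epsilon> = 1\<^sub>m (mdim (proj a))"
      with e nz show "a \<in> D" by (cases "a \<in> D") (simp_all add: mult_mat_one_left d mact_zero[OF m])
    next
      assume "a \<in> D"
      show "mact (proj a) \<epsilon> = 1\<^sub>m (mdim (proj a))"
      proof (rule ccontr)
        assume "mact (proj a) \<epsilon> \<noteq> 1\<^sub>m (mdim (proj a))"
        then have "mact (proj a) \<epsilon> = 0\<^sub>m (mdim (proj a)) (mdim (proj a))" using dich[OF ind] by blast
        with e nz \<open>a \<in> D\<close> show False by (simp add: mult_mat_zero_left d)
      qed
    qed
  qed
  obtain a where a: "a \<in> D" using D(2) by blast
  have con: "Digraph_Component.connected (AR_quiver sc)" using with_length by (simp add: component_with_length_def)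
  have "v \<in> D" if v: "v \<in> verts Q" for v
    using connected_constant[OF con iso_class_in_AR_verts[OF proj_indecomposable[OF v]]
        iso_class_in_AR_verts[OF proj_indecomposable[OF subsetD[OF D(1) a]]], of P] arcs proj[OF v] proj[OF subsetD[OF D(1) a]] a
    by blast
  then show ?thesis using D(1) by blast
qed

end

section \<open>Zero-relations meeting the vertices of maximal level\<close>

lemma common_prefix:
  "\<exists>q x y. p = q @ x \<and> p' = q @ y \<and> (x = [] \<or> y = [] \<or> hd x \<noteq> hd y)"
proof (induction p arbitrary: p')
  case Nil
  then show ?case by - (rule exI[of _ "[]"], rule exI[of _ "[]"], rule exI[of _ p'], simp)
next
  case (Cons a p)
  show ?case
  proof (cases "p' \<noteq> [] \<and> hd p' = a")
    case True
    then obtain t where t: "p' = a # t" by (cases p') auto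
    from Cons.IH[of t] obtain q x y where "p = q @ x" "t = q @ y" "x = [] \<or> y = [] \<or> hd x \<noteq> hd y" by blast
    then show ?thesis using t by - (rule exI[of _ "a # q"], rule exI[of _ x], rule exI[of _ y], simp)
  next
    case False
    then show ?thesis by - (rule exI[of _ "[]"], rule exI[of _ "a # p"], rule exI[of _ p'], auto)
  qed
qed

lemma common_suffix:
  "\<exists>q x y. p = x @ q \<and> p' = y @ q \<and> (x = [] \<or> y = [] \<or> last x \<noteq> last y)"
proof -
  obtain q x y where e: "rev p = q @ x" "rev p' = q @ y" "x = [] \<or> y = [] \<or> hd x \<noteq> hd y"
    using common_prefix[of "rev p" "rev p'"] by blast
  have "p = rev x @ rev q" "p' = rev y @ rev q" using arg_cong[OF e(1), of rev] arg_cong[OF e(2), of rev] by simp_all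
  then show ?thesis using e(3) by - (rule exI[of _ "rev q"], rule exI[of _ "rev x"], rule exI[of _ "rev y"], (simp add: last_rev))
qed

lemma list_change:
  assumes "x \<in> set l" "y \<in> set l" "P x" "\<not> P y"
  shows "\<exists>k a b m. l = k @ a # b # m \<and> P a \<noteq> P b"
  using assms
proof (induction l arbitrary: x y)
  case (Cons c l)
  show ?case
  proof (cases "\<exists>d\<in>set l. P d \<noteq> P c")
    case True
    then obtain d where d: "d \<in> set l" "P d \<noteq> P c" by blast
    then obtain e t where l: "l = e # t" by (cases l) auto
    show ?thesis
    proof (cases "P e = P c")
      case True
      then have "\<exists>k a b m. l = k @ a # b # m \<and> P a \<noteq> P b"
        using Cons.IH[of d e] Cons.IH[of e d] d l by (cases "P d") auto
      then obtain k a b m where "l = k @ a # b # m" "P a \<noteq> P b" by blast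
      then show ?thesis by - (rule exI[of _ "c # k"], rule exI[of _ a], rule exI[of _ b], rule exI[of _ m], simp)
    next
      case False
      then show ?thesis using l by - (rule exI[of _ "[]"], rule exI[of _ c], rule exI[of _ e], rule exI[of _ t], simp)
    qed
  next
    case False
    then show ?thesis using Cons.prems by auto
  qed
qed simp

text \<open>\<open>D\<close> will be the set of vertices of maximal level; under the assumption that all chosen
  vertices lie outside of \<open>D\<close>, no zero-relation passes through \<open>D\<close>.\<close>

locale block_descent = directed_path_basis sc Q R bs co
  for sc :: "'k :: alg_closed_field \<Rightarrow> 'a :: ring_1 \<Rightarrow> 'a" and Q :: "('v, 'b) pre_digraph" and R bs co +
  fixes D :: "'v set"
  assumes relation_walk: "r \<in> R \<Longrightarrow> \<exists>u v. awalk u r v"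
    and relation_minimal: "r \<in> R \<Longrightarrow> r' \<in> R \<Longrightarrow> sublist r r' \<Longrightarrow> r = r'"
    and last_relation: "\<beta> \<in> arcs Q \<Longrightarrow> tail Q \<beta> \<in> D \<Longrightarrow> head Q \<beta> \<notin> D \<Longrightarrow> \<exists>r\<in>R. last r = \<beta>"
    and first_relation: "\<beta> \<in> arcs Q \<Longrightarrow> tail Q \<beta> \<notin> D \<Longrightarrow> head Q \<beta> \<in> D \<Longrightarrow> \<exists>r\<in>R. hd r = \<beta>"
    and interior: "r \<in> R \<Longrightarrow> \<exists>\<gamma>\<in>set (tl r). tail Q \<gamma> \<notin> D"
    and overlap_interior: "k @ m \<in> R \<Longrightarrow> m @ l \<in> R \<Longrightarrow> k \<noteq> [] \<Longrightarrow> m \<noteq> [] \<Longrightarrow> k @ m \<noteq> m @ l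
      \<Longrightarrow> \<exists>\<gamma>\<in>set (tl m). tail Q \<gamma> \<notin> D"
begin

text \<open>A block enters \<open>D\<close> with its first arrow and leaves it with its last one.\<close>

definition block :: "'b list \<Rightarrow> bool" where
  "block p \<longleftrightarrow> p \<noteq> [] \<and> tl p \<noteq> [] \<and> tail Q (hd p) \<notin> D \<and> (\<forall>\<gamma>\<in>set (tl p). tail Q \<gamma> \<in> D) \<and> head Q (last p) \<notin> D"

definition initial_blocks :: "'b list set" where
  "initial_blocks = {p. block p \<and> (\<exists>s. s \<noteq> [] \<and> p @ s \<in> R)}"

lemma walk_step:
  assumes "awalk u (k @ x # y # l) v"
  shows "head Q x = tail Q y" "x \<in> arcs Q" "y \<in> arcs Q"
  using assms by (auto simp: awalk_Cons_iff)

lemma relation_step: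
  assumes "k @ x # y # l \<in> R"
  shows "head Q x = tail Q y" "x \<in> arcs Q" "y \<in> arcs Q"
  using relation_walk[OF assms] walk_step[of _ k x y l] by blast+

lemma walk_no_repeat: "\<not> awalk u (x @ \<beta> # y @ \<beta> # z) v"
proof
  assume w: "awalk u (x @ \<beta> # y @ \<beta> # z) v"
  then obtain t where "awalk t (\<beta> # y @ \<beta> # z) v" by (auto simp: awalk_Cons_iff)
  then have "awalk (tail Q \<beta>) ((\<beta> # y) @ \<beta> # z) v" by (auto simp: awalk_Cons_iff)
  then obtain t where "awalk (tail Q \<beta>) (\<beta> # y) t" "awalk t (\<beta> # z) v" unfolding awalk_append_iff by blast
  then have "awalk (tail Q \<beta>) (\<beta> # y) (tail Q \<beta>)" by (auto simp: awalk_Cons_iff)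
  from acyclic[OF this] show False by simp
qed

text \<open>The relation starting with \<open>\<alpha>\<close> has an interior vertex outside of
  \<open>D\<close>. Cutting it at the first one gives the block, and the rest of the relation is
  nonempty.\<close>

lemma initial_block:
  assumes \<alpha>: "\<alpha> \<in> arcs Q" "tail Q \<alpha> \<notin> D" "head Q \<alpha> \<in> D"
  shows "\<exists>p\<in>initial_blocks. hd p = \<alpha>"
proof -
  obtain r where r: "r \<in> R" "hd r = \<alpha>" using first_relation[OF \<alpha>] by blast
  then obtain r' where r': "r = \<alpha> # r'" using rel_length[OF r(1)] by (cases r) auto
  from interior[OF r(1)] r' have "\<exists>\<gamma>\<in>set r'. tail Q \<gamma> \<notin> D" by simp
  from split_list_first_prop[OF this] obtain ys \<gamma> zs where s: "r' = ys @ \<gamma> # zs" "tail Q \<gamma> \<notin> D" "\<forall>y\<in>set ys. tail Q y \<in> D" by blast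
  have ys: "ys \<noteq> []"
  proof
    assume "ys = []"
    then have "[] @ \<alpha> # \<gamma> # zs \<in> R" using r(1) r' s(1) by simp
    from relation_step(1)[OF this] s(2) \<alpha>(3) show False by simp
  qed
  then have "ys = butlast ys @ [last ys]" by simp
  then have "(\<alpha> # butlast ys) @ last ys # \<gamma> # zs \<in> R" using r(1) r' s(1)
    by (metis append_Cons append_assoc append_Nil)
  from relation_step(1)[OF this] have "head Q (last ys) \<notin> D" using s(2) by simp
  then have "block (\<alpha> # ys)" using ys s(3) \<alpha>(2) by (simp add: block_def)
  moreover have "(\<alpha> # ys) @ \<gamma> # zs \<in> R" using r(1) r' s(1) by simp
  ultimately have "\<alpha> # ys \<in> initial_blocks" unfolding initial_blocks_def by blast
  then show ?thesis by force
qed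

text \<open>Mirror image of \<open>initial_block\<close>, cutting at the last interior vertex
  outside of \<open>D\<close>; as this vertex is interior, at least the arrow \<open>a\<close>
  precedes the block.\<close>

lemma final_block:
  assumes \<beta>: "\<beta> \<in> arcs Q" "tail Q \<beta> \<in> D" "head Q \<beta> \<notin> D"
  shows "\<exists>k p. k \<noteq> [] \<and> k @ p \<in> R \<and> block p \<and> last p = \<beta>"
proof -
  obtain r where r: "r \<in> R" "last r = \<beta>" using last_relation[OF \<beta>] by blast
  then obtain a r' where r': "r = a # r'" using rel_length[OF r(1)] by (cases r) auto
  from interior[OF r(1)] r' have "\<exists>\<gamma>\<in>set r'. tail Q \<gamma> \<notin> D" by simp
  from split_list_last_prop[OF this] obtain ys \<gamma> zs where s: "r' = ys @ \<gamma> # zs" "tail Q \<gamma> \<notin> D" "\<forall>y\<in>set zs. tail Q y \<in> D" by blast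
  have zs: "zs \<noteq> []" using r(2) r' s(1,2) \<beta>(2) by auto
  then have "last (\<gamma> # zs) = \<beta>" using r(2) r' s(1) by simp
  moreover from this have "block (\<gamma> # zs)" using zs s(2,3) \<beta>(3) by (simp add: block_def)
  moreover have "(a # ys) @ \<gamma> # zs \<in> R" using r(1) r' s(1) by simp
  ultimately show ?thesis by blast
qed

lemma block_shape:
  assumes "block p"
  obtains \<alpha> x t where "p = \<alpha> # x # t" "tail Q \<alpha> \<notin> D" "tail Q x \<in> D"
  using assms by (cases p; cases "tl p") (auto simp: block_def)

lemma block_suffix: "block p \<Longrightarrow> block (m @ p) \<Longrightarrow> m = []"
  by (cases m; cases p) (auto simp: block_def)

text \<open>A block ends as soon as it leaves \<open>D\<close>, so the next arrow of a longer block
  would start outside of \<open>D\<close>.\<close>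

lemma block_prefix:
  assumes "block p" "block (p @ m)" "awalk u (p @ m) v"
  shows "m = []"
proof (rule ccontr)
  assume "m \<noteq> []"
  then obtain y m' where m: "m = y # m'" by (cases m) auto
  have p: "p = butlast p @ [last p]" using assms(1) by (simp add: block_def)
  have "awalk u (butlast p @ last p # y # m') v" using assms(3) m p by (metis append_assoc append_Cons append_Nil)
  from walk_step(1)[OF this] have "tail Q y \<notin> D" using assms(1) by (simp add: block_def)
  moreover have "y \<in> set (tl (p @ m))" using assms(1) m by (simp add: block_def)
  ultimately show False using assms(2) by (simp add: block_def)
qed

text \<open>Two different relations would overlap exactly in \<open>p\<close>, and an overlap has an
  interior vertex outside of \<open>D\<close>, unlike a block. If both are the same relation, its
  last arrow occurs twice, against acyclicity.\<close>

lemma block_not_both: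
  assumes p: "block p" and k: "k \<noteq> []" "k @ p \<in> R" and s: "s \<noteq> []" "p @ s \<in> R"
  shows False
proof (cases "k @ p = p @ s")
  case False
  have "p \<noteq> []" using p by (simp add: block_def)
  from overlap_interior[OF k(2) s(2) k(1) this False] p show False by (auto simp: block_def)
next
  case True
  obtain p' \<beta> where p': "p = p' @ [\<beta>]" using p by (cases p rule: rev_cases) (auto simp: block_def)
  obtain s' \<delta> where s': "s = s' @ [\<delta>]" using s(1) by (cases s rule: rev_cases) auto
  have "\<delta> = \<beta>" using arg_cong[OF True, of last] unfolding p' s' by simp
  then have "p' @ \<beta> # s' @ \<beta> # [] \<in> R" using s(2) unfolding p' s' by simp
  then show False using relation_walk walk_no_repeat by blast
qed

text \<open>By minimality a relation contains no other one, so its proper nonempty parts are nonzero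
  paths.\<close>

lemma proper_part:
  assumes r: "k @ p @ s \<in> R" and ks: "k \<noteq> [] \<or> s \<noteq> []" and p: "p \<noteq> []"
  shows "(tail Q (hd p), p) \<in> N"
proof -
  obtain u v where "awalk u (k @ p @ s) v" using relation_walk[OF r] by blast
  then obtain u' v' where w: "awalk u' p v'" unfolding awalk_append_iff by blast
  then have "u' = tail Q (hd p)" using p by (cases p) (auto simp: awalk_Cons_iff)
  moreover have "\<not> contains_relation R p"
  proof
    assume "contains_relation R p"
    then obtain r' where r': "r' \<in> R" "sublist r' p" by (auto simp: contains_relation_def)
    have "sublist r' (k @ p @ s)" using r'(2) by (meson sublist_appendI sublist_order.order.trans)
    from relation_minimal[OF r'(1) r this] sublist_length_le[OF r'(2)] ks show False by auto
  qed
  ultimately show ?thesis using w by (auto simp: nonzero_paths_def qpaths_def)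
qed

abbreviation umod :: "'b list \<Rightarrow> ('a, 'k) rmod" where
  "umod p \<equiv> pmod (sufs (tail Q (hd p), p))"

lemma umod_indecomposable: "p \<in> N \<Longrightarrow> indecomposable sc (pmod (sufs p))"
  by (rule rooted_indecomposable[OF rooted_sufs(1)])

lemma block_awlast:
  assumes "block p"
  shows "awlast u p = head Q (last p)"
proof -
  have p: "p = butlast p @ [last p]" using assms by (simp add: block_def)
  have "awlast u (butlast p @ [last p]) = head Q (last p)" by (simp add: awlast_append)
  then show ?thesis by (simp only: p[symmetric])
qed

text \<open>The final block \<open>p3\<close> ends with the last arrow of \<open>p\<close> and
  starts with the first arrow of an initial block \<open>p4\<close>. By
  \<open>block_not_both\<close> it differs from both, so it branches off both. If it follows
  \<open>p4\<close> up to the arrow by which it joins \<open>p\<close>, a single extension links the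
  two uniserial modules; otherwise they are linked through the uniserial module on the segment of
  \<open>p3\<close> in between.\<close>

lemma block_chain:
  assumes p: "p \<in> initial_blocks"
  shows "\<exists>p'\<in>initial_blocks. \<exists>n\<ge>1. AR_walk sc (umod p') (umod p) n"
proof -
  from p obtain s where bp: "block p" and s: "s \<noteq> []" "p @ s \<in> R" unfolding initial_blocks_def by blast
  have pne: "p \<noteq> []" using bp by (simp add: block_def)
  let ?\<beta> = "last p"
  have \<beta>: "?\<beta> \<in> arcs Q" "tail Q ?\<beta> \<in> D" "head Q ?\<beta> \<notin> D"
  proof -
    obtain u v where "awalk u (p @ s) v" using relation_walk[OF s(2)] by blast
    then have "set (p @ s) \<subseteq> arcs Q" by (rule awalkE)
    then show "?\<beta> \<in> arcs Q" using pne by auto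
    have "?\<beta> \<in> set (tl p)" using bp by (metis block_def last_in_set last_tl)
    then show "tail Q ?\<beta> \<in> D" "head Q ?\<beta> \<notin> D" using bp by (auto simp: block_def)
  qed
  obtain k p3 where k: "k \<noteq> []" "k @ p3 \<in> R" and b3: "block p3" and l3: "last p3 = ?\<beta>" using final_block[OF \<beta>] by blast
  obtain \<alpha> x t where p3: "p3 = \<alpha> # x # t" "tail Q \<alpha> \<notin> D" "tail Q x \<in> D" using b3 by (rule block_shape)
  have \<alpha>: "\<alpha> \<in> arcs Q" "head Q \<alpha> \<in> D" using relation_step[of k \<alpha> x t] k(2) p3 by auto
  obtain p4 where p4: "p4 \<in> initial_blocks" "hd p4 = \<alpha>" using initial_block[OF \<alpha>(1) p3(2) \<alpha>(2)] by blast
  from p4(1) obtain s4 where b4: "block p4" and s4: "s4 \<noteq> []" "p4 @ s4 \<in> R" unfolding initial_blocks_def by blast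
  have p4ne: "p4 \<noteq> []" using b4 by (simp add: block_def)
  let ?u = "tail Q \<alpha>"
  have N3: "(?u, p3) \<in> N" using proper_part[of k p3 "[]"] k p3(1) by simp
  have N4: "(?u, p4) \<in> N" using proper_part[of "[]" p4 s4] s4 p4(2) p4ne by simp
  have N2: "(tail Q (hd p), p) \<in> N" using proper_part[of "[]" p s] s pne by simp
  have w3: "awalk ?u p3 (awlast ?u p3)" and w4: "awalk ?u p4 (awlast ?u p4)"
    using nonzero_pathsD(1)[OF N3] nonzero_pathsD(1)[OF N4] by (simp_all add: qpaths_iff)
  have end3: "awlast ?u p3 = path_end Q (tail Q (hd p), p)"
    using block_awlast[OF b3, of ?u] block_awlast[OF bp, of "tail Q (hd p)"] l3 by simp
  have ns: "p3 \<noteq> p"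
  proof
    assume e: "p3 = p"
    show False by (rule block_not_both[OF bp k(1) k(2)[unfolded e] s])
  qed
  have ns': "p3 \<noteq> p4"
  proof
    assume e: "p3 = p4"
    show False by (rule block_not_both[OF b4 k(1) k(2)[unfolded e] s4])
  qed
  have suf: "\<not> suffix p3 p" "\<not> suffix p p3"
  proof -
    show "\<not> suffix p3 p"
    proof
      assume "suffix p3 p"
      then obtain m where m: "p = m @ p3" by (rule suffixE)
      have "m = []" by (rule block_suffix[OF b3 bp[unfolded m]])
      then show False using m ns by simp
    qed
    show "\<not> suffix p p3"
    proof
      assume "suffix p p3"
      then obtain m where m: "p3 = m @ p" by (rule suffixE)
      have "m = []" by (rule block_suffix[OF bp b3[unfolded m]])
      then show False using m ns by simp
    qed
  qed
  have pre: "\<not> prefix p3 p4" "\<not> prefix p4 p3"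
  proof -
    show "\<not> prefix p3 p4"
    proof
      assume "prefix p3 p4"
      then obtain m where m: "p4 = p3 @ m" by (rule prefixE)
      have "m = []" by (rule block_prefix[OF b3 b4[unfolded m] w4[unfolded m]])
      then show False using m ns' by simp
    qed
    show "\<not> prefix p4 p3"
    proof
      assume "prefix p4 p3"
      then obtain m where m: "p3 = p4 @ m" by (rule prefixE)
      have "m = []" by (rule block_prefix[OF b4 b3[unfolded m] w3[unfolded m]])
      then show False using m ns' by simp
    qed
  qed
  \<comment> \<open>\<open>q0\<close> is the longest common end of \<open>p\<close> and
    \<open>p3\<close>. The arrow \<open>\<delta>\<close> preceding it on \<open>p3\<close> differs
    from the one preceding it on \<open>p\<close>, so gluing by \<open>\<delta>\<close> is
    possible.\<close>
  obtain q0 y w where q0: "p = y @ q0" "p3 = w @ q0" "y = [] \<or> w = [] \<or> last y \<noteq> last w" using common_suffix by blast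
  have y: "y \<noteq> []"
  proof
    assume "y = []"
    then have "p3 = w @ p" using q0(1,2) by simp
    then have "suffix p p3" by (rule suffixI)
    with suf(2) show False ..
  qed
  have wn: "w \<noteq> []"
  proof
    assume "w = []"
    then have "p = y @ p3" using q0(1,2) by simp
    then have "suffix p3 p" by (rule suffixI)
    with suf(1) show False ..
  qed
  obtain \<omega> \<delta> where w: "w = \<omega> @ [\<delta>]" using wn by (cases w rule: rev_cases) auto
  have p3': "p3 = \<omega> @ \<delta> # q0" using q0(2) w by simp
  have sq0: "suffix q0 (snd (tail Q (hd p), p))" using suffixI[OF q0(1)] by simp
  have nsuf: "\<not> suffix (\<delta> # q0) (snd (tail Q (hd p), p))"
  proof
    assume "suffix (\<delta> # q0) (snd (tail Q (hd p), p))"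
    then obtain z where "p = z @ \<delta> # q0" by (auto simp: suffix_def)
    then have "y @ q0 = (z @ [\<delta>]) @ q0" unfolding q0(1)[symmetric] by simp
    then have "y = z @ [\<delta>]" by (simp only: append_same_eq)
    then show False using q0(3) y wn w by simp
  qed
  note I4 = umod_indecomposable[OF N4] and I2 = umod_indecomposable[OF N2]
  have "\<exists>n\<ge>1. AR_walk sc (pmod (sufs (?u, p4))) (umod p) n"
  proof (cases "prefix \<omega> p4")
    case True
    then obtain p' where p': "p4 = \<omega> @ p'" by (auto simp: prefix_def)
    \<comment> \<open>Otherwise \<open>p3\<close> would be an initial part of \<open>p4\<close>. The
      path that realises the gluing is \<open>p3\<close> itself.\<close>
    have np: "\<not> prefix (\<delta> # q0) p'" using pre(1) unfolding p3' p' by (auto simp: prefix_def)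
    show ?thesis unfolding p'
      by (rule path_extension_walk[OF directed_modules_axioms N4[unfolded p'] I4[unfolded p'] N2 I2 sq0
            N3[unfolded p3'] end3[unfolded p3'] nsuf np])
  next
    case False
    \<comment> \<open>\<open>p3\<close> leaves \<open>p4\<close> by an arrow
      \<open>\<epsilon>\<close> before it reaches \<open>\<delta>\<close>, and \<open>\<mu>\<close>
      is the segment of \<open>p3\<close> strictly between these two arrows.\<close>
    obtain \<eta> x' p' where \<eta>: "\<omega> = \<eta> @ x'" "p4 = \<eta> @ p'" "x' = [] \<or> p' = [] \<or> hd x' \<noteq> hd p'" using common_prefix by blast
    have x': "x' \<noteq> []"
    proof
      assume "x' = []"
      then have "p4 = \<omega> @ p'" using \<eta>(1,2) by simp
      with False show False using prefixI by blast
    qed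
    then obtain \<epsilon> \<mu> where x'e: "x' = \<epsilon> # \<mu>" by (cases x') auto
    have p3e: "p3 = \<eta> @ (\<epsilon> # \<mu>) @ \<delta> # q0" using p3' \<eta>(1) x'e by simp
    have p'n: "p' \<noteq> []"
    proof
      assume "p' = []"
      then have "p3 = p4 @ (\<epsilon> # \<mu>) @ \<delta> # q0" using p3e \<eta>(2) by simp
      with pre(2) show False using prefixI by blast
    qed
    have np: "\<not> prefix (\<epsilon> # \<mu>) p'" using \<eta>(3) p'n x'e by (cases p') auto
    have N\<eta>: "(?u, \<eta> @ \<epsilon> # \<mu>) \<in> N" using nonzero_subpath(1)[of ?u "[]" "\<eta> @ \<epsilon> # \<mu>" "\<delta> # q0"] N3 p3e by simp
    have au: "awlast ?u (\<eta> @ [\<epsilon>]) = head Q \<epsilon>" by (simp add: awlast_append)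
    have N\<mu>: "(head Q \<epsilon>, \<mu>) \<in> N" using nonzero_subpath(1)[of ?u "\<eta> @ [\<epsilon>]" \<mu> "\<delta> # q0"] N3 p3e au by simp
    have N\<mu>': "(head Q \<epsilon>, \<mu> @ \<delta> # q0) \<in> N" using nonzero_subpath(1)[of ?u "\<eta> @ [\<epsilon>]" "\<mu> @ \<delta> # q0" "[]"] N3 p3e au by simp
    have e1: "awlast ?u (\<eta> @ \<epsilon> # \<mu>) = path_end Q (head Q \<epsilon>, \<mu>)" by (simp add: awlast_append)
    have e2: "awlast (head Q \<epsilon>) (\<mu> @ \<delta> # q0) = path_end Q (tail Q (hd p), p)"
      using end3 unfolding p3e by (simp add: awlast_append)
    note I\<mu> = umod_indecomposable[OF N\<mu>]
    have nl: "\<not> suffix (\<epsilon> # \<mu>) (snd (head Q \<epsilon>, \<mu>))" by (auto dest: suffix_length_le)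
    \<comment> \<open>First link: \<open>\<epsilon>\<close> glues the module of \<open>\<mu>\<close>
      on top of that of \<open>p4\<close>.\<close>
    have "\<exists>n\<ge>1. AR_walk sc (pmod (sufs (?u, \<eta> @ p'))) (pmod (sufs (head Q \<epsilon>, \<mu>))) n"
      by (rule path_extension_walk[OF directed_modules_axioms N4[unfolded \<eta>(2)] I4[unfolded \<eta>(2)] N\<mu> I\<mu> _ N\<eta> e1 nl np]) simp
    then obtain n where n: "n \<ge> 1" "AR_walk sc (pmod (sufs (?u, p4))) (pmod (sufs (head Q \<epsilon>, \<mu>))) n" unfolding \<eta>(2) by blast
    have N\<mu>n: "(head Q \<epsilon>, \<mu> @ []) \<in> N" using N\<mu> by simp
    have npn: "\<not> prefix (\<delta> # q0) []" by simp
    \<comment> \<open>Second link: \<open>\<delta>\<close> glues the module of \<open>p\<close> on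
      top of that of \<open>\<mu>\<close>, and it arrives at the top of the latter, whence the empty
      list in the place of \<open>p'\<close>.\<close>
    have "\<exists>n\<ge>1. AR_walk sc (pmod (sufs (head Q \<epsilon>, \<mu> @ []))) (umod p) n"
      by (rule path_extension_walk[OF directed_modules_axioms N\<mu>n umod_indecomposable[OF N\<mu>n] N2 I2 sq0 N\<mu>' e2 nsuf npn])
    then obtain m where "AR_walk sc (pmod (sufs (head Q \<epsilon>, \<mu>))) (umod p) m" by auto
    from AR_walk_trans[OF n(2) this] n(1) show ?thesis by (intro exI[of _ "n + m"]) simp
  qed
  then show ?thesis using p4 by (intro bexI[of _ p4]) simp_all
qed

lemma no_initial_blocks: "initial_blocks = {}"
proof (rule ccontr)
  assume "initial_blocks \<noteq> {}"
  then obtain p0 where p0: "p0 \<in> initial_blocks" by blast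
  then obtain s where "block p0" "s \<noteq> []" "p0 @ s \<in> R" unfolding initial_blocks_def by blast
  then have N0: "(tail Q (hd p0), p0) \<in> N" using proper_part[of "[]" p0 s] by (simp add: block_def)
  have "\<exists>p\<in>initial_blocks. \<exists>n\<ge>j. AR_walk sc (umod p) (umod p0) n" for j
  proof (induction j)
    case 0
    have "AR_walk sc (umod p0) (umod p0) 0"
      using AR_walk_zero[OF umod_indecomposable[OF N0] indecomposableD(1)[OF umod_indecomposable[OF N0]] isomorphic_refl[OF indecomposableD(1)[OF umod_indecomposable[OF N0]]]] .
    then show ?case using p0 by blast
  next
    case (Suc j)
    then obtain p n where p: "p \<in> initial_blocks" "n \<ge> j" "AR_walk sc (umod p) (umod p0) n" by blast
    from block_chain[OF p(1)] obtain p' m where p': "p' \<in> initial_blocks" "m \<ge> 1" "AR_walk sc (umod p') (umod p) m" by blast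
    from AR_walk_trans[OF p'(3) p(3)] p'(1,2) p(2) show ?case by (intro bexI[of _ p'] exI[of _ "m + n"]) simp_all
  qed
  from this[of "Suc (card (verts (AR_quiver sc)))"] AR_walk_bound show False by fastforce
qed

text \<open>A relation with interior vertices in \<open>D\<close> and outside of \<open>D\<close>
  crosses the border of \<open>D\<close>, and a crossing in either direction produces an initial
  block.\<close>

lemma relation_avoids:
  assumes r: "r \<in> R" and \<gamma>: "\<gamma> \<in> set (tl r)"
  shows "tail Q \<gamma> \<notin> D"
proof
  assume d: "tail Q \<gamma> \<in> D"
  obtain \<gamma>' where \<gamma>': "\<gamma>' \<in> set (tl r)" "tail Q \<gamma>' \<notin> D" using interior[OF r] by blast
  from list_change[OF \<gamma> \<gamma>'(1), of "\<lambda>\<gamma>. tail Q \<gamma> \<in> D", OF d \<gamma>'(2)] obtain k x y m where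
    l: "tl r = k @ x # y # m" "(tail Q x \<in> D) \<noteq> (tail Q y \<in> D)" by blast
  have "r = (hd r # k) @ x # y # m" using l(1) rel_length[OF r] by (cases r) auto
  then have xy: "head Q x = tail Q y" "x \<in> arcs Q" using relation_step(1,2)[of "hd r # k" x y m] r by auto
  show False
  proof (cases "tail Q x \<in> D")
    case True
    then have h: "head Q x \<notin> D" using l(2) xy(1) by simp
    obtain k p where k: "k \<noteq> []" "k @ p \<in> R" "block p" using final_block[OF xy(2) True h] by blast
    obtain \<alpha> x t where p: "p = \<alpha> # x # t" "tail Q \<alpha> \<notin> D" "tail Q x \<in> D" using k(3) by (rule block_shape)
    have "\<alpha> \<in> arcs Q" "head Q \<alpha> \<in> D" using relation_step[of k \<alpha> x t] k(2) p by auto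
    from initial_block[OF this(1) p(2) this(2)] show False using no_initial_blocks by blast
  next
    case False
    then have "head Q x \<in> D" using l(2) xy(1) by simp
    from initial_block[OF xy(2) False this] show False using no_initial_blocks by blast
  qed
qed

end

section \<open>The vertices of maximal level and the choice of vertices\<close>

locale directed_monomial = monomial_presentation sc Q I \<phi> \<chi> + directed_modules sc
  for sc :: "'k :: alg_closed_field \<Rightarrow> 'a :: ring_1 \<Rightarrow> 'a" and Q :: "('v, 'b) pre_digraph" and I \<phi> \<chi> +
  assumes relations_nonempty: "\<chi> \<noteq> {}"

sublocale directed_monomial \<subseteq> directed_path_basis sc Q rels bs co ..

context directed_monomial begin

lemma generator_walk: "\<gamma> \<in> \<chi> \<Longrightarrow> awalk (fst \<gamma>) (snd \<gamma>) (path_end Q \<gamma>)"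
  by (rule qpaths_awalk[OF generators_paths])

lemma relation_shape:
  assumes "\<gamma> \<in> \<chi>"
  obtains x y t where "snd \<gamma> = x # y # t" "head Q x = tail Q y"
proof -
  obtain x l where l: "snd \<gamma> = x # l" "1 \<le> length l" using generator_length[OF assms] by (cases "snd \<gamma>") auto
  then obtain y t where "l = y # t" by (cases l) auto
  then show thesis using that l(1) generator_walk[OF assms] by (auto simp: awalk_Cons_iff)
qed

lemma involved_vertices_subset: "\<gamma> \<in> \<chi> \<Longrightarrow> involved_vertices Q \<gamma> \<subseteq> verts Q"
proof -
  assume \<gamma>: "\<gamma> \<in> \<chi>"
  then have "set (snd \<gamma>) \<subseteq> arcs Q" using generator_walk by blast
  then have "set (tl (snd \<gamma>)) \<subseteq> arcs Q" by (cases "snd \<gamma>") auto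
  then show "involved_vertices Q \<gamma> \<subseteq> verts Q" unfolding involved_vertices_def using tail_in_verts by blast
qed

lemma relation_vertices_subset: "relation_vertices Q \<chi> \<subseteq> verts Q"
  unfolding relation_vertices_def using involved_vertices_subset by blast

lemma relation_vertices_nonempty: "relation_vertices Q \<chi> \<noteq> {}"
proof -
  obtain \<gamma> where \<gamma>: "\<gamma> \<in> \<chi>" using relations_nonempty by blast
  obtain x y t where "snd \<gamma> = x # y # t" using relation_shape[OF \<gamma>] by blast
  then have "tail Q y \<in> involved_vertices Q \<gamma>" by (simp add: involved_vertices_def)
  then show ?thesis using \<gamma> unfolding relation_vertices_def by blast
qed

lemma verts_nonempty: "verts Q \<noteq> {}"
  using relation_vertices_subset relation_vertices_nonempty by blast

definition top_vertices :: "'v set" where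
  "top_vertices = {a \<in> verts Q. level a = Max (level ` verts Q)}"

lemma level_le_Max: "a \<in> verts Q \<Longrightarrow> level a \<le> Max (level ` verts Q)"
  by (intro Max_ge) simp_all

lemma top_vertices_nonempty: "top_vertices \<noteq> {}"
proof -
  have "Max (level ` verts Q) \<in> level ` verts Q" using verts_nonempty by (intro Max_in) simp_all
  then obtain a where "a \<in> verts Q" "level a = Max (level ` verts Q)" by auto
  then show ?thesis by (auto simp: top_vertices_def)
qed

lemma top_vertices_up:
  assumes "a \<in> top_vertices" "b \<in> verts Q" "level a \<le> level b"
  shows "b \<in> top_vertices"
  using assms level_le_Max[OF assms(2)] by (simp add: top_vertices_def)

lemma top_last_relation:
  assumes "\<beta> \<in> arcs Q" "tail Q \<beta> \<in> top_vertices" "head Q \<beta> \<notin> top_vertices"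
  shows "\<exists>r\<in>rels. last r = \<beta>"
  using top_vertices_up[OF assms(2) head_in_verts[OF assms(1)]] level_tail_le[OF assms(1)] assms(3) by blast

lemma top_first_relation:
  assumes "\<beta> \<in> arcs Q" "tail Q \<beta> \<notin> top_vertices" "head Q \<beta> \<in> top_vertices"
  shows "\<exists>r\<in>rels. hd r = \<beta>"
  using top_vertices_up[OF assms(3) tail_in_verts[OF assms(1)]] level_head_le[OF assms(1)] assms(2) by blast

lemma relation_vertices_top: "relation_vertices Q \<chi> \<inter> top_vertices \<noteq> {}"
proof
  assume disj: "relation_vertices Q \<chi> \<inter> top_vertices = {}"
  have "tail Q \<beta> \<in> top_vertices \<longleftrightarrow> head Q \<beta> \<in> top_vertices" if \<beta>: "\<beta> \<in> arcs Q" for \<beta>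
  proof (rule ccontr)
    assume n: "\<not> (tail Q \<beta> \<in> top_vertices \<longleftrightarrow> head Q \<beta> \<in> top_vertices)"
    show False
    proof (cases "tail Q \<beta> \<in> top_vertices")
      case True
      then obtain \<gamma> where \<gamma>: "\<gamma> \<in> \<chi>" "last (snd \<gamma>) = \<beta>" using top_last_relation[OF \<beta>] n by auto
      obtain x y t where "snd \<gamma> = x # y # t" using relation_shape[OF \<gamma>(1)] by blast
      then have "\<beta> \<in> set (tl (snd \<gamma>))" using \<gamma>(2) last_in_set[of "y # t"] by auto
      then have "tail Q \<beta> \<in> relation_vertices Q \<chi>" using \<gamma>(1) by (auto simp: relation_vertices_def involved_vertices_def)
      then show False using True disj by blast
    next
      case False
      then have h: "head Q \<beta> \<in> top_vertices" using n by blast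
      then obtain \<gamma> where \<gamma>: "\<gamma> \<in> \<chi>" "hd (snd \<gamma>) = \<beta>" using top_first_relation[OF \<beta> False] by auto
      obtain x y t where s: "snd \<gamma> = x # y # t" "head Q x = tail Q y" using relation_shape[OF \<gamma>(1)] by blast
      then have "head Q \<beta> \<in> involved_vertices Q \<gamma>" using \<gamma>(2) by (simp add: involved_vertices_def)
      then have "head Q \<beta> \<in> relation_vertices Q \<chi>" using \<gamma>(1) by (auto simp: relation_vertices_def)
      then show False using h disj by blast
    qed
  qed
  from quiver_connected[OF _ top_vertices_nonempty this] have "top_vertices = verts Q" by (simp add: top_vertices_def)
  then show False using disj relation_vertices_subset relation_vertices_nonempty by blast
qed

text \<open>This needs the quiver to be acyclic, as a vertex might otherwise occur twice on the common path.\<close>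

lemma overlap_common_vertex:
  assumes w: "awalk u (k @ m @ l) v" and m: "m \<noteq> []"
    and x: "x \<in> tail Q ` set (tl (k @ m))" "x \<in> tail Q ` set (tl (m @ l))"
  shows "x \<in> tail Q ` set (tl m)"
proof (rule ccontr)
  assume n: "x \<notin> tail Q ` set (tl m)"
  obtain \<alpha> where \<alpha>: "\<alpha> \<in> set (tl (k @ m))" "x = tail Q \<alpha>" using x(1) by blast
  obtain \<alpha>' where \<alpha>': "\<alpha>' \<in> set (tl (m @ l))" "x = tail Q \<alpha>'" using x(2) by blast
  have "\<alpha>' \<in> set l" using \<alpha>' m n by auto
  then obtain c d where l: "l = c @ \<alpha>' # d" by (meson split_list)
  have "set (tl z) \<subseteq> set z" for z :: "'b list" by (cases z) auto
  then have "\<alpha> \<in> set (k @ m)" using \<alpha>(1) by blast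
  then obtain a b where km: "k @ m = a @ \<alpha> # b" by (meson split_list)
  have "(k @ m) @ l = (a @ \<alpha> # b) @ (c @ \<alpha>' # d)" by (simp only: km l)
  then have e: "k @ m @ l = a @ (\<alpha> # b @ c) @ \<alpha>' # d" by (simp only: append_assoc append_Cons)
  obtain t where "awalk t ((\<alpha> # b @ c) @ \<alpha>' # d) v" using w unfolding e awalk_append_iff[of u a] by blast
  then obtain t' where "awalk t (\<alpha> # b @ c) t'" "awalk t' (\<alpha>' # d) v" unfolding awalk_append_iff by blast
  then have "awalk (tail Q \<alpha>) (\<alpha> # b @ c) (tail Q \<alpha>)" using \<alpha>(2) \<alpha>'(2) by (auto simp: awalk_Cons_iff)
  from acyclic[OF this] show False by simp
qed

lemma overlapping_walk:
  assumes "awalk u (k @ m) v" "awalk u' (m @ l) v'" "m \<noteq> []"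
  shows "awalk u (k @ m @ l) v'"
proof -
  obtain t where t: "awalk u k t" "awalk t m v" using assms(1) unfolding awalk_append_iff by blast
  obtain t' where t': "awalk u' m t'" "awalk t' l v'" using assms(2) unfolding awalk_append_iff by blast
  have "t = u'" using t(2) t'(1) assms(3) by (cases m) (auto simp: awalk_Cons_iff)
  then have "awalk t m t'" using t'(1) by simp
  from awalk_appendI[OF t(1) awalk_appendI[OF this t'(2)]] show ?thesis .
qed

text \<open>A selection avoiding the vertices of maximal level would make them an instance of
  \<open>block_descent\<close>; then no relation has an interior vertex of maximal level, contrary
  to \<open>relation_vertices_top\<close>.\<close>

lemma selection_meets_top:
  assumes S: "vertex_selection Q \<chi> S"
  shows "S \<inter> top_vertices \<noteq> {}"
proof
  assume disj: "S \<inter> top_vertices = {}"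
  obtain f where f: "\<forall>G\<in>relation_groups Q \<chi>. \<forall>\<gamma>\<in>G. f G \<in> involved_vertices Q \<gamma>" "S = f ` relation_groups Q \<chi>"
    using S unfolding vertex_selection_def by blast
  have descent: "block_descent sc Q rels bs co top_vertices"
  proof (intro block_descent.intro directed_path_basis_axioms block_descent_axioms.intro)
    fix \<beta> assume "\<beta> \<in> arcs Q" "tail Q \<beta> \<in> top_vertices" "head Q \<beta> \<notin> top_vertices"
    then show "\<exists>r\<in>rels. last r = \<beta>" by (rule top_last_relation)
  next
    fix \<beta> assume "\<beta> \<in> arcs Q" "tail Q \<beta> \<notin> top_vertices" "head Q \<beta> \<in> top_vertices"
    then show "\<exists>r\<in>rels. hd r = \<beta>" by (rule top_first_relation)
  next
    fix r assume "r \<in> rels"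
    then obtain \<gamma> where \<gamma>: "\<gamma> \<in> \<chi>" "r = snd \<gamma>" by blast
    show "\<exists>u v. awalk u r v" using generator_walk[OF \<gamma>(1)] unfolding \<gamma>(2) by blast
    show "r = r'" if "r' \<in> rels" "sublist r r'" for r'
    proof -
      from that(1) obtain \<gamma>' where \<gamma>': "\<gamma>' \<in> \<chi>" "r' = snd \<gamma>'" by blast
      from minimal_relation[OF \<gamma>'(1) \<gamma>(1)] that(2) \<gamma>(2) \<gamma>'(2) show ?thesis by simp
    qed
    \<comment> \<open>Every relation belongs to some group, and the vertex chosen for that group is
      interior to the relation.\<close>
    obtain G where G: "G \<in> relation_groups Q \<chi>" "\<gamma> \<in> G"
    proof (cases "\<exists>\<gamma>'\<in>\<chi>. overlap Q \<gamma> \<gamma>'")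
      case True
      then obtain \<gamma>' where "\<gamma>' \<in> \<chi>" "overlap Q \<gamma> \<gamma>'" by blast
      then have "{\<gamma>, \<gamma>'} \<in> relation_groups Q \<chi>" using \<gamma>(1) unfolding relation_groups_def by blast
      then show thesis using that by blast
    next
      case False
      then have "{\<gamma>} \<in> relation_groups Q \<chi>" using \<gamma>(1) unfolding relation_groups_def by blast
      then show thesis using that by blast
    qed
    have "f G \<in> S" "f G \<in> involved_vertices Q \<gamma>" using f G by blast+
    then show "\<exists>\<gamma>\<in>set (tl r). tail Q \<gamma> \<notin> top_vertices" using disj unfolding involved_vertices_def \<gamma>(2) by auto
  next
    \<comment> \<open>Two relations sharing \<open>m\<close> overlap on the common path
      \<open>k @ m @ l\<close>, and the vertex chosen for this pair is interior to
      \<open>m\<close>.\<close>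
    fix k m l assume "k @ m \<in> rels" "m @ l \<in> rels" and k: "k \<noteq> []" and m: "m \<noteq> []" and ne: "k @ m \<noteq> m @ l"
    then obtain \<gamma> \<gamma>' where \<gamma>: "\<gamma> \<in> \<chi>" "k @ m = snd \<gamma>" and \<gamma>': "\<gamma>' \<in> \<chi>" "m @ l = snd \<gamma>'" by blast
    have "awalk (fst \<gamma>) (k @ m) (path_end Q \<gamma>)" "awalk (fst \<gamma>') (m @ l) (path_end Q \<gamma>')"
      unfolding \<gamma>(2) \<gamma>'(2) by (rule generator_walk[OF \<gamma>(1)], rule generator_walk[OF \<gamma>'(1)])
    from overlapping_walk[OF this m] have w: "awalk (fst \<gamma>) (k @ m @ l) (path_end Q \<gamma>')" .
    have wq: "(fst \<gamma>, k @ m @ l) \<in> qpaths Q" using w unfolding qpaths_def by blast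
    have "overlap Q \<gamma> \<gamma>'"
      unfolding overlap_def \<gamma>(2)[symmetric] \<gamma>'(2)[symmetric]
    proof (intro conjI bexI[OF _ wq])
      show "\<gamma> \<noteq> \<gamma>'" using ne \<gamma>(2) \<gamma>'(2) by auto
      show "\<exists>a\<^sub>1 b\<^sub>1 a\<^sub>2 b\<^sub>2. snd (fst \<gamma>, k @ m @ l) = a\<^sub>1 @ (k @ m) @ b\<^sub>1 \<and> snd (fst \<gamma>, k @ m @ l) = a\<^sub>2 @ (m @ l) @ b\<^sub>2 \<and>
        (length a\<^sub>1 < length a\<^sub>2 \<and> length a\<^sub>2 < length a\<^sub>1 + length (k @ m) \<or>
         length a\<^sub>2 < length a\<^sub>1 \<and> length a\<^sub>1 < length a\<^sub>2 + length (m @ l))"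
        by (rule exI[of _ "[]"], rule exI[of _ l], rule exI[of _ k], rule exI[of _ "[]"]) (use k m in simp)
    qed
    then have G: "{\<gamma>, \<gamma>'} \<in> relation_groups Q \<chi>" using \<gamma>(1) \<gamma>'(1) unfolding relation_groups_def by blast
    have "f {\<gamma>, \<gamma>'} \<in> S" "f {\<gamma>, \<gamma>'} \<in> involved_vertices Q \<gamma>" "f {\<gamma>, \<gamma>'} \<in> involved_vertices Q \<gamma>'" using f G by blast+
    moreover from this(2,3) have "f {\<gamma>, \<gamma>'} \<in> tail Q ` set (tl m)"
      unfolding involved_vertices_def \<gamma>(2)[symmetric] \<gamma>'(2)[symmetric] by (rule overlap_common_vertex[OF w m])
    ultimately obtain \<alpha> where \<alpha>: "\<alpha> \<in> set (tl m)" "tail Q \<alpha> \<in> S" by auto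
    show "\<exists>\<gamma>\<in>set (tl m). tail Q \<gamma> \<notin> top_vertices" by (rule bexI[OF _ \<alpha>(1)]) (use \<alpha>(2) disj in blast)
  qed
  obtain a where a: "a \<in> relation_vertices Q \<chi>" "a \<in> top_vertices" using relation_vertices_top by blast
  then obtain \<gamma> where \<gamma>: "\<gamma> \<in> \<chi>" "a \<in> involved_vertices Q \<gamma>" unfolding relation_vertices_def by blast
  then obtain \<alpha> where \<alpha>: "\<alpha> \<in> set (tl (snd \<gamma>))" "a = tail Q \<alpha>" unfolding involved_vertices_def by blast
  have "snd \<gamma> \<in> rels" using \<gamma>(1) by blast
  from block_descent.relation_avoids[OF descent this \<alpha>(1)] a(2) \<alpha>(2) show False by simp
qed

lemma selection_subset:
  assumes S: "vertex_selection Q \<chi> S"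
  shows "S \<subseteq> relation_vertices Q \<chi>"
proof -
  obtain f where f: "\<forall>G\<in>relation_groups Q \<chi>. \<forall>\<gamma>\<in>G. f G \<in> involved_vertices Q \<gamma>" "S = f ` relation_groups Q \<chi>"
    using S unfolding vertex_selection_def by blast
  have "f G \<in> relation_vertices Q \<chi>" if G: "G \<in> relation_groups Q \<chi>" for G
  proof -
    obtain \<gamma> where \<gamma>: "\<gamma> \<in> G" "\<gamma> \<in> \<chi>" using G unfolding relation_groups_def by blast
    then have "f G \<in> involved_vertices Q \<gamma>" using f(1) G by blast
    then show ?thesis using \<gamma>(2) unfolding relation_vertices_def by blast
  qed
  then show ?thesis unfolding f(2) by blast
qed

text \<open>One vertex of maximal level in \<open>A\<close> suffices to attain the maximum over all
  vertices; both halves of the theorem are instances.\<close>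

lemma nilpotency_index_Max:
  assumes A: "A \<subseteq> verts Q" "A \<inter> top_vertices \<noteq> {}"
  shows "nilpotency_index sc = Max ((\<lambda>u. proj_inj_length sc \<phi> u + 1) ` A)"
proof -
  have l: "proj_inj_length sc \<phi> u = level u" if "u \<in> verts Q" for u
    using proj_inj_walks[OF that] by (simp add: proj_inj_length_def vertex_idem_def bs_def)
  have "Max ((\<lambda>u. proj_inj_length sc \<phi> u + 1) ` A) = Suc (Max (level ` verts Q))"
  proof (rule Max_eqI)
    show "finite ((\<lambda>u. proj_inj_length sc \<phi> u + 1) ` A)" using A(1) finite_verts finite_subset by blast
    show "y \<le> Suc (Max (level ` verts Q))" if "y \<in> (\<lambda>u. proj_inj_length sc \<phi> u + 1) ` A" for y
      using that A(1) level_le_Max by (auto simp: l subset_iff)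
    obtain a where a: "a \<in> A" "a \<in> top_vertices" using A(2) by blast
    then have "proj_inj_length sc \<phi> a + 1 = Suc (Max (level ` verts Q))" using A(1) l[of a] by (auto simp: top_vertices_def)
    then show "Suc (Max (level ` verts Q)) \<in> (\<lambda>u. proj_inj_length sc \<phi> u + 1) ` A" using a(1) by (metis imageI)
  qed
  then show ?thesis using nilpotency_index_eq[OF verts_nonempty] by simp
qed

end

theorem theoremA:
  fixes sc :: "'k :: alg_closed_field \<Rightarrow> 'a :: ring_1 \<Rightarrow> 'a"
    and Q :: "('v, 'b) pre_digraph"
    and I :: "(('v, 'b) qpath \<Rightarrow>\<^sub>0 'k) set"
    and \<phi> :: "(('v, 'b) qpath \<Rightarrow>\<^sub>0 'k) \<Rightarrow> 'a"
    and \<chi> :: "('v, 'b) qpath set"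
  assumes "fd_algebra sc"
    and "fin_digraph Q"
    and "admissible_ideal Q I"
    and "algebra_presentation sc Q I \<phi>"
    and "minimal_path_generators Q I \<chi>"
    and "\<chi> \<noteq> {}"
    and "representation_finite sc"
    and "component_with_length (AR_quiver sc)"
  shows "nilpotency_index sc =
           Max ((\<lambda>u. proj_inj_length sc \<phi> u + 1) ` relation_vertices Q \<chi>) \<and>
         (\<forall>S. vertex_selection Q \<chi> S \<longrightarrow>
           nilpotency_index sc = Max ((\<lambda>a. proj_inj_length sc \<phi> a + 1) ` S))"
proof -
  interpret fd_algebra sc by fact
  interpret fin_digraph Q by fact
  interpret directed_monomial sc Q I \<phi> \<chi> by unfold_locales fact+
  show ?thesis
  proof (intro conjI allI impI)
    show "nilpotency_index sc = Max ((\<lambda>u. proj_inj_length sc \<phi> u + 1) ` relation_vertices Q \<chi>)"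
      by (rule nilpotency_index_Max[OF relation_vertices_subset relation_vertices_top])
    fix S assume S: "vertex_selection Q \<chi> S"
    show "nilpotency_index sc = Max ((\<lambda>a. proj_inj_length sc \<phi> a + 1) ` S)"
      using selection_subset[OF S] relation_vertices_subset
      by (intro nilpotency_index_Max[OF _ selection_meets_top[OF S]]) blast
  qed
qed

end
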